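(* Let $k$ be a field and let $(\mathcal{T},\mathcal{S},\mathbb{S},\mathcal{M})$ be a relative Serre quadruple over $k$, with AGK category $\mathcal{C}=\mathcal{T}/\mathcal{S}$ and fundamental domain $\mathcal{Z}\subset\mathcal{T}$. Assume that one of the following conditions holds. (i) $\mathbb{S}:\mathcal{S}\to\mathcal{S}$ extends to a triangle equivalence $\mathbb{S}:\mathcal{T}\to\mathcal{T}$; (ii) $\mathcal{M}$ has an additive generator $M$. Then the composition $\mathcal{Z}\subset\mathcal{T}\to\mathcal{C}$ is an equivalence. As a consequence, the AGK category $\mathcal{C}$ is a Hom-finite Krull--Schmidt triangulated category. Moreover, in case (i), $\mathcal{C}$ has a Serre functor $\mathbb{S}\circ[-1]$.
   Context: Let $D=\mathrm{Hom}_k(-,k)$. For full subcategories $\mathcal{X},\mathcal{Y}$ of a triangulated category $\mathcal{T}$ with shift $[1]$, $\mathcal{X}*\mathcal{Y}$ is the full subcategory of objects $T\in\mathcal{T}$ for which there is a triangle $X\to T\to Y\to X[1]$ with $X\in\mathcal{X}$, $Y\in\mathcal{Y}$. When $\mathrm{Hom}_{\mathcal{T}}(\mathcal{X},\mathcal{Y})=0$, one writes $\mathcal{X}\perp\mathcal{Y}$ for $\mathcal{X}*\mathcal{Y}$. Put $\mathcal{X}^\perp:=\{T\in\mathcal{T}\mid\mathrm{Hom}_{\mathcal{T}}(\mathcal{X},T)=0\}$ and ${}^\perp\mathcal{X}:=\{T\in\mathcal{T}\mid\mathrm{Hom}_{\mathcal{T}}(T,\mathcal{X})=0\}$. A torsion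 pair $\mathcal{T}=\mathcal{X}\perp\mathcal{Y}$ means that $\mathcal{T}=\mathcal{X}\perp\mathcal{Y}$, $\mathcal{X}={}^\perp\mathcal{Y}$ and $\mathcal{Y}=\mathcal{X}^\perp$; it is called a t-structure if $\mathcal{X}[1]\subset\mathcal{X}$. $\mathcal{M}[<0]$ (resp. $\mathcal{M}[\ge0]$) denotes the collection of all $M[i]$ with $M\in\mathcal{M}$ and $i<0$ (resp. $i\ge0$); similarly $\mathcal{M}[>0]$. Thus $\mathcal{M}[<0]^\perp=\{T\mid\mathrm{Hom}_{\mathcal{T}}(M,T[i])=0\ \forall M\in\mathcal{M},\, i>0\}$ and $\mathcal{M}[\ge0]^\perp=\{T\mid\mathrm{Hom}_{\mathcal{T}}(M,T[i])=0\ \forall M\in\mathcal{M},\, i\le0\}$. A full subcategory $\mathcal{M}$ of $\mathcal{T}$ is silting if $\mathrm{Hom}_{\mathcal{T}}(\mathcal{M},\mathcal{M}[>0])=0$ and the smallest thick subcategory of $\mathcal{T}$ containing $\mathcal{M}$ is $\mathcal{T}$. An additive generator of $\mathcal{M}$ is an object $M$ with $\mathcal{M}=\mathsf{add}\,M$. A dualizing $k$-variety is meant in the sense of Auslander--Reiten ($D$ induces a duality between the categories of finitely presented contravariant and covariant $k$-linear functors from $\mathcal{M}$ to $k$-vector spaces). $(\mathcal{T},\mathcal{S},\mathbb{S},\mathcal{M})$ is a relative Serre quadruple if: (RS0) $\mathcal{T}$ is a $k$-linear Hom-finite Krull--Schmidt triangulated category and $\mathcal{S}$ is a thick subcategory of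 $\mathcal{T}$. (RS1) $\mathbb{S}:\mathcal{S}\to\mathcal{S}$ is a triangle equivalence such that there is a bifunctorial isomorphism $D\,\mathrm{Hom}_{\mathcal{T}}(X,Y)\simeq\mathrm{Hom}_{\mathcal{T}}(Y,\mathbb{S}X)$ for any $X\in\mathcal{S}$ and $Y\in\mathcal{T}$. (RS2) $\mathcal{M}$ is a silting subcategory of $\mathcal{T}$ and $\mathcal{T}=\mathcal{M}[<0]^\perp\perp\mathcal{M}[\ge0]^\perp$ is a t-structure of $\mathcal{T}$ satisfying $\mathcal{M}[\ge0]^\perp\subset\mathcal{S}$. Moreover, $\mathcal{M}$ is a dualizing $k$-variety. The AGK category is the Verdier quotient $\mathcal{C}:=\mathcal{T}/\mathcal{S}$. The fundamental domain is the full subcategory $\mathcal{Z}=\mathcal{X}^\perp\cap{}^\perp(\mathcal{Y}[1])\subset\mathcal{T}$, where $\mathcal{X}=\mathcal{M}[<0]^\perp\cap\mathcal{S}$ and $\mathcal{Y}=\mathcal{M}[\ge0]^\perp$. In the last assertion $\mathbb{S}\circ[-1]$ denotes the functor induced on $\mathcal{C}$ by $\mathbb{S}\circ[-1]:\mathcal{T}\to\mathcal{T}$. *)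

theory Defs
  imports "Jordan_Normal_Form.Missing_VectorSpace"
begin

section \<open>Linear categories\<close>

text \<open>A category is given by a carrier set of objects and by Hom-sets that carry their
  \<open>K\<close>-vector space structure as a record of type \<^typ>\<open>('k, 'm) module\<close> (only the additive part and
  the scalar multiplication of this record are meaningful). Distinct pairs of objects have
  disjoint Hom-sets, so that composition needs no object arguments.\<close>

record ('o, 'm, 'k) lincat =
  Ob :: "'o set"
  Hom :: "'o \<Rightarrow> 'o \<Rightarrow> ('k, 'm) module"
  Comp :: "'m \<Rightarrow> 'm \<Rightarrow> 'm" (infixl \<open>\<cdot>\<index>\<close> 72)
  Id :: "'o \<Rightarrow> 'm"

abbreviation arr :: "('o, 'm, 'k, 'z) lincat_scheme \<Rightarrow> 'o \<Rightarrow> 'o \<Rightarrow> 'm set" where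
  "arr C x y \<equiv> carrier (Hom C x y)"

locale lin_category = field K for K :: "('k, 'r) ring_scheme" (structure) +
  fixes C :: "('o, 'm, 'k, 'z) lincat_scheme"
  assumes hom_vectorspace: "\<lbrakk>x \<in> Ob C; y \<in> Ob C\<rbrakk> \<Longrightarrow> vectorspace K (Hom C x y)"
    and hom_disjoint: "\<lbrakk>x \<in> Ob C; y \<in> Ob C; x' \<in> Ob C; y' \<in> Ob C;
      f \<in> arr C x y; f \<in> arr C x' y'\<rbrakk> \<Longrightarrow> x = x' \<and> y = y'"
    and id_arr: "x \<in> Ob C \<Longrightarrow> Id C x \<in> arr C x x"
    and id_left: "\<lbrakk>x \<in> Ob C; y \<in> Ob C; f \<in> arr C x y\<rbrakk> \<Longrightarrow> Id C y \<cdot>\<^bsub>C\<^esub> f = f"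
    and id_right: "\<lbrakk>x \<in> Ob C; y \<in> Ob C; f \<in> arr C x y\<rbrakk> \<Longrightarrow> f \<cdot>\<^bsub>C\<^esub> Id C x = f"
    and comp_assoc: "\<lbrakk>w \<in> Ob C; x \<in> Ob C; y \<in> Ob C; z \<in> Ob C;
      f \<in> arr C w x; g \<in> arr C x y; h \<in> arr C y z\<rbrakk>
      \<Longrightarrow> h \<cdot>\<^bsub>C\<^esub> g \<cdot>\<^bsub>C\<^esub> f = h \<cdot>\<^bsub>C\<^esub> (g \<cdot>\<^bsub>C\<^esub> f)"
    and comp_linear_right: "\<lbrakk>x \<in> Ob C; y \<in> Ob C; z \<in> Ob C; g \<in> arr C y z\<rbrakk>
      \<Longrightarrow> (\<lambda>f. g \<cdot>\<^bsub>C\<^esub> f) \<in> module_hom K (Hom C x y) (Hom C x z)"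
    and comp_linear_left: "\<lbrakk>x \<in> Ob C; y \<in> Ob C; z \<in> Ob C; f \<in> arr C x y\<rbrakk>
      \<Longrightarrow> (\<lambda>g. g \<cdot>\<^bsub>C\<^esub> f) \<in> module_hom K (Hom C y z) (Hom C x z)"

definition src :: "('o, 'm, 'k, 'z) lincat_scheme \<Rightarrow> 'm \<Rightarrow> 'o" where
  "src C f = (THE x. x \<in> Ob C \<and> (\<exists>y\<in>Ob C. f \<in> arr C x y))"

definition full_subcat ::
  "('o, 'm, 'k, 'z) lincat_scheme \<Rightarrow> 'o set \<Rightarrow> ('o, 'm, 'k, 'z) lincat_scheme" where
  "full_subcat C P = C\<lparr>Ob := P\<rparr>"

definition opcat :: "('o, 'm, 'k, 'z) lincat_scheme \<Rightarrow> ('o, 'm, 'k, 'z) lincat_scheme" where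
  "opcat C = C\<lparr>Hom := (\<lambda>x y. Hom C y x), Comp := (\<lambda>g f. f \<cdot>\<^bsub>C\<^esub> g)\<rparr>"

definition isos :: "('o, 'm, 'k, 'z) lincat_scheme \<Rightarrow> 'o \<Rightarrow> 'o \<Rightarrow> 'm set" where
  "isos C x y = {f \<in> arr C x y. \<exists>g\<in>arr C y x. g \<cdot>\<^bsub>C\<^esub> f = Id C x \<and> f \<cdot>\<^bsub>C\<^esub> g = Id C y}"

definition hom_zero :: "('o, 'm, 'k, 'z) lincat_scheme \<Rightarrow> 'o set \<Rightarrow> 'o set \<Rightarrow> bool" where
  "hom_zero C X Y \<longleftrightarrow> (\<forall>x\<in>X. \<forall>y\<in>Y. arr C x y = {\<zero>\<^bsub>Hom C x y\<^esub>})"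

definition zero_object :: "('o, 'm, 'k, 'z) lincat_scheme \<Rightarrow> 'o \<Rightarrow> bool" where
  "zero_object C z \<longleftrightarrow> z \<in> Ob C \<and> hom_zero C (Ob C) {z} \<and> hom_zero C {z} (Ob C)"

text \<open>\<open>direct_sum C xs b\<close>: the object \<open>b\<close> is a direct sum (biproduct) of the family \<open>xs\<close>.\<close>

definition direct_sum :: "('o, 'm, 'k, 'z) lincat_scheme \<Rightarrow> 'o list \<Rightarrow> 'o \<Rightarrow> bool" where
  "direct_sum C xs b \<longleftrightarrow> set xs \<subseteq> Ob C \<and> b \<in> Ob C \<and>
    (\<exists>\<iota> \<pi>. (\<forall>i<length xs. \<iota> i \<in> arr C (xs ! i) b \<and> \<pi> i \<in> arr C b (xs ! i)) \<and>
      (\<forall>i<length xs. \<forall>j<length xs. \<pi> j \<cdot>\<^bsub>C\<^esub> \<iota> i =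
        (if i = j then Id C (xs ! i) else \<zero>\<^bsub>Hom C (xs ! i) (xs ! j)\<^esub>)) \<and>
      (\<Oplus>\<^bsub>Hom C b b\<^esub>i\<in>{..<length xs}. \<iota> i \<cdot>\<^bsub>C\<^esub> \<pi> i) = Id C b)"

definition additive_cat :: "('o, 'm, 'k, 'z) lincat_scheme \<Rightarrow> bool" where
  "additive_cat C \<longleftrightarrow> (\<forall>xs. set xs \<subseteq> Ob C \<longrightarrow> (\<exists>b. direct_sum C xs b))"

definition idempotents_split :: "('o, 'm, 'k, 'z) lincat_scheme \<Rightarrow> bool" where
  "idempotents_split C \<longleftrightarrow> (\<forall>x\<in>Ob C. \<forall>e\<in>arr C x x. e \<cdot>\<^bsub>C\<^esub> e = e \<longrightarrow>
    (\<exists>y\<in>Ob C. \<exists>p\<in>arr C x y. \<exists>i\<in>arr C y x. i \<cdot>\<^bsub>C\<^esub> p = e \<and> p \<cdot>\<^bsub>C\<^esub> i = Id C y))"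

definition hom_finite :: "('k, 'r) ring_scheme \<Rightarrow> ('o, 'm, 'k, 'z) lincat_scheme \<Rightarrow> bool" where
  "hom_finite K C \<longleftrightarrow> (\<forall>x\<in>Ob C. \<forall>y\<in>Ob C. vectorspace.fin_dim K (Hom C x y))"

definition local_ring :: "('a, 'z) ring_scheme \<Rightarrow> bool" where
  "local_ring R \<longleftrightarrow> ring R \<and> \<one>\<^bsub>R\<^esub> \<noteq> \<zero>\<^bsub>R\<^esub> \<and>
    (\<forall>a\<in>carrier R - Units R. \<forall>b\<in>carrier R - Units R. a \<oplus>\<^bsub>R\<^esub> b \<in> carrier R - Units R)"

definition End_ring :: "('o, 'm, 'k, 'z) lincat_scheme \<Rightarrow> 'o \<Rightarrow> ('k, 'm) module" where
  "End_ring C x = (Hom C x x)\<lparr>mult := Comp C, one := Id C x\<rparr>"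

definition krull_schmidt :: "('o, 'm, 'k, 'z) lincat_scheme \<Rightarrow> bool" where
  "krull_schmidt C \<longleftrightarrow> additive_cat C \<and>
    (\<forall>x\<in>Ob C. \<exists>xs. (\<forall>y\<in>set xs. local_ring (End_ring C y)) \<and> direct_sum C xs x)"

definition add_closure :: "('o, 'm, 'k, 'z) lincat_scheme \<Rightarrow> 'o \<Rightarrow> 'o set" where
  "add_closure C m = {x. \<exists>n y b. direct_sum C (replicate n m) b \<and> direct_sum C [x, y] b}"


section \<open>Linear functors and equivalences\<close>

record ('o, 'm, 'p, 'n) cfun =
  omap :: "'o \<Rightarrow> 'p"
  amap :: "'m \<Rightarrow> 'n"

definition id_cfun :: "('o, 'm, 'o, 'm) cfun" where
  "id_cfun = \<lparr>omap = (\<lambda>x. x), amap = (\<lambda>f. f)\<rparr>"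

definition comp_cfun ::
  "('p, 'n, 'q, 'l) cfun \<Rightarrow> ('o, 'm, 'p, 'n) cfun \<Rightarrow> ('o, 'm, 'q, 'l) cfun" (infixl \<open>\<circ>\<^sub>F\<close> 72) where
  "G \<circ>\<^sub>F F = \<lparr>omap = omap G \<circ> omap F, amap = amap G \<circ> amap F\<rparr>"

definition lin_functor :: "('k, 'r) ring_scheme \<Rightarrow> ('o, 'm, 'k, 'z) lincat_scheme
    \<Rightarrow> ('p, 'n, 'k, 'y) lincat_scheme \<Rightarrow> ('o, 'm, 'p, 'n) cfun \<Rightarrow> bool" where
  "lin_functor K C D F \<longleftrightarrow>
    (\<forall>x\<in>Ob C. omap F x \<in> Ob D \<and> amap F (Id C x) = Id D (omap F x)) \<and>
    (\<forall>x\<in>Ob C. \<forall>y\<in>Ob C. amap F \<in> module_hom K (Hom C x y) (Hom D (omap F x) (omap F y))) \<and>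
    (\<forall>x\<in>Ob C. \<forall>y\<in>Ob C. \<forall>z\<in>Ob C. \<forall>f\<in>arr C x y. \<forall>g\<in>arr C y z.
      amap F (g \<cdot>\<^bsub>C\<^esub> f) = amap F g \<cdot>\<^bsub>D\<^esub> amap F f)"

definition nat_iso :: "('o, 'm, 'k, 'z) lincat_scheme \<Rightarrow> ('p, 'n, 'k, 'y) lincat_scheme
    \<Rightarrow> ('o, 'm, 'p, 'n) cfun \<Rightarrow> ('o, 'm, 'p, 'n) cfun \<Rightarrow> ('o \<Rightarrow> 'n) \<Rightarrow> bool" where
  "nat_iso C D F G \<eta> \<longleftrightarrow>
    (\<forall>x\<in>Ob C. \<eta> x \<in> isos D (omap F x) (omap G x)) \<and>
    (\<forall>x\<in>Ob C. \<forall>y\<in>Ob C. \<forall>f\<in>arr C x y. \<eta> y \<cdot>\<^bsub>D\<^esub> amap F f = amap G f \<cdot>\<^bsub>D\<^esub> \<eta> x)"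

definition quasi_inverse :: "('k, 'r) ring_scheme \<Rightarrow> ('o, 'm, 'k, 'z) lincat_scheme
    \<Rightarrow> ('p, 'n, 'k, 'y) lincat_scheme \<Rightarrow> ('o, 'm, 'p, 'n) cfun \<Rightarrow> ('p, 'n, 'o, 'm) cfun \<Rightarrow> bool" where
  "quasi_inverse K C D F G \<longleftrightarrow> lin_functor K C D F \<and> lin_functor K D C G \<and>
    (\<exists>\<eta>. nat_iso C C (G \<circ>\<^sub>F F) id_cfun \<eta>) \<and> (\<exists>\<epsilon>. nat_iso D D (F \<circ>\<^sub>F G) id_cfun \<epsilon>)"

definition cat_equivalence :: "('k, 'r) ring_scheme \<Rightarrow> ('o, 'm, 'k, 'z) lincat_scheme
    \<Rightarrow> ('p, 'n, 'k, 'y) lincat_scheme \<Rightarrow> ('o, 'm, 'p, 'n) cfun \<Rightarrow> bool" where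
  "cat_equivalence K C D F \<longleftrightarrow> (\<exists>G. quasi_inverse K C D F G)"


section \<open>Duality and Serre functors\<close>

text \<open>The dual space \<open>Hom\<^sub>K(V, K)\<close>; functionals are extensional, i.e. \<^const>\<open>undefined\<close> off the
  carrier of \<open>V\<close>, so that equality of functionals is equality of functions.\<close>

definition dual :: "('k, 'r) ring_scheme \<Rightarrow> ('k, 'v) module \<Rightarrow> ('k, 'v \<Rightarrow> 'k) module" where
  "dual K V = \<lparr>carrier = {\<phi> \<in> carrier V \<rightarrow>\<^sub>E carrier K.
        (\<forall>v\<in>carrier V. \<forall>w\<in>carrier V. \<phi> (v \<oplus>\<^bsub>V\<^esub> w) = \<phi> v \<oplus>\<^bsub>K\<^esub> \<phi> w) \<and>
        (\<forall>a\<in>carrier K. \<forall>v\<in>carrier V. \<phi> (a \<odot>\<^bsub>V\<^esub> v) = a \<otimes>\<^bsub>K\<^esub> \<phi> v)},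
     mult = undefined, one = undefined,
     zero = (\<lambda>v\<in>carrier V. \<zero>\<^bsub>K\<^esub>),
     add = (\<lambda>\<phi> \<psi>. \<lambda>v\<in>carrier V. \<phi> v \<oplus>\<^bsub>K\<^esub> \<psi> v),
     smult = (\<lambda>a \<phi>. \<lambda>v\<in>carrier V. a \<otimes>\<^bsub>K\<^esub> \<phi> v)\<rparr>"

text \<open>An isomorphism \<open>D Hom(x, y) \<cong> Hom(y, F x)\<close>, natural in \<open>x \<in> P\<close> and in \<open>y\<close>.\<close>

definition serre_duality :: "('k, 'r) ring_scheme \<Rightarrow> ('o, 'm, 'k, 'z) lincat_scheme \<Rightarrow> 'o set
    \<Rightarrow> ('o, 'm, 'o, 'm) cfun \<Rightarrow> bool" where
  "serre_duality K C P F \<longleftrightarrow> (\<exists>\<eta>.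
    (\<forall>x\<in>P. \<forall>y\<in>Ob C.
      \<eta> x y \<in> module_hom K (dual K (Hom C x y)) (Hom C y (omap F x)) \<and>
      bij_betw (\<eta> x y) (carrier (dual K (Hom C x y))) (arr C y (omap F x))) \<and>
    (\<forall>x\<in>P. \<forall>x'\<in>P. \<forall>y\<in>Ob C. \<forall>y'\<in>Ob C. \<forall>a\<in>arr C x x'. \<forall>b\<in>arr C y' y.
      \<forall>\<phi>\<in>carrier (dual K (Hom C x y)).
      \<eta> x' y' (\<lambda>g\<in>arr C x' y'. \<phi> (b \<cdot>\<^bsub>C\<^esub> g \<cdot>\<^bsub>C\<^esub> a)) = amap F a \<cdot>\<^bsub>C\<^esub> \<eta> x y \<phi> \<cdot>\<^bsub>C\<^esub> b))"

definition serre_functor :: "('k, 'r) ring_scheme \<Rightarrow> ('o, 'm, 'k, 'z) lincat_scheme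
    \<Rightarrow> ('o, 'm, 'o, 'm) cfun \<Rightarrow> bool" where
  "serre_functor K C F \<longleftrightarrow> cat_equivalence K C C F \<and> serre_duality K C (Ob C) F"


section \<open>Dualizing varieties\<close>

text \<open>Covariant \<open>K\<close>-linear functors from \<open>C\<close> to \<open>K\<close>-vector spaces with values in a type \<open>'v\<close>;
  contravariant ones are covariant functors on \<^term>\<open>opcat C\<close>.\<close>

record ('o, 'm, 'k, 'v) vfun =
  vob :: "'o \<Rightarrow> ('k, 'v) module"
  vmap :: "'m \<Rightarrow> 'v \<Rightarrow> 'v"

definition vect_functor :: "('k, 'r) ring_scheme \<Rightarrow> ('o, 'm, 'k, 'z) lincat_scheme
    \<Rightarrow> ('o, 'm, 'k, 'v) vfun \<Rightarrow> bool" where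
  "vect_functor K C F \<longleftrightarrow>
    (\<forall>x\<in>Ob C. vectorspace K (vob F x) \<and> (\<forall>v\<in>carrier (vob F x). vmap F (Id C x) v = v)) \<and>
    (\<forall>x\<in>Ob C. \<forall>y\<in>Ob C. \<forall>f\<in>arr C x y. vmap F f \<in> module_hom K (vob F x) (vob F y)) \<and>
    (\<forall>x\<in>Ob C. \<forall>y\<in>Ob C. \<forall>v\<in>carrier (vob F x).
      (\<lambda>f. vmap F f v) \<in> module_hom K (Hom C x y) (vob F y)) \<and>
    (\<forall>x\<in>Ob C. \<forall>y\<in>Ob C. \<forall>z\<in>Ob C. \<forall>f\<in>arr C x y. \<forall>g\<in>arr C y z. \<forall>v\<in>carrier (vob F x).
      vmap F (g \<cdot>\<^bsub>C\<^esub> f) v = vmap F g (vmap F f v))"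

definition vnat_trans :: "('k, 'r) ring_scheme \<Rightarrow> ('o, 'm, 'k, 'z) lincat_scheme
    \<Rightarrow> ('o, 'm, 'k, 'v) vfun \<Rightarrow> ('o, 'm, 'k, 'w) vfun \<Rightarrow> ('o \<Rightarrow> 'v \<Rightarrow> 'w) \<Rightarrow> bool" where
  "vnat_trans K C F G \<eta> \<longleftrightarrow>
    (\<forall>x\<in>Ob C. \<eta> x \<in> module_hom K (vob F x) (vob G x)) \<and>
    (\<forall>x\<in>Ob C. \<forall>y\<in>Ob C. \<forall>f\<in>arr C x y. \<forall>v\<in>carrier (vob F x).
      \<eta> y (vmap F f v) = vmap G f (\<eta> x v))"

definition hom_functor :: "('o, 'm, 'k, 'z) lincat_scheme \<Rightarrow> 'o \<Rightarrow> ('o, 'm, 'k, 'm) vfun" where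
  "hom_functor C m = \<lparr>vob = Hom C m, vmap = Comp C\<rparr>"

text \<open>\<open>Hom(m\<^sub>1, -) \<rightarrow> Hom(m\<^sub>0, -) \<rightarrow> F \<rightarrow> 0\<close> is exact for some \<open>m\<^sub>0\<close> and \<open>m\<^sub>1\<close>.\<close>

definition fin_presented :: "('k, 'r) ring_scheme \<Rightarrow> ('o, 'm, 'k, 'z) lincat_scheme
    \<Rightarrow> ('o, 'm, 'k, 'v) vfun \<Rightarrow> bool" where
  "fin_presented K C F \<longleftrightarrow> vect_functor K C F \<and>
    (\<exists>m0\<in>Ob C. \<exists>m1\<in>Ob C. \<exists>q p.
      vnat_trans K C (hom_functor C m1) (hom_functor C m0) q \<and>
      vnat_trans K C (hom_functor C m0) F p \<and>
      (\<forall>x\<in>Ob C. q x ` arr C m1 x = {g \<in> arr C m0 x. p x g = \<zero>\<^bsub>vob F x\<^esub>} \<and>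
        p x ` arr C m0 x = carrier (vob F x)))"

text \<open>The category of finitely presented functors on \<open>C\<close>. A morphism is a triple consisting of
  source, target and a natural transformation made extensional by \<open>vext\<close>.\<close>

definition vext :: "('o, 'm, 'k, 'z) lincat_scheme \<Rightarrow> ('o, 'm, 'k, 'v) vfun
    \<Rightarrow> ('o \<Rightarrow> 'v \<Rightarrow> 'w) \<Rightarrow> ('o \<Rightarrow> 'v \<Rightarrow> 'w)" where
  "vext C F \<eta> = (\<lambda>x\<in>Ob C. \<lambda>v\<in>carrier (vob F x). \<eta> x v)"

type_synonym ('o, 'm, 'k, 'v) vnat =
  "('o, 'm, 'k, 'v) vfun \<times> ('o, 'm, 'k, 'v) vfun \<times> ('o \<Rightarrow> 'v \<Rightarrow> 'v)"

definition fp_cat :: "('k, 'r) ring_scheme \<Rightarrow> ('o, 'm, 'k, 'z) lincat_scheme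
    \<Rightarrow> (('o, 'm, 'k, 'v) vfun, ('o, 'm, 'k, 'v) vnat, 'k) lincat" where
  "fp_cat K C = \<lparr>
     Ob = {F. fin_presented K C F},
     Hom = (\<lambda>F G. \<lparr>carrier = {(F, G, vext C F \<eta>) | \<eta>. vnat_trans K C F G \<eta>},
       mult = undefined, one = undefined,
       zero = (F, G, vext C F (\<lambda>x v. \<zero>\<^bsub>vob G x\<^esub>)),
       add = (\<lambda>(_, _, \<eta>) (_, _, \<theta>). (F, G, vext C F (\<lambda>x v. \<eta> x v \<oplus>\<^bsub>vob G x\<^esub> \<theta> x v))),
       smult = (\<lambda>a (_, _, \<eta>). (F, G, vext C F (\<lambda>x v. a \<odot>\<^bsub>vob G x\<^esub> \<eta> x v)))\<rparr>),
     Comp = (\<lambda>(_, H, \<theta>) (F, _, \<eta>). (F, H, vext C F (\<lambda>x v. \<theta> x (\<eta> x v)))),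
     Id = (\<lambda>F. (F, F, vext C F (\<lambda>x v. v)))\<rparr>"

text \<open>Pointwise dual of a functor on \<open>C\<close>, which is a functor on \<^term>\<open>opcat C\<close>, and the induced
  functor \<open>D\<close> from finitely presented functors on \<open>C\<close> to functors on \<^term>\<open>opcat C\<close>,
  contravariant in the functor.\<close>

definition dual_vfun :: "('k, 'r) ring_scheme \<Rightarrow> ('o, 'm, 'k, 'z) lincat_scheme
    \<Rightarrow> ('o, 'm, 'k, 'v) vfun \<Rightarrow> ('o, 'm, 'k, 'v \<Rightarrow> 'k) vfun" where
  "dual_vfun K C F = \<lparr>vob = (\<lambda>x. dual K (vob F x)),
     vmap = (\<lambda>f \<phi>. \<lambda>v\<in>carrier (vob F (src C f)). \<phi> (vmap F f v))\<rparr>"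

definition dual_functor :: "('k, 'r) ring_scheme \<Rightarrow> ('o, 'm, 'k, 'z) lincat_scheme
    \<Rightarrow> (('o, 'm, 'k, 'v) vfun, ('o, 'm, 'k, 'v) vnat,
        ('o, 'm, 'k, 'v \<Rightarrow> 'k) vfun, ('o, 'm, 'k, 'v \<Rightarrow> 'k) vnat) cfun" where
  "dual_functor K C = \<lparr>omap = dual_vfun K C,
     amap = (\<lambda>(F, G, \<eta>). (dual_vfun K C G, dual_vfun K C F,
       vext C (dual_vfun K C G) (\<lambda>x \<phi>. \<lambda>v\<in>carrier (vob F x). \<phi> (\<eta> x v))))\<rparr>"

text \<open>A dualizing variety is a Hom-finite additive category with split idempotents for
  which \<open>D\<close> is a duality from the finitely presented contravariant functors to the finitely
  presented covariant ones. Contravariant functors take values in \<open>'m set\<close> and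
  covariant ones in \<open>'m set \<Rightarrow> 'k\<close>; up to isomorphism this is no restriction, since the
  cokernel of \<open>Hom(-, m\<^sub>1) \<rightarrow> Hom(-, m\<^sub>0)\<close> (or of \<open>Hom(m\<^sub>1, -) \<rightarrow> Hom(m\<^sub>0, -)\<close>) consists of
  cosets, which are sets of morphisms, and \<open>'m set\<close> embeds into \<open>'m set \<Rightarrow> 'k\<close>.\<close>

definition dualizing_variety ::
  "('k, 'r) ring_scheme \<Rightarrow> ('o, 'm, 'k, 'z) lincat_scheme \<Rightarrow> bool" where
  "dualizing_variety K C \<longleftrightarrow>
    lin_category K C \<and> additive_cat C \<and> hom_finite K C \<and> idempotents_split C \<and>
    cat_equivalence K
      (opcat (fp_cat K (opcat C)) ::
        (('o, 'm, 'k, 'm set) vfun, ('o, 'm, 'k, 'm set) vnat, 'k) lincat)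
      (fp_cat K C) (dual_functor K (opcat C))"


section \<open>Triangulated categories\<close>

text \<open>The shift \<open>Sh\<close> is an autoequivalence with a chosen quasi-inverse \<open>Shi\<close>; a distinguished
  triangle \<open>x \<rightarrow> y \<rightarrow> z \<rightarrow> Sh x\<close> is given by its three morphisms.\<close>

record ('o, 'm, 'k) tricat = "('o, 'm, 'k) lincat" +
  Sh :: "('o, 'm, 'o, 'm) cfun"
  Shi :: "('o, 'm, 'o, 'm) cfun"
  Tri :: "('m \<times> 'm \<times> 'm) set"

definition candidate :: "('o, 'm, 'k, 'z) lincat_scheme \<Rightarrow> ('o, 'm, 'o, 'm) cfun
    \<Rightarrow> 'o \<Rightarrow> 'o \<Rightarrow> 'o \<Rightarrow> 'm \<times> 'm \<times> 'm \<Rightarrow> bool" where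
  "candidate C \<Sigma> x y z = (\<lambda>(f, g, h). x \<in> Ob C \<and> y \<in> Ob C \<and> z \<in> Ob C \<and>
    f \<in> arr C x y \<and> g \<in> arr C y z \<and> h \<in> arr C z (omap \<Sigma> x))"

definition isomorphic_triangles :: "('o, 'm, 'k, 'z) lincat_scheme \<Rightarrow> ('o, 'm, 'o, 'm) cfun
    \<Rightarrow> 'm \<times> 'm \<times> 'm \<Rightarrow> 'm \<times> 'm \<times> 'm \<Rightarrow> bool" where
  "isomorphic_triangles C \<Sigma> = (\<lambda>(f, g, h) (f', g', h'). \<exists>x y z x' y' z' a b c.
    candidate C \<Sigma> x y z (f, g, h) \<and> candidate C \<Sigma> x' y' z' (f', g', h') \<and>
    a \<in> isos C x x' \<and> b \<in> isos C y y' \<and> c \<in> isos C z z' \<and>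
    b \<cdot>\<^bsub>C\<^esub> f = f' \<cdot>\<^bsub>C\<^esub> a \<and> c \<cdot>\<^bsub>C\<^esub> g = g' \<cdot>\<^bsub>C\<^esub> b \<and> amap \<Sigma> a \<cdot>\<^bsub>C\<^esub> h = h' \<cdot>\<^bsub>C\<^esub> c)"

definition triangle :: "('o, 'm, 'k, 'z) tricat_scheme \<Rightarrow> 'o \<Rightarrow> 'o \<Rightarrow> 'o
    \<Rightarrow> 'm \<Rightarrow> 'm \<Rightarrow> 'm \<Rightarrow> bool" where
  "triangle T x y z f g h \<longleftrightarrow> candidate T (Sh T) x y z (f, g, h) \<and> (f, g, h) \<in> Tri T"

locale triangulated_category = lin_category K T
  for K :: "('k, 'r) ring_scheme" (structure) and T :: "('o, 'm, 'k, 'z) tricat_scheme" +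
  assumes additive: "additive_cat T"
    and shift: "quasi_inverse K T T (Sh T) (Shi T)"
    and tri_candidate: "t \<in> Tri T \<Longrightarrow> \<exists>x y z. candidate T (Sh T) x y z t"
    and TR1_id: "\<lbrakk>x \<in> Ob T; zero_object T z\<rbrakk> \<Longrightarrow>
      triangle T x x z (Id T x) \<zero>\<^bsub>Hom T x z\<^esub> \<zero>\<^bsub>Hom T z (omap (Sh T) x)\<^esub>"
    and TR1_iso: "\<lbrakk>t \<in> Tri T; isomorphic_triangles T (Sh T) t t'\<rbrakk> \<Longrightarrow> t' \<in> Tri T"
    and TR1_ex: "\<lbrakk>x \<in> Ob T; y \<in> Ob T; f \<in> arr T x y\<rbrakk> \<Longrightarrow> \<exists>z g h. triangle T x y z f g h"
    and TR2: "candidate T (Sh T) x y z (f, g, h) \<Longrightarrow>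
      triangle T x y z f g h \<longleftrightarrow>
      triangle T y z (omap (Sh T) x) g h
        (\<ominus>\<^bsub>Hom T (omap (Sh T) x) (omap (Sh T) y)\<^esub> amap (Sh T) f)"
    and TR3: "\<lbrakk>triangle T x y z f g h; triangle T x' y' z' f' g' h';
      \<alpha> \<in> arr T x x'; \<beta> \<in> arr T y y'; \<beta> \<cdot>\<^bsub>T\<^esub> f = f' \<cdot>\<^bsub>T\<^esub> \<alpha>\<rbrakk> \<Longrightarrow>
      \<exists>\<gamma>\<in>arr T z z'. \<gamma> \<cdot>\<^bsub>T\<^esub> g = g' \<cdot>\<^bsub>T\<^esub> \<beta> \<and> amap (Sh T) \<alpha> \<cdot>\<^bsub>T\<^esub> h = h' \<cdot>\<^bsub>T\<^esub> \<gamma>"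
    and TR4: "\<lbrakk>triangle T x y a f u u'; triangle T y z b g v v';
      triangle T x z c (g \<cdot>\<^bsub>T\<^esub> f) w w'\<rbrakk> \<Longrightarrow>
      \<exists>s t. triangle T a c b s t (amap (Sh T) u \<cdot>\<^bsub>T\<^esub> v') \<and>
        s \<cdot>\<^bsub>T\<^esub> u = w \<cdot>\<^bsub>T\<^esub> g \<and> w' \<cdot>\<^bsub>T\<^esub> s = u' \<and> t \<cdot>\<^bsub>T\<^esub> w = v \<and>
        v' \<cdot>\<^bsub>T\<^esub> t = amap (Sh T) f \<cdot>\<^bsub>T\<^esub> w'"

definition thick :: "('o, 'm, 'k, 'z) tricat_scheme \<Rightarrow> 'o set \<Rightarrow> bool" where
  "thick T S \<longleftrightarrow> S \<subseteq> Ob T \<and> S \<noteq> {} \<and>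
    (\<forall>x\<in>S. omap (Sh T) x \<in> S \<and> omap (Shi T) x \<in> S) \<and>
    (\<forall>x y z f g h. triangle T x y z f g h \<and> x \<in> S \<and> y \<in> S \<longrightarrow> z \<in> S) \<and>
    (\<forall>x y b. direct_sum T [x, y] b \<and> b \<in> S \<longrightarrow> x \<in> S \<and> y \<in> S)"

definition thick_closure :: "('o, 'm, 'k, 'z) tricat_scheme \<Rightarrow> 'o set \<Rightarrow> 'o set" where
  "thick_closure T M = \<Inter>{S. thick T S \<and> M \<subseteq> S}"

definition full_tri_subcat ::
  "('o, 'm, 'k, 'z) tricat_scheme \<Rightarrow> 'o set \<Rightarrow> ('o, 'm, 'k, 'z) tricat_scheme" where
  "full_tri_subcat T S = (full_subcat T S)
    \<lparr>Tri := {(f, g, h) |f g h. \<exists>x\<in>S. \<exists>y\<in>S. \<exists>z\<in>S. triangle T x y z f g h}\<rparr>"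

definition triangle_functor :: "('k, 'r) ring_scheme \<Rightarrow> ('o, 'm, 'k, 'z) tricat_scheme
    \<Rightarrow> ('p, 'n, 'k, 'y) tricat_scheme \<Rightarrow> ('o, 'm, 'p, 'n) cfun \<Rightarrow> bool" where
  "triangle_functor K T T' F \<longleftrightarrow> lin_functor K T T' F \<and>
    (\<exists>\<phi>. nat_iso T T' (F \<circ>\<^sub>F Sh T) (Sh T' \<circ>\<^sub>F F) \<phi> \<and>
      (\<forall>x y z f g h. triangle T x y z f g h \<longrightarrow>
        triangle T' (omap F x) (omap F y) (omap F z)
          (amap F f) (amap F g) (\<phi> x \<cdot>\<^bsub>T'\<^esub> amap F h)))"

definition triangle_equivalence :: "('k, 'r) ring_scheme \<Rightarrow> ('o, 'm, 'k, 'z) tricat_scheme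
    \<Rightarrow> ('p, 'n, 'k, 'y) tricat_scheme \<Rightarrow> ('o, 'm, 'p, 'n) cfun \<Rightarrow> bool" where
  "triangle_equivalence K T T' F \<longleftrightarrow> triangle_functor K T T' F \<and> cat_equivalence K T T' F"


section \<open>Torsion pairs and silting subcategories\<close>

definition star :: "('o, 'm, 'k, 'z) tricat_scheme \<Rightarrow> 'o set \<Rightarrow> 'o set \<Rightarrow> 'o set" where
  "star T X Y = {t. \<exists>x\<in>X. \<exists>y\<in>Y. \<exists>f g h. triangle T x t y f g h}"

definition rperp :: "('o, 'm, 'k, 'z) lincat_scheme \<Rightarrow> 'o set \<Rightarrow> 'o set" where
  "rperp C X = {t \<in> Ob C. hom_zero C X {t}}"

definition lperp :: "('o, 'm, 'k, 'z) lincat_scheme \<Rightarrow> 'o set \<Rightarrow> 'o set" where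
  "lperp C X = {t \<in> Ob C. hom_zero C {t} X}"

definition torsion_pair :: "('o, 'm, 'k, 'z) tricat_scheme \<Rightarrow> 'o set \<Rightarrow> 'o set \<Rightarrow> bool" where
  "torsion_pair T X Y \<longleftrightarrow> X \<subseteq> Ob T \<and> Y \<subseteq> Ob T \<and>
    hom_zero T X Y \<and> star T X Y = Ob T \<and> X = lperp T Y \<and> Y = rperp T X"

definition t_structure :: "('o, 'm, 'k, 'z) tricat_scheme \<Rightarrow> 'o set \<Rightarrow> 'o set \<Rightarrow> bool" where
  "t_structure T X Y \<longleftrightarrow> torsion_pair T X Y \<and> omap (Sh T) ` X \<subseteq> X"

definition shift_ob :: "('o, 'm, 'k, 'z) tricat_scheme \<Rightarrow> int \<Rightarrow> 'o \<Rightarrow> 'o" where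
  "shift_ob T i x = (if 0 \<le> i then (omap (Sh T) ^^ nat i) x else (omap (Shi T) ^^ nat (- i)) x)"

definition shifts :: "('o, 'm, 'k, 'z) tricat_scheme \<Rightarrow> 'o set \<Rightarrow> int set \<Rightarrow> 'o set" where
  "shifts T M I = {shift_ob T i m | i m. i \<in> I \<and> m \<in> M}"

definition silting :: "('o, 'm, 'k, 'z) tricat_scheme \<Rightarrow> 'o set \<Rightarrow> bool" where
  "silting T M \<longleftrightarrow> M \<subseteq> Ob T \<and> hom_zero T M (shifts T M {0<..}) \<and> thick_closure T M = Ob T"


section \<open>Verdier quotients\<close>

text \<open>Morphisms \<open>x \<rightarrow> y\<close> in \<open>T/S\<close> are equivalence classes of roofs \<open>x \<leftarrow> z \<rightarrow> y\<close>, written \<open>(s, f)\<close>,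
  where the cone of \<open>s : z \<rightarrow> x\<close> lies in \<open>S\<close>.\<close>

definition cone_in :: "('o, 'm, 'k, 'z) tricat_scheme \<Rightarrow> 'o set \<Rightarrow> 'm set" where
  "cone_in T S = {s. \<exists>x y z g h. triangle T x y z s g h \<and> z \<in> S}"

definition roofs :: "('o, 'm, 'k, 'z) tricat_scheme \<Rightarrow> 'o set \<Rightarrow> 'o \<Rightarrow> 'o \<Rightarrow> ('m \<times> 'm) set" where
  "roofs T S x y = {(s, f). \<exists>z\<in>Ob T. s \<in> arr T z x \<inter> cone_in T S \<and> f \<in> arr T z y}"

text \<open>Two roofs are equivalent if they are dominated by a common roof.\<close>

definition roof_rel :: "('o, 'm, 'k, 'z) tricat_scheme \<Rightarrow> 'o set \<Rightarrow> (('m \<times> 'm) \<times> ('m \<times> 'm)) set" where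
  "roof_rel T S = {((s, f), (s', f')). \<exists>x\<in>Ob T. \<exists>y\<in>Ob T.
     (s, f) \<in> roofs T S x y \<and> (s', f') \<in> roofs T S x y \<and>
     (\<exists>w\<in>Ob T. \<exists>u\<in>arr T w (src T s). \<exists>u'\<in>arr T w (src T s').
       s \<cdot>\<^bsub>T\<^esub> u = s' \<cdot>\<^bsub>T\<^esub> u' \<and> f \<cdot>\<^bsub>T\<^esub> u = f' \<cdot>\<^bsub>T\<^esub> u' \<and> s \<cdot>\<^bsub>T\<^esub> u \<in> cone_in T S)}"

text \<open>Sums are formed over a common denominator, and composites \<open>B \<circ> A\<close> after choosing a
  representative of \<open>A\<close> whose numerator factors through the denominator of one of \<open>B\<close>. By the
  Ore condition such representatives exist, and the resulting class does not depend on them.\<close>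

definition quotient_cat :: "('o, 'm, 'k, 'z) tricat_scheme \<Rightarrow> 'o set
    \<Rightarrow> ('o, ('m \<times> 'm) set, 'k) lincat" where
  "quotient_cat T S = \<lparr>
     Ob = Ob T,
     Hom = (\<lambda>x y. \<lparr>carrier = roofs T S x y // roof_rel T S,
       mult = undefined, one = undefined,
       zero = roof_rel T S `` {(Id T x, \<zero>\<^bsub>Hom T x y\<^esub>)},
       add = (\<lambda>A B. roof_rel T S ``
         {(s, f \<oplus>\<^bsub>Hom T (src T s) y\<^esub> g) | s f g. (s, f) \<in> A \<and> (s, g) \<in> B}),
       smult = (\<lambda>a A. roof_rel T S `` {(s, a \<odot>\<^bsub>Hom T (src T s) y\<^esub> f) | s f. (s, f) \<in> A})\<rparr>),
     Comp = (\<lambda>B A. roof_rel T S ``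
       {(s, g \<cdot>\<^bsub>T\<^esub> p) | s t p g.
         p \<in> arr T (src T s) (src T t) \<and> (s, t \<cdot>\<^bsub>T\<^esub> p) \<in> A \<and> (t, g) \<in> B}),
     Id = (\<lambda>x. roof_rel T S `` {(Id T x, Id T x)})\<rparr>"

definition quotient_functor :: "('o, 'm, 'k, 'z) tricat_scheme \<Rightarrow> 'o set
    \<Rightarrow> ('o, 'm, 'o, ('m \<times> 'm) set) cfun" where
  "quotient_functor T S = \<lparr>omap = (\<lambda>x. x), amap = (\<lambda>f. roof_rel T S `` {(Id T (src T f), f)})\<rparr>"

text \<open>The functor induced on \<open>T/S\<close> by an endofunctor of \<open>T\<close>.\<close>

definition induced_functor :: "('o, 'm, 'k, 'z) tricat_scheme \<Rightarrow> 'o set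
    \<Rightarrow> ('o, 'm, 'o, 'm) cfun \<Rightarrow> ('o, ('m \<times> 'm) set, 'o, ('m \<times> 'm) set) cfun" where
  "induced_functor T S F = \<lparr>omap = omap F,
     amap = (\<lambda>A. roof_rel T S `` {(amap F s, amap F f) | s f. (s, f) \<in> A})\<rparr>"

definition verdier_quotient :: "('o, 'm, 'k, 'z) tricat_scheme \<Rightarrow> 'o set
    \<Rightarrow> ('o, ('m \<times> 'm) set, 'k) tricat" where
  "verdier_quotient T S = (let C = quotient_cat T S; Q = quotient_functor T S;
      \<Sigma> = induced_functor T S (Sh T) in
    \<lparr>Ob = Ob C, Hom = Hom C, Comp = Comp C, Id = Id C,
     Sh = \<Sigma>, Shi = induced_functor T S (Shi T),
     Tri = {t. \<exists>(f, g, h)\<in>Tri T. isomorphic_triangles C \<Sigma> (amap Q f, amap Q g, amap Q h) t}\<rparr>)"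


section \<open>Relative Serre quadruples\<close>

locale relative_serre_quadruple = triangulated_category K T
  for K :: "('k, 'r) ring_scheme" (structure) and T :: "('o, 'm, 'k, 'z) tricat_scheme" +
  fixes S :: "'o set" and \<SS> :: "('o, 'm, 'o, 'm) cfun" and M :: "'o set"
  assumes RS0_hom_finite: "hom_finite K T"
    and RS0_krull_schmidt: "krull_schmidt T"
    and RS0_thick: "thick T S"
    and RS1_equivalence: "triangle_equivalence K (full_tri_subcat T S) (full_tri_subcat T S) \<SS>"
    and RS1_serre: "serre_duality K T S \<SS>"
    and RS2_silting: "silting T M"
    and RS2_t_structure: "t_structure T (rperp T (shifts T M {..<0})) (rperp T (shifts T M {0..}))"
    and RS2_subset: "rperp T (shifts T M {0..}) \<subseteq> S"
    and RS2_dualizing: "dualizing_variety K (full_subcat T M)"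

definition fundamental_domain :: "('o, 'm, 'k, 'z) tricat_scheme \<Rightarrow> 'o set \<Rightarrow> 'o set \<Rightarrow> 'o set" where
  "fundamental_domain T S M =
    (let X = rperp T (shifts T M {..<0}) \<inter> S; Y = rperp T (shifts T M {0..})
     in rperp T X \<inter> lperp T (omap (Sh T) ` Y))"

text \<open>\<open>F\<close> is a triangle autoequivalence of \<open>T\<close> whose restriction to \<open>S\<close> is \<open>\<SS>\<close>, up to natural
  isomorphism.\<close>

definition extends_serre :: "('k, 'r) ring_scheme \<Rightarrow> ('o, 'm, 'k, 'z) tricat_scheme \<Rightarrow> 'o set
    \<Rightarrow> ('o, 'm, 'o, 'm) cfun \<Rightarrow> ('o, 'm, 'o, 'm) cfun \<Rightarrow> bool" where
  "extends_serre K T S \<SS> F \<longleftrightarrow> triangle_equivalence K T T F \<and>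
    (\<exists>\<eta>. nat_iso (full_subcat T S) T F \<SS> \<eta>)"

end

theory Submission
 imports Defs
begin

text \<open>
 Let \<open>U\<close> be the class of all \<open>t\<close> with \<open>Hom(t, M[i]) = 0\<close> for \<open>i > 0\<close>, and \<open>V\<close> the class of all \<open>v \<in> S\<close> with
 \<open>Hom(v, M[i]) = 0\<close> for \<open>i \<le> 0\<close>. For \<open>t \<in> U\<close> the functor \<open>Hom(t, -)\<close> on \<open>M\<close> is finitely presented by left
 \<open>M\<close>-approximations. Since \<open>M\<close> is a dualizing variety, its dual is the cokernel of a morphism of
 \<open>Hom(-, M)\<close>, hence of the form \<open>Hom(-, h)\<close> with \<open>h\<close> in the heart of the t-structure. As \<open>h \<in> S\<close>, Serre
 duality yields a triangle \<open>v \<rightarrow> t \<rightarrow> c\<close> with \<open>v[1] \<in> V\<close> and \<open>c[1] \<in> U\<close>. Iteration gives \<open>T = V * U\<close>, because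
 every object has a shift in \<open>U\<close>. In case (i) \<open>\<SS>[-1]\<close> carries this to \<open>T = X * X\<^sup>\<bottom>\<close>. In case (ii) the heart has
 finite length and finitely many simple objects, so \<open>X\<close> is contained in a shift of \<open>V\<close>, and truncating by
 the t-structure again gives \<open>T = X * X\<^sup>\<bottom>\<close>.

 Truncating the cone of a roof from \<open>a \<in> \<^sup>\<bottom>(Y[1])\<close> to \<open>b \<in> X\<^sup>\<bottom>\<close> shows that it comes from a unique morphism of \<open>T\<close>,
 and the two torsion pairs move every object into \<open>Z\<close> without changing it in the quotient.

 For the Serre functor, a roof \<open>x \<leftarrow> w \<rightarrow> (\<SS> x)[-1]\<close> whose left leg has cone \<open>c \<in> S\<close> gives
 \<open>c \<rightarrow> w[1] \<rightarrow> \<SS> x \<rightarrow> \<SS> c\<close>, and the Serre trace of this composite is a trace form on the quotient. It suffices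
 to show that it is nondegenerate on \<open>Z\<close>, where the pairings are computed in \<open>T\<close>.
\<close>

text \<open>The given t-structure measures Hom(M, -), whereas the pair V, U measures Hom(-, M). On S
  the two are exchanged by \<open>\<SS>\<close>: Hom(v, M[i]) vanishes exactly when Hom(M[i], \<SS>
  v) does, so V is the inverse image of a shifted aisle. On T there is no such exchange, and this is
  the obstacle: for t outside S the truncation towards V cannot be transported from the t-structure.
  The dualizing condition supplies the missing piece, the heart object that a Serre dual of t would
  have in degree 0. An isomorphism on M between Hom(t, -) and Hom(v, -) is not yet an arrow v -> t,
  since t is not in M. The arrow is assembled from two successive left M-approximations, and these
  exist because M generates a weight structure. The quotient has to be triangulated by hand. Its
  octahedra are transported from T along isomorphisms of triangles, which presupposes TR3 and the
  five lemma in the quotient; hence the axioms are split into those before and after the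
  octahedron.\<close>

context lin_category
begin

text \<open>Distinct pairs of objects have disjoint Hom-sets, so an arrow determines its endpoints.
  With \<open>ar\<close>, \<open>dm\<close> and \<open>cd\<close> every typing condition becomes an
  equation that rewriting can discharge without object arguments.\<close>

definition ar :: "'m => bool" where
 "ar f \<longleftrightarrow> (\<exists>x\<in>Ob C. \<exists>y\<in>Ob C. f \<in> arr C x y)"

abbreviation dm :: "'m => 'o" where
 "dm \<equiv> src C"

definition cd :: "'m => 'o" where
 "cd f = (THE y. y \<in> Ob C & (\<exists>x\<in>Ob C. f \<in> arr C x y))"

definition hom :: "'o => 'o => 'm set" where
 "hom x y = {f. x \<in> Ob C & y \<in> Ob C & f \<in> arr C x y}"

abbreviation cmp :: "'m => 'm => 'm" (infixr \<open>**\<close> 72) where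
 "g ** f \<equiv> Comp C g f"

abbreviation idt :: "'o => 'm" where
 "idt \<equiv> Id C"

definition zr :: "'o => 'o => 'm" where
 "zr x y = \<zero>\<^bsub>Hom C x y\<^esub>"

text \<open>The Hom-space is read off from the first summand; \<open>pl_eq\<close> translates back
  when the endpoints are given by name.\<close>

definition pl :: "'m => 'm => 'm" (infixl \<open>\<boxplus>\<close> 65) where
 "f \<boxplus> g = f \<oplus>\<^bsub>Hom C (dm f) (cd f)\<^esub> g"

definition ng :: "'m => 'm" where
 "ng f = \<ominus>\<^bsub>Hom C (dm f) (cd f)\<^esub> f"

definition sm :: "'k => 'm => 'm" where
 "sm a f = a \<odot>\<^bsub>Hom C (dm f) (cd f)\<^esub> f"

abbreviation hz :: "'o => 'o => bool" where
 "hz x y \<equiv> hom_zero C {x} {y}"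

lemma src_eq: "[|x \<in> Ob C; y \<in> Ob C; f \<in> arr C x y|] ==> dm f = x"
 unfolding src_def by (rule the_equality) (use hom_disjoint in blast)+

lemma cd_eq: "[|x \<in> Ob C; y \<in> Ob C; f \<in> arr C x y|] ==> cd f = y"
 unfolding cd_def by (rule the_equality) (use hom_disjoint in blast)+

lemma hom_iff [simp]:
 "f \<in> hom x y \<longleftrightarrow> ar f & dm f = x & cd f = y & x \<in> Ob C & y \<in> Ob C"
 unfolding hom_def ar_def using src_eq cd_eq by auto

lemma ar_Ob [simp]: "ar f ==> dm f \<in> Ob C" "ar f ==> cd f \<in> Ob C"
 unfolding ar_def using src_eq cd_eq by auto

lemma arr_iff [simp]: "[|x \<in> Ob C; y \<in> Ob C|] ==> f \<in> arr C x y \<longleftrightarrow> ar f & dm f = x & cd f = y"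
 using hom_iff[of f x y] unfolding hom_def by auto

lemma arI: "ar f ==> f \<in> arr C (dm f) (cd f)"
 by simp

lemma hom_arr: "[|x \<in> Ob C; y \<in> Ob C|] ==> arr C x y = hom x y"
 by auto

lemma cmp_closed: "[|ar f; ar g; dm g = cd f|] ==> g ** f \<in> arr C (dm f) (cd g)"
 using comp_linear_right[of "dm f" "cd f" "cd g" g] module_hom_closed arI by (fastforce simp: Pi_iff)

lemma ar_cmp [simp]:
 assumes "ar f" "ar g" "dm g = cd f"
 shows "ar (g ** f)" "dm (g ** f) = dm f" "cd (g ** f) = cd g"
 using cmp_closed[OF assms] assms by auto

lemma ar_idt [simp]: "x \<in> Ob C ==> ar (idt x)" "x \<in> Ob C ==> dm (idt x) = x"
 "x \<in> Ob C ==> cd (idt x) = x"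
 using id_arr[of x] by auto

lemma cmp_idt [simp]: "[|ar f; cd f = x|] ==> idt x ** f = f" "[|ar f; dm f = x|] ==> f ** idt x = f"
 using id_left[of "dm f" "cd f" f] id_right[of "dm f" "cd f" f] by auto

lemma cmp_assoc [simp]: "[|ar f; ar g; ar h; dm g = cd f; dm h = cd g|] ==>
 (h ** g) ** f = h ** (g ** f)"
 using comp_assoc[of "dm f" "cd f" "cd g" "cd h" f g h] by auto

text \<open>\<open>cmp_assoc\<close> nests composites to the right, which hides the factor
  \<open>g ** f\<close> inside \<open>g ** (f ** k)\<close>. This form applies a known value of
  \<open>g ** f\<close> there.\<close>

lemma pull: "[|g ** f = e; ar f; ar g; ar k; dm g = cd f; cd k = dm f|] ==> g ** (f ** k) = e ** k"
 by (metis cmp_assoc)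

lemma hom_ab: "[|x \<in> Ob C; y \<in> Ob C|] ==> abelian_group (Hom C x y)"
 using hom_vectorspace[of x y] unfolding vectorspace_def module_def by blast

lemma hom_mod: "[|x \<in> Ob C; y \<in> Ob C|] ==> module K (Hom C x y)"
 using hom_vectorspace[of x y] unfolding vectorspace_def by blast

lemma ar_zr [simp]:
 assumes "x \<in> Ob C" "y \<in> Ob C"
 shows "ar (zr x y)" "dm (zr x y) = x" "cd (zr x y) = y"
proof -
 interpret H: abelian_group "Hom C x y" using hom_ab assms .
 have "zr x y \<in> arr C x y" using H.zero_closed unfolding zr_def .
 then show "ar (zr x y)" "dm (zr x y) = x" "cd (zr x y) = y" using assms by auto
qed

lemma ar_pl [simp]:
 assumes "ar f" "ar g" "dm g = dm f" "cd g = cd f"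
 shows "ar (f \<boxplus> g)" "dm (f \<boxplus> g) = dm f" "cd (f \<boxplus> g) = cd f"
proof -
 interpret H: abelian_group "Hom C (dm f) (cd f)" using hom_ab assms by simp
 have "f \<boxplus> g \<in> arr C (dm f) (cd f)" unfolding pl_def
  by (rule H.a_closed) (use assms in auto)
 then show "ar (f \<boxplus> g)" "dm (f \<boxplus> g) = dm f" "cd (f \<boxplus> g) = cd f" using assms by auto
qed

lemma ar_ng [simp]:
 assumes "ar f"
 shows "ar (ng f)" "dm (ng f) = dm f" "cd (ng f) = cd f"
proof -
 interpret H: abelian_group "Hom C (dm f) (cd f)" using hom_ab assms by simp
 have "ng f \<in> arr C (dm f) (cd f)" unfolding ng_def
  by (rule H.a_inv_closed) (use assms in auto)
 then show "ar (ng f)" "dm (ng f) = dm f" "cd (ng f) = cd f" using assms by auto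
qed

lemma ar_sm [simp]:
 assumes "ar f" "a \<in> carrier K"
 shows "ar (sm a f)" "dm (sm a f) = dm f" "cd (sm a f) = cd f"
proof -
 interpret H: module K "Hom C (dm f) (cd f)" using hom_mod assms by simp
 have "sm a f \<in> arr C (dm f) (cd f)" unfolding sm_def
  by (rule H.smult_closed) (use assms in auto)
 then show "ar (sm a f)" "dm (sm a f) = dm f" "cd (sm a f) = cd f" using assms by auto
qed

lemma pl_eq: "[|ar f; dm f = x; cd f = y|] ==> f \<oplus>\<^bsub>Hom C x y\<^esub> g = f \<boxplus> g"
 by (simp add: pl_def)

lemma sm_eq: "[|ar f; dm f = x; cd f = y|] ==> a \<odot>\<^bsub>Hom C x y\<^esub> f = sm a f"
 by (simp add: sm_def)

lemma ng_eq: "[|ar f; dm f = x; cd f = y|] ==> \<ominus>\<^bsub>Hom C x y\<^esub> f = ng f"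
 by (simp add: ng_def)

lemma zr_eq: "\<zero>\<^bsub>Hom C x y\<^esub> = zr x y"
 by (simp add: zr_def)

lemma pl_comm: "[|ar f; ar g; dm g = dm f; cd g = cd f|] ==> f \<boxplus> g = g \<boxplus> f"
 using abelian_monoid.a_comm[OF abelian_group.axioms(1)[OF hom_ab], of "dm f" "cd f" f g]
 by (simp add: pl_def)

lemma pl_assoc: "[|ar f; ar g; ar h; dm g = dm f; cd g = cd f; dm h = dm f; cd h = cd f|] ==>
 (f \<boxplus> g) \<boxplus> h = f \<boxplus> (g \<boxplus> h)"
 using abelian_monoid.a_assoc[OF abelian_group.axioms(1)[OF hom_ab], of "dm f" "cd f" f g h]
  ar_pl[of f g] ar_pl[of g h]
 by (simp add: pl_def)

lemma pl_lcomm: "[|ar f; ar g; ar h; dm g = dm f; cd g = cd f; dm h = dm f; cd h = cd f|] ==>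
 g \<boxplus> (f \<boxplus> h) = f \<boxplus> (g \<boxplus> h)"
 by (metis pl_assoc pl_comm)

lemma pl_zr [simp]: "[|ar f; dm f = x; cd f = y|] ==> f \<boxplus> zr x y = f"
 "[|ar f; dm f = x; cd f = y|] ==> zr x y \<boxplus> f = f"
 using abelian_monoid.r_zero[OF abelian_group.axioms(1)[OF hom_ab], of x y f]
  abelian_monoid.l_zero[OF abelian_group.axioms(1)[OF hom_ab], of x y f] ar_zr[of x y]
 by (auto simp: pl_def zr_def)

lemma pl_ng [simp]: "ar f ==> f \<boxplus> ng f = zr (dm f) (cd f)" "ar f ==> ng f \<boxplus> f = zr (dm f) (cd f)"
 using abelian_group.r_neg[OF hom_ab, of "dm f" "cd f" f]
  abelian_group.l_neg[OF hom_ab, of "dm f" "cd f" f] ar_ng[of f]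
 by (auto simp: pl_def zr_def ng_def)

lemma cmp_pl: "[|ar f; ar g; ar h; dm g = dm f; cd g = cd f; dm h = cd f|] ==>
 h ** (f \<boxplus> g) = (h ** f) \<boxplus> (h ** g)"
 using module_hom_add[OF comp_linear_right[of "dm f" "cd f" "cd h" h], of f g]
 by (simp add: pl_def)

lemma pl_cmp: "[|ar f; ar g; ar h; dm g = dm f; cd g = cd f; dm f = cd h|] ==>
 (f \<boxplus> g) ** h = (f ** h) \<boxplus> (g ** h)"
 using module_hom_add[OF comp_linear_left[of "dm h" "dm f" "cd f" h], of f g]
 by (simp add: pl_def)

lemma cmp_sm: "[|ar f; ar h; dm h = cd f; a \<in> carrier K|] ==> h ** sm a f = sm a (h ** f)"
 using module_hom_smult[OF comp_linear_right[of "dm f" "cd f" "cd h" h], of a f]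
 by (simp add: sm_def)

lemma sm_cmp: "[|ar f; ar h; dm h = cd f; a \<in> carrier K|] ==> sm a h ** f = sm a (h ** f)"
 using module_hom_smult[OF comp_linear_left[of "dm f" "cd f" "cd h" f], of a h]
 by (simp add: sm_def)

lemma pl_cancel: "[|ar f; ar g; ar h; dm g = dm f; cd g = cd f; dm h = dm f; cd h = cd f|] ==>
 f \<boxplus> g = f \<boxplus> h \<longleftrightarrow> g = h"
 by (metis pl_assoc pl_ng(2) ar_ng pl_zr(2))

text \<open>Zero is the only additive idempotent. Additive maps therefore preserve zero, which gives
  the laws for composition with zero and for linear functors at zero.\<close>

lemma zr_unique: "[|ar f; f \<boxplus> f = f|] ==> f = zr (dm f) (cd f)"
 by (metis ar_Ob(1) ar_Ob(2) ar_zr(1) ar_zr(2) ar_zr(3) pl_cancel pl_zr(1))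

lemma ng_unique: "[|ar f; ar g; dm g = dm f; cd g = cd f; f \<boxplus> g = zr (dm f) (cd f)|] ==> g = ng f"
 by (metis ar_ng pl_cancel pl_ng(1))

lemma cmp_zr [simp]: "[|ar f; dm f = y; x \<in> Ob C|] ==> f ** zr x y = zr x (cd f)"
 using zr_unique[of "f ** zr x y"] cmp_pl[of "zr x y" "zr x y" f] by auto

lemma zr_cmp [simp]: "[|ar f; cd f = x; y \<in> Ob C|] ==> zr x y ** f = zr (dm f) y"
 using zr_unique[of "zr x y ** f"] pl_cmp[of "zr x y" "zr x y" f] by auto

lemma ng_ng [simp]: "ar f ==> ng (ng f) = f"
 using ng_unique[of "ng f" f] by auto

lemma ng_zr [simp]: "[|x \<in> Ob C; y \<in> Ob C|] ==> ng (zr x y) = zr x y"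
 using ng_unique[of "zr x y" "zr x y"] by auto

lemma cmp_ng [simp]: "[|ar f; ar h; dm h = cd f|] ==> h ** ng f = ng (h ** f)"
 using ng_unique[of "h ** f" "h ** ng f"] cmp_pl[of f "ng f" h] by auto

lemma ng_cmp [simp]: "[|ar f; ar h; dm h = cd f|] ==> ng h ** f = ng (h ** f)"
 using ng_unique[of "h ** f" "ng h ** f"] pl_cmp[of h "ng h" f] by auto

lemma ng_inj [simp]: "[|ar f; ar g|] ==> ng f = ng g \<longleftrightarrow> f = g"
 by (metis ng_ng)

lemma diff_zr: "[|ar f; ar g; dm g = dm f; cd g = cd f|] ==>
 f \<boxplus> ng g = zr (dm f) (cd f) \<longleftrightarrow> f = g"
 by (metis ar_ng(1) ar_ng(2) ar_ng(3) ng_ng ng_unique pl_comm pl_ng(1))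

lemma ng_sm: "ar f ==> ng f = sm (\<ominus> \<one>) f"
 using module.smult_l_minus[OF hom_mod, of "dm f" "cd f" "\<one>" f]
  module.smult_one[OF hom_mod, of "dm f" "cd f" f] by (simp add: ng_def sm_def)

lemma hz_iff: "[|x \<in> Ob C; y \<in> Ob C|] ==> hz x y \<longleftrightarrow> (\<forall>f\<in>hom x y. f = zr x y)"
 unfolding hom_zero_def using hom_arr[of x y] ar_zr[of x y]
 by (auto simp: zr_eq)

lemma hzI: "[|x \<in> Ob C; y \<in> Ob C; !!f. [|ar f; dm f = x; cd f = y|] ==> f = zr x y|] ==> hz x y"
 by (simp add: hz_iff)

lemma hzD: "[|hz x y; ar f; dm f = x; cd f = y|] ==> f = zr x y"
 using hz_iff[of x y] by auto

lemma hom_zero_iff: "hom_zero C X Y \<longleftrightarrow> (\<forall>x\<in>X. \<forall>y\<in>Y. hz x y)"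
 unfolding hom_zero_def by auto

subsection \<open>Isomorphisms\<close>

definition is_iso :: "'m => bool" where
 "is_iso f \<longleftrightarrow> ar f & (\<exists>g. ar g & dm g = cd f & cd g = dm f &
  g ** f = idt (dm f) & f ** g = idt (cd f))"

definition iv :: "'m => 'm" where
 "iv f = (SOME g. ar g & dm g = cd f & cd g = dm f &
  g ** f = idt (dm f) & f ** g = idt (cd f))"

lemma isos_iff: "[|x \<in> Ob C; y \<in> Ob C|] ==> f \<in> isos C x y \<longleftrightarrow> is_iso f & dm f = x & cd f = y"
 unfolding isos_def is_iso_def Bex_def mem_Collect_eq by (auto simp: arr_iff)

lemma iso_ar [simp]: "is_iso f ==> ar f"
 by (simp add: is_iso_def)

lemma iv [simp]:
 assumes "is_iso f"
 shows "ar (iv f)" "dm (iv f) = cd f" "cd (iv f) = dm f"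
  "iv f ** f = idt (dm f)" "f ** iv f = idt (cd f)"
proof -
 have "\<exists>g. ar g & dm g = cd f & cd g = dm f & g ** f = idt (dm f) & f ** g = idt (cd f)"
  using assms unfolding is_iso_def by blast
 note * = someI_ex[OF this, folded iv_def]
 show "ar (iv f)" "dm (iv f) = cd f" "cd (iv f) = dm f"
  "iv f ** f = idt (dm f)" "f ** iv f = idt (cd f)" using * by simp_all
qed

lemma iv_cancel [simp]: "[|is_iso f; ar g; cd g = dm f|] ==> iv f ** f ** g = g"
 "[|is_iso f; ar g; cd g = cd f|] ==> f ** iv f ** g = g"
 using pull[OF iv(4), of f g] pull[OF iv(5), of f g] by auto

lemma isoI: "[|ar f; ar g; dm g = cd f; cd g = dm f; g ** f = idt (dm f); f ** g = idt (cd f)|] ==> is_iso f"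
 unfolding is_iso_def by blast

lemma iso_iv [simp]: "is_iso f ==> is_iso (iv f)"
 by (rule isoI[of _ f]) auto

lemma iso_idt [simp]: "x \<in> Ob C ==> is_iso (idt x)"
 by (rule isoI[of _ "idt x"]) auto

lemma iso_cmp [simp]: "[|is_iso f; is_iso g; dm g = cd f|] ==> is_iso (g ** f)"
 by (rule isoI[of _ "iv f ** iv g"]) auto

lemma iso_ng [simp]: "is_iso f ==> is_iso (ng f)"
 by (rule isoI[of _ "ng (iv f)"]) auto

lemma iv_eqI: "[|is_iso f; ar g; dm g = cd f; cd g = dm f; g ** f = idt (dm f)|] ==> iv f = g"
 by (metis iv(1-3) iv(5) cmp_assoc cmp_idt iso_ar)

lemma iv_idt [simp]: "x \<in> Ob C ==> iv (idt x) = idt x"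
 by (rule iv_eqI) auto

lemma iso_lcancel: "[|is_iso f; ar g; ar h; cd g = dm f; cd h = dm f; f ** g = f ** h|] ==> g = h"
 by (metis iv_cancel(1))

lemma iso_rcancel: "[|is_iso f; ar g; ar h; dm g = cd f; dm h = cd f; g ** f = h ** f|] ==> g = h"
 by (metis cmp_assoc cmp_idt(2) iso_ar iv(1) iv(3) iv(5))

text \<open>The Yoneda form of invertibility, with injectivity of Hom(-, f) tested on kernels. A
  right inverse \<open>g\<close> is a preimage of the identity, and f (g f - 1) = 0 makes it a left
  inverse.\<close>

lemma iso_if_bij:
 assumes f: "ar f"
  and surj: "!!b. [|ar b; cd b = cd f|] ==> \<exists>a. ar a & dm a = dm b & cd a = dm f & f ** a = b"
  and inj: "!!a. [|ar a; cd a = dm f; f ** a = zr (dm a) (cd f)|] ==> a = zr (dm a) (dm f)"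
 shows "is_iso f"
proof -
 obtain g where g: "ar g" "dm g = cd f" "cd g = dm f" "f ** g = idt (cd f)"
  using surj[of "idt (cd f)"] f by auto
 let ?a = "(g ** f) \<boxplus> ng (idt (dm f))"
 have "f ** ?a = zr (dm f) (cd f)" using g f pull[OF g(4), of f] by (simp add: cmp_pl)
 then have "?a = zr (dm f) (dm f)" using inj[of ?a] g f by simp
 then have "g ** f = idt (dm f)" using g f diff_zr[of "g ** f" "idt (dm f)"] by simp
 then show ?thesis using g f by (intro isoI[of _ g]) auto
qed

definition isom :: "'o => 'o => bool" (infix \<open>\<simeq>\<close> 50) where
 "x \<simeq> y \<longleftrightarrow> (\<exists>f. is_iso f & dm f = x & cd f = y)"

lemma isomI: "[|is_iso f; dm f = x; cd f = y|] ==> x \<simeq> y"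
 unfolding isom_def by blast

lemma isom_refl [simp]: "x \<in> Ob C ==> x \<simeq> x"
 by (rule isomI[of "idt x"]) auto

lemma isom_sym: "x \<simeq> y ==> y \<simeq> x"
 unfolding isom_def by (metis iso_iv iv(2,3))

lemma isom_trans: "[|x \<simeq> y; y \<simeq> z|] ==> x \<simeq> z"
 unfolding isom_def by (metis iso_cmp ar_cmp(2,3) iso_ar)

lemma isom_Ob: "x \<simeq> y ==> x \<in> Ob C" "x \<simeq> y ==> y \<in> Ob C"
 unfolding isom_def by auto

lemma hz_isom_left:
 assumes "x \<simeq> x'" "y \<in> Ob C" "hz x y" shows "hz x' y"
proof -
 obtain f where f: "is_iso f" "dm f = x" "cd f = x'" using assms by (auto simp: isom_def)
 show ?thesis
 proof (rule hzI)
  fix g assume g: "ar g" "dm g = x'" "cd g = y"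
  have "g ** f = zr x y" by (rule hzD[OF assms(3)]) (use f g in auto)
  then show "g = zr x' y" using iso_rcancel[of f g "zr x' y"] f g assms by auto
 qed (use f assms in auto)
qed

lemma hz_isom_right:
 assumes "y \<simeq> y'" "x \<in> Ob C" "hz x y" shows "hz x y'"
proof -
 obtain f where f: "is_iso f" "dm f = y'" "cd f = y" using isom_sym[OF assms(1)] by (auto simp: isom_def)
 show ?thesis
 proof (rule hzI)
  fix g assume g: "ar g" "dm g = x" "cd g = y'"
  have "f ** g = zr x y" by (rule hzD[OF assms(3)]) (use f g in auto)
  then show "g = zr x y'" using iso_lcancel[of f g "zr x y'"] f g assms by auto
 qed (use f assms in auto)
qed

lemma zero_objectD:
 assumes "zero_object C z" shows "z \<in> Ob C" "x \<in> Ob C ==> hz x z" "x \<in> Ob C ==> hz z x"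
 using assms unfolding zero_object_def hom_zero_def by auto

lemma zero_objectI: "[|z \<in> Ob C; idt z = zr z z|] ==> zero_object C z"
 unfolding zero_object_def hom_zero_iff[of "Ob C"] hom_zero_iff[of _ "Ob C"]
 by (metis ar_Ob(1) ar_Ob(2) cmp_idt(1) cmp_idt(2) cmp_zr hzI singletonD zr_cmp)

lemma hz_self: "hz z z ==> z \<in> Ob C ==> zero_object C z"
 by (rule zero_objectI) (auto dest: hzD[of z z "idt z"])

lemma zero_object_isom: "[|zero_object C z; z \<simeq> z'|] ==> zero_object C z'"
 by (meson hz_isom_left hz_isom_right hz_self isom_Ob zero_objectD)

lemma zero_objects_isom: "[|zero_object C z; zero_object C z'|] ==> z \<simeq> z'"
 apply (rule isomI[of "zr z z'"])
  apply (rule isoI[of _ "zr z' z"])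
 by (simp_all add: zero_objectD(1) hzD[OF zero_objectD(2), symmetric])

subsection \<open>Finite sums and direct sums\<close>

definition fsum :: "'o => 'o => (nat => 'm) => nat => 'm" where
 "fsum x y f n = (\<Oplus>\<^bsub>Hom C x y\<^esub>i\<in>{..<n}. f i)"

lemma fsum_ar [simp]:
 assumes "x \<in> Ob C" "y \<in> Ob C" "!!i. i < n ==> ar (f i) & dm (f i) = x & cd (f i) = y"
 shows "ar (fsum x y f n)" "dm (fsum x y f n) = x" "cd (fsum x y f n) = y"
proof -
 interpret H: abelian_group "Hom C x y" using hom_ab assms by simp
 have "fsum x y f n \<in> arr C x y" unfolding fsum_def
  by (rule H.finsum_closed) (use assms in auto)
 then show "ar (fsum x y f n)" "dm (fsum x y f n) = x" "cd (fsum x y f n) = y" using assms by auto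
qed

lemma fsum_0 [simp]: "[|x \<in> Ob C; y \<in> Ob C|] ==> fsum x y f 0 = zr x y"
 using abelian_monoid.finsum_empty[OF abelian_group.axioms(1)[OF hom_ab], of x y f]
 by (simp add: fsum_def zr_def)

lemma fsum_Suc:
 assumes "x \<in> Ob C" "y \<in> Ob C" "!!i. i < Suc n ==> ar (f i) & dm (f i) = x & cd (f i) = y"
 shows "fsum x y f (Suc n) = f n \<boxplus> fsum x y f n"
proof -
 interpret H: abelian_group "Hom C x y" using hom_ab assms by simp
 have "finsum (Hom C x y) f (insert n {..<n}) = f n \<oplus>\<^bsub>Hom C x y\<^esub> finsum (Hom C x y) f {..<n}"
  by (rule H.finsum_insert) (use assms in "auto simp: less_Suc_eq")
 then show ?thesis using assms(3)[of n] by (simp add: fsum_def lessThan_Suc pl_def)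
qed

lemma fsum_cong: "(!!i. i < n ==> f i = g i & ar (g i) & dm (g i) = x & cd (g i) = y) ==>
  x \<in> Ob C ==> y \<in> Ob C ==> fsum x y f n = fsum x y g n"
proof (induction n)
 case (Suc n)
 have "fsum x y f n = fsum x y g n" by (rule Suc.IH) (use Suc.prems in auto)
 then show ?case using Suc.prems by (simp add: fsum_Suc)
qed simp

lemma fsum_cmp:
 assumes "x \<in> Ob C" "y \<in> Ob C" "ar g" "dm g = y" "ar h" "cd h = x"
 shows "(!!i. i < n ==> ar (f i) & dm (f i) = x & cd (f i) = y) ==>
  g ** fsum x y f n ** h = fsum (dm h) (cd g) (\<lambda>i. g ** f i ** h) n"
proof (induction n)
 case (Suc n)
 then have "g ** fsum x y f n ** h = fsum (dm h) (cd g) (\<lambda>i. g ** f i ** h) n" by simp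
 then show ?case using Suc.prems assms by (simp add: fsum_Suc cmp_pl pl_cmp)
qed (use assms in simp)

lemma direct_sum_iff:
 "direct_sum C xs b \<longleftrightarrow> set xs \<subseteq> Ob C & b \<in> Ob C & (\<exists>\<iota> \<pi>.
  (\<forall>i<length xs. ar (\<iota> i) & dm (\<iota> i) = xs ! i & cd (\<iota> i) = b &
    ar (\<pi> i) & dm (\<pi> i) = b & cd (\<pi> i) = xs ! i) &
  (\<forall>i<length xs. \<forall>j<length xs. \<pi> j ** \<iota> i = (if i = j then idt (xs ! i) else zr (xs ! i) (xs ! j))) &
  fsum b b (\<lambda>i. \<iota> i ** \<pi> i) (length xs) = idt b)"
proof (cases "set xs \<subseteq> Ob C & b \<in> Ob C")
 case True
 then have "!!i. i < length xs ==> xs ! i \<in> Ob C" by (meson nth_mem subsetD)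
 then have "!!i f. i < length xs ==> f \<in> arr C (xs ! i) b \<longleftrightarrow> ar f & dm f = xs ! i & cd f = b"
  "!!i f. i < length xs ==> f \<in> arr C b (xs ! i) \<longleftrightarrow> ar f & dm f = b & cd f = xs ! i"
  using True by auto
 with True show ?thesis unfolding direct_sum_def fsum_def zr_def[symmetric]
  by (simp cong: conj_cong)
qed (auto simp: direct_sum_def)

lemma direct_sumI:
 assumes "set xs \<subseteq> Ob C" "b \<in> Ob C"
  "!!i. i < length xs ==> ar (\<iota> i) & dm (\<iota> i) = xs ! i & cd (\<iota> i) = b &
    ar (\<pi> i) & dm (\<pi> i) = b & cd (\<pi> i) = xs ! i"
  "!!i j. [|i < length xs; j < length xs|] ==>
    \<pi> j ** \<iota> i = (if i = j then idt (xs ! i) else zr (xs ! i) (xs ! j))"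
  "fsum b b (\<lambda>i. \<iota> i ** \<pi> i) (length xs) = idt b"
 shows "direct_sum C xs b"
 unfolding direct_sum_iff using assms by blast

lemma direct_sum_isom:
 assumes ds: "direct_sum C xs b" and len: "length ys = length xs"
  and iso: "!!i. i < length xs ==> xs ! i \<simeq> ys ! i" and b: "b \<simeq> c"
 shows "direct_sum C ys c"
proof -
 obtain \<iota> \<pi> where d: "!!i. i < length xs ==> ar (\<iota> i) & dm (\<iota> i) = xs ! i & cd (\<iota> i) = b &
    ar (\<pi> i) & dm (\<pi> i) = b & cd (\<pi> i) = xs ! i"
  and e: "!!i j. [|i < length xs; j < length xs|] ==>
   \<pi> j ** \<iota> i = (if i = j then idt (xs ! i) else zr (xs ! i) (xs ! j))"
  and s: "fsum b b (\<lambda>i. \<iota> i ** \<pi> i) (length xs) = idt b"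
  using ds unfolding direct_sum_iff by blast
 obtain a where a: "!!i. i < length xs ==> is_iso (a i) & dm (a i) = xs ! i & cd (a i) = ys ! i"
  using iso unfolding isom_def by metis
 obtain k where k: "is_iso k" "dm k = b" "cd k = c" using b unfolding isom_def by blast
 let ?i = "\<lambda>i. k ** \<iota> i ** iv (a i)" and ?p = "\<lambda>i. a i ** \<pi> i ** iv k"
 have ys: "i < length xs ==> ys ! i \<in> Ob C" "i < length xs ==> xs ! i \<in> Ob C" for i
  using isom_Ob iso by blast+
 have "ar (?i i) & dm (?i i) = ys ! i & cd (?i i) = c &
    ar (?p i) & dm (?p i) = c & cd (?p i) = ys ! i" if "i < length xs" for i
  using d[OF that] a[OF that] k by simp
 moreover have "?p j ** ?i i = (if i = j then idt (ys ! i) else zr (ys ! i) (ys ! j))"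
  if "i < length xs" "j < length xs" for i j
  using e[OF that] d[OF that(1)] a[OF that(1)] d[OF that(2)] a[OF that(2)] k ys that
   pull[OF e[OF that], of "iv (a i)"] by auto
 moreover have "fsum c c (\<lambda>i. ?i i ** ?p i) (length xs) = idt c"
 proof -
  have "k ** fsum b b (\<lambda>i. \<iota> i ** \<pi> i) (length xs) ** iv k =
    fsum c c (\<lambda>i. k ** (\<iota> i ** \<pi> i) ** iv k) (length xs)"
   using fsum_cmp[of b b k "iv k" "length xs" "\<lambda>i. \<iota> i ** \<pi> i"] d k by auto
  also have "... = fsum c c (\<lambda>i. ?i i ** ?p i) (length xs)"
   by (rule fsum_cong) (use d a k in auto)
  finally show ?thesis using s k by simp
 qed
 ultimately show ?thesis using len ys k
  by (intro direct_sumI[of ys c ?i ?p]) (auto simp: in_set_conv_nth)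
qed

lemma direct_sum_empty: "direct_sum C [] b \<longleftrightarrow> zero_object C b"
proof
 assume "direct_sum C [] b"
 then show "zero_object C b" by (auto simp: direct_sum_iff intro: zero_objectI)
next
 assume "zero_object C b"
 then show "direct_sum C [] b" using hzD[OF zero_objectD(2), of b b "idt b"] zero_objectD(1)[of b]
  by (auto simp: direct_sum_iff)
qed

lemma direct_sum_two: "direct_sum C [x, y] b \<longleftrightarrow> x \<in> Ob C & y \<in> Ob C & b \<in> Ob C & (\<exists>i j p q.
  i \<in> hom x b & j \<in> hom y b & p \<in> hom b x & q \<in> hom b y & p ** i = idt x & q ** j = idt y &
  p ** j = zr y x & q ** i = zr x y & (i ** p) \<boxplus> (j ** q) = idt b)" (is "?L \<longleftrightarrow> ?R")
proof
 assume ?L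
 then obtain \<iota> \<pi> where *: "x \<in> Ob C" "y \<in> Ob C" "b \<in> Ob C"
  "(\<forall>i<2. ar (\<iota> i) & dm (\<iota> i) = [x,y] ! i & cd (\<iota> i) = b &
    ar (\<pi> i) & dm (\<pi> i) = b & cd (\<pi> i) = [x,y] ! i)"
  "(\<forall>i<2. \<forall>j<2. \<pi> j ** \<iota> i = (if i = j then idt ([x,y] ! i) else zr ([x,y] ! i) ([x,y] ! j)))"
  "fsum b b (\<lambda>i. \<iota> i ** \<pi> i) 2 = idt b"
  unfolding direct_sum_iff by (auto simp: numeral_2_eq_2)
 have "fsum b b (\<lambda>i. \<iota> i ** \<pi> i) 2 = (\<iota> 1 ** \<pi> 1) \<boxplus> (\<iota> 0 ** \<pi> 0)"
 proof -
  have "i < 2 ==> ar (\<iota> i ** \<pi> i) & dm (\<iota> i ** \<pi> i) = b & cd (\<iota> i ** \<pi> i) = b" for i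
   using *(4) by simp
  then show ?thesis using fsum_Suc[of b b 0 "\<lambda>i. \<iota> i ** \<pi> i"] fsum_Suc[of b b 1 "\<lambda>i. \<iota> i ** \<pi> i"] *(3)
   by (simp add: numeral_2_eq_2 less_Suc_eq)
 qed
 then have "(\<iota> 0 ** \<pi> 0) \<boxplus> (\<iota> 1 ** \<pi> 1) = idt b"
  using * pl_comm[of "\<iota> 1 ** \<pi> 1" "\<iota> 0 ** \<pi> 0"] by (simp add: numeral_2_eq_2 All_less_Suc)
 moreover have "\<iota> 0 \<in> hom x b" "\<iota> 1 \<in> hom y b" "\<pi> 0 \<in> hom b x" "\<pi> 1 \<in> hom b y"
  "\<pi> 0 ** \<iota> 0 = idt x" "\<pi> 1 ** \<iota> 1 = idt y" "\<pi> 0 ** \<iota> 1 = zr y x" "\<pi> 1 ** \<iota> 0 = zr x y"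
  using * by (simp_all add: numeral_2_eq_2 All_less_Suc)
 ultimately show ?R using *(1-3) by blast
next
 assume ?R
 then obtain i j p q where *: "x \<in> Ob C" "y \<in> Ob C" "b \<in> Ob C"
  "i \<in> hom x b" "j \<in> hom y b" "p \<in> hom b x" "q \<in> hom b y" "p ** i = idt x" "q ** j = idt y"
  "p ** j = zr y x" "q ** i = zr x y" "(i ** p) \<boxplus> (j ** q) = idt b" by auto
 let ?i = "\<lambda>n::nat. if n = 0 then i else j" and ?p = "\<lambda>n::nat. if n = 0 then p else q"
 show ?L
  by (rule direct_sumI[of _ _ ?i ?p])
   (use * pl_comm[of "i ** p" "j ** q"] in "auto simp: fsum_Suc less_Suc_eq")
qed

end

subsection \<open>Linear functors\<close>

locale two_lin_categories = lin_category K C + D: lin_category K D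
 for K :: "('k, 'r) ring_scheme" (structure)
  and C :: "('o, 'm, 'k, 'z) lincat_scheme" and D :: "('p, 'n, 'k, 'y) lincat_scheme"

locale linear_functor = two_lin_categories K C D
 for K :: "('k, 'r) ring_scheme" (structure)
  and C :: "('o, 'm, 'k, 'z) lincat_scheme" and D :: "('p, 'n, 'k, 'y) lincat_scheme" +
 fixes F :: "('o, 'm, 'p, 'n) cfun"
 assumes F: "lin_functor K C D F"
begin

lemma F_ob [simp]: "x \<in> Ob C ==> omap F x \<in> Ob D"
 and F_idt [simp]: "x \<in> Ob C ==> amap F (idt x) = D.idt (omap F x)"
 using F unfolding lin_functor_def by auto

lemma F_mod: "[|x \<in> Ob C; y \<in> Ob C|] ==> amap F \<in> module_hom K (Hom C x y) (Hom D (omap F x) (omap F y))"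
 using F unfolding lin_functor_def by auto

lemma F_ar [simp]:
 assumes "ar f" shows "D.ar (amap F f)" "D.dm (amap F f) = omap F (dm f)" "D.cd (amap F f) = omap F (cd f)"
proof -
 have "amap F f \<in> arr D (omap F (dm f)) (omap F (cd f))"
  using module_hom_closed[OF F_mod[of "dm f" "cd f"]] arI[OF assms] assms by auto
 then show "D.ar (amap F f)" "D.dm (amap F f) = omap F (dm f)" "D.cd (amap F f) = omap F (cd f)"
  using assms by auto
qed

lemma F_cmp [simp]: "[|ar f; ar g; dm g = cd f|] ==> amap F (g ** f) = amap F g \<cdot>\<^bsub>D\<^esub> amap F f"
 using F unfolding lin_functor_def by (metis ar_Ob arI)

lemma F_pl [simp]: "[|ar f; ar g; dm g = dm f; cd g = cd f|] ==> amap F (f \<boxplus> g) = D.pl (amap F f) (amap F g)"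
 using module_hom_add[OF F_mod[of "dm f" "cd f"], of f g] by (simp add: pl_def D.pl_def)

lemma F_sm [simp]: "[|ar f; a \<in> carrier K|] ==> amap F (sm a f) = D.sm a (amap F f)"
 using module_hom_smult[OF F_mod[of "dm f" "cd f"], of a f] by (simp add: sm_def D.sm_def)

lemma F_zr [simp]: "[|x \<in> Ob C; y \<in> Ob C|] ==> amap F (zr x y) = D.zr (omap F x) (omap F y)"
 using D.zr_unique[of "amap F (zr x y)"] F_pl[of "zr x y" "zr x y"] by (simp del: F_pl)

lemma F_ng [simp]: "ar f ==> amap F (ng f) = D.ng (amap F f)"
 using D.ng_unique[of "amap F f" "amap F (ng f)"] F_pl[of f "ng f"] by (simp del: F_pl)

lemma F_iso [simp]: "is_iso f ==> D.is_iso (amap F f)"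
 by (rule D.isoI[of _ "amap F (iv f)"]) (simp_all flip: F_cmp)

lemma F_iv [simp]: "is_iso f ==> amap F (iv f) = D.iv (amap F f)"
 by (rule D.iv_eqI[symmetric]) (simp_all flip: F_cmp)

lemma F_isom: "x \<simeq> y ==> D.isom (omap F x) (omap F y)"
 by (metis D.isomI F_ar(2,3) F_iso is_iso_def isom_def)

lemma F_zero:
 assumes "zero_object C z" shows "zero_object D (omap F z)"
proof -
 have z: "z \<in> Ob C" "idt z = zr z z"
  using hzD[OF zero_objectD(2)[OF assms], of z "idt z"] zero_objectD(1)[OF assms] by auto
 have "D.idt (omap F z) = D.zr (omap F z) (omap F z)"
  using F_idt[OF z(1)] F_zr[OF z(1) z(1)] z(2) by metis
 then show ?thesis using z by (intro D.zero_objectI) simp_all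
qed

lemma F_fsum: "[|x \<in> Ob C; y \<in> Ob C; !!i. i < n ==> ar (f i) & dm (f i) = x & cd (f i) = y|] ==>
  amap F (fsum x y f n) = D.fsum (omap F x) (omap F y) (\<lambda>i. amap F (f i)) n"
 by (induction n) (simp_all add: fsum_Suc D.fsum_Suc)

lemma F_direct_sum:
 assumes "direct_sum C xs b"
 shows "direct_sum D (map (omap F) xs) (omap F b)"
proof -
 obtain \<iota> \<pi> where d: "!!i. i < length xs ==> ar (\<iota> i) & dm (\<iota> i) = xs ! i & cd (\<iota> i) = b &
    ar (\<pi> i) & dm (\<pi> i) = b & cd (\<pi> i) = xs ! i"
  and e: "!!i j. [|i < length xs; j < length xs|] ==>
   \<pi> j ** \<iota> i = (if i = j then idt (xs ! i) else zr (xs ! i) (xs ! j))"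
  and s: "fsum b b (\<lambda>i. \<iota> i ** \<pi> i) (length xs) = idt b" and b: "b \<in> Ob C" "set xs \<subseteq> Ob C"
  using assms unfolding direct_sum_iff by blast
 have xs: "i < length xs ==> xs ! i \<in> Ob C" for i using b by (meson nth_mem subsetD)
 have "D.fsum (omap F b) (omap F b) (\<lambda>i. amap F (\<iota> i) \<cdot>\<^bsub>D\<^esub> amap F (\<pi> i)) (length xs) =
   D.fsum (omap F b) (omap F b) (\<lambda>i. amap F (\<iota> i ** \<pi> i)) (length xs)"
  by (rule D.fsum_cong) (use d b in auto)
 also have "... = D.idt (omap F b)" using F_fsum[of b b "length xs" "\<lambda>i. \<iota> i ** \<pi> i"] d b s by auto
 finally have *: "D.fsum (omap F b) (omap F b) (\<lambda>i. amap F (\<iota> i) \<cdot>\<^bsub>D\<^esub> amap F (\<pi> i)) (length xs) = D.idt (omap F b)" .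
 have **: "amap F (\<pi> j) \<cdot>\<^bsub>D\<^esub> amap F (\<iota> i) = (if i = j then D.idt (omap F (xs ! i)) else D.zr (omap F (xs ! i)) (omap F (xs ! j)))"
  if "i < length xs" "j < length xs" for i j
  using F_cmp[of "\<iota> i" "\<pi> j"] e[OF that] d[OF that(1)] d[OF that(2)] xs that by (auto split: if_splits)
 show ?thesis
  by (rule D.direct_sumI[of _ _ "\<lambda>i. amap F (\<iota> i)" "\<lambda>i. amap F (\<pi> i)"]) (use * ** d b in auto)
qed

definition full :: bool where
 "full \<longleftrightarrow> (\<forall>x\<in>Ob C. \<forall>y\<in>Ob C. \<forall>g. D.ar g & D.dm g = omap F x & D.cd g = omap F y -->
  (\<exists>f. ar f & dm f = x & cd f = y & amap F f = g))"

text \<open>By linearity it suffices to test the fibre over zero; \<open>faithfulD\<close> recovers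
  injectivity.\<close>

definition faithful :: bool where
 "faithful \<longleftrightarrow> (\<forall>f. ar f & amap F f = D.zr (omap F (dm f)) (omap F (cd f)) --> f = zr (dm f) (cd f))"

definition dense :: bool where
 "dense \<longleftrightarrow> (\<forall>d\<in>Ob D. \<exists>x\<in>Ob C. D.isom (omap F x) d)"

lemma faithfulD:
 assumes "faithful" "ar f" "ar g" "dm g = dm f" "cd g = cd f" "amap F f = amap F g"
 shows "f = g"
proof -
 have "amap F (f \<boxplus> ng g) = D.zr (omap F (dm f)) (omap F (cd f))"
  using assms D.pl_ng(1)[of "amap F g"] by simp
 then have "f \<boxplus> ng g = zr (dm f) (cd f)"
  using assms(1)[unfolded faithful_def, rule_format, of "f \<boxplus> ng g"] assms(2-5) by simp
 then show ?thesis using assms diff_zr by blast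
qed

lemma fullD: "[|full; x \<in> Ob C; y \<in> Ob C; D.ar g; D.dm g = omap F x; D.cd g = omap F y|] ==>
  \<exists>f. ar f & dm f = x & cd f = y & amap F f = g"
 unfolding full_def by blast

lemma ff_reflects_iso:
 assumes "full" "faithful" "ar f" "D.is_iso (amap F f)"
 shows "is_iso f"
proof -
 obtain g where g: "ar g" "dm g = cd f" "cd g = dm f" "amap F g = D.iv (amap F f)"
  using fullD[of "cd f" "dm f" "D.iv (amap F f)"] assms by auto
 have "g ** f = idt (dm f)" by (rule faithfulD) (use assms g in auto)
 moreover have "f ** g = idt (cd f)" by (rule faithfulD) (use assms g in auto)
 ultimately show ?thesis using assms g by (auto intro: isoI)
qed

lemma ff_reflects_isom:
 assumes "full" "faithful" "x \<in> Ob C" "y \<in> Ob C" "D.isom (omap F x) (omap F y)"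
 shows "x \<simeq> y"
proof -
 obtain k where k: "D.is_iso k" "D.dm k = omap F x" "D.cd k = omap F y"
  using assms by (auto simp: D.isom_def)
 obtain f where "ar f" "dm f = x" "cd f = y" "amap F f = k"
  using fullD[of x y k] assms k by auto
 then show ?thesis using ff_reflects_iso assms k isomI by metis
qed

text \<open>The quasi-inverse is chosen: \<open>G0 d\<close> is a preimage of \<open>d\<close> up to
  the isomorphism \<open>e d\<close>, and \<open>G1 h\<close> is the only lift of the conjugate of
  \<open>h\<close> by \<open>e\<close>. All functor laws then follow from uniqueness of lifts
  (\<open>G1_eq\<close>).\<close>

lemma equivalenceI:
 assumes "full" "faithful" "dense"
 shows "cat_equivalence K C D F"
proof -
 obtain G0 where G0: "!!d. d \<in> Ob D ==> G0 d \<in> Ob C & D.isom (omap F (G0 d)) d"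
  using assms(3) unfolding dense_def by metis
 then obtain e where e: "!!d. d \<in> Ob D ==> D.is_iso (e d) & D.dm (e d) = omap F (G0 d) & D.cd (e d) = d"
  unfolding D.isom_def by metis
 have "\<exists>f. ar f & dm f = G0 (D.dm h) & cd f = G0 (D.cd h) &
   amap F f = (D.iv (e (D.cd h)) \<cdot>\<^bsub>D\<^esub> (h \<cdot>\<^bsub>D\<^esub> e (D.dm h)))" if "D.ar h" for h
  by (rule fullD) (use assms G0 e that in auto)
 then obtain G1 where G1: "!!h. D.ar h ==> ar (G1 h) & dm (G1 h) = G0 (D.dm h) & cd (G1 h) = G0 (D.cd h) &
   amap F (G1 h) = (D.iv (e (D.cd h)) \<cdot>\<^bsub>D\<^esub> (h \<cdot>\<^bsub>D\<^esub> e (D.dm h)))" by metis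
 define G where "G = \<lparr>omap = G0, amap = G1\<rparr>"
 have G1_eq: "G1 h = f" if "D.ar h" "ar f" "dm f = G0 (D.dm h)" "cd f = G0 (D.cd h)"
  "amap F f = (D.iv (e (D.cd h)) \<cdot>\<^bsub>D\<^esub> (h \<cdot>\<^bsub>D\<^esub> e (D.dm h)))" for h f
  by (rule faithfulD) (use assms that G1 in auto)
 have G_lin: "lin_functor K D C G"
  unfolding lin_functor_def
 proof (intro conjI ballI)
  fix x assume x: "x \<in> Ob D"
  then show "omap G x \<in> Ob C" using G0 by (simp add: G_def)
  show "amap G (D.idt x) = idt (omap G x)" unfolding G_def
   by simp (rule G1_eq, use x G0 e in auto)
 next
  fix x y assume xy: "x \<in> Ob D" "y \<in> Ob D"
  have "G1 (f \<oplus>\<^bsub>Hom D x y\<^esub> g) = G1 f \<oplus>\<^bsub>Hom C (G0 x) (G0 y)\<^esub> G1 g"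
   if "D.ar f" "D.ar g" "D.dm f = x" "D.dm g = x" "D.cd f = y" "D.cd g = y" for f g
   using that xy G0 e G1 D.pl_eq[of f x y g] pl_eq[of "G1 f" "G0 x" "G0 y" "G1 g"]
   by (auto intro!: G1_eq simp: D.pl_cmp D.cmp_pl)
  moreover have "G1 (a \<odot>\<^bsub>Hom D x y\<^esub> f) = a \<odot>\<^bsub>Hom C (G0 x) (G0 y)\<^esub> G1 f"
   if "D.ar f" "D.dm f = x" "D.cd f = y" "a \<in> carrier K" for f a
   using that xy G0 e G1 D.sm_eq[of f x y a] sm_eq[of "G1 f" "G0 x" "G0 y" a]
   by (auto intro!: G1_eq simp: D.sm_cmp D.cmp_sm)
  ultimately show "amap G \<in> module_hom K (Hom D x y) (Hom C (omap G x) (omap G y))"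
   using G1 G0 xy by (auto simp: module_hom_def G_def)
 next
  fix x y z f g assume *: "x \<in> Ob D" "y \<in> Ob D" "z \<in> Ob D" "f \<in> arr D x y" "g \<in> arr D y z"
  show "amap G (g \<cdot>\<^bsub>D\<^esub> f) = amap G g ** amap G f"
   unfolding G_def by simp (rule G1_eq, use * G0 G1 e in auto)
 qed
 \<comment> \<open>The unit is the lift of \<open>e (omap F x)\<close>; it is invertible because a
   fully faithful functor reflects isomorphisms.\<close>
 have "\<exists>a. ar a & dm a = G0 (omap F x) & cd a = x & amap F a = e (omap F x)" if "x \<in> Ob C" for x
  by (rule fullD) (use assms that G0 e in auto)
 then obtain a where a: "!!x. x \<in> Ob C ==> ar (a x) & dm (a x) = G0 (omap F x) & cd (a x) = x & amap F (a x) = e (omap F x)"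
  by metis
 have "nat_iso C C (G \<circ>\<^sub>F F) id_cfun a"
  unfolding nat_iso_def comp_cfun_def id_cfun_def G_def
 proof (simp, intro conjI ballI impI allI)
  fix x assume x: "x \<in> Ob C"
  then have "is_iso (a x)" using ff_reflects_iso[OF assms(1,2), of "a x"] a e by auto
  then show "a x \<in> isos C (G0 (omap F x)) x" using a x G0 isos_iff by auto
 next
  fix x y f assume *: "x \<in> Ob C" "y \<in> Ob C" and "f \<in> arr C x y"
  then have f: "ar f" "dm f = x" "cd f = y" by auto
  show "a y ** G1 (amap F f) = f ** a x"
   by (rule faithfulD[OF assms(2)]) (use * f a G1 e in auto)
 qed
 moreover have "nat_iso D D (F \<circ>\<^sub>F G) id_cfun e"
  unfolding nat_iso_def comp_cfun_def id_cfun_def G_def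
  using e G0 G1 D.isos_iff by auto
 ultimately show ?thesis unfolding cat_equivalence_def quasi_inverse_def using F G_lin by blast
qed

end

lemma lin_functor_id: "lin_category K C ==> lin_functor K C C id_cfun"
 unfolding lin_functor_def id_cfun_def module_hom_def by auto

lemma comp_cfun_simps [simp]: "omap (G \<circ>\<^sub>F F) x = omap G (omap F x)" "amap (G \<circ>\<^sub>F F) f = amap G (amap F f)"
 "omap id_cfun x = x" "amap id_cfun f = f"
 by (simp_all add: comp_cfun_def id_cfun_def)

lemma module_hom_comp: "[|f \<in> module_hom K U V; g \<in> module_hom K V W|] ==> (\<lambda>v. g (f v)) \<in> module_hom K U W"
 unfolding module_hom_def by (simp add: Pi_iff)

lemma lin_functor_comp:
 assumes "lin_functor K C D F" "lin_functor K D E G"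
 shows "lin_functor K C E (G \<circ>\<^sub>F F)"
proof -
 have *: "amap F f \<in> arr D (omap F x) (omap F y)" if "x \<in> Ob C" "y \<in> Ob C" "f \<in> arr C x y" for f x y
 proof -
  have "amap F \<in> module_hom K (Hom C x y) (Hom D (omap F x) (omap F y))"
   using assms(1) that(1,2) unfolding lin_functor_def by blast
  then show ?thesis using module_hom_closed that(3) by blast
 qed
 show ?thesis
  unfolding lin_functor_def comp_cfun_simps
 proof (intro conjI ballI)
  fix x y assume "x \<in> Ob C" "y \<in> Ob C"
  then have "amap F \<in> module_hom K (Hom C x y) (Hom D (omap F x) (omap F y))"
   "amap G \<in> module_hom K (Hom D (omap F x) (omap F y)) (Hom E (omap G (omap F x)) (omap G (omap F y)))"
   using assms unfolding lin_functor_def by blast+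
  from module_hom_comp[OF this]
  show "(\<lambda>f. amap G (amap F f)) \<in> module_hom K (Hom C x y) (Hom E (omap G (omap F x)) (omap G (omap F y)))" .
 next
  fix x y z f g assume a: "x \<in> Ob C" "y \<in> Ob C" "z \<in> Ob C" "f \<in> arr C x y" "g \<in> arr C y z"
  then have "amap F (g \<cdot>\<^bsub>C\<^esub> f) = amap F g \<cdot>\<^bsub>D\<^esub> amap F f"
   using assms(1) unfolding lin_functor_def by blast
  moreover have "omap F x \<in> Ob D" "omap F y \<in> Ob D" "omap F z \<in> Ob D"
   using a assms(1) unfolding lin_functor_def by blast+
  ultimately show "amap G (amap F (g \<cdot>\<^bsub>C\<^esub> f)) = amap G (amap F g) \<cdot>\<^bsub>E\<^esub> amap G (amap F f)"
   using a *[of x y f] *[of y z g] assms(2) unfolding lin_functor_def by metis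
 next
  fix x assume x: "x \<in> Ob C"
  then have F: "omap F x \<in> Ob D" "amap F (Id C x) = Id D (omap F x)"
   using assms(1) unfolding lin_functor_def by blast+
  then show "omap G (omap F x) \<in> Ob E" "amap G (amap F (Id C x)) = Id E (omap G (omap F x))"
   using assms(2) unfolding lin_functor_def by auto
 qed
qed

lemma quasi_inverse_sym: "quasi_inverse K C D F G ==> quasi_inverse K D C G F"
 unfolding quasi_inverse_def by blast

lemma comp_id_cfun [simp]: "F \<circ>\<^sub>F id_cfun = F"
 by (cases F) (simp add: comp_cfun_def id_cfun_def o_def)

text \<open>Naturality of unit and counit makes \<open>F\<close> and \<open>G\<close> injective on
  arrows. Fullness follows: the candidate is the conjugate of \<open>amap G g\<close> by the unit,
  and its image under \<open>F\<close> agrees with \<open>g\<close> after the injective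
  \<open>G\<close> is applied.\<close>

lemma (in linear_functor) equivalenceD:
 assumes "quasi_inverse K C D F G"
 shows "faithful" "full" "dense"
proof -
 have G: "lin_functor K D C G" using assms by (auto simp: quasi_inverse_def)
 interpret G: linear_functor K D C G by unfold_locales (rule G)
 obtain a b where a: "nat_iso C C (G \<circ>\<^sub>F F) id_cfun a" and b: "nat_iso D D (F \<circ>\<^sub>F G) id_cfun b"
  using assms by (auto simp: quasi_inverse_def)
 have a1: "is_iso (a x)" "dm (a x) = omap G (omap F x)" "cd (a x) = x" if "x \<in> Ob C" for x
  using a that isos_iff unfolding nat_iso_def by auto
 have a2: "a (cd f) ** amap G (amap F f) = f ** a (dm f)" if "ar f" for f
  using a that arI unfolding nat_iso_def by auto
 have b1: "D.is_iso (b x)" "D.dm (b x) = omap F (omap G x)" "D.cd (b x) = x" if "x \<in> Ob D" for x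
  using b that D.isos_iff unfolding nat_iso_def by auto
 have b2: "b (D.cd f) \<cdot>\<^bsub>D\<^esub> amap F (amap G f) = f \<cdot>\<^bsub>D\<^esub> b (D.dm f)" if "D.ar f" for f
  using b that D.arI unfolding nat_iso_def by auto
 have inj: "f = g" if "ar f" "ar g" "dm g = dm f" "cd g = cd f" "amap F f = amap F g" for f g
 proof (rule iso_rcancel)
  show "f ** a (dm f) = g ** a (dm f)" using a2[OF that(1)] a2[OF that(2)] that(3-5) by metis
 qed (use that a1[of "dm f"] in auto)
 have Ginj: "f = g" if "D.ar f" "D.ar g" "D.dm g = D.dm f" "D.cd g = D.cd f" "amap G f = amap G g" for f g
 proof (rule D.iso_rcancel)
  show "f \<cdot>\<^bsub>D\<^esub> b (D.dm f) = g \<cdot>\<^bsub>D\<^esub> b (D.dm f)" using b2[OF that(1)] b2[OF that(2)] that(3-5) by metis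
 qed (use that b1[of "D.dm f"] in auto)
 show "faithful" unfolding faithful_def
 proof (intro allI impI)
  fix f assume "ar f & amap F f = D.zr (omap F (dm f)) (omap F (cd f))"
  then show "f = zr (dm f) (cd f)" by (intro inj) auto
 qed
 show "dense" unfolding dense_def D.isom_def using b1 G.F_ob by metis
 show full unfolding full_def
 proof (intro ballI allI impI)
  fix x y g assume *: "x \<in> Ob C" "y \<in> Ob C" and g: "D.ar g & D.dm g = omap F x & D.cd g = omap F y"
  let ?f = "a y ** amap G g ** iv (a x)"
  have f: "ar ?f" "dm ?f = x" "cd ?f = y" using * g a1 by auto
  have "a y ** amap G (amap F ?f) = ?f ** a x" using a2[OF f(1)] f by simp
  also have "... = a y ** amap G g" using * g a1 by simp
  finally have "amap G (amap F ?f) = amap G g"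
   by (rule iso_lcancel[rotated -1]) (use a1 * g f in "auto simp del: F_cmp")
  then have "amap F ?f = g" by (rule Ginj[rotated -1]) (use * g f in "auto simp del: F_cmp")
  then show "\<exists>f. ar f & dm f = x & cd f = y & amap F f = g" using f by blast
 qed
qed

section \<open>Weak kernels and the five lemma\<close>

context lin_category
begin

text \<open>\<open>f\<close> is a weak kernel of \<open>g\<close>: Hom(w, -) is exact at the middle
  term for every \<open>w\<close>, with lifts that may fail to be unique. This is the exactness that
  the five lemma consumes, and it survives localization (\<open>Q_exr\<close>).\<close>

definition exr :: "'m => 'm => bool" where
 "exr f g \<longleftrightarrow> ar f & ar g & dm g = cd f & g ** f = zr (dm f) (cd g) &
  (\<forall>a. ar a & cd a = cd f & g ** a = zr (dm a) (cd g) -->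
   (\<exists>b. ar b & dm b = dm a & cd b = dm f & f ** b = a))"

lemma exrE:
 assumes "exr f g" "ar a" "cd a = cd f" "g ** a = zr (dm a) (cd g)"
 obtains b where "ar b" "dm b = dm a" "cd b = dm f" "f ** b = a"
 using assms unfolding exr_def by blast

lemma zero_cd: "[|zero_object C z; ar f; cd f = z; x = dm f; y = z|] ==> f = zr x y"
 by (metis ar_Ob(1) hzD zero_objectD(2))

lemma iso_zrD: "[|is_iso a; a ** b = zr x y; ar b; cd b = dm a; x = dm b; y = cd a; x' = dm b; z = dm a|] ==> b = zr x' z"
 by (metis ar_Ob ar_zr cmp_zr iso_ar iso_lcancel)

text \<open>The usual chase with arrows as generalized elements: an arrow into \<open>cd a3\<close>
  is lifted, an arrow killed by \<open>a3\<close> is shown to vanish. \<open>iso_if_bij\<close>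
  turns this into invertibility.\<close>

lemma five_lemma:
 assumes e: "exr f1 f2" "exr f2 f3" "exr f3 f4" and e': "exr g1 g2" "exr g2 g3" "exr g3 g4"
  and i: "is_iso a1" "is_iso a2" "is_iso a4" "is_iso a5" and a3: "ar a3"
  and t: "dm a1 = dm f1" "dm a2 = dm f2" "dm a3 = dm f3" "dm a4 = dm f4" "dm a5 = cd f4"
   "cd a1 = dm g1" "cd a2 = dm g2" "cd a3 = dm g3" "cd a4 = dm g4" "cd a5 = cd g4"
  and c: "a2 ** f1 = g1 ** a1" "a3 ** f2 = g2 ** a2" "a4 ** f3 = g3 ** a3" "a5 ** f4 = g4 ** a4"
 shows "is_iso a3"
proof (rule iso_if_bij[OF a3])
 note e0 = e[unfolded exr_def] e'[unfolded exr_def]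
 have T: "ar f1" "ar f2" "ar f3" "ar f4" "ar g1" "ar g2" "ar g3" "ar g4"
  "dm f2 = cd f1" "dm f3 = cd f2" "dm f4 = cd f3" "dm g2 = cd g1" "dm g3 = cd g2" "dm g4 = cd g3"
  "f2 ** f1 = zr (dm f1) (cd f2)" "g4 ** g3 = zr (dm g3) (cd g4)"
  using e0 by blast+
 fix b assume b: "ar b" "cd b = cd a3"
 define c4 where "c4 = iv a4 ** g3 ** b"
 have c4: "ar c4" "dm c4 = dm b" "cd c4 = dm f4" using b t T i by (simp_all add: c4_def)
 have a4: "a4 ** c4 = g3 ** b" using b t T i by (simp add: c4_def)
 have "a5 ** f4 ** c4 = g4 ** a4 ** c4" using pull[OF c(4), of c4] c4 T t i by simp
 also have "... = zr (dm b) (cd g4)" unfolding a4 using pull[OF T(16), of b] b T t by simp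
 finally have "f4 ** c4 = zr (dm c4) (cd f4)"
  by (rule iso_zrD[OF i(4)]) (use c4 T t in simp_all)
 then obtain c3 where c3: "ar c3" "dm c3 = dm b" "cd c3 = dm f3" "f3 ** c3 = c4"
  by - (rule exrE[OF e(3), of c4], use c4 T in auto)
 have "g3 ** a3 ** c3 = g3 ** b" using pull[OF c(3)[symmetric], of c3] c3 T t i a3 a4 by simp
 then have "g3 ** (b \<boxplus> ng (a3 ** c3)) = zr (dm b) (cd g3)"
  using b c3 T t a3 pl_ng(1)[of "g3 ** b"] by (simp add: cmp_pl)
 then obtain d where d: "ar d" "dm d = dm b" "cd d = dm g2" "g2 ** d = b \<boxplus> ng (a3 ** c3)"
  by - (rule exrE[OF e'(2), of "b \<boxplus> ng (a3 ** c3)"], use b c3 T t a3 in auto)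
 have "a3 ** f2 ** iv a2 ** d = g2 ** d"
  using pull[OF c(2), of "iv a2 ** d"] d T t i a3 by simp
 then have "a3 ** (c3 \<boxplus> (f2 ** iv a2 ** d)) = (a3 ** c3) \<boxplus> (b \<boxplus> ng (a3 ** c3))"
  using c3 d T t i a3 by (simp add: cmp_pl)
 also have "... = b \<boxplus> ((a3 ** c3) \<boxplus> ng (a3 ** c3))" by (rule pl_lcomm) (use b c3 T t a3 in auto)
 also have "... = b" using b c3 T t a3 by simp
 finally show "\<exists>a. ar a & dm a = dm b & cd a = dm a3 & a3 ** a = b"
  using c3 d T t i a3 by (intro exI[of _ "c3 \<boxplus> (f2 ** iv a2 ** d)"]) simp
next
 have T: "ar f1" "ar f2" "ar f3" "ar f4" "ar g1" "ar g2" "ar g3" "ar g4"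
  "dm f2 = cd f1" "dm f3 = cd f2" "dm f4 = cd f3" "dm g2 = cd g1" "dm g3 = cd g2" "dm g4 = cd g3"
  "f2 ** f1 = zr (dm f1) (cd f2)" "g4 ** g3 = zr (dm g3) (cd g4)"
  using e e' unfolding exr_def by blast+
 fix a assume a: "ar a" "cd a = dm a3" "a3 ** a = zr (dm a) (cd a3)"
 have "a4 ** f3 ** a = g3 ** a3 ** a" using pull[OF c(3), of a] a T t i a3 by simp
 also have "... = zr (dm a) (cd g3)" using a T t a3 by simp
 finally have "f3 ** a = zr (dm a) (cd f3)"
  by (rule iso_zrD[OF i(3)]) (use a T t in simp_all)
 then obtain k where k: "ar k" "dm k = dm a" "cd k = dm f2" "f2 ** k = a"
  by - (rule exrE[OF e(2), of a], use a T t in auto)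
 have "g2 ** a2 ** k = a3 ** a" using pull[OF c(2)[symmetric], of k] k T t i a3 by simp
 then obtain d where d: "ar d" "dm d = dm a" "cd d = dm g1" "g1 ** d = a2 ** k"
  by - (rule exrE[OF e'(1), of "a2 ** k"], use k a T t i in auto)
 have "a2 ** f1 ** iv a1 ** d = a2 ** k"
  using pull[OF c(1), of "iv a1 ** d"] d T t i by simp
 then have "f1 ** iv a1 ** d = k" by (rule iso_lcancel[rotated -1]) (use d k T t i in auto)
 then have "a = f2 ** f1 ** iv a1 ** d" using k by simp
 also have "... = zr (dm a) (dm a3)" using pull[OF T(15), of "iv a1 ** d"] d T t i by simp
 finally show "a = zr (dm a) (dm a3)" .
qed

end

subsection \<open>Triangulated categories\<close>

text \<open>The axioms short of the octahedron. The quotient is first made an instance of this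
  locale, so that the lemmas below are at hand when its octahedral axiom is proved.\<close>

locale pretriangulated = lin_category K T
 for K :: "('k, 'r) ring_scheme" (structure) and T :: "('o, 'm, 'k, 'z) tricat_scheme" +
 assumes p_additive: "additive_cat T"
  and p_shift: "quasi_inverse K T T (Sh T) (Shi T)"
  and p_tri_candidate: "t \<in> Tri T ==> \<exists>x y z. candidate T (Sh T) x y z t"
  and p_TR1_id: "[|x \<in> Ob T; zero_object T z|] ==>
   triangle T x x z (Id T x) \<zero>\<^bsub>Hom T x z\<^esub> \<zero>\<^bsub>Hom T z (omap (Sh T) x)\<^esub>"
  and p_TR1_iso: "[|t \<in> Tri T; isomorphic_triangles T (Sh T) t t'|] ==> t' \<in> Tri T"
  and p_TR1_ex: "[|x \<in> Ob T; y \<in> Ob T; f \<in> arr T x y|] ==> \<exists>z g h. triangle T x y z f g h"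
  and p_TR2: "candidate T (Sh T) x y z (f, g, h) ==>
   triangle T x y z f g h \<longleftrightarrow>
   triangle T y z (omap (Sh T) x) g h
    (\<ominus>\<^bsub>Hom T (omap (Sh T) x) (omap (Sh T) y)\<^esub> amap (Sh T) f)"
  and p_TR3: "[|triangle T x y z f g h; triangle T x' y' z' f' g' h';
   \<alpha> \<in> arr T x x'; \<beta> \<in> arr T y y'; \<beta> \<cdot>\<^bsub>T\<^esub> f = f' \<cdot>\<^bsub>T\<^esub> \<alpha>|] ==>
   \<exists>\<gamma>\<in>arr T z z'. \<gamma> \<cdot>\<^bsub>T\<^esub> g = g' \<cdot>\<^bsub>T\<^esub> \<beta> & amap (Sh T) \<alpha> \<cdot>\<^bsub>T\<^esub> h = h' \<cdot>\<^bsub>T\<^esub> \<gamma>"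

sublocale triangulated_category \<subseteq> pretriangulated
 by unfold_locales (fact additive shift tri_candidate TR1_id TR1_iso TR1_ex TR2 TR3)+

sublocale pretriangulated \<subseteq> Sh: linear_functor K T T "Sh T"
 by unfold_locales (use p_shift in "simp add: quasi_inverse_def")

sublocale pretriangulated \<subseteq> Shi: linear_functor K T T "Shi T"
 by unfold_locales (use p_shift in "simp add: quasi_inverse_def")

context pretriangulated
begin

notation cmp (infixr \<open>**\<close> 72)
notation pl (infixl \<open>\<boxplus>\<close> 65)
notation isom (infix \<open>\<simeq>\<close> 50)

abbreviation sho :: "'o => 'o" where "sho \<equiv> omap (Sh T)"
abbreviation sha :: "'m => 'm" where "sha \<equiv> amap (Sh T)"
abbreviation shi :: "'o => 'o" where "shi \<equiv> omap (Shi T)"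

lemma sh_full: "[|x \<in> Ob T; y \<in> Ob T; ar g; dm g = sho x; cd g = sho y|] ==>
  \<exists>f. ar f & dm f = x & cd f = y & sha f = g"
 using Sh.fullD[OF Sh.equivalenceD(2)[OF p_shift]] .

lemma sh_faithful: "[|ar f; ar g; dm g = dm f; cd g = cd f; sha f = sha g|] ==> f = g"
 using Sh.faithfulD[OF Sh.equivalenceD(1)[OF p_shift]] .

lemma sh_shi: assumes "x \<in> Ob T" shows "sho (shi x) \<simeq> x"
proof -
 obtain e where "nat_iso T T (Sh T \<circ>\<^sub>F Shi T) id_cfun e" using p_shift unfolding quasi_inverse_def by blast
 then have "e x \<in> isos T (sho (shi x)) x" using assms unfolding nat_iso_def by simp
 then show ?thesis using isos_iff[of "sho (shi x)" x "e x"] assms by (intro isomI[of "e x"]) auto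
qed

lemma shi_sh: assumes "x \<in> Ob T" shows "shi (sho x) \<simeq> x"
proof -
 obtain e where "nat_iso T T (Shi T \<circ>\<^sub>F Sh T) id_cfun e" using p_shift unfolding quasi_inverse_def by blast
 then have "e x \<in> isos T (shi (sho x)) x" using assms unfolding nat_iso_def by simp
 then show ?thesis using isos_iff[of "shi (sho x)" x "e x"] assms by (intro isomI[of "e x"]) auto
qed

definition dist :: "'m => 'm => 'm => bool" where
 "dist f g h \<longleftrightarrow> (f, g, h) \<in> Tri T"

lemma dist_ar:
 assumes "dist f g h"
 shows "ar f" "ar g" "ar h" "dm g = cd f" "dm h = cd g" "cd h = sho (dm f)"
proof -
 obtain x y z where "candidate T (Sh T) x y z (f, g, h)"
  using p_tri_candidate assms unfolding dist_def by blast
 then show "ar f" "ar g" "ar h" "dm g = cd f" "dm h = cd g" "cd h = sho (dm f)"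
  unfolding candidate_def by auto
qed

lemma candidate_iff: "candidate T (Sh T) x y z (f, g, h) \<longleftrightarrow> ar f & ar g & ar h &
  dm f = x & cd f = y & dm g = y & cd g = z & dm h = z & cd h = sho x"
 unfolding candidate_def by auto

lemma triangle_iff: "triangle T x y z f g h \<longleftrightarrow> dist f g h & dm f = x & cd f = y & cd g = z"
 using dist_ar[of f g h] unfolding triangle_def candidate_iff dist_def by auto

lemma dist_rot: "dist f g h ==> dist g h (ng (sha f))"
 using p_TR2[of "dm f" "cd f" "cd g" f g h] dist_ar[of f g h] ng_eq[of "sha f" "sho (dm f)" "sho (cd f)"]
 by (simp add: candidate_iff triangle_iff)

lemma dist_unrot: "[|dist g h (ng (sha f)); ar f; cd f = dm g; cd h = sho (dm f)|] ==> dist f g h"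
 using p_TR2[of "dm f" "cd f" "cd g" f g h] dist_ar[of g h "ng (sha f)"]
  ng_eq[of "sha f" "sho (dm f)" "sho (cd f)"]
 by (simp add: candidate_iff triangle_iff)

lemma dist_iso:
 assumes "dist f g h" "is_iso a" "is_iso b" "is_iso c" "ar f'" "ar g'" "ar h'"
  "dm a = dm f" "dm b = dm g" "dm c = dm h" "cd a = dm f'" "cd b = dm g'" "cd c = dm h'"
  "cd f' = cd b" "cd g' = cd c" "cd h' = sho (cd a)"
  "b ** f = f' ** a" "c ** g = g' ** b" "sha a ** h = h' ** c"
 shows "dist f' g' h'"
proof -
 have "candidate T (Sh T) (dm f) (cd f) (cd g) (f, g, h)"
  "candidate T (Sh T) (dm f') (cd f') (cd g') (f', g', h')"
  "a \<in> isos T (dm f) (dm f')" "b \<in> isos T (cd f) (cd f')" "c \<in> isos T (cd g) (cd g')"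
  using assms dist_ar[OF assms(1)] isos_iff by (simp_all add: candidate_iff)
 then have "isomorphic_triangles T (Sh T) (f, g, h) (f', g', h')"
  unfolding isomorphic_triangles_def using assms(17-19) by blast
 then show ?thesis using p_TR1_iso assms(1) unfolding dist_def by blast
qed

lemma dist_ex: "ar f ==> \<exists>g h. dist f g h"
 using p_TR1_ex[of "dm f" "cd f" f] arI[of f] by (auto simp: triangle_iff)

lemma dist_morphism:
 assumes "dist f g h" "dist f' g' h'" "ar a" "ar b" "dm a = dm f" "cd a = dm f'"
  "dm b = cd f" "cd b = cd f'" "b ** f = f' ** a"
 shows "\<exists>c. ar c & dm c = cd g & cd c = cd g' & c ** g = g' ** b & sha a ** h = h' ** c"
proof -
 note d = dist_ar[OF assms(1)] dist_ar[OF assms(2)]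
 obtain c where "c \<in> arr T (cd g) (cd g')" "c ** g = g' ** b" "sha a ** h = h' ** c"
  using p_TR3[of "dm f" "cd f" "cd g" f g h "dm f'" "cd f'" "cd g'" f' g' h' a b] assms d
   arI[of a] arI[of b] by (auto simp: triangle_iff)
 then show ?thesis using d by auto
qed

lemma dist_idt: "[|x \<in> Ob T; zero_object T z|] ==> dist (idt x) (zr x z) (zr z (sho x))"
 using p_TR1_id[of x z] by (simp add: zr_eq triangle_iff)

lemma zero_ex: "\<exists>z. zero_object T z"
 using p_additive direct_sum_empty unfolding additive_cat_def by (metis empty_subsetI list.set(1))

lemma dist_idt2:
 assumes "x \<in> Ob T" "zero_object T z"
 shows "dist (zr z x) (idt x) (zr x (sho z))"
proof (rule dist_unrot)
 have "sho z \<in> Ob T" "z \<in> Ob T" using zero_objectD(1)[OF assms(2)] by auto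
 then show "dist (idt x) (zr x (sho z)) (ng (sha (zr z x)))"
  using dist_idt[OF assms(1) Sh.F_zero[OF assms(2)]] assms by simp
qed (use assms zero_objectD(1)[OF assms(2)] in auto)

text \<open>TR3, applied to the trivial triangle on \<open>dm f\<close>, factors
  \<open>g ** f\<close> through a zero object.\<close>

lemma dist_zero1: assumes "dist f g h" shows "g ** f = zr (dm f) (cd g)"
proof -
 note d = dist_ar[OF assms]
 obtain z where z: "zero_object T z" using zero_ex by blast
 note z' = zero_objectD(1)[OF z]
 obtain c where "ar c" "dm c = z" "cd c = cd g" "c ** zr (dm f) z = g ** f"
  using dist_morphism[OF dist_idt[OF _ z, of "dm f"] assms, of "idt (dm f)" f] d z' by fastforce
 then show ?thesis using d by (metis ar_Ob(1) cmp_zr)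
qed

lemma dist_zero3: assumes "dist f g h" shows "sha f ** h = zr (cd g) (sho (cd f))"
 using dist_zero1[OF dist_rot[OF dist_rot[OF assms]]] dist_ar[OF assms]
 by (metis (no_types, lifting) Sh.F_ar ar_Ob ar_cmp(1) ar_ng(1-3) ng_cmp ng_ng ng_zr)

text \<open>An arrow killing \<open>f\<close> starts a morphism into the trivial triangle on
  \<open>cd a\<close>, and the wanted factor is the arrow that TR3 adds. So \<open>g\<close> is a
  weak cokernel of \<open>f\<close>.\<close>

lemma dist_factor_left:
 assumes "dist f g h" "ar a" "dm a = cd f" "a ** f = zr (dm f) (cd a)"
 obtains b where "ar b" "dm b = cd g" "cd b = cd a" "b ** g = a"
proof -
 note d = dist_ar[OF assms(1)]
 obtain z where z: "zero_object T z" using zero_ex by blast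
 note z' = zero_objectD(1)[OF z]
 have "\<exists>b. ar b & dm b = cd g & cd b = cd (idt (cd a)) & b ** g = idt (cd a) ** a &
   sha (zr (dm f) z) ** h = zr (cd a) (sho z) ** b"
  by (rule dist_morphism[OF assms(1) dist_idt2[OF _ z, of "cd a"], of "zr (dm f) z" a]) (use d z' assms in auto)
 then show ?thesis using that assms by auto
qed

text \<open>TR3 only produces a third arrow, so both triangles are rotated until the wanted arrow is
  the third one. It then runs between shifts and is desuspended by fullness and faithfulness of the
  shift.\<close>

lemma dist_factor_right:
 assumes "dist f g h" "ar a" "cd a = cd f" "g ** a = zr (dm a) (cd g)"
 obtains b where "ar b" "dm b = dm a" "cd b = dm f" "f ** b = a"
proof -
 note d = dist_ar[OF assms(1)]
 obtain z where z: "zero_object T z" using zero_ex by blast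
 note z' = zero_objectD(1)[OF z]
 let ?w = "dm a"
 have "dist (zr ?w z) (zr z (sho ?w)) (ng (sha (idt ?w)))"
  using dist_rot[OF dist_idt[OF _ z, of ?w]] assms by simp
 then obtain c where c: "ar c" "dm c = sho ?w" "cd c = sho (dm f)"
  "sha a ** ng (sha (idt ?w)) = ng (sha f) ** c"
  using dist_morphism[OF _ dist_rot[OF assms(1)], of "zr ?w z" "zr z (sho ?w)" "ng (sha (idt ?w))" a "zr z (cd g)"]
   d z' assms by auto
 obtain b where b: "ar b" "dm b = ?w" "cd b = dm f" "sha b = c"
  using sh_full[of ?w "dm f" c] c d assms by auto
 have "ng (sha a) = ng (sha f ** c)" using c d assms by simp
 then have "sha a = sha f ** c" using c d assms ng_inj[of "sha a" "sha f ** c"] by simp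
 then have "sha (f ** b) = sha a" using b d by simp
 then have "f ** b = a" by (rule sh_faithful[rotated -1]) (use b d assms in auto)
 then show ?thesis using b that by blast
qed

lemma dist_exr:
 assumes "dist f g h"
 shows "exr f g" "exr g h" "exr h (sha f)"
proof -
 have 1: "exr f g" if "dist f g h" for f g h
  unfolding exr_def
 proof (intro conjI allI impI)
  fix a assume "ar a & cd a = cd f & g ** a = zr (dm a) (cd g)"
  then show "\<exists>b. ar b & dm b = dm a & cd b = dm f & f ** b = a"
   using dist_factor_right[OF that, of a] by metis
 qed (use dist_zero1[OF that] dist_ar[OF that] in auto)
 show "exr f g" "exr g h" using 1 assms dist_rot by blast+
 have "exr h (ng (sha f))" using 1 assms dist_rot by blast
 moreover have "ng (sha f) ** a = zr (dm a) (cd (sha f)) \<longleftrightarrow> sha f ** a = zr (dm a) (cd (sha f))"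
  if "ar a" "cd a = sho (dm f)" for a
  using that dist_ar[OF assms] ng_inj[of "sha f ** a" "zr (dm a) (cd (sha f))"] by simp
 ultimately show "exr h (sha f)" using dist_ar[OF assms] dist_zero3[OF assms] unfolding exr_def by auto
qed

lemma dist_morphism_iso:
 assumes "dist f g h" "dist f' g' h'" "is_iso a" "is_iso b" "ar c" "dm a = dm f" "cd a = dm f'"
  "dm b = cd f" "cd b = cd f'" "dm c = cd g" "cd c = cd g'"
  "b ** f = f' ** a" "c ** g = g' ** b" "sha a ** h = h' ** c"
 shows "is_iso c"
proof (rule five_lemma[of f g h "sha f" f' g' h' "sha f'" a b "sha a" "sha b" c])
 show "sha b ** sha f = sha f' ** sha a"
  using assms(12) dist_ar[OF assms(1)] dist_ar[OF assms(2)] assms(3-9) by (simp flip: Sh.F_cmp)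
qed (use assms dist_exr[OF assms(1)] dist_exr[OF assms(2)] dist_ar[OF assms(1)] dist_ar[OF assms(2)] in auto)

lemma dist_iso_complete:
 assumes "dist f g h" "dist f' g' h'" "is_iso a" "is_iso b" "dm a = dm f" "cd a = dm f'"
  "dm b = cd f" "cd b = cd f'" "b ** f = f' ** a"
 shows "\<exists>c. is_iso c & dm c = cd g & cd c = cd g' & c ** g = g' ** b & sha a ** h = h' ** c"
proof -
 obtain c where "ar c" "dm c = cd g" "cd c = cd g'" "c ** g = g' ** b" "sha a ** h = h' ** c"
  using dist_morphism[of f g h f' g' h' a b] assms by auto
 then show ?thesis using dist_morphism_iso[of f g h f' g' h' a b c] assms by auto
qed

text \<open>The shift is dense only up to isomorphism. The cone \<open>cd h'\<close> is therefore
  replaced by the shift of \<open>shi (cd h')\<close> along \<open>e\<close>, and the sign of the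
  rotation is absorbed into \<open>f\<close>.\<close>

lemma dist_ex2:
 assumes "ar g" shows "\<exists>f h. dist f g h"
proof -
 obtain h' k where d: "dist g h' k" using dist_ex[OF assms] by blast
 note t = dist_ar[OF d]
 obtain e where e: "is_iso e" "dm e = sho (shi (cd h'))" "cd e = cd h'"
  using sh_shi[of "cd h'"] t by (auto simp: isom_def)
 obtain f where f: "ar f" "dm f = shi (cd h')" "cd f = dm g" "sha f = ng (k ** e)"
  using sh_full[of "shi (cd h')" "dm g" "ng (k ** e)"] t e by auto
 have "dist g (iv e ** h') (ng (sha f))"
  by (rule dist_iso[OF d, of "idt (dm g)" "idt (cd g)" "iv e"]) (use t e f in auto)
 then have "dist f g (iv e ** h')" using dist_unrot[of g _ f] t e f by auto
 then show ?thesis by blast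
qed

text \<open>Only the existence of a triangle on the three objects. Unlike \<open>dist\<close> it is
  invariant under isomorphism of each object, which is what arguments about classes of objects
  use.\<close>

definition tr :: "'o => 'o => 'o => bool" where
 "tr x y z \<longleftrightarrow> (\<exists>f g h. triangle T x y z f g h)"

lemma tr_iff: "tr x y z \<longleftrightarrow> (\<exists>f g h. dist f g h & dm f = x & cd f = y & cd g = z)"
 by (simp add: tr_def triangle_iff)

lemma trI: "[|dist f g h; dm f = x; cd f = y; cd g = z|] ==> tr x y z"
 unfolding tr_iff by blast

lemma tr_Ob: "tr x y z ==> x \<in> Ob T & y \<in> Ob T & z \<in> Ob T"
 unfolding tr_iff using dist_ar by (metis ar_Ob)

lemma trE:
 assumes "tr x y z"
 obtains f g h where "dist f g h" "dm f = x" "cd f = y" "cd g = z"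
 using assms unfolding tr_iff by blast

lemma tr_rot: assumes "tr x y z" shows "tr y z (sho x)"
proof -
 obtain f g h where d: "dist f g h" "dm f = x" "cd f = y" "cd g = z" using assms by (rule trE)
 show ?thesis by (rule trI[OF dist_rot[OF d(1)]]) (use d dist_ar[OF d(1)] in auto)
qed

lemma tr_isom:
 assumes "tr x y z" "x \<simeq> x'" "y \<simeq> y'" "z \<simeq> z'"
 shows "tr x' y' z'"
proof -
 obtain f g h where d: "dist f g h" "dm f = x" "cd f = y" "cd g = z" using assms(1) by (rule trE)
 note t = dist_ar[OF d(1)]
 obtain a b c where i: "is_iso a" "dm a = x" "cd a = x'" "is_iso b" "dm b = y" "cd b = y'"
  "is_iso c" "dm c = z" "cd c = z'" using assms by (auto simp: isom_def)
 have "dist (b ** f ** iv a) (c ** g ** iv b) (sha a ** h ** iv c)"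
  by (rule dist_iso[OF d(1), of a b c]) (use i d t in auto)
 then show ?thesis by (rule trI) (use i d t in auto)
qed

lemma isom_tr: "[|x \<simeq> y; zero_object T z|] ==> tr x y z"
 using trI[OF dist_idt[of x z], of x x z] tr_isom[of x x z x y z] isom_Ob[of x y] zero_objectD(1)[of z]
 by auto

lemma isom_tr2: "[|x \<simeq> y; zero_object T z|] ==> tr z x y"
 using trI[OF dist_idt2[of x z], of z x x] tr_isom[of z x x z x y] isom_Ob[of x y] zero_objectD(1)[of z]
 by auto

lemma cone_unique:
 assumes "dist f g h" "dist f g' h'" shows "cd g \<simeq> cd g'"
proof -
 note t = dist_ar[OF assms(1)]
 show ?thesis
  using dist_iso_complete[OF assms, of "idt (dm f)" "idt (cd f)"] t isomI by auto
qed

lemma tr_zero3: assumes "tr x y z" "zero_object T z" shows "x \<simeq> y"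
proof -
 obtain f g h where d: "dist f g h" "dm f = x" "cd f = y" "cd g = z" using assms(1) by (rule trE)
 note t = dist_ar[OF d(1)]
 have "is_iso f"
 proof (rule iso_if_bij)
  fix b assume b: "ar b" "cd b = cd f"
  then have "g ** b = zr (dm b) (cd g)" by - (rule zero_cd[OF assms(2)], use t d in auto)
  then show "\<exists>a. ar a & dm a = dm b & cd a = dm f & f ** a = b"
   by - (rule dist_factor_right[OF d(1), of b], use b in auto)
 next
  fix a assume a: "ar a" "cd a = dm f" "f ** a = zr (dm a) (cd f)"
  then have "sha f ** sha a = zr (dm (sha a)) (cd (sha f))" using t by (simp flip: Sh.F_cmp)
  then obtain b where b: "ar b" "dm b = sho (dm a)" "cd b = cd g" "h ** b = sha a"
   by - (rule exrE[OF dist_exr(3)[OF d(1)], of "sha a"], use t a in auto)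
  have "b = zr (dm b) (cd b)" by (rule zero_cd[OF assms(2)]) (use b d in auto)
  then have "sha a = sha (zr (dm a) (dm f))" using b t a by (metis Sh.F_zr ar_Ob cmp_zr)
  then show "a = zr (dm a) (dm f)" by (rule sh_faithful[rotated -1]) (use a t in auto)
 qed (use t in auto)
 then show ?thesis using d isomI by blast
qed

lemma sho_isom_iff: "[|x \<in> Ob T; y \<in> Ob T|] ==> sho x \<simeq> sho y \<longleftrightarrow> x \<simeq> y"
 using Sh.ff_reflects_isom[OF Sh.equivalenceD(2)[OF p_shift] Sh.equivalenceD(1)[OF p_shift]] Sh.F_isom by blast

lemma tr_unrot_ex:
 assumes "tr x y z" shows "\<exists>w\<in>Ob T. tr w x y & sho w \<simeq> z"
proof -
 obtain f g h where d: "dist f g h" "dm f = x" "cd f = y" "cd g = z" using assms(1) by (rule trE)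
 obtain k l where e: "dist k f l" using dist_ex2 dist_ar[OF d(1)] by blast
 have "cd l \<simeq> cd g" using cone_unique[OF dist_rot[OF e] d(1)] .
 then have "sho (dm k) \<simeq> z" using dist_ar[OF e] d by simp
 moreover have "tr (dm k) x y" by (rule trI[OF e]) (use dist_ar[OF e] d in auto)
 ultimately show ?thesis using dist_ar[OF e] by (intro bexI[of _ "dm k"]) auto
qed

lemma tr_unrot: assumes "tr x y z" shows "tr (shi z) x y"
proof -
 obtain w where w: "w \<in> Ob T" "tr w x y" "sho w \<simeq> z" using tr_unrot_ex[OF assms] by blast
 have "sho w \<simeq> sho (shi z)" using w(3) sh_shi isom_sym isom_trans isom_Ob by metis
 then have "w \<simeq> shi z" using sho_isom_iff w tr_Ob[OF assms] by simp
 then show ?thesis using tr_isom[OF w(2)] tr_Ob[OF assms] by simp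
qed

lemma tr_unrot_sh: assumes "tr x y (sho z)" "z \<in> Ob T" shows "tr z x y"
 using tr_isom[OF tr_unrot[OF assms(1)] shi_sh] tr_Ob[OF assms(1)] assms by simp

lemma tr_sh: "tr x y z ==> tr (sho x) (sho y) (sho z)"
 by (intro tr_rot)

lemma tr_unsh: "[|tr (sho x) (sho y) (sho z); x \<in> Ob T; y \<in> Ob T; z \<in> Ob T|] ==> tr x y z"
 using tr_unrot_sh[of "sho x" "sho y" z] tr_unrot_sh[of z "sho x" y] tr_unrot_sh[of y z x] by simp

lemma tr_shi: "tr x y z ==> tr (shi x) (shi y) (shi z)"
 by (intro tr_unrot)

lemma tr_zero1: "[|tr x y z; zero_object T x|] ==> y \<simeq> z"
 using tr_zero3[OF tr_rot] Sh.F_zero by blast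

lemma tr_zero2: "[|tr x y z; zero_object T y|] ==> z \<simeq> sho x"
 using tr_zero1[OF tr_rot] .

lemma tr_hz_mid: assumes "tr x y z" "w \<in> Ob T" "hz w x" "hz w z" shows "hz w y"
proof -
 obtain f g h where d: "dist f g h" "dm f = x" "cd f = y" "cd g = z" using assms(1) by (rule trE)
 note t = dist_ar[OF d(1)]
 show ?thesis
 proof (rule hzI)
  fix a assume a: "ar a" "dm a = w" "cd a = y"
  have "g ** a = zr w z" by (rule hzD[OF assms(4)]) (use a d t in auto)
  then obtain b where b: "ar b" "dm b = w" "cd b = x" "f ** b = a"
   by - (rule dist_factor_right[OF d(1), of a], use a d in auto)
  then have "b = zr w x" using hzD[OF assms(3)] by blast
  then show "a = zr w y" using b d t assms by auto
 qed (use assms d t in auto)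
qed

lemma tr_hz_mid2: assumes "tr x y z" "w \<in> Ob T" "hz x w" "hz z w" shows "hz y w"
proof -
 obtain f g h where d: "dist f g h" "dm f = x" "cd f = y" "cd g = z" using assms(1) by (rule trE)
 note t = dist_ar[OF d(1)]
 show ?thesis
 proof (rule hzI)
  fix a assume a: "ar a" "dm a = y" "cd a = w"
  have "a ** f = zr x w" by (rule hzD[OF assms(3)]) (use a d t in auto)
  then obtain b where b: "ar b" "dm b = z" "cd b = w" "b ** g = a"
   by - (rule dist_factor_left[OF d(1), of a], use a d in auto)
  then have "b = zr z w" using hzD[OF assms(4)] by blast
  then show "a = zr y w" using b d t assms by auto
 qed (use assms d t in auto)
qed

lemma hz_sho [simp]: "[|x \<in> Ob T; y \<in> Ob T|] ==> hz (sho x) (sho y) \<longleftrightarrow> hz x y"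
proof
 assume *: "x \<in> Ob T" "y \<in> Ob T" "hz (sho x) (sho y)"
 show "hz x y"
 proof (rule hzI)
  fix f assume f: "ar f" "dm f = x" "cd f = y"
  have "sha f = zr (sho x) (sho y)" by (rule hzD[OF *(3)]) (use f in auto)
  then have "sha f = sha (zr x y)" using * by simp
  then show "f = zr x y" by (rule sh_faithful[rotated -1]) (use f * in auto)
 qed (use * in auto)
next
 assume *: "x \<in> Ob T" "y \<in> Ob T" "hz x y"
 show "hz (sho x) (sho y)"
 proof (rule hzI)
  fix g assume g: "ar g" "dm g = sho x" "cd g = sho y"
  then obtain f where "ar f" "dm f = x" "cd f = y" "sha f = g" using sh_full * by blast
  moreover from this have "f = zr x y" by (intro hzD[OF *(3)])
  ultimately show "g = zr (sho x) (sho y)" using * Sh.F_zr by metis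
 qed (use * in auto)
qed

lemma hz_shi [simp]:
 assumes "x \<in> Ob T" "y \<in> Ob T" shows "hz (shi x) (shi y) \<longleftrightarrow> hz x y"
proof -
 have "hz (shi x) (shi y) \<longleftrightarrow> hz (sho (shi x)) (sho (shi y))" using assms by simp
 also have "... \<longleftrightarrow> hz x y"
  using hz_isom_left[OF sh_shi[of x]] hz_isom_right[OF sh_shi[of y]]
   hz_isom_left[OF isom_sym[OF sh_shi[of x]]] hz_isom_right[OF isom_sym[OF sh_shi[of y]]] assms
  by (meson Sh.F_ob Shi.F_ob)
 finally show ?thesis .
qed

abbreviation sft :: "int => 'o => 'o" where "sft \<equiv> shift_ob T"

lemma funpow_Ob: "x \<in> Ob T ==> (sho ^^ n) x \<in> Ob T" "x \<in> Ob T ==> (shi ^^ n) x \<in> Ob T"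
 by (induction n) auto

lemma sft_Ob [simp]: "x \<in> Ob T ==> sft i x \<in> Ob T"
 by (simp add: shift_ob_def funpow_Ob)

lemma sft_simps [simp]: "sft 0 x = x" "sft 1 x = sho x" "sft (- 1) x = shi x"
 by (simp_all add: shift_ob_def)

lemma sho_sft: assumes "x \<in> Ob T" shows "sho (sft i x) \<simeq> sft (i + 1) x"
proof (cases "i \<ge> 0")
 case True
 then have "sho (sft i x) = sft (i + 1) x" by (simp add: shift_ob_def nat_add_distrib)
 then show ?thesis using assms by simp
next
 case False
 then have n: "nat (- i) = Suc (nat (- (i + 1)))" by simp
 have "sft i x = shi (sft (i + 1) x)"
  by (cases "i = -1") (use False n in "simp_all add: shift_ob_def")
 then show ?thesis using sh_shi assms by simp
qed

lemma shi_isom: "x \<simeq> y ==> shi x \<simeq> shi y" and sho_isom: "x \<simeq> y ==> sho x \<simeq> sho y"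
 by (fact Shi.F_isom Sh.F_isom)+

lemma shi_sft: assumes "x \<in> Ob T" shows "shi (sft i x) \<simeq> sft (i - 1) x"
 using isom_trans[OF isom_sym[OF shi_isom[OF sho_sft[OF assms, of "i - 1"]]] shi_sh] assms by simp

declare isom_trans [trans]

text \<open>\<open>Sh\<close> and \<open>Shi\<close> are only quasi-inverse, so shifts compose up to
  isomorphism. The induction runs from 0 in both directions.\<close>

lemma sft_sft: assumes "x \<in> Ob T" shows "sft i (sft j x) \<simeq> sft (i + j) x"
proof (induction i rule: int_induct[where k = 0])
 case (step1 i)
 have "sft (i + 1) (sft j x) \<simeq> sho (sft i (sft j x))" using isom_sym[OF sho_sft] assms by simp
 also have "sho (sft i (sft j x)) \<simeq> sho (sft (i + j) x)" using sho_isom step1(2) .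
 also have "sho (sft (i + j) x) \<simeq> sft (i + j + 1) x" using sho_sft assms by blast
 finally show ?case by (simp add: algebra_simps)
next
 case (step2 i)
 have "sft (i - 1) (sft j x) \<simeq> shi (sft i (sft j x))" using isom_sym[OF shi_sft] assms by simp
 also have "shi (sft i (sft j x)) \<simeq> shi (sft (i + j) x)" using shi_isom step2(2) .
 also have "shi (sft (i + j) x) \<simeq> sft (i + j - 1) x" using shi_sft assms by blast
 finally show ?case by (simp add: algebra_simps)
qed (use assms in simp)

lemma hz_cong: assumes "x \<simeq> x'" "y \<simeq> y'" shows "hz x y \<longleftrightarrow> hz x' y'"
 using hz_isom_left[of x x' y] hz_isom_right[of y y' x'] hz_isom_left[OF isom_sym[OF assms(1)], of y']
  hz_isom_right[OF isom_sym[OF assms(2)], of x] assms isom_Ob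
 by (meson hz_isom_left hz_isom_right isom_sym)

lemma hz_sft [simp]: assumes "x \<in> Ob T" "y \<in> Ob T" shows "hz (sft i x) (sft i y) \<longleftrightarrow> hz x y"
proof (induction i rule: int_induct[where k = 0])
 case (step1 i)
 then show ?case using hz_cong[OF sho_sft[of x i] sho_sft[of y i]] assms by simp
next
 case (step2 i)
 then show ?case using hz_cong[OF shi_sft[of x i] shi_sft[of y i]] assms by simp
qed simp

lemma hz_sft_left: assumes "x \<in> Ob T" "y \<in> Ob T" shows "hz (sft i x) y \<longleftrightarrow> hz x (sft (- i) y)"
proof -
 have "hz x (sft (- i) y) \<longleftrightarrow> hz (sft i x) (sft i (sft (- i) y))" using assms by simp
 also have "... \<longleftrightarrow> hz (sft i x) y"
  using hz_cong[OF isom_refl[of "sft i x"] sft_sft[of y i "- i"]] assms by simp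
 finally show ?thesis by simp
qed

lemma hz_sft_sft: assumes "x \<in> Ob T" "y \<in> Ob T" shows "hz (sft i x) (sft j y) \<longleftrightarrow> hz x (sft (j - i) y)"
 using hz_sft_left[of x "sft j y" i] hz_cong[OF isom_refl[of x] sft_sft[of y "- i" j]] assms
 by (simp add: algebra_simps)

lemma tr_sft: assumes "tr x y z" shows "tr (sft i x) (sft i y) (sft i z)"
proof (induction i rule: int_induct[where k = 0])
 case (step1 i)
 then show ?case using tr_isom[OF tr_sh sho_sft sho_sft sho_sft] tr_Ob[OF assms] by blast
next
 case (step2 i)
 then show ?case using tr_isom[OF tr_shi shi_sft shi_sft shi_sft] tr_Ob[OF assms] by blast
qed (use assms in simp)

lemma sft_neg_cancel: "x \<in> Ob T ==> sft (- i) (sft i x) \<simeq> x" "x \<in> Ob T ==> sft i (sft (- i) x) \<simeq> x"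
 using sft_sft[of x "- i" i] sft_sft[of x i "- i"] by auto

lemma star_iff: "t \<in> star T X Y \<longleftrightarrow> (\<exists>x\<in>X. \<exists>y\<in>Y. tr x t y)"
 unfolding star_def tr_def by blast

definition replete :: "'o set => bool" where
 "replete A \<longleftrightarrow> A \<subseteq> Ob T & (\<forall>x\<in>A. \<forall>y. x \<simeq> y --> y \<in> A)"

definition ext_closed :: "'o set => bool" where
 "ext_closed A \<longleftrightarrow> (\<forall>x\<in>A. \<forall>z\<in>A. \<forall>y. tr x y z --> y \<in> A)"

lemma repleteD: "[|replete A; x \<in> A; x \<simeq> y|] ==> y \<in> A"
 unfolding replete_def by blast

lemma ext_closedD: "[|ext_closed A; x \<in> A; z \<in> A; tr x y z|] ==> y \<in> A"
 unfolding ext_closed_def by blast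

text \<open>Retracts stand in for direct summands: they compose and pass to cones
  (\<open>retr_cone\<close>) without a choice of complements.\<close>

definition retr :: "'o => 'o => bool" where
 "retr x y \<longleftrightarrow> (\<exists>i p. ar i & ar p & dm i = x & cd i = y & dm p = y & cd p = x & p ** i = idt x)"

lemma retr_Ob: "retr x y ==> x \<in> Ob T & y \<in> Ob T"
 unfolding retr_def by auto

lemma retr_hz_left: assumes "retr x y" "w \<in> Ob T" "hz y w" shows "hz x w"
proof -
 obtain i p where r: "ar i" "ar p" "dm i = x" "cd i = y" "dm p = y" "cd p = x" "p ** i = idt x"
  using assms unfolding retr_def by blast
 show ?thesis
 proof (rule hzI)
  fix f assume f: "ar f" "dm f = x" "cd f = w"
  have "f ** p = zr y w" by (rule hzD[OF assms(3)]) (use f r in auto)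
  then have "f ** p ** i = zr x w" using pull[of f p "zr y w" i] f r assms by simp
  then show "f = zr x w" using f r by simp
 qed (use r assms in auto)
qed

lemma retr_hz_right: assumes "retr x y" "w \<in> Ob T" "hz w y" shows "hz w x"
proof -
 obtain i p where r: "ar i" "ar p" "dm i = x" "cd i = y" "dm p = y" "cd p = x" "p ** i = idt x"
  using assms unfolding retr_def by blast
 show ?thesis
 proof (rule hzI)
  fix f assume f: "ar f" "dm f = w" "cd f = x"
  have "i ** f = zr w y" by (rule hzD[OF assms(3)]) (use f r in auto)
  then have "p ** i ** f = zr w x" using f r assms by simp
  then show "f = zr w x" using pull[OF r(7), of f] f r by simp
 qed (use r assms in auto)
qed

lemma isom_retr: "x \<simeq> y ==> retr x y"
 unfolding isom_def retr_def by (metis iv(1-4) iso_ar)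

lemma retr_trans: assumes "retr x y" "retr y z" shows "retr x z"
proof -
 obtain i p where r: "ar i" "ar p" "dm i = x" "cd i = y" "dm p = y" "cd p = x" "p ** i = idt x"
  using assms unfolding retr_def by blast
 obtain j q where s: "ar j" "ar q" "dm j = y" "cd j = z" "dm q = z" "cd q = y" "q ** j = idt y"
  using assms unfolding retr_def by blast
 have "(p ** q) ** (j ** i) = idt x" using r s pull[OF s(7), of i] by simp
 then show ?thesis unfolding retr_def using r s by (intro exI[of _ "j ** i"] exI[of _ "p ** q"]) simp
qed

lemma direct_sum_retr: assumes "direct_sum T [x, y] b" shows "retr x b" "retr y b"
 using assms unfolding direct_sum_two retr_def hom_iff by blast+

lemma retr_sho: assumes "retr x y" shows "retr (sho x) (sho y)"
proof -
 obtain i p where r: "ar i" "ar p" "dm i = x" "cd i = y" "dm p = y" "cd p = x" "p ** i = idt x"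
  using assms unfolding retr_def by blast
 have "sha p ** sha i = idt (sho x)" using r Sh.F_cmp[of i p] by (simp del: Sh.F_cmp) (use r in auto)
 then show ?thesis unfolding retr_def using r by (intro exI[of _ "sha i"] exI[of _ "sha p"]) simp
qed

lemma retr_shi: assumes "retr x y" shows "retr (shi x) (shi y)"
proof -
 obtain i p where r: "ar i" "ar p" "dm i = x" "cd i = y" "dm p = y" "cd p = x" "p ** i = idt x"
  using assms unfolding retr_def by blast
 have "amap (Shi T) p ** amap (Shi T) i = idt (shi x)"
  using r Shi.F_cmp[of i p] by (simp del: Shi.F_cmp) (use r in auto)
 then show ?thesis unfolding retr_def using r
  by (intro exI[of _ "amap (Shi T) i"] exI[of _ "amap (Shi T) p"]) simp
qed

text \<open>The arrow y1 -> y2 is \<open>f\<close> padded by the retraction \<open>p\<close> and the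
  inclusion \<open>j\<close>. TR3 gives arrows between the cones in both directions. Their composite
  on x3 need not be the identity, but the five lemma makes it invertible, and its inverse corrects
  the retraction.\<close>

lemma retr_cone:
 assumes "tr x1 x2 x3" "retr x1 y1" "retr x2 y2"
 shows "\<exists>y3. tr y1 y2 y3 & retr x3 y3"
proof -
 obtain f g h where d: "dist f g h" "dm f = x1" "cd f = x2" "cd g = x3" using assms(1) by (rule trE)
 note t = dist_ar[OF d(1)]
 obtain i p where r: "ar i" "ar p" "dm i = x1" "cd i = y1" "dm p = y1" "cd p = x1" "p ** i = idt x1"
  using assms unfolding retr_def by blast
 obtain j q where s: "ar j" "ar q" "dm j = x2" "cd j = y2" "dm q = y2" "cd q = x2" "q ** j = idt x2"
  using assms unfolding retr_def by blast
 let ?f = "j ** f ** p"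
 obtain g' h' where e: "dist ?f g' h'" using dist_ex[of ?f] r s d t by auto
 note t' = dist_ar[OF e]
 have "\<exists>c. ar c & dm c = cd g & cd c = cd g' & c ** g = g' ** j & sha i ** h = h' ** c"
  by (rule dist_morphism[OF d(1) e]) (use r s d t in auto)
 then obtain c where c: "ar c" "dm c = cd g" "cd c = cd g'" "c ** g = g' ** j" "sha i ** h = h' ** c" by blast
 have "\<exists>c. ar c & dm c = cd g' & cd c = cd g & c ** g' = g ** q & sha p ** h' = h ** c"
  by (rule dist_morphism[OF e d(1)]) (use r s d t pull[OF s(7), of "f ** p"] in auto)
 then obtain c' where c': "ar c'" "dm c' = cd g'" "cd c' = cd g" "c' ** g' = g ** q" "sha p ** h' = h ** c'" by blast
 have iso: "is_iso (c' ** c)"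
 proof (rule dist_morphism_iso[OF d(1) d(1), of "idt x1" "idt x2"])
  show "(c' ** c) ** g = g ** idt x2"
   using c c' t t' r s d pull[OF c'(4), of j] by simp
  have "sha p ** sha i ** h = h"
   using pull[OF Sh.F_cmp[symmetric], of i p h] r t d tr_Ob[OF assms(1)] by simp
  then have "sha p ** h' ** c = h" using c(5) by simp
  moreover have "h ** (c' ** c) = (sha p ** h') ** c"
   by (rule pull[OF c'(5)[symmetric]]) (use c(1-3) c'(1-3) t t'(1-3) d in simp_all)
  moreover have "(sha p ** h') ** c = sha p ** h' ** c"
   by (rule cmp_assoc) (use c(1-3) t' r(1-6) s(1-6) t d in simp_all)
  ultimately have "h ** (c' ** c) = h" by (simp only:)
  then show "sha (idt x1) ** h = h ** (c' ** c)" using t d tr_Ob[OF assms(1)] by simp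
 qed (use c(1-3) c'(1-3) t t'(1-3) d tr_Ob[OF assms(1)] in auto)
 have "retr x3 (cd g')" unfolding retr_def
  by (rule exI[of _ c], rule exI[of _ "iv (c' ** c) ** c'"]) (use iso c c' d in simp)
 moreover have "tr y1 y2 (cd g')" by (rule trI[OF e]) (use r s t d in auto)
 ultimately show ?thesis by blast
qed

end

section \<open>Octahedral axiom, extensions and filtrations\<close>

context triangulated_category
begin

lemma octahedron:
 assumes "dist f u u'" "dist g v v'" "dist (g ** f) w w'" "dm g = cd f"
 obtains s t where "dist s t (sha u ** v')" "ar s" "ar t" "dm s = cd u" "cd s = cd w" "dm t = cd w" "cd t = cd v"
  "s ** u = w ** g" "w' ** s = u'" "t ** w = v" "v' ** t = sha f ** w'"
proof -
 note d = dist_ar[OF assms(1)] dist_ar[OF assms(2)] dist_ar[OF assms(3)]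
 have "\<exists>s t. triangle T (cd u) (cd w) (cd v) s t (sha u ** v') &
    s ** u = w ** g & w' ** s = u' & t ** w = v & v' ** t = sha f ** w'"
  by (rule TR4[of "dm f" "cd f" _ f u u' "cd g" _ g v v']) (use assms d in "auto simp: triangle_iff")
 then obtain s t where *: "dist s t (sha u ** v')" "dm s = cd u" "cd s = cd w" "cd t = cd v"
  "s ** u = w ** g" "w' ** s = u'" "t ** w = v" "v' ** t = sha f ** w'"
  by (auto simp: triangle_iff)
 then show ?thesis using that[of s t] dist_ar[OF *(1)] by auto
qed

lemma octahedron_tr:
 assumes "dist f u u'" "dist g v v'" "dist (g ** f) w w'" "dm g = cd f"
 shows "tr (cd u) (cd w) (cd v)"
 by (rule octahedron[OF assms]) (metis trI)

text \<open>The connecting arrow vanishes, so \<open>g\<close> has a section \<open>s\<close>. The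
  octahedron for \<open>g ** s = idt z\<close> identifies the cone of \<open>s\<close> with
  \<open>x\<close>, which exchanges the outer terms.\<close>

lemma tr_split:
 assumes "tr x y z" "hz z (sho x)" shows "tr z y x"
proof -
 obtain f g h where d: "dist f g h" "dm f = x" "cd f = y" "cd g = z" using assms(1) by (rule trE)
 note t = dist_ar[OF d(1)]
 have "h ** idt z = zr z (sho x)" using hzD[OF assms(2), of h] t d by auto
 then obtain s where s: "ar s" "dm s = z" "cd s = y" "g ** s = idt z"
  by - (rule exrE[OF dist_exr(2)[OF d(1)], of "idt z"], use t d in auto)
 obtain w w' where e: "dist s w w'" using dist_ex[OF s(1)] by blast
 obtain n where n: "zero_object T n" using zero_ex by blast
 have "dist (g ** s) (zr z n) (zr n (sho z))" using dist_idt[OF _ n, of z] s t d by auto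
 from octahedron_tr[OF e dist_rot[OF d(1)] this] have "tr (cd w) n (sho x)" using s t d n zero_objectD(1) by auto
 then have "sho x \<simeq> sho (cd w)" using tr_zero2 n by blast
 then have "cd w \<simeq> x" using sho_isom_iff[of x "cd w"] isom_sym t d dist_ar[OF e] by auto
 moreover have "tr z y (cd w)" by (rule trI[OF e]) (use s in auto)
 ultimately show ?thesis using tr_isom tr_Ob isom_refl by meson
qed

text \<open>The octahedral axiom for a -> e -> t. The converse \<open>tr_assoc2\<close> is the
  octahedron for t -> d -> c, desuspended once; together they make \<open>star\<close>
  associative.\<close>

lemma tr_assoc1:
 assumes "tr a e b" "tr e t c"
 shows "\<exists>d. tr b d c & tr a t d"
proof -
 obtain f u u' where d: "dist f u u'" "dm f = a" "cd f = e" "cd u = b" using assms(1) by (rule trE)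
 obtain g v v' where k: "dist g v v'" "dm g = e" "cd g = t" "cd v = c" using assms(2) by (rule trE)
 note t = dist_ar[OF d(1)] dist_ar[OF k(1)]
 obtain w w' where l: "dist (g ** f) w w'" using dist_ex[of "g ** f"] t d k by auto
 have "tr b (cd w) c" using octahedron_tr[OF d(1) k(1) l] d k by simp
 moreover have "tr a t (cd w)" by (rule trI[OF l]) (use t d k in auto)
 ultimately show ?thesis by blast
qed

lemma tr_assoc2:
 assumes "tr a t d" "tr b d c"
 shows "\<exists>e. tr a e b & tr e t c"
proof -
 obtain x where x: "tr d c x" "x = sho b" using tr_rot assms(2) by blast
 obtain f u u' where d: "dist f u u'" "dm f = t" "cd f = d" "cd u = sho a" using tr_rot[OF assms(1)] by (rule trE)
 obtain g v v' where k: "dist g v v'" "dm g = d" "cd g = c" "cd v = sho b" using tr_rot[OF assms(2)] by (rule trE)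
 note t = dist_ar[OF d(1)] dist_ar[OF k(1)]
 obtain w w' where l: "dist (g ** f) w w'" using dist_ex[of "g ** f"] t d k by auto
 have 1: "tr (sho a) (cd w) (sho b)" using octahedron_tr[OF d(1) k(1) l] d k by simp
 have 2: "tr t c (cd w)" by (rule trI[OF l]) (use t d k in auto)
 have "cd w \<simeq> sho (shi (cd w))" using isom_sym[OF sh_shi] tr_Ob[OF 2] by blast
 then have "tr (sho a) (sho (shi (cd w))) (sho b)" using tr_isom[OF 1] tr_Ob[OF 1] by simp
 then have "tr a (shi (cd w)) b" by (rule tr_unsh) (use tr_Ob[OF assms(1)] tr_Ob[OF assms(2)] tr_Ob[OF 2] in auto)
 then show ?thesis using tr_unrot[OF 2] by blast
qed

lemma star_assoc: "star T (star T A B) C = star T A (star T B C)"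
proof (intro equalityI subsetI)
 fix t assume "t \<in> star T (star T A B) C"
 then obtain a b c e where "a \<in> A" "b \<in> B" "c \<in> C" "tr a e b" "tr e t c" by (auto simp: star_iff)
 then obtain d where "tr b d c" "tr a t d" using tr_assoc1 by blast
 then have "d \<in> star T B C" using \<open>b \<in> B\<close> \<open>c \<in> C\<close> by (auto simp: star_iff)
 then show "t \<in> star T A (star T B C)" using \<open>a \<in> A\<close> \<open>tr a t d\<close> unfolding star_iff[of t] by blast
next
 fix t assume "t \<in> star T A (star T B C)"
 then obtain a b c d where "a \<in> A" "b \<in> B" "c \<in> C" "tr a t d" "tr b d c" by (auto simp: star_iff)
 then obtain e where "tr a e b" "tr e t c" using tr_assoc2 by blast
 then have "e \<in> star T A B" using \<open>b \<in> B\<close> \<open>a \<in> A\<close> by (auto simp: star_iff)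
 then show "t \<in> star T (star T A B) C" using \<open>c \<in> C\<close> \<open>tr e t c\<close> unfolding star_iff[of t] by blast
qed

lemma star_mono: assumes "A \<subseteq> A'" "B \<subseteq> B'" shows "star T A B \<subseteq> star T A' B'"
proof
 fix t assume "t \<in> star T A B"
 then obtain a b where "a \<in> A" "b \<in> B" "tr a t b" by (auto simp: star_iff)
 then have "a \<in> A'" "b \<in> B'" using assms by auto
 with \<open>tr a t b\<close> show "t \<in> star T A' B'" unfolding star_iff by blast
qed

lemma ext_closed_iff: "ext_closed A \<longleftrightarrow> star T A A \<subseteq> A"
proof
 assume *: "ext_closed A"
 show "star T A A \<subseteq> A"
 proof
  fix t assume "t \<in> star T A A"
  then obtain a b where "a \<in> A" "b \<in> A" "tr a t b" by (auto simp: star_iff)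
  then show "t \<in> A" using ext_closedD[OF *] by blast
 qed
next
 assume *: "star T A A \<subseteq> A"
 have "y \<in> A" if "x \<in> A" "z \<in> A" "tr x y z" for x y z
 proof -
  have "y \<in> star T A A" using that unfolding star_iff by blast
  then show ?thesis using * by blast
 qed
 then show "ext_closed A" unfolding ext_closed_def by blast
qed

text \<open>The hypothesis splits every extension taken in the wrong order, so B * A lies in A * B.
  Associativity then reorders A * B * A * B to A * A * B * B.\<close>

lemma ext_closed_star:
 assumes "ext_closed A" "ext_closed B" "!!a b. [|a \<in> A; b \<in> B|] ==> hz a (sho b)"
 shows "ext_closed (star T A B)"
proof -
 have 1: "star T A A \<subseteq> A" "star T B B \<subseteq> B" using assms(1,2) unfolding ext_closed_iff .
 have 2: "star T B A \<subseteq> star T A B"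
 proof
  fix t assume "t \<in> star T B A"
  then obtain a b where ab: "a \<in> A" "b \<in> B" "tr b t a" by (auto simp: star_iff)
  then show "t \<in> star T A B" using tr_split[OF ab(3) assms(3)[OF ab(1,2)]] unfolding star_iff by blast
 qed
 have "star T (star T A B) (star T A B) = star T A (star T (star T B A) B)" by (simp add: star_assoc)
 also have "... \<subseteq> star T A (star T (star T A B) B)" by (intro star_mono order_refl 2)
 also have "... = star T (star T A A) (star T B B)" by (simp add: star_assoc)
 also have "... \<subseteq> star T A B" by (intro star_mono 1)
 finally show ?thesis unfolding ext_closed_iff .
qed

text \<open>The extension closure of \<open>A\<close>, grown by one factor at a time: Hom-vanishing,
  finiteness of the set of factors and comparison with other classes become inductions.\<close>

inductive_set filt :: "'o set => 'o set" for A :: "'o set" where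
 zero: "zero_object T z ==> z \<in> filt A"
| step: "[|a \<in> filt A; b \<in> A; tr a t b|] ==> t \<in> filt A"

lemma filt_Ob: "x \<in> filt A ==> x \<in> Ob T"
 by (induction rule: filt.induct) (auto dest: tr_Ob zero_objectD)

lemma filt_replete: "replete (filt A)"
proof -
 have "y \<in> filt A" if "x \<in> filt A" "x \<simeq> y" for x y
  using that
 proof (cases rule: filt.cases)
  case zero
  then show ?thesis using zero_object_isom that filt.zero by blast
 next
  case (step a b)
  then show ?thesis using filt.step tr_isom[OF step(3) _ that(2)] tr_Ob[OF step(3)] by auto
 qed
 then show ?thesis unfolding replete_def using filt_Ob by blast
qed

lemma filt_base: "[|a \<in> A; a \<in> Ob T|] ==> a \<in> filt A"
 using filt.zero filt.step isom_tr2[OF isom_refl, of a] zero_ex by blast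

text \<open>The induction is on the term \<open>b\<close> on the right, whose last factor is moved
  to the outside by \<open>tr_assoc2\<close>; the term \<open>a\<close> on the left is kept
  fixed.\<close>

lemma filt_ext: "ext_closed (filt A)"
proof -
 have "t \<in> filt A" if "b \<in> filt A" "a \<in> filt A" "tr a t b" for a b t
  using that
 proof (induction arbitrary: t rule: filt.induct)
  case (zero z)
  then show ?case using repleteD[OF filt_replete] tr_zero3 isom_sym by blast
 next
  case (step b' c b)
  then show ?case using tr_assoc2[of a t b b' c] filt.step by blast
 qed
 then show ?thesis unfolding ext_closed_def by blast
qed

lemma filt_subset: assumes "!!a. a \<in> A ==> a \<in> B" "ext_closed B" "!!z. zero_object T z ==> z \<in> B"
 shows "filt A \<subseteq> B"
proof
 fix x assume "x \<in> filt A" then show "x \<in> B"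
  by induction (use assms ext_closedD in blast)+
qed

lemma filt_hz_left: assumes "x \<in> filt A" "w \<in> Ob T" "!!a. a \<in> A ==> hz a w" shows "hz x w"
 using assms(1) by induction (use assms tr_hz_mid2 zero_objectD in blast)+

lemma filt_hz_right: assumes "x \<in> filt A" "w \<in> Ob T" "!!a. a \<in> A ==> hz w a" shows "hz w x"
 using assms(1) by induction (use assms tr_hz_mid zero_objectD in blast)+

lemma sft_zero: "zero_object T z ==> zero_object T (sft i z)"
 using hz_self[of "sft i z"] zero_objectD[of z] by simp

lemma filt_sft: assumes "x \<in> filt A" "!!a. a \<in> A ==> sft i a \<in> filt B" shows "sft i x \<in> filt B"
 using assms(1)
proof induction
 case (zero z)
 then show ?case using sft_zero filt.zero by blast
next
 case (step a b t)
 then show ?case using tr_sft[OF step(3), of i] assms(2)[OF step(2)] ext_closedD[OF filt_ext] by blast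
qed

end

section \<open>Morphisms with cone in a thick subcategory\<close>

locale verdier = triangulated_category K T
 for K :: "('k, 'r) ring_scheme" (structure) and T :: "('o, 'm, 'k, 'z) tricat_scheme" +
 fixes S :: "'o set"
 assumes S_thick: "thick T S"
begin

lemma S_Ob: "x \<in> S ==> x \<in> Ob T"
 and S_sho: "x \<in> S ==> sho x \<in> S" and S_shi: "x \<in> S ==> shi x \<in> S"
 using S_thick unfolding thick_def by blast+

lemma S_cone: "[|tr x y z; x \<in> S; y \<in> S|] ==> z \<in> S"
 using S_thick unfolding thick_def tr_def by blast

lemma S_zero: assumes "zero_object T z" shows "z \<in> S"
proof -
 obtain x where x: "x \<in> S" using S_thick unfolding thick_def by blast
 then show ?thesis using S_cone[OF isom_tr[OF isom_refl assms]] S_Ob by blast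
qed

lemma S_isom: assumes "x \<in> S" "x \<simeq> y" shows "y \<in> S"
proof -
 obtain z where z: "zero_object T z" using zero_ex by blast
 show ?thesis using S_cone[OF isom_tr2[OF assms(2) z] S_zero[OF z] assms(1)] .
qed

lemma S_isom_iff: "x \<simeq> y ==> x \<in> S \<longleftrightarrow> y \<in> S"
 using S_isom isom_sym by blast

lemma S_sho_iff: "x \<in> Ob T ==> sho x \<in> S \<longleftrightarrow> x \<in> S"
 using S_isom_iff[OF shi_sh] S_sho S_shi by blast

lemma S_fiber: "[|tr x y z; y \<in> S; z \<in> S|] ==> x \<in> S"
 using S_cone[OF tr_rot] S_sho_iff tr_Ob by blast

lemma S_ext: "[|tr x y z; x \<in> S; z \<in> S|] ==> y \<in> S"
 using S_fiber[OF tr_rot] S_sho by blast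

definition Sg :: "'m set" where "Sg = cone_in T S"

lemma Sg_def': "s \<in> Sg \<longleftrightarrow> (\<exists>g h. dist s g h & cd g \<in> S)"
 unfolding Sg_def cone_in_def by (auto simp: triangle_iff)

lemma Sg_ar [simp]: "s \<in> Sg ==> ar s"
 unfolding Sg_def' using dist_ar by blast

lemma Sg_iff: "dist s g h ==> s \<in> Sg \<longleftrightarrow> cd g \<in> S"
 unfolding Sg_def' using cone_unique S_isom by blast

text \<open>By the octahedron the cones of \<open>f\<close>, \<open>g ** f\<close> and
  \<open>g\<close> form a triangle, so each cancellation property of \<open>Sg\<close> is an
  instance of two-out-of-three for \<open>S\<close>.\<close>

lemma Sg_cones:
 assumes "ar f" "ar g" "dm g = cd f"
 shows "\<exists>a b c. tr a b c & (f \<in> Sg \<longleftrightarrow> a \<in> S) & (g ** f \<in> Sg \<longleftrightarrow> b \<in> S) & (g \<in> Sg \<longleftrightarrow> c \<in> S)"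
proof -
 obtain u u' where d: "dist f u u'" using dist_ex[OF assms(1)] by blast
 obtain v v' where e: "dist g v v'" using dist_ex[OF assms(2)] by blast
 obtain w w' where k: "dist (g ** f) w w'" using dist_ex[of "g ** f"] assms by auto
 show ?thesis using octahedron_tr[OF d e k assms(3)] Sg_iff[OF d] Sg_iff[OF e] Sg_iff[OF k] by blast
qed

lemma Sg_cmp [simp]: "[|f \<in> Sg; g \<in> Sg; dm g = cd f|] ==> g ** f \<in> Sg"
 using Sg_cones[of f g] S_ext Sg_ar by blast

lemma Sg_left: "[|g ** f \<in> Sg; g \<in> Sg; ar f; dm g = cd f|] ==> f \<in> Sg"
 using Sg_cones[of f g] S_fiber Sg_ar by blast

lemma Sg_right: "[|g ** f \<in> Sg; f \<in> Sg; ar g; dm g = cd f|] ==> g \<in> Sg"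
 using Sg_cones[of f g] S_cone Sg_ar by blast

lemma Sg_idt [simp]: "x \<in> Ob T ==> idt x \<in> Sg"
proof -
 assume x: "x \<in> Ob T"
 obtain z where z: "zero_object T z" using zero_ex by blast
 show ?thesis using Sg_iff[OF dist_idt[OF x z]] S_zero[OF z] x zero_objectD(1)[OF z] by simp
qed

lemma Sg_iso: "is_iso f ==> f \<in> Sg"
proof -
 assume f: "is_iso f"
 obtain z where z: "zero_object T z" using zero_ex by blast
 note z' = zero_objectD(1)[OF z]
 have "dist f (zr (cd f) z) (zr z (sho (dm f)))"
  by (rule dist_iso[OF dist_idt[OF _ z, of "dm f"], of "idt (dm f)" f "idt z"]) (use f z' in auto)
 from Sg_iff[OF this] show ?thesis using S_zero[OF z] f z' by simp
qed

text \<open>With \<open>c\<close> the arrow from \<open>cd s\<close> to the cone of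
  \<open>s\<close>, take \<open>u\<close> to be the fibre of \<open>c ** f\<close>. Its cone is
  \<open>cd c\<close>, which lies in \<open>S\<close>, and vanishing of \<open>c ** f ** u\<close>
  makes \<open>f ** u\<close> factor through \<open>s\<close>.\<close>

lemma ore:
 assumes "ar f" "s \<in> Sg" "cd s = cd f"
 obtains u g where "u \<in> Sg" "cd u = dm f" "ar g" "dm g = dm u" "cd g = dm s" "f ** u = s ** g"
proof -
 obtain c h where d: "dist s c h" "cd c \<in> S" using assms(2) unfolding Sg_def' by blast
 have t: "ar s" "ar c" "dm c = cd f" "cd s = cd f" using dist_ar[OF d(1)] assms by auto
 obtain u k where e: "dist u (c ** f) k" using dist_ex2[of "c ** f"] t assms by auto
 have u: "ar u" "cd u = dm f" using dist_ar(1,4)[OF e] t assms(1) by auto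
 have "u \<in> Sg" using Sg_iff[OF e] d t assms(1) by simp
 have "(c ** f) ** u = zr (dm u) (cd c)" using dist_zero1[OF e] t assms(1) by simp
 then have z: "c ** f ** u = zr (dm (f ** u)) (cd c)" using u t assms(1) by simp
 obtain g where "ar g" "dm g = dm (f ** u)" "cd g = dm s" "s ** g = f ** u"
 proof (rule dist_factor_right[OF d(1) _ _ z])
  show "ar (f ** u)" "cd (f ** u) = cd s" using u t assms(1) by simp_all
 qed
 then show ?thesis using that[of u g] \<open>u \<in> Sg\<close> u assms(1) by simp
qed

text \<open>\<open>f\<close> factors by some \<open>b\<close> through the fibre of \<open>s\<close>,
  an object of \<open>S\<close>; the fibre of \<open>b\<close> is the required
  \<open>u\<close>.\<close>

lemma Sg_cancel0:
 assumes "ar f" "s \<in> Sg" "dm s = cd f" "s ** f = zr (dm f) (cd s)"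
 obtains u where "u \<in> Sg" "cd u = dm f" "f ** u = zr (dm u) (cd f)"
proof -
 obtain k l where d: "dist k s l" using dist_ex2[of s] assms by auto
 have t: "ar k" "cd k = cd f" using dist_ar[OF d] assms by auto
 have "sho (dm k) \<in> S" using Sg_iff[OF dist_rot[OF d]] assms(2) dist_ar(6)[OF d] by simp
 then have k: "dm k \<in> S" using S_sho_iff t by simp
 obtain b where b: "ar b" "dm b = dm f" "cd b = dm k" "k ** b = f"
  by (rule dist_factor_right[OF d assms(1) _ assms(4)]) (use t in simp_all)
 obtain u m where e: "dist u b m" using dist_ex2[of b] b by auto
 have u: "ar u" "cd u = dm f" using dist_ar(1,4)[OF e] b by auto
 have "u \<in> Sg" using Sg_iff[OF e] b k by simp
 moreover have "f ** u = zr (dm u) (cd f)"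
 proof -
  have "b ** u = zr (dm u) (dm k)" using dist_zero1[OF e] b by simp
  then have "k ** b ** u = zr (dm u) (cd f)" using t u by simp
  then show ?thesis using pull[OF b(4), of u] b(1-3) u t by simp
 qed
 ultimately show ?thesis using that[of u] u by simp
qed

lemma Sg_cancel:
 assumes "ar f" "ar g" "dm g = dm f" "cd g = cd f" "s \<in> Sg" "dm s = cd f" "s ** f = s ** g"
 obtains u where "u \<in> Sg" "cd u = dm f" "f ** u = g ** u"
proof -
 have "s ** (f \<boxplus> ng g) = (s ** f) \<boxplus> ng (s ** g)" using assms(1-6) by (simp add: cmp_pl)
 also have "... = (s ** g) \<boxplus> ng (s ** g)" by (simp only: assms(7))
 also have "... = zr (dm f) (cd s)" using assms(1-6) by simp
 finally obtain u where u: "u \<in> Sg" "cd u = dm f" "(f \<boxplus> ng g) ** u = zr (dm u) (cd f)"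
  by - (rule Sg_cancel0[of "f \<boxplus> ng g" s], use assms(1-6) in auto)
 have "(f \<boxplus> ng g) ** u = (f ** u) \<boxplus> ng (g ** u)" using assms(1-6) u(1,2) by (simp add: pl_cmp)
 then have "(f ** u) \<boxplus> ng (g ** u) = zr (dm (f ** u)) (cd (f ** u))" using u assms(1-6) by simp
 then have "f ** u = g ** u"
  by (rule iffD1[OF diff_zr, rotated -1]) (use assms(1-6) u(1,2) in simp_all)
 then show ?thesis using that u by blast
qed

text \<open>This describes the kernel of the localization and is the way faithfulness on the
  fundamental domain is checked. A factorization through \<open>S\<close> comes from the cone of
  \<open>u\<close>; conversely \<open>u\<close> is the fibre of the first factor.\<close>

lemma Sg_kills_iff:
 assumes "ar f"
 shows "(\<exists>u\<in>Sg. cd u = dm f & f ** u = zr (dm u) (cd f)) \<longleftrightarrow>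
  (\<exists>a b. ar a & ar b & cd a = dm b & dm b \<in> S & f = b ** a)" (is "?L \<longleftrightarrow> ?R")
proof
 assume ?L
 then obtain u where u: "u \<in> Sg" "cd u = dm f" "f ** u = zr (dm u) (cd f)" by blast
 obtain g h where d: "dist u g h" "cd g \<in> S" using u(1) unfolding Sg_def' by blast
 obtain b where "ar b" "dm b = cd g" "b ** g = f"
  by (rule dist_factor_left[OF d(1), of f]) (use u assms in auto)
 then show ?R using d dist_ar[OF d(1)] by (intro exI[of _ g] exI[of _ b]) auto
next
 assume ?R
 then obtain a b where ab: "ar a" "ar b" "cd a = dm b" "dm b \<in> S" "f = b ** a" by blast
 obtain u h where d: "dist u a h" using dist_ex2[OF ab(1)] by blast
 note t = dist_ar[OF d]
 have "u \<in> Sg" using Sg_iff[OF d] ab by simp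
 moreover have "f ** u = zr (dm u) (cd f)" using dist_zero1[OF d] ab t by simp
 ultimately show ?L using t ab by auto
qed

subsection \<open>Roofs\<close>

definition roof :: "'m => 'm => bool" where
 "roof s f \<longleftrightarrow> s \<in> Sg & ar f & dm f = dm s"

definition cls :: "'m => 'm => ('m \<times> 'm) set" where
 "cls s f = roof_rel T S `` {(s, f)}"

declare roof_def [simp]

lemma roofs_iff: "[|x \<in> Ob T; y \<in> Ob T|] ==> (s, f) \<in> roofs T S x y \<longleftrightarrow> roof s f & cd s = x & cd f = y"
 unfolding roofs_def by (auto simp flip: Sg_def)

definition rel :: "'m => 'm => 'm => 'm => bool" where
 "rel s f s' f' \<longleftrightarrow> roof s f & roof s' f' & cd s = cd s' & cd f = cd f' &
  (\<exists>u u'. ar u & ar u' & dm u = dm u' & cd u = dm s & cd u' = dm s' &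
   s ** u = s' ** u' & f ** u = f' ** u' & s ** u \<in> Sg)"

text \<open>The relation asks only that the common composite \<open>s ** u\<close> be in
  \<open>Sg\<close>; cancellation puts both legs \<open>u\<close> and \<open>u'\<close>
  there.\<close>

lemma relE:
 assumes "rel s f s' f'"
 obtains u u' where "u \<in> Sg" "u' \<in> Sg" "dm u = dm u'" "cd u = dm s" "cd u' = dm s'"
   "s ** u = s' ** u'" "f ** u = f' ** u'"
proof -
 obtain u u' where *: "ar u" "ar u'" "dm u = dm u'" "cd u = dm s" "cd u' = dm s'"
   "s ** u = s' ** u'" "f ** u = f' ** u'" "s ** u \<in> Sg" using assms unfolding rel_def by blast
 have r: "roof s f" "roof s' f'" using assms unfolding rel_def by auto
 have "u \<in> Sg" by (rule Sg_left[OF *(8)]) (use * r in auto)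
 moreover have "u' \<in> Sg" by (rule Sg_left[of s']) (use * r in auto)
 ultimately show ?thesis using that * by blast
qed

lemma relI:
 assumes "roof s f" "roof s' f'" "cd s = cd s'" "cd f = cd f'" "u \<in> Sg" "ar u'" "dm u = dm u'"
  "cd u = dm s" "cd u' = dm s'" "s ** u = s' ** u'" "f ** u = f' ** u'"
 shows "rel s f s' f'"
proof -
 have "ar u" "s ** u \<in> Sg" using assms(1,5,8) by simp_all
 then show ?thesis unfolding rel_def using assms by blast
qed

lemma roof_rel_iff: "((s, f), (s', f')) \<in> roof_rel T S \<longleftrightarrow> rel s f s' f'"
proof
 assume "((s, f), (s', f')) \<in> roof_rel T S"
 then obtain x y w u u' where *: "x \<in> Ob T" "y \<in> Ob T" "(s, f) \<in> roofs T S x y" "(s', f') \<in> roofs T S x y"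
  "w \<in> Ob T" "u \<in> arr T w (dm s)" "u' \<in> arr T w (dm s')" "s ** u = s' ** u'" "f ** u = f' ** u'"
  "s ** u \<in> cone_in T S"
  unfolding roof_rel_def by blast
 have **: "roof s f" "cd s = x" "cd f = y" "roof s' f'" "cd s' = x" "cd f' = y"
  using *(1-4) roofs_iff by auto
 have u: "ar u" "dm u = w" "cd u = dm s" "ar u'" "dm u' = w" "cd u' = dm s'"
  using *(5-7) ** by simp_all
 have "s ** u \<in> Sg" "dm u = dm u'" "cd s = cd s'" "cd f = cd f'" using *(10) u ** by (simp_all add: Sg_def)
 then show "rel s f s' f'" unfolding rel_def using **(1,4) u *(8,9) by blast
next
 assume r: "rel s f s' f'"
 then obtain u u' where *: "ar u" "ar u'" "dm u = dm u'" "cd u = dm s" "cd u' = dm s'"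
   "s ** u = s' ** u'" "f ** u = f' ** u'" "s ** u \<in> Sg" unfolding rel_def by blast
 have **: "roof s f" "roof s' f'" "cd s = cd s'" "cd f = cd f'" using r unfolding rel_def by auto
 have "(s, f) \<in> roofs T S (cd s) (cd f)" "(s', f') \<in> roofs T S (cd s) (cd f)" using ** roofs_iff by simp_all
 moreover have "u \<in> arr T (dm u) (dm s)" "u' \<in> arr T (dm u) (dm s')" using * ** by simp_all
 moreover have "cd s \<in> Ob T" "cd f \<in> Ob T" "dm u \<in> Ob T" using * ** by simp_all
 moreover have "s ** u \<in> cone_in T S" using *(8) by (simp add: Sg_def)
 ultimately show "((s, f), (s', f')) \<in> roof_rel T S" unfolding roof_rel_def using *(6,7) by blast
qed

lemma rel_refl: "roof s f ==> rel s f s f"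
 by (rule relI[of _ _ _ _ "idt (dm s)" "idt (dm s)"]) auto

lemma rel_sym: assumes "rel s f s' f'" shows "rel s' f' s f"
proof -
 have r: "roof s f" "roof s' f'" "cd s = cd s'" "cd f = cd f'" using assms unfolding rel_def by auto
 obtain u u' where *: "u \<in> Sg" "u' \<in> Sg" "dm u = dm u'" "cd u = dm s" "cd u' = dm s'"
   "s ** u = s' ** u'" "f ** u = f' ** u'" using assms by (rule relE)
 show ?thesis by (rule relI[of s' f' s f u' u]) (use * r in simp_all)
qed

text \<open>The two dominating roofs refine the middle roof along \<open>u'\<close> and
  \<open>v\<close>; the Ore condition joins these refinements.\<close>

lemma rel_trans: assumes "rel s f s' f'" "rel s' f' s'' f''" shows "rel s f s'' f''"
proof -
 have r: "roof s f" "roof s' f'" "roof s'' f''" "cd s = cd s'" "cd f = cd f'" "cd s' = cd s''" "cd f' = cd f''"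
  using assms unfolding rel_def by auto
 obtain u u' where u: "u \<in> Sg" "u' \<in> Sg" "dm u = dm u'" "cd u = dm s" "cd u' = dm s'"
   "s ** u = s' ** u'" "f ** u = f' ** u'" using assms(1) by (rule relE)
 obtain v v' where v: "v \<in> Sg" "v' \<in> Sg" "dm v = dm v'" "cd v = dm s'" "cd v' = dm s''"
   "s' ** v = s'' ** v'" "f' ** v = f'' ** v'" using assms(2) by (rule relE)
 obtain a b where ab: "a \<in> Sg" "cd a = dm u'" "ar b" "dm b = dm a" "cd b = dm v" "u' ** a = v ** b"
  by (rule ore[of u' v]) (use u(1-5) v(1-5) in auto)
 have e: "k ** u ** a = k'' ** v' ** b" if "k ** u = k' ** u'" "k' ** v = k'' ** v'" "ar k" "ar k'" "ar k''"
  "dm k = dm s" "dm k' = dm s'" "dm k'' = dm s''" for k k' k''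
 proof -
  have "k ** u ** a = (k' ** u') ** a" by (rule pull[OF that(1)]) (use that u(1-5) ab in auto)
  also have "... = k' ** u' ** a" by (rule cmp_assoc) (use that u(1-5) ab in auto)
  also have "... = k' ** v ** b" by (simp only: ab)
  also have "... = (k'' ** v') ** b" by (rule pull[OF that(2)]) (use that v(1-5) ab in auto)
  also have "... = k'' ** v' ** b" by (rule cmp_assoc) (use that v(1-5) ab in auto)
  finally show ?thesis .
 qed
 show ?thesis
 proof (rule relI[of s f s'' f'' "u ** a" "v' ** b"])
  show "s ** u ** a = s'' ** v' ** b" by (rule e[OF u(6) v(6)]) (use r in simp_all)
  show "f ** u ** a = f'' ** v' ** b" by (rule e[OF u(7) v(7)]) (use r in simp_all)
 qed (use r u(1-5) v(1-5) ab(1-5) in simp_all)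
qed

lemma cls_iff: "(s', f') \<in> cls s f \<longleftrightarrow> rel s f s' f'"
 unfolding cls_def by (simp add: roof_rel_iff)

lemma cls_eq: assumes "rel s f s' f'" shows "cls s f = cls s' f'"
proof -
 have "(t, g) \<in> cls s f \<longleftrightarrow> (t, g) \<in> cls s' f'" for t g
  unfolding cls_iff using assms rel_sym rel_trans by blast
 then show ?thesis by auto
qed

lemma cls_eq_iff: assumes "roof s f" shows "cls s f = cls s' f' \<longleftrightarrow> rel s f s' f'"
proof
 assume "cls s f = cls s' f'"
 then have "(s, f) \<in> cls s' f'" using rel_refl[OF assms] cls_iff[of s f s f] by simp
 then show "rel s f s' f'" using rel_sym unfolding cls_iff by blast
qed (rule cls_eq)

lemma cls_ext:
 assumes "roof s f" "u \<in> Sg" "cd u = dm s"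
 shows "cls (s ** u) (f ** u) = cls s f" "roof (s ** u) (f ** u)"
proof -
 show r: "roof (s ** u) (f ** u)" using assms by simp
 show "cls (s ** u) (f ** u) = cls s f"
  by (rule cls_eq, rule relI[of _ _ _ _ "idt (dm u)" u]) (use assms r in simp_all)
qed

text \<open>Each operation of the quotient is the image under \<open>roof_rel\<close> of all
  admissible representatives. If one of them is related to all of them, the image is its class, so
  independence of choices is exactly the second premise.\<close>

lemma image_cls:
 assumes "(s, f) \<in> P" "!!s' f'. (s', f') \<in> P ==> rel s f s' f'"
 shows "roof_rel T S `` P = cls s f"
proof -
 have "(t, g) \<in> roof_rel T S `` P \<longleftrightarrow> (\<exists>a b. (a, b) \<in> P & rel a b t g)" for t g
  by (auto simp: Image_iff Bex_def roof_rel_iff)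
 then have "(t, g) \<in> roof_rel T S `` P \<longleftrightarrow> (t, g) \<in> cls s f" for t g
  unfolding cls_iff using assms rel_trans by blast
 then show ?thesis by auto
qed

lemma common_denominator:
 assumes "roof s f" "roof t g" "cd s = cd t"
 obtains r f' g' where "roof r f'" "roof r g'" "cd r = cd s" "cd f' = cd f" "cd g' = cd g"
  "cls s f = cls r f'" "cls t g = cls r g'"
proof -
 obtain u v where u: "u \<in> Sg" "cd u = dm s" "ar v" "dm v = dm u" "cd v = dm t" "s ** u = t ** v"
  by (rule ore[of s t]) (use assms in auto)
 have v: "v \<in> Sg" by (rule Sg_left[of t]) (use u assms Sg_cmp[of u s] in auto)
 have 1: "cls (s ** u) (f ** u) = cls s f" "roof (s ** u) (f ** u)" using cls_ext[OF assms(1) u(1,2)] .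
 have "cls (t ** v) (g ** v) = cls t g" "roof (t ** v) (g ** v)" using cls_ext[OF assms(2) v u(5)] .
 then have 2: "cls (s ** u) (g ** v) = cls t g" "roof (s ** u) (g ** v)" by (simp_all only: u(6))
 show ?thesis by (rule that[of "s ** u" "f ** u" "g ** v"]) (use 1 2 u(1-5) v assms in simp_all)
qed

abbreviation QC :: "('o, ('m \<times> 'm) set, 'k) tricat" where
 "QC \<equiv> verdier_quotient T S"

abbreviation Q_comp (infixr \<open>*q\<close> 72) where
 "B *q A \<equiv> Comp QC B A"

lemma QC_simps:
 "Ob QC = Ob T" "Comp QC = Comp (quotient_cat T S)" "Id QC = Id (quotient_cat T S)"
 "Hom QC = Hom (quotient_cat T S)"
 by (simp_all add: verdier_quotient_def quotient_cat_def Let_def)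

lemma Q_carrier: assumes "x \<in> Ob T" "y \<in> Ob T"
 shows "arr QC x y = {cls s f |s f. roof s f & cd s = x & cd f = y}"
proof -
 have "arr QC x y = roofs T S x y // roof_rel T S" by (simp add: QC_simps quotient_cat_def)
 also have "... = {cls s f |s f. (s, f) \<in> roofs T S x y}"
  unfolding quotient_def cls_def by auto
 finally show ?thesis using roofs_iff[OF assms] by simp
qed

text \<open>The legs found for \<open>f\<close> and for \<open>g\<close> must be made equal. Ore
  aligns \<open>u\<close> with \<open>v\<close>; then \<open>u'\<close> and \<open>v'\<close> agree
  only after composition with \<open>s'\<close>, and \<open>Sg_cancel\<close> supplies the further
  refinement \<open>c\<close>.\<close>

lemma rel_pl:
 assumes "rel s f s' f'" "rel s g s' g'" "cd g = cd f"
 shows "rel s (f \<boxplus> g) s' (f' \<boxplus> g')"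
proof -
 have r: "roof s f" "roof s' f'" "cd s = cd s'" "cd f = cd f'" "roof s g" "roof s' g'" "cd g = cd g'"
  using assms unfolding rel_def by auto
 obtain u u' where u: "u \<in> Sg" "u' \<in> Sg" "dm u = dm u'" "cd u = dm s" "cd u' = dm s'"
   "s ** u = s' ** u'" "f ** u = f' ** u'" using assms(1) by (rule relE)
 obtain v v' where v: "v \<in> Sg" "v' \<in> Sg" "dm v = dm v'" "cd v = dm s" "cd v' = dm s'"
   "s ** v = s' ** v'" "g ** v = g' ** v'" using assms(2) by (rule relE)
 obtain a b where ab: "a \<in> Sg" "cd a = dm u" "ar b" "dm b = dm a" "cd b = dm v" "u ** a = v ** b"
  by (rule ore[of u v]) (use u(1-5) v(1-5) in auto)
 have e: "k ** w ** d = k' ** w' ** d" if "k ** w = k' ** w'" "ar k" "ar k'" "ar w" "ar w'" "ar d"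
  "dm k = cd w" "dm k' = cd w'" "cd d = dm w" "dm w = dm w'" for k k' w w' d
  by (metis that cmp_assoc)
 have 1: "s ** u ** a = s' ** u' ** a" by (rule e[OF u(6)]) (use r u(1-5) ab(1-5) in simp_all)
 have 2: "s ** v ** b = s' ** v' ** b" by (rule e[OF v(6)]) (use r v(1-5) ab(1-5) in simp_all)
 have "s' ** u' ** a = s' ** v' ** b" using 1 2 ab(6) by simp
 then obtain c where c: "c \<in> Sg" "cd c = dm a" "(u' ** a) ** c = (v' ** b) ** c"
  by - (rule Sg_cancel[of "u' ** a" "v' ** b" s'], use r u(1-5) v(1-5) ab(1-5) in simp_all)
 let ?p = "u ** a ** c" and ?q = "u' ** a ** c"
 note ty = r u(1-5) v(1-5) ab(1-5) c(1,2)
 have p: "?p = v ** b ** c" by (rule e[OF ab(6)]) (use ty in simp_all)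
 have q: "?q = v' ** b ** c" using c(3) ty by simp
 show ?thesis
 proof (rule relI[of _ _ _ _ ?p ?q])
  show "s ** ?p = s' ** ?q" by (rule e[OF u(6)]) (use ty in simp_all)
  have 3: "f ** ?p = f' ** ?q" by (rule e[OF u(7)]) (use ty in simp_all)
  have "g ** v ** b ** c = g' ** v' ** b ** c" by (rule e[OF v(7)]) (use ty in simp_all)
  then have 4: "g ** ?p = g' ** ?q" unfolding p q .
  have "(f \<boxplus> g) ** ?p = (f ** ?p) \<boxplus> (g ** ?p)" by (rule pl_cmp) (use ty assms(3) in simp_all)
  also have "... = (f' ** ?q) \<boxplus> (g' ** ?q)" by (simp only: 3 4)
  also have "... = (f' \<boxplus> g') ** ?q" by (rule pl_cmp[symmetric]) (use ty assms(3) in simp_all)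
  finally show "(f \<boxplus> g) ** ?p = (f' \<boxplus> g') ** ?q" .
 qed (use ty assms(3) in simp_all)
qed

lemma rel_sm:
 assumes "rel s f s' f'" "a \<in> carrier K"
 shows "rel s (sm a f) s' (sm a f')"
proof -
 have r: "roof s f" "roof s' f'" "cd s = cd s'" "cd f = cd f'"
  using assms unfolding rel_def by auto
 obtain u u' where u: "u \<in> Sg" "u' \<in> Sg" "dm u = dm u'" "cd u = dm s" "cd u' = dm s'"
   "s ** u = s' ** u'" "f ** u = f' ** u'" using assms(1) by (rule relE)
 show ?thesis by (rule relI[of _ _ _ _ u u']) (use r u assms(2) in "simp_all add: sm_cmp")
qed

text \<open>The factor \<open>p\<close> is not determined by \<open>t ** p\<close> and can be
  compared only after refinement: \<open>c\<close> and \<open>c'\<close> cancel the denominators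
  \<open>t\<close> and \<open>t'\<close>, and a last Ore square makes the two refinements
  equal.\<close>

lemma rel_cmp:
 assumes "rel s (t ** p) s' (t' ** p')" "rel t g t' g'"
  "ar p" "dm p = dm s" "cd p = dm t" "ar p'" "dm p' = dm s'" "cd p' = dm t'"
 shows "rel s (g ** p) s' (g' ** p')"
proof -
 have r: "s \<in> Sg" "s' \<in> Sg" "cd s = cd s'" "roof t g" "roof t' g'" "cd t = cd t'" "cd g = cd g'"
  using assms unfolding rel_def by auto
 obtain u u' where u: "u \<in> Sg" "u' \<in> Sg" "dm u = dm u'" "cd u = dm s" "cd u' = dm s'"
   "s ** u = s' ** u'" "(t ** p) ** u = (t' ** p') ** u'" using assms(1) by (rule relE)
 obtain v v' where v: "v \<in> Sg" "v' \<in> Sg" "dm v = dm v'" "cd v = dm t" "cd v' = dm t'"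
   "t ** v = t' ** v'" "g ** v = g' ** v'" using assms(2) by (rule relE)
 obtain a b where ab: "a \<in> Sg" "cd a = dm u" "ar b" "dm b = dm a" "cd b = dm v"
  "(t ** p ** u) ** a = (t ** v) ** b"
  by (rule ore[of "t ** p ** u" "t ** v"]) (use r u(1-5) v(1-5) assms(3-) in simp_all)
 note ty = r u(1-5) v(1-5) ab(1-5) assms(3-)
 have "t ** p ** u ** a = t ** v ** b" using ab(6) ty by simp
 then obtain c where c: "c \<in> Sg" "cd c = dm a" "(p ** u ** a) ** c = (v ** b) ** c"
  by - (rule Sg_cancel[of "p ** u ** a" "v ** b" t], use ty in simp_all)
 have "t' ** p' ** u' = t ** p ** u" using u(7) ty by simp
 then have "(t' ** p' ** u') ** a = (t' ** v') ** b" using ab(6) v(6) by simp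
 then have "t' ** p' ** u' ** a = t' ** v' ** b" using ty by simp
 then obtain c' where c': "c' \<in> Sg" "cd c' = dm a" "(p' ** u' ** a) ** c' = (v' ** b) ** c'"
  by - (rule Sg_cancel[of "p' ** u' ** a" "v' ** b" t'], use ty in simp_all)
 obtain d d' where d: "d \<in> Sg" "cd d = dm c" "ar d'" "dm d' = dm d" "cd d' = dm c'" "c ** d = c' ** d'"
  by (rule ore[of c c']) (use c c' in auto)
 note ty' = ty c(1,2) c'(1,2) d(1-5)
 let ?e = "c ** d"
 have "((p ** u ** a) ** c) ** d = ((v ** b) ** c) ** d" by (simp only: c)
 then have 1: "p ** u ** a ** ?e = v ** b ** ?e" using ty' by simp
 have "((p' ** u' ** a) ** c') ** d' = ((v' ** b) ** c') ** d'" by (simp only: c')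
 then have "p' ** u' ** a ** (c' ** d') = v' ** b ** (c' ** d')" using ty' by simp
 then have 2: "p' ** u' ** a ** ?e = v' ** b ** ?e" by (simp only: d(6))
 have e: "k ** w ** d = k' ** w' ** d" if "k ** w = k' ** w'" "ar k" "ar k'" "ar w" "ar w'" "ar d"
  "dm k = cd w" "dm k' = cd w'" "cd d = dm w" "dm w = dm w'" for k k' w w' d
  by (metis that cmp_assoc)
 show ?thesis
 proof (rule relI[of _ _ _ _ "u ** a ** ?e" "u' ** a ** ?e"])
  show "s ** u ** a ** ?e = s' ** u' ** a ** ?e" by (rule e[OF u(6)]) (use ty' in simp_all)
  have "(g ** p) ** u ** a ** ?e = g ** (p ** u ** a ** ?e)" by (rule cmp_assoc) (use ty' in simp_all)
  also have "... = g ** v ** b ** ?e" by (simp only: 1)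
  also have "... = g' ** v' ** b ** ?e" by (rule e[OF v(7)]) (use ty' in simp_all)
  also have "... = g' ** (p' ** u' ** a ** ?e)" by (simp only: 2)
  also have "... = (g' ** p') ** u' ** a ** ?e" by (rule cmp_assoc[symmetric]) (use ty' in simp_all)
  finally show "(g ** p) ** u ** a ** ?e = (g' ** p') ** u' ** a ** ?e" .
 qed (use ty' in simp_all)
qed

lemma Q_add:
 assumes "roof s f" "roof s g" "cd s = x" "cd f = y" "cd g = y"
 shows "cls s f \<oplus>\<^bsub>Hom QC x y\<^esub> cls s g = cls s (f \<boxplus> g)"
proof -
 let ?P = "{(s', f' \<oplus>\<^bsub>Hom T (dm s') y\<^esub> g') |s' f' g'. (s', f') \<in> cls s f & (s', g') \<in> cls s g}"
 have "cls s f \<oplus>\<^bsub>Hom QC x y\<^esub> cls s g = roof_rel T S `` ?P"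
  by (simp add: QC_simps quotient_cat_def)
 also have "... = cls s (f \<boxplus> g)"
 proof (rule image_cls)
  show "(s, f \<boxplus> g) \<in> ?P"
   using rel_refl[OF assms(1)] rel_refl[OF assms(2)] pl_eq[of f "dm s" y g] assms by (force simp: cls_iff)
 next
  fix s' h assume "(s', h) \<in> ?P"
  then obtain f' g' where *: "h = f' \<oplus>\<^bsub>Hom T (dm s') y\<^esub> g'" "rel s f s' f'" "rel s g s' g'" by (auto simp: cls_iff)
  have "h = f' \<boxplus> g'" using *(1,2) pl_eq[of f' "dm s'" y g'] assms(4) unfolding rel_def by auto
  then show "rel s (f \<boxplus> g) s' h" using rel_pl[OF *(2,3)] assms by simp
 qed
 finally show ?thesis .
qed

lemma Q_smult:
 assumes "roof s f" "cd s = x" "cd f = y" "a \<in> carrier K"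
 shows "a \<odot>\<^bsub>Hom QC x y\<^esub> cls s f = cls s (sm a f)"
proof -
 let ?P = "{(s', a \<odot>\<^bsub>Hom T (dm s') y\<^esub> f') |s' f'. (s', f') \<in> cls s f}"
 have "a \<odot>\<^bsub>Hom QC x y\<^esub> cls s f = roof_rel T S `` ?P"
  by (simp add: QC_simps quotient_cat_def)
 also have "... = cls s (sm a f)"
 proof (rule image_cls)
  show "(s, sm a f) \<in> ?P"
   using rel_refl[OF assms(1)] sm_eq[of f "dm s" y a] assms by (force simp: cls_iff)
 next
  fix s' h assume "(s', h) \<in> ?P"
  then obtain f' where *: "h = a \<odot>\<^bsub>Hom T (dm s') y\<^esub> f'" "rel s f s' f'" by (auto simp: cls_iff)
  have "h = sm a f'" using *(1,2) sm_eq[of f' "dm s'" y a] assms(3) unfolding rel_def by auto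
  then show "rel s (sm a f) s' h" using rel_sm[OF *(2)] assms by simp
 qed
 finally show ?thesis .
qed

lemma Q_cmp:
 assumes "roof s (t ** p)" "roof t g" "ar p" "dm p = dm s" "cd p = dm t"
 shows "Comp QC (cls t g) (cls s (t ** p)) = cls s (g ** p)"
proof -
 let ?P = "{(s', g' ** p') |s' t' p' g'. p' \<in> arr T (dm s') (dm t') & (s', t' ** p') \<in> cls s (t ** p) & (t', g') \<in> cls t g}"
 have "Comp QC (cls t g) (cls s (t ** p)) = roof_rel T S `` ?P"
  by (simp add: QC_simps quotient_cat_def)
 also have "... = cls s (g ** p)"
 proof (rule image_cls)
  have "p \<in> arr T (dm s) (dm t)" using assms by simp
  then show "(s, g ** p) \<in> ?P"
   using rel_refl[OF assms(1)] rel_refl[OF assms(2)] unfolding cls_iff by blast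
 next
  fix s' h assume "(s', h) \<in> ?P"
  then obtain t' p' g' where *: "h = g' ** p'" "rel s (t ** p) s' (t' ** p')" "rel t g t' g'" "p' \<in> arr T (dm s') (dm t')"
   by (auto simp: cls_iff)
  have "dm s' \<in> Ob T" "dm t' \<in> Ob T" using *(2,3) unfolding rel_def by auto
  then have "ar p'" "dm p' = dm s'" "cd p' = dm t'" using *(4) by simp_all
  then show "rel s (g ** p) s' h" using rel_cmp[OF *(2,3)] assms *(1) by simp
 qed
 finally show ?thesis .
qed

lemma Q_Id: "Id QC x = cls (idt x) (idt x)"
 by (simp add: QC_simps quotient_cat_def cls_def)

lemma Q_zero: "\<zero>\<^bsub>Hom QC x y\<^esub> = cls (idt x) (zr x y)"
 by (simp add: QC_simps quotient_cat_def cls_def zr_def)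

lemma cls_zr: "[|s \<in> Sg; cd s = x; y \<in> Ob T|] ==> cls s (zr (dm s) y) = cls (idt x) (zr x y)"
 using cls_ext(1)[of "idt x" "zr x y" s] by auto

lemma Q_arr_cases:
 assumes "A \<in> arr QC x y" "x \<in> Ob T" "y \<in> Ob T"
 obtains s f where "roof s f" "cd s = x" "cd f = y" "A = cls s f"
 using assms Q_carrier[OF assms(2,3)] by auto

lemma Q_vectorspace:
 assumes "x \<in> Ob T" "y \<in> Ob T" shows "vectorspace K (Hom QC x y)"
proof -
 let ?V = "Hom QC x y"
 note car = Q_carrier[OF assms]
 have clsI: "cls s f \<in> carrier ?V" if "roof s f" "cd s = x" "cd f = y" for s f
  using that car by blast
 \<comment> \<open>Addition is computed over one denominator, so the group laws need pairs and
   triples of classes with a common one; for triples the pair is refined once more against the third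
   class.\<close>
 have two: thesis if AB: "A \<in> carrier ?V" "B \<in> carrier ?V"
  and th: "!!s f g. [|roof s f; roof s g; cd s = x; cd f = y; cd g = y; A = cls s f; B = cls s g|] ==> thesis"
  for A B thesis
 proof -
  obtain s f t g where *: "roof s f" "cd s = x" "cd f = y" "A = cls s f" "roof t g" "cd t = x" "cd g = y" "B = cls t g"
   using AB Q_arr_cases[OF _ assms] by metis
  show ?thesis by (rule common_denominator[of s f t g]) (use * th in auto)
 qed
 have three: thesis if ABD: "A \<in> carrier ?V" "B \<in> carrier ?V" "D \<in> carrier ?V"
  and th: "!!s f g h. [|roof s f; roof s g; roof s h; cd s = x; cd f = y; cd g = y; cd h = y;
    A = cls s f; B = cls s g; D = cls s h|] ==> thesis"
  for A B D thesis
 proof -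
  obtain s f g where *: "roof s f" "roof s g" "cd s = x" "cd f = y" "cd g = y" "A = cls s f" "B = cls s g"
   by (rule two[OF ABD(1,2)])
  obtain t h where **: "roof t h" "cd t = x" "cd h = y" "D = cls t h" using ABD(3) Q_arr_cases[OF _ assms] by metis
  obtain u v where u: "u \<in> Sg" "cd u = dm s" "ar v" "dm v = dm u" "cd v = dm t" "s ** u = t ** v"
   by (rule ore[of s t]) (use * ** in auto)
  have v: "v \<in> Sg" by (rule Sg_left[of t]) (use u * ** Sg_cmp[of u s] in auto)
  have 1: "cls (s ** u) (f ** u) = A" "roof (s ** u) (f ** u)" "cls (s ** u) (g ** u) = B" "roof (s ** u) (g ** u)"
   using cls_ext[OF *(1) u(1,2)] cls_ext[OF *(2) u(1,2)] *(6,7) by simp_all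
  have "cls (t ** v) (h ** v) = D" "roof (t ** v) (h ** v)" using cls_ext[OF **(1) v u(5)] **(4) by simp_all
  then have 2: "cls (s ** u) (h ** v) = D" "roof (s ** u) (h ** v)" by (simp_all only: u(6))
  show ?thesis by (rule th[of "s ** u" "f ** u" "g ** u" "h ** v"]) (use 1 2 * ** u(1-5) v in simp_all)
 qed
 have rI: "roof s (f \<boxplus> g)" if "roof s f" "roof s g" "cd f = cd g" for s f g
  using that by simp
 have rs: "roof s (sm a f)" if "roof s f" "a \<in> carrier K" for s f a
  using that by simp
 have "abelian_group ?V"
 proof (rule abelian_groupI)
  fix A B assume "A \<in> carrier ?V" "B \<in> carrier ?V"
  then show "A \<oplus>\<^bsub>?V\<^esub> B \<in> carrier ?V"
   by (rule two) (simp add: Q_add clsI rI)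
 next
  show "\<zero>\<^bsub>?V\<^esub> \<in> carrier ?V" unfolding Q_zero using assms by (intro clsI) simp_all
 next
  fix A B D assume "A \<in> carrier ?V" "B \<in> carrier ?V" "D \<in> carrier ?V"
  then show "A \<oplus>\<^bsub>?V\<^esub> B \<oplus>\<^bsub>?V\<^esub> D = A \<oplus>\<^bsub>?V\<^esub> (B \<oplus>\<^bsub>?V\<^esub> D)"
   by (rule three) (simp add: Q_add clsI rI pl_assoc)
 next
  fix A B assume "A \<in> carrier ?V" "B \<in> carrier ?V"
  then show "A \<oplus>\<^bsub>?V\<^esub> B = B \<oplus>\<^bsub>?V\<^esub> A"
   by (rule two) (simp add: Q_add pl_comm)
 next
  fix A assume "A \<in> carrier ?V"
  then obtain s f where *: "roof s f" "cd s = x" "cd f = y" "A = cls s f" using Q_arr_cases[OF _ assms] by metis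
  have z: "\<zero>\<^bsub>?V\<^esub> = cls s (zr (dm s) y)" "roof s (zr (dm s) y)"
   using cls_zr[of s x y] * assms by (simp_all add: Q_zero)
  show "\<zero>\<^bsub>?V\<^esub> \<oplus>\<^bsub>?V\<^esub> A = A" unfolding z using * z(2) Q_add[of s "zr (dm s) y" f x y] assms by simp
  have "cls s (ng f) \<oplus>\<^bsub>?V\<^esub> A = \<zero>\<^bsub>?V\<^esub>" unfolding z using * Q_add[of s "ng f" f x y] assms
   by simp
  moreover have "cls s (ng f) \<in> carrier ?V" by (rule clsI) (use * in simp_all)
  ultimately show "\<exists>B\<in>carrier ?V. B \<oplus>\<^bsub>?V\<^esub> A = \<zero>\<^bsub>?V\<^esub>" by blast
 qed
 moreover have "cring K" by (rule is_cring)
 moreover have sc: "a \<odot>\<^bsub>?V\<^esub> A \<in> carrier ?V" "\<one> \<odot>\<^bsub>?V\<^esub> A = A"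
  "(a \<oplus> b) \<odot>\<^bsub>?V\<^esub> A = a \<odot>\<^bsub>?V\<^esub> A \<oplus>\<^bsub>?V\<^esub> b \<odot>\<^bsub>?V\<^esub> A"
  "(a \<otimes> b) \<odot>\<^bsub>?V\<^esub> A = a \<odot>\<^bsub>?V\<^esub> (b \<odot>\<^bsub>?V\<^esub> A)"
  if ab: "a \<in> carrier K" "b \<in> carrier K" "A \<in> carrier ?V" for a b A
 proof -
  obtain s f where *: "roof s f" "cd s = x" "cd f = y" "A = cls s f" using ab(3) Q_arr_cases[OF _ assms] by metis
  interpret H: module K "Hom T (dm s) y" by (rule hom_mod) (use * assms in simp_all)
  have f: "f \<in> arr T (dm s) y" using * assms by simp
  have 1: "sm a f \<in> arr T (dm s) y" "sm b f \<in> arr T (dm s) y" using * assms ab by simp_all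
  have 2: "sm (a \<oplus> b) f = sm a f \<boxplus> sm b f" "sm (a \<otimes> b) f = sm a (sm b f)" "sm \<one> f = f"
   using H.smult_l_distr[OF ab(1,2) f] H.smult_assoc1[OF ab(1,2) f] H.smult_one[OF f] * ab
   by (simp_all add: sm_eq pl_eq)
  show "a \<odot>\<^bsub>?V\<^esub> A \<in> carrier ?V" using * ab Q_smult[of s f x y a] rs[of s f a] clsI[of s "sm a f"] by simp
  show "\<one> \<odot>\<^bsub>?V\<^esub> A = A" using * Q_smult[of s f x y \<one>] 2 by simp
  show "(a \<oplus> b) \<odot>\<^bsub>?V\<^esub> A = a \<odot>\<^bsub>?V\<^esub> A \<oplus>\<^bsub>?V\<^esub> b \<odot>\<^bsub>?V\<^esub> A"
   using * ab Q_smult[of s f x y "a \<oplus> b"] Q_smult[of s f x y a] Q_smult[of s f x y b]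
    Q_add[of s "sm a f" "sm b f" x y] rs 2 by simp
  show "(a \<otimes> b) \<odot>\<^bsub>?V\<^esub> A = a \<odot>\<^bsub>?V\<^esub> (b \<odot>\<^bsub>?V\<^esub> A)"
   using * ab Q_smult[of s f x y "a \<otimes> b"] Q_smult[of s "sm b f" x y a] Q_smult[of s f x y b] rs 2 by simp
 qed
 moreover have "a \<odot>\<^bsub>?V\<^esub> (A \<oplus>\<^bsub>?V\<^esub> B) = a \<odot>\<^bsub>?V\<^esub> A \<oplus>\<^bsub>?V\<^esub> a \<odot>\<^bsub>?V\<^esub> B"
  if a: "a \<in> carrier K" and AB: "A \<in> carrier ?V" "B \<in> carrier ?V" for a A B
 proof (rule two[OF AB])
  fix s f g assume *: "roof s f" "roof s g" "cd s = x" "cd f = y" "cd g = y" "A = cls s f" "B = cls s g"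
  interpret H: module K "Hom T (dm s) y" by (rule hom_mod) (use * assms in simp_all)
  have "sm a (f \<boxplus> g) = sm a f \<boxplus> sm a g"
   using H.smult_r_distr[OF a, of f g] * assms a by (simp add: sm_eq pl_eq)
  then show ?thesis using * a Q_add[of s f g x y] Q_smult[of s f x y a] Q_smult[of s g x y a]
   Q_smult[of s "f \<boxplus> g" x y a] Q_add[of s "sm a f" "sm a g" x y] rs rI by simp
 qed
 moreover have "\<one> \<odot>\<^bsub>?V\<^esub> A = A" if "A \<in> carrier ?V" for A
  using sc(2)[OF one_closed one_closed that] .
 ultimately have "module K ?V" by (intro moduleI)
 then show ?thesis unfolding vectorspace_def using field_axioms by blast
qed

text \<open>The Ore condition produces the representative of the first class whose numerator factors
  through \<open>t\<close>, the form on which composition is defined.\<close>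

lemma Q_compose:
 assumes "roof s f" "roof t g" "cd t = cd f"
 obtains u p where "u \<in> Sg" "cd u = dm s" "ar p" "dm p = dm u" "cd p = dm t" "f ** u = t ** p"
  "cls s f = cls (s ** u) (t ** p)" "Comp QC (cls t g) (cls s f) = cls (s ** u) (g ** p)"
proof -
 obtain u p where u: "u \<in> Sg" "cd u = dm f" "ar p" "dm p = dm u" "cd p = dm t" "f ** u = t ** p"
  by (rule ore[of f t]) (use assms in auto)
 have e: "cls s f = cls (s ** u) (t ** p)"
  using cls_ext(1)[OF assms(1) u(1)] u(2,6) assms(1) by simp
 have "Comp QC (cls t g) (cls (s ** u) (t ** p)) = cls (s ** u) (g ** p)"
  by (rule Q_cmp) (use u(1-5) assms in simp_all)
 then show ?thesis using that[of u p] u e assms(1) by simp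
qed

lemma cls_in: assumes "roof s f" "cd s = x" "cd f = y" shows "cls s f \<in> arr QC x y"
proof -
 have "x \<in> Ob T" "y \<in> Ob T" using assms by auto
 then show ?thesis unfolding Q_carrier[OF \<open>x \<in> Ob T\<close> \<open>y \<in> Ob T\<close>] using assms by blast
qed

lemma Q_lin_category: "lin_category K QC"
proof (rule lin_category.intro[OF field_axioms lin_category_axioms.intro])
 fix x y assume "x \<in> Ob QC" "y \<in> Ob QC"
 then show "vectorspace K (Hom QC x y)" using Q_vectorspace by (simp add: QC_simps)
next
 fix x y x' y' A assume *: "x \<in> Ob QC" "y \<in> Ob QC" "x' \<in> Ob QC" "y' \<in> Ob QC" "A \<in> arr QC x y" "A \<in> arr QC x' y'"
 obtain s f where 1: "roof s f" "cd s = x" "cd f = y" "A = cls s f"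
  by (rule Q_arr_cases[OF *(5)]) (use * in "auto simp: QC_simps")
 obtain s' f' where 2: "roof s' f'" "cd s' = x'" "cd f' = y'" "A = cls s' f'"
  by (rule Q_arr_cases[OF *(6)]) (use * in "auto simp: QC_simps")
 have "rel s f s' f'" by (rule iffD1[OF cls_eq_iff[OF 1(1)]]) (use 1(4) 2(4) in simp)
 then show "x = x' & y = y'" using 1(2,3) 2(2,3) unfolding rel_def by simp
next
 fix x assume "x \<in> Ob QC"
 then show "Id QC x \<in> arr QC x x" unfolding Q_Id by (intro cls_in) (auto simp: QC_simps)
next
 fix x y A assume *: "x \<in> Ob QC" "y \<in> Ob QC" "A \<in> arr QC x y"
 obtain s f where 1: "roof s f" "cd s = x" "cd f = y" "A = cls s f"
  by (rule Q_arr_cases[OF *(3)]) (use * in "auto simp: QC_simps")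
 have y: "y \<in> Ob T" "x \<in> Ob T" using * by (auto simp: QC_simps)
 have "Comp QC (cls (idt y) (idt y)) (cls s (idt y ** f)) = cls s (idt y ** f)"
  by (rule Q_cmp) (use 1 y in auto)
 then show "Id QC y *q A = A" using 1 unfolding Q_Id by simp
 obtain u p where u: "u \<in> Sg" "cd u = dm (idt x)" "ar p" "dm p = dm u" "cd p = dm s" "idt x ** u = s ** p"
  "cls (idt x) (idt x) = cls (idt x ** u) (s ** p)" "Comp QC (cls s f) (cls (idt x) (idt x)) = cls (idt x ** u) (f ** p)"
  by (rule Q_compose[of "idt x" "idt x" s f]) (use 1 y in auto)
 have sp: "s ** p = u" using u(1,2,6) y by simp
 have p: "p \<in> Sg" by (rule Sg_left[of s]) (use sp u 1 in simp_all)
 have "cls (idt x ** u) (f ** p) = cls (s ** p) (f ** p)" using u(6) by simp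
 also have "... = A" using cls_ext(1)[OF 1(1) p] u(5) 1 by simp
 finally show "A *q Id QC x = A" using u(8) 1(4) unfolding Q_Id by simp
next
 fix w x y z A B D assume *: "w \<in> Ob QC" "x \<in> Ob QC" "y \<in> Ob QC" "z \<in> Ob QC"
  "A \<in> arr QC w x" "B \<in> arr QC x y" "D \<in> arr QC y z"
 then have ob: "w \<in> Ob T" "x \<in> Ob T" "y \<in> Ob T" "z \<in> Ob T" by (auto simp: QC_simps)
 obtain s f where 1: "roof s f" "cd s = w" "cd f = x" "A = cls s f" by (rule Q_arr_cases[OF *(5) ob(1,2)])
 obtain t g where 2: "roof t g" "cd t = x" "cd g = y" "B = cls t g" by (rule Q_arr_cases[OF *(6) ob(2,3)])
 obtain r h where 3: "roof r h" "cd r = y" "cd h = z" "D = cls r h" by (rule Q_arr_cases[OF *(7) ob(3,4)])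
 obtain v q where v: "v \<in> Sg" "cd v = dm t" "ar q" "dm q = dm v" "cd q = dm r" "g ** v = r ** q"
  "cls t g = cls (t ** v) (r ** q)" "Comp QC (cls r h) (cls t g) = cls (t ** v) (h ** q)"
  by (rule Q_compose[OF 2(1) 3(1)]) (use 2 3 in auto)
 have tv: "roof (t ** v) (r ** q)" "roof (t ** v) (h ** q)" using 2 3 v(1-5) by auto
 obtain u p where u: "u \<in> Sg" "cd u = dm s" "ar p" "dm p = dm u" "cd p = dm (t ** v)" "f ** u = (t ** v) ** p"
  "cls s f = cls (s ** u) ((t ** v) ** p)" "Comp QC (cls (t ** v) (r ** q)) (cls s f) = cls (s ** u) ((r ** q) ** p)"
  by (rule Q_compose[OF 1(1) tv(1)]) (use 1 2 v(1,2) in auto)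
 have p: "cd p = dm v" using u(5) v(1,2) 2 by simp
 have "Comp QC (cls (t ** v) (h ** q)) (cls s f) = cls (s ** u) ((h ** q) ** p)"
  unfolding u(7) by (rule Q_cmp) (use 1 2 3 v(1-5) u(1-4) p in simp_all)
 moreover have "Comp QC (cls r h) (cls (s ** u) (r ** (q ** p))) = cls (s ** u) (h ** (q ** p))"
  by (rule Q_cmp) (use 1 2 3 v(1-5) u(1-4) p in simp_all)
 moreover have "(h ** q) ** p = h ** (q ** p)" "(r ** q) ** p = r ** (q ** p)"
  using 1 2 3 v(1-5) u(1-4) p by simp_all
 ultimately show "(D *q B) *q A = D *q B *q A"
  using u(8) v(7,8) 1(4) 2(4) 3(4) by simp
next
 fix x y z B assume *: "x \<in> Ob QC" "y \<in> Ob QC" "z \<in> Ob QC" "B \<in> arr QC y z"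
 then have ob: "x \<in> Ob T" "y \<in> Ob T" "z \<in> Ob T" by (auto simp: QC_simps)
 obtain t g where 2: "roof t g" "cd t = y" "cd g = z" "B = cls t g" by (rule Q_arr_cases[OF *(4) ob(2,3)])
 have clo: "B *q A \<in> arr QC x z" if A: "A \<in> arr QC x y" for A
 proof -
  obtain s f where 1: "roof s f" "cd s = x" "cd f = y" "A = cls s f" by (rule Q_arr_cases[OF A ob(1,2)])
  obtain u p where u: "u \<in> Sg" "cd u = dm s" "ar p" "dm p = dm u" "cd p = dm t" "f ** u = t ** p"
   "cls s f = cls (s ** u) (t ** p)" "Comp QC (cls t g) (cls s f) = cls (s ** u) (g ** p)"
   by (rule Q_compose[OF 1(1) 2(1)]) (use 1 2 in auto)
  show ?thesis unfolding 1(4) 2(4) u(8) by (rule cls_in) (use 1 2 u(1-5) in simp_all)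
 qed
 have add: "B *q (A1 \<oplus>\<^bsub>Hom QC x y\<^esub> A2) = B *q A1 \<oplus>\<^bsub>Hom QC x z\<^esub> B *q A2"
  if A: "A1 \<in> arr QC x y" "A2 \<in> arr QC x y" for A1 A2
 proof -
  obtain s0 f0 where 0: "roof s0 f0" "cd s0 = x" "cd f0 = y" "A1 = cls s0 f0" by (rule Q_arr_cases[OF A(1) ob(1,2)])
  obtain s1 f1 where 1: "roof s1 f1" "cd s1 = x" "cd f1 = y" "A2 = cls s1 f1" by (rule Q_arr_cases[OF A(2) ob(1,2)])
  obtain s f f' where s: "roof s f" "roof s f'" "cd s = cd s0" "cd f = cd f0" "cd f' = cd f1"
    "cls s0 f0 = cls s f" "cls s1 f1 = cls s f'"
   by (rule common_denominator[of s0 f0 s1 f1]) (use 0 1 in auto)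
  \<comment> \<open>Both numerators must factor through \<open>t\<close> over one denominator, so
    the Ore condition is applied to \<open>f\<close> and then to \<open>f' ** u\<close>.\<close>
  obtain u p where u: "u \<in> Sg" "cd u = dm f" "ar p" "dm p = dm u" "cd p = dm t" "f ** u = t ** p"
   by (rule ore[of f t]) (use s 0 2 in auto)
  obtain v q where v: "v \<in> Sg" "cd v = dm (f' ** u)" "ar q" "dm q = dm v" "cd q = dm t" "(f' ** u) ** v = t ** q"
   by (rule ore[of "f' ** u" t]) (use s u(1-2) 1 2 in auto)
  have v2: "cd v = dm u" using v(2) u(1,2) s by simp
  note ty = 0(1-3) 1(1-3) 2(1-3) s(1-5) u(1-5) v(1) v(3-5) v2
  let ?w = "u ** v"
  have w: "?w \<in> Sg" "cd ?w = dm s" using ty by simp_all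
  have f1: "f ** ?w = t ** (p ** v)" using pull[OF u(6), of v] ty by simp
  have f2: "f' ** ?w = t ** q" using v(6) ty by simp
  have A1: "A1 = cls (s ** ?w) (t ** (p ** v))" using cls_ext(1)[OF s(1) w] f1 0 s by simp
  have A2: "A2 = cls (s ** ?w) (t ** q)" using cls_ext(1)[OF s(2) w] f2 1 s by simp
  have "A1 \<oplus>\<^bsub>Hom QC x y\<^esub> A2 = cls (s ** ?w) ((t ** (p ** v)) \<boxplus> (t ** q))"
   unfolding A1 A2 by (rule Q_add) (use ty in simp_all)
  also have "(t ** (p ** v)) \<boxplus> (t ** q) = t ** ((p ** v) \<boxplus> q)" by (rule cmp_pl[symmetric]) (use ty in simp_all)
  finally have "B *q (A1 \<oplus>\<^bsub>Hom QC x y\<^esub> A2) = Comp QC (cls t g) (cls (s ** ?w) (t ** ((p ** v) \<boxplus> q)))" using 2 by simp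
  also have "... = cls (s ** ?w) (g ** ((p ** v) \<boxplus> q))" by (rule Q_cmp) (use ty in simp_all)
  also have "g ** ((p ** v) \<boxplus> q) = (g ** (p ** v)) \<boxplus> (g ** q)" by (rule cmp_pl) (use ty in simp_all)
  also have "cls (s ** ?w) ... = cls (s ** ?w) (g ** (p ** v)) \<oplus>\<^bsub>Hom QC x z\<^esub> cls (s ** ?w) (g ** q)"
   by (rule Q_add[symmetric]) (use ty in simp_all)
  also have "cls (s ** ?w) (g ** (p ** v)) = B *q A1"
   unfolding 2(4) A1 by (rule Q_cmp[symmetric]) (use ty in simp_all)
  also have "cls (s ** ?w) (g ** q) = B *q A2"
   unfolding 2(4) A2 by (rule Q_cmp[symmetric]) (use ty in simp_all)
  finally show ?thesis .
 qed
 have sm: "B *q (a \<odot>\<^bsub>Hom QC x y\<^esub> A) = a \<odot>\<^bsub>Hom QC x z\<^esub> (B *q A)"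
  if A: "A \<in> arr QC x y" and a: "a \<in> carrier K" for A a
 proof -
  obtain s f where 1: "roof s f" "cd s = x" "cd f = y" "A = cls s f" by (rule Q_arr_cases[OF A ob(1,2)])
  obtain u p where u: "u \<in> Sg" "cd u = dm s" "ar p" "dm p = dm u" "cd p = dm t" "f ** u = t ** p"
   "cls s f = cls (s ** u) (t ** p)" "Comp QC (cls t g) (cls s f) = cls (s ** u) (g ** p)"
   by (rule Q_compose[OF 1(1) 2(1)]) (use 1 2 in auto)
  note ty = 1(1-3) 2(1-3) u(1-5)
  have "a \<odot>\<^bsub>Hom QC x y\<^esub> A = cls (s ** u) (sm a (t ** p))"
   unfolding 1(4) u(7) by (rule Q_smult) (use ty a in simp_all)
  also have "sm a (t ** p) = t ** sm a p" by (rule cmp_sm[symmetric]) (use ty a in simp_all)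
  finally have "B *q (a \<odot>\<^bsub>Hom QC x y\<^esub> A) = Comp QC (cls t g) (cls (s ** u) (t ** sm a p))" using 2 by simp
  also have "... = cls (s ** u) (g ** sm a p)" by (rule Q_cmp) (use ty a in simp_all)
  also have "g ** sm a p = sm a (g ** p)" by (rule cmp_sm) (use ty a in simp_all)
  also have "cls (s ** u) ... = a \<odot>\<^bsub>Hom QC x z\<^esub> cls (s ** u) (g ** p)"
   by (rule Q_smult[symmetric]) (use ty a in simp_all)
  finally show ?thesis using u(8) 1(4) 2(4) by simp
 qed
 show "(\<lambda>f. B *q f) \<in> module_hom K (Hom QC x y) (Hom QC x z)"
  unfolding module_hom_def using clo add sm by blast
next
 fix x y z A assume *: "x \<in> Ob QC" "y \<in> Ob QC" "z \<in> Ob QC" "A \<in> arr QC x y"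
 then have ob: "x \<in> Ob T" "y \<in> Ob T" "z \<in> Ob T" by (auto simp: QC_simps)
 obtain s f where 1: "roof s f" "cd s = x" "cd f = y" "A = cls s f" by (rule Q_arr_cases[OF *(4) ob(1,2)])
 have clo: "B *q A \<in> arr QC x z" if B: "B \<in> arr QC y z" for B
 proof -
  obtain t g where 2: "roof t g" "cd t = y" "cd g = z" "B = cls t g" by (rule Q_arr_cases[OF B ob(2,3)])
  obtain u p where u: "u \<in> Sg" "cd u = dm s" "ar p" "dm p = dm u" "cd p = dm t" "f ** u = t ** p"
   "cls s f = cls (s ** u) (t ** p)" "Comp QC (cls t g) (cls s f) = cls (s ** u) (g ** p)"
   by (rule Q_compose[OF 1(1) 2(1)]) (use 1 2 in auto)
  show ?thesis unfolding 1(4) 2(4) u(8) by (rule cls_in) (use 1 2 u(1-5) in simp_all)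
 qed
 have add: "(B1 \<oplus>\<^bsub>Hom QC y z\<^esub> B2) *q A = B1 *q A \<oplus>\<^bsub>Hom QC x z\<^esub> B2 *q A"
  if B: "B1 \<in> arr QC y z" "B2 \<in> arr QC y z" for B1 B2
 proof -
  obtain s0 f0 where 0: "roof s0 f0" "cd s0 = y" "cd f0 = z" "B1 = cls s0 f0" by (rule Q_arr_cases[OF B(1) ob(2,3)])
  obtain s1 f1 where 2: "roof s1 f1" "cd s1 = y" "cd f1 = z" "B2 = cls s1 f1" by (rule Q_arr_cases[OF B(2) ob(2,3)])
  obtain t g g' where t: "roof t g" "roof t g'" "cd t = cd s0" "cd g = cd f0" "cd g' = cd f1"
    "cls s0 f0 = cls t g" "cls s1 f1 = cls t g'"
   by (rule common_denominator[of s0 f0 s1 f1]) (use 0 2 in auto)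
  obtain u p where u: "u \<in> Sg" "cd u = dm s" "ar p" "dm p = dm u" "cd p = dm t" "f ** u = t ** p"
   "cls s f = cls (s ** u) (t ** p)" "Comp QC (cls t g) (cls s f) = cls (s ** u) (g ** p)"
   by (rule Q_compose[OF 1(1) t(1)]) (use 0 1 t in auto)
  note ty = 0(1-3) 1(1-3) 2(1-3) t(1-5) u(1-5)
  have "B1 \<oplus>\<^bsub>Hom QC y z\<^esub> B2 = cls t (g \<boxplus> g')"
   unfolding 0(4) 2(4) t(6,7) by (rule Q_add) (use ty in simp_all)
  then have "(B1 \<oplus>\<^bsub>Hom QC y z\<^esub> B2) *q A = Comp QC (cls t (g \<boxplus> g')) (cls (s ** u) (t ** p))" using 1(4) u(7) by simp
  also have "... = cls (s ** u) ((g \<boxplus> g') ** p)" by (rule Q_cmp) (use ty in simp_all)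
  also have "(g \<boxplus> g') ** p = (g ** p) \<boxplus> (g' ** p)" by (rule pl_cmp) (use ty in simp_all)
  also have "cls (s ** u) ... = cls (s ** u) (g ** p) \<oplus>\<^bsub>Hom QC x z\<^esub> cls (s ** u) (g' ** p)"
   by (rule Q_add[symmetric]) (use ty in simp_all)
  also have "cls (s ** u) (g ** p) = B1 *q A" using u(8) 1(4) 0(4) t(6) by simp
  also have "cls (s ** u) (g' ** p) = B2 *q A"
   unfolding 2(4) t(7) 1(4) u(7) by (rule Q_cmp[symmetric]) (use ty in simp_all)
  finally show ?thesis .
 qed
 have sm: "(a \<odot>\<^bsub>Hom QC y z\<^esub> B) *q A = a \<odot>\<^bsub>Hom QC x z\<^esub> (B *q A)"
  if B: "B \<in> arr QC y z" and a: "a \<in> carrier K" for B a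
 proof -
  obtain t g where 2: "roof t g" "cd t = y" "cd g = z" "B = cls t g" by (rule Q_arr_cases[OF B ob(2,3)])
  obtain u p where u: "u \<in> Sg" "cd u = dm s" "ar p" "dm p = dm u" "cd p = dm t" "f ** u = t ** p"
   "cls s f = cls (s ** u) (t ** p)" "Comp QC (cls t g) (cls s f) = cls (s ** u) (g ** p)"
   by (rule Q_compose[OF 1(1) 2(1)]) (use 1 2 in auto)
  note ty = 1(1-3) 2(1-3) u(1-5)
  have "a \<odot>\<^bsub>Hom QC y z\<^esub> B = cls t (sm a g)" unfolding 2(4) by (rule Q_smult) (use ty a in simp_all)
  then have "(a \<odot>\<^bsub>Hom QC y z\<^esub> B) *q A = Comp QC (cls t (sm a g)) (cls (s ** u) (t ** p))" using 1(4) u(7) by simp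
  also have "... = cls (s ** u) (sm a g ** p)" by (rule Q_cmp) (use ty a in simp_all)
  also have "sm a g ** p = sm a (g ** p)" by (rule sm_cmp) (use ty a in simp_all)
  also have "cls (s ** u) ... = a \<odot>\<^bsub>Hom QC x z\<^esub> cls (s ** u) (g ** p)"
   by (rule Q_smult[symmetric]) (use ty a in simp_all)
  finally show ?thesis using u(8) 1(4) 2(4) by simp
 qed
 show "(\<lambda>g. g *q A) \<in> module_hom K (Hom QC y z) (Hom QC x z)"
  unfolding module_hom_def using clo add sm by blast
qed

end

sublocale verdier \<subseteq> Q: lin_category K "verdier_quotient T S"
 by (rule Q_lin_category)

context verdier
begin

notation Q.pl (infixl \<open>\<boxplus>\<^sub>q\<close> 65)
notation Q.isom (infix \<open>\<simeq>\<^sub>q\<close> 50)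

abbreviation Qm :: "'m => ('m \<times> 'm) set" where
 "Qm \<equiv> amap (quotient_functor T S)"

lemma Q_Ob [simp]: "Ob QC = Ob T"
 by (simp add: QC_simps)

lemma Qm_eq: "Qm f = cls (idt (dm f)) f"
 by (simp add: quotient_functor_def cls_def)

lemma omap_quotient [simp]: "omap (quotient_functor T S) x = x"
 by (simp add: quotient_functor_def)

lemma cls_ar [simp]:
 assumes "roof s f" shows "Q.ar (cls s f)" "Q.dm (cls s f) = cd s" "Q.cd (cls s f) = cd f"
proof -
 have "cls s f \<in> arr QC (cd s) (cd f)" by (rule cls_in[OF assms refl refl])
 moreover have "cd s \<in> Ob QC" "cd f \<in> Ob QC" using assms by simp_all
 ultimately show "Q.ar (cls s f)" "Q.dm (cls s f) = cd s" "Q.cd (cls s f) = cd f" by simp_all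
qed

lemma Q_functor: "lin_functor K T QC (quotient_functor T S)"
 unfolding lin_functor_def
proof (intro conjI ballI)
 fix x assume "x \<in> Ob T"
 then show "omap (quotient_functor T S) x \<in> Ob QC" "Qm (idt x) = Id QC (omap (quotient_functor T S) x)"
  by (simp_all add: Qm_eq Q_Id)
next
 fix x y assume xy: "x \<in> Ob T" "y \<in> Ob T"
 have 1: "Qm f \<in> arr QC x y" if "f \<in> arr T x y" for f
  unfolding Qm_eq by (rule cls_in) (use that xy in auto)
 have 2: "Qm (f \<oplus>\<^bsub>Hom T x y\<^esub> g) = Qm f \<oplus>\<^bsub>Hom QC x y\<^esub> Qm g" if "f \<in> arr T x y" "g \<in> arr T x y" for f g
  using Q_add[of "idt x" f g x y] that xy by (simp add: Qm_eq pl_eq)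
 have 3: "Qm (a \<odot>\<^bsub>Hom T x y\<^esub> f) = a \<odot>\<^bsub>Hom QC x y\<^esub> Qm f" if "f \<in> arr T x y" "a \<in> carrier K" for f a
  using Q_smult[of "idt x" f x y a] that xy by (simp add: Qm_eq sm_eq)
 show "Qm \<in> module_hom K (Hom T x y) (Hom QC (omap (quotient_functor T S) x) (omap (quotient_functor T S) y))"
  unfolding omap_quotient module_hom_def using 1 2 3 by blast
next
 fix x y z f g assume *: "x \<in> Ob T" "y \<in> Ob T" "z \<in> Ob T" "f \<in> arr T x y" "g \<in> arr T y z"
 have "Comp QC (cls (idt y) g) (cls (idt x) (idt y ** f)) = cls (idt x) (g ** f)"
  by (rule Q_cmp) (use * in auto)
 then show "Qm (g ** f) = Qm g *q Qm f" using * by (simp add: Qm_eq)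
qed

end

sublocale verdier \<subseteq> Qf: linear_functor K T "verdier_quotient T S" "quotient_functor T S"
 by unfold_locales (rule Q_functor)

context verdier
begin

lemma Qm_inverse:
 assumes "s \<in> Sg" shows "Qm s *q cls s (idt (dm s)) = Q.idt (cd s)" "cls s (idt (dm s)) *q Qm s = Q.idt (dm s)"
proof -
 have "Comp QC (cls (idt (dm s)) s) (cls s (idt (dm s) ** idt (dm s))) = cls s (s ** idt (dm s))"
  by (rule Q_cmp) (use assms in simp_all)
 moreover have "cls (idt (cd s) ** s) (idt (cd s) ** s) = cls (idt (cd s)) (idt (cd s))"
  by (rule cls_ext) (use assms in simp_all)
 ultimately show "Qm s *q cls s (idt (dm s)) = Q.idt (cd s)" using assms by (simp add: Qm_eq Q_Id)
 have "Comp QC (cls s (idt (dm s))) (cls (idt (dm s)) (s ** idt (dm s))) = cls (idt (dm s)) (idt (dm s) ** idt (dm s))"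
  by (rule Q_cmp) (use assms in simp_all)
 then show "cls s (idt (dm s)) *q Qm s = Q.idt (dm s)" using assms by (simp add: Qm_eq Q_Id)
qed

lemma Qm_iso [simp]: "s \<in> Sg ==> Q.is_iso (Qm s)"
 by (rule Q.isoI[of _ "cls s (idt (dm s))"]) (simp_all add: Qm_inverse)

lemma Qm_iv: "s \<in> Sg ==> Q.iv (Qm s) = cls s (idt (dm s))"
 by (rule Q.iv_eqI) (simp_all add: Qm_inverse)

lemma cls_Qm: assumes "roof s f" shows "cls s f = Qm f *q Q.iv (Qm s)"
proof -
 have "Comp QC (cls (idt (dm s)) f) (cls s (idt (dm s) ** idt (dm s))) = cls s (f ** idt (dm s))"
  by (rule Q_cmp) (use assms in auto)
 moreover have "s \<in> Sg" using assms by simp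
 ultimately show ?thesis unfolding Qm_iv[OF \<open>s \<in> Sg\<close>] unfolding Qm_eq using assms by simp
qed

lemma Q_arrE:
 assumes "Q.ar A"
 obtains s f where "s \<in> Sg" "ar f" "dm f = dm s" "cd s = Q.dm A" "cd f = Q.cd A" "A = cls s f"
  "A = Qm f *q Q.iv (Qm s)"
proof -
 have "A \<in> arr QC (Q.dm A) (Q.cd A)" using assms by (rule Q.arI)
 then obtain s f where "roof s f" "cd s = Q.dm A" "cd f = Q.cd A" "A = cls s f"
  by (rule Q_arr_cases) (use assms Q.ar_Ob in "simp_all flip: Q_Ob")
 then show ?thesis using that[of s f] cls_Qm[of s f] by simp
qed

lemma Qm_zero_iff:
 assumes "ar f"
 shows "Qm f = Q.zr (dm f) (cd f) \<longleftrightarrow> (\<exists>u\<in>Sg. cd u = dm f & f ** u = zr (dm u) (cd f))"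
proof
 assume "Qm f = Q.zr (dm f) (cd f)"
 then have "cls (idt (dm f)) f = cls (idt (dm f)) (zr (dm f) (cd f))"
  by (simp add: Qm_eq Q_zero flip: Q.zr_eq)
 then have "rel (idt (dm f)) f (idt (dm f)) (zr (dm f) (cd f))" using cls_eq_iff[of "idt (dm f)" f] assms by simp
 then obtain u u' where u: "u \<in> Sg" "u' \<in> Sg" "dm u = dm u'" "cd u = dm (idt (dm f))" "cd u' = dm (idt (dm f))"
   "idt (dm f) ** u = idt (dm f) ** u'" "f ** u = zr (dm f) (cd f) ** u'" by (rule relE)
 then have "f ** u = zr (dm u) (cd f)" "cd u = dm f" using assms by simp_all
 then show "\<exists>u\<in>Sg. cd u = dm f & f ** u = zr (dm u) (cd f)" using u(1) by blast
next
 assume "\<exists>u\<in>Sg. cd u = dm f & f ** u = zr (dm u) (cd f)"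
 then obtain u where u: "u \<in> Sg" "cd u = dm f" "f ** u = zr (dm u) (cd f)" by blast
 have "Qm f *q Qm u = Qm (f ** u)" using u(1,2) assms by simp
 also have "... = Q.zr (dm f) (cd f) *q Qm u" using u(1,2) assms by (simp add: u(3))
 finally show "Qm f = Q.zr (dm f) (cd f)"
  by (rule Q.iso_rcancel[rotated -1]) (use u(1,2) assms in simp_all)
qed

lemma Qm_eq_iff:
 assumes "ar f" "ar g" "dm g = dm f" "cd g = cd f"
 shows "Qm f = Qm g \<longleftrightarrow> (\<exists>u\<in>Sg. cd u = dm f & f ** u = g ** u)"
proof -
 have "Qm f = Qm g \<longleftrightarrow> Qm (f \<boxplus> ng g) = Q.zr (dm f) (cd f)"
  using assms Q.diff_zr[of "Qm f" "Qm g"] by simp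
 also have "... \<longleftrightarrow> (\<exists>u\<in>Sg. cd u = dm f & (f \<boxplus> ng g) ** u = zr (dm u) (cd f))"
  using assms Qm_zero_iff[of "f \<boxplus> ng g"] by simp
 also have "... \<longleftrightarrow> (\<exists>u\<in>Sg. cd u = dm f & f ** u = g ** u)"
 proof (rule bex_cong[OF refl], rule conj_cong[OF refl])
  fix u assume u: "u \<in> Sg" "cd u = dm f"
  have "(f \<boxplus> ng g) ** u = (f ** u) \<boxplus> ng (g ** u)" using u assms by (simp add: pl_cmp)
  then show "(f \<boxplus> ng g) ** u = zr (dm u) (cd f) \<longleftrightarrow> f ** u = g ** u"
   using u assms diff_zr[of "f ** u" "g ** u"] by simp
 qed
 finally show ?thesis .
qed

text \<open>Every arrow of the quotient is a fraction, and a square that is natural for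
  \<open>Qm s\<close> is natural for its inverse. So naturality may be checked on images of arrows
  of \<open>T\<close>.\<close>

lemma naturality_extends:
 assumes "linear_functor K QC D H" "linear_functor K QC D H'" "lin_category K D"
  and e: "!!x. x \<in> Ob T ==> lin_category.is_iso D (e x) & src D (e x) = omap H x & lin_category.cd D (e x) = omap H' x"
  and nat: "!!f. ar f ==> e (cd f) \<cdot>\<^bsub>D\<^esub> amap H (Qm f) = amap H' (Qm f) \<cdot>\<^bsub>D\<^esub> e (dm f)"
  and A: "Q.ar A"
 shows "e (Q.cd A) \<cdot>\<^bsub>D\<^esub> amap H A = amap H' A \<cdot>\<^bsub>D\<^esub> e (Q.dm A)"
proof -
 interpret H: linear_functor K QC D H by (rule assms(1))
 interpret H': linear_functor K QC D H' by (rule assms(2))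
 note [simp] = H.F_ar H.F_iso H.F_cmp H.F_iv H'.F_ar H'.F_iso H'.F_cmp H'.F_iv
 obtain s f where s: "s \<in> Sg" "ar f" "dm f = dm s" "cd s = Q.dm A" "cd f = Q.cd A" "A = Qm f *q Q.iv (Qm s)"
  by (rule Q_arrE[OF A])
 let ?c = "Comp D"
 have ob: "dm s \<in> Ob T" "cd s \<in> Ob T" "cd f \<in> Ob T" using s(1-3) by simp_all
 have e': "H.D.is_iso (e x)" "H.D.dm (e x) = omap H x" "H.D.cd (e x) = omap H' x" if "x \<in> Ob T" for x
  using e[OF that] by auto
 have n1: "?c (e (cd f)) (amap H (Qm f)) = ?c (amap H' (Qm f)) (e (dm s))" using nat[OF s(2)] s(3) by simp
 have n2: "?c (e (cd s)) (amap H (Qm s)) = ?c (amap H' (Qm s)) (e (dm s))" using nat[of s] s(1) by simp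
 have n3: "?c (e (dm s)) (H.D.iv (amap H (Qm s))) = ?c (H.D.iv (amap H' (Qm s))) (e (cd s))"
 proof -
  have "?c (amap H' (Qm s)) (?c (e (dm s)) (H.D.iv (amap H (Qm s)))) = ?c (?c (e (cd s)) (amap H (Qm s))) (H.D.iv (amap H (Qm s)))"
   by (rule H.D.pull[OF n2[symmetric]]) (use s(1-3) ob e' in simp_all)
  also have "... = ?c (amap H' (Qm s)) (?c (H.D.iv (amap H' (Qm s))) (e (cd s)))"
   using s(1-3) ob e' by simp
  finally show ?thesis by (rule H.D.iso_lcancel[rotated -1]) (use s(1-3) ob e' in simp_all)
 qed
 have "?c (e (cd f)) (amap H A) = ?c (e (cd f)) (?c (amap H (Qm f)) (H.D.iv (amap H (Qm s))))"
  unfolding s(6) using s(1-3) by simp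
 also have "... = ?c (?c (amap H' (Qm f)) (e (dm s))) (H.D.iv (amap H (Qm s)))"
  by (rule H.D.pull[OF n1]) (use s(1-3) ob e' in simp_all)
 also have "... = ?c (amap H' (Qm f)) (?c (e (dm s)) (H.D.iv (amap H (Qm s))))"
  by (rule H.D.cmp_assoc) (use s(1-3) ob e' in simp_all)
 also have "... = ?c (amap H' (Qm f)) (?c (H.D.iv (amap H' (Qm s))) (e (cd s)))" by (simp only: n3)
 also have "... = ?c (?c (amap H' (Qm f)) (H.D.iv (amap H' (Qm s)))) (e (cd s))"
  by (rule H.D.cmp_assoc[symmetric]) (use s(1-3) ob e' in simp_all)
 also have "?c (amap H' (Qm f)) (H.D.iv (amap H' (Qm s))) = amap H' A"
  unfolding s(6) using s(1-3) by simp
 finally show ?thesis using s(4,5) by simp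
qed

section \<open>Induced functors and the shift of the quotient\<close>

definition preserves_Sg :: "('o, 'm, 'o, 'm) cfun => bool" where
 "preserves_Sg F \<longleftrightarrow> lin_functor K T T F & (\<forall>s\<in>Sg. amap F s \<in> Sg)"

lemma induced_cls:
 assumes "preserves_Sg F" "roof s f"
 shows "amap (induced_functor T S F) (cls s f) = cls (amap F s) (amap F f)"
proof -
 interpret F: linear_functor K T T F by unfold_locales (use assms in "simp add: preserves_Sg_def")
 note [simp] = F.F_ar F.F_cmp F.F_ob
 have p: "s \<in> Sg ==> amap F s \<in> Sg" for s using assms by (simp add: preserves_Sg_def)
 let ?P = "{(amap F s', amap F f') |s' f'. (s', f') \<in> cls s f}"
 have "amap (induced_functor T S F) (cls s f) = roof_rel T S `` ?P" by (simp add: induced_functor_def)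
 also have "... = cls (amap F s) (amap F f)"
 proof (rule image_cls)
  show "(amap F s, amap F f) \<in> ?P" using rel_refl[OF assms(2)] by (auto simp: cls_iff)
 next
  fix s1 f1 assume "(s1, f1) \<in> ?P"
  then obtain s' f' where *: "s1 = amap F s'" "f1 = amap F f'" "rel s f s' f'" by (auto simp: cls_iff)
  have r: "roof s f" "roof s' f'" "cd s = cd s'" "cd f = cd f'" using *(3) unfolding rel_def by auto
  obtain u u' where u: "u \<in> Sg" "u' \<in> Sg" "dm u = dm u'" "cd u = dm s" "cd u' = dm s'"
   "s ** u = s' ** u'" "f ** u = f' ** u'" using *(3) by (rule relE)
  have 1: "amap F s ** amap F u = amap F s' ** amap F u'" using r u F.F_cmp[of u s] F.F_cmp[of u' s'] by simp
  have 2: "amap F f ** amap F u = amap F f' ** amap F u'" using r u F.F_cmp[of u f] F.F_cmp[of u' f'] by simp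
  show "rel (amap F s) (amap F f) s1 f1" unfolding *(1,2)
   by (rule relI[OF _ _ _ _ _ _ _ _ _ 1 2]) (use r u(1-5) p in simp_all)
 qed
 finally show ?thesis .
qed

lemma induced_ob [simp]: "omap (induced_functor T S F) x = omap F x"
 by (simp add: induced_functor_def)

lemma induced_functor: assumes "preserves_Sg F" shows "lin_functor K QC QC (induced_functor T S F)"
proof -
 interpret F: linear_functor K T T F by unfold_locales (use assms in "simp add: preserves_Sg_def")
 note [simp] = F.F_ar F.F_cmp F.F_ob F.F_idt F.F_pl F.F_sm
 have p [simp]: "s \<in> Sg ==> amap F s \<in> Sg" for s using assms by (simp add: preserves_Sg_def)
 let ?I = "induced_functor T S F"
 note i = induced_cls[OF assms]
 have rF: "roof (amap F s) (amap F f)" if "roof s f" for s f using that by simp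
 show ?thesis unfolding lin_functor_def
 proof (intro conjI ballI)
  fix x assume "x \<in> Ob QC"
  then show "omap ?I x \<in> Ob QC" "amap ?I (Id QC x) = Id QC (omap ?I x)" by (simp_all add: Q_Id i)
 next
  fix x y assume xy: "x \<in> Ob QC" "y \<in> Ob QC"
  then have ob: "x \<in> Ob T" "y \<in> Ob T" by simp_all
  have 1: "amap ?I A \<in> arr QC (omap F x) (omap F y)" if A: "A \<in> arr QC x y" for A
  proof -
   obtain s f where s: "roof s f" "cd s = x" "cd f = y" "A = cls s f" by (rule Q_arr_cases[OF A ob])
   then show ?thesis using i[OF s(1)] cls_in[of "amap F s" "amap F f"] by simp
  qed
  have 2: "amap ?I (A \<oplus>\<^bsub>Hom QC x y\<^esub> B) = amap ?I A \<oplus>\<^bsub>Hom QC (omap F x) (omap F y)\<^esub> amap ?I B"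
   if A: "A \<in> arr QC x y" and B: "B \<in> arr QC x y" for A B
  proof -
   obtain s0 f0 where 0: "roof s0 f0" "cd s0 = x" "cd f0 = y" "A = cls s0 f0" by (rule Q_arr_cases[OF A ob])
   obtain s1 f1 where 1: "roof s1 f1" "cd s1 = x" "cd f1 = y" "B = cls s1 f1" by (rule Q_arr_cases[OF B ob])
   obtain s f f' where s: "roof s f" "roof s f'" "cd s = cd s0" "cd f = cd f0" "cd f' = cd f1"
     "cls s0 f0 = cls s f" "cls s1 f1 = cls s f'"
    by (rule common_denominator[of s0 f0 s1 f1]) (use 0 1 in auto)
   have "A \<oplus>\<^bsub>Hom QC x y\<^esub> B = cls s (f \<boxplus> f')" unfolding 0(4) 1(4) s(6,7)
    by (rule Q_add) (use 0(1-3) 1(1-3) s(1-5) in simp_all)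
   then have "amap ?I (A \<oplus>\<^bsub>Hom QC x y\<^esub> B) = cls (amap F s) (amap F f \<boxplus> amap F f')"
    using i[of s "f \<boxplus> f'"] 0(1-3) 1(1-3) s(1-5) by simp
   also have "... = cls (amap F s) (amap F f) \<oplus>\<^bsub>Hom QC (omap F x) (omap F y)\<^esub> cls (amap F s) (amap F f')"
    by (rule Q_add[symmetric]) (use 0(1-3) 1(1-3) s(1-5) in simp_all)
   finally show ?thesis unfolding 0(4) 1(4) s(6,7) using i[OF s(1)] i[OF s(2)] by simp
  qed
  have 3: "amap ?I (a \<odot>\<^bsub>Hom QC x y\<^esub> A) = a \<odot>\<^bsub>Hom QC (omap F x) (omap F y)\<^esub> amap ?I A"
   if A: "A \<in> arr QC x y" and a: "a \<in> carrier K" for A a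
  proof -
   obtain s f where s: "roof s f" "cd s = x" "cd f = y" "A = cls s f" by (rule Q_arr_cases[OF A ob])
   have "a \<odot>\<^bsub>Hom QC x y\<^esub> A = cls s (sm a f)" unfolding s(4) by (rule Q_smult) (use s(1-3) a in simp_all)
   then have "amap ?I (a \<odot>\<^bsub>Hom QC x y\<^esub> A) = cls (amap F s) (sm a (amap F f))" using i[of s "sm a f"] s(1-3) a by simp
   also have "... = a \<odot>\<^bsub>Hom QC (omap F x) (omap F y)\<^esub> cls (amap F s) (amap F f)"
    by (rule Q_smult[symmetric]) (use s(1-3) a in simp_all)
   finally show ?thesis unfolding s(4) using i[OF s(1)] by simp
  qed
  show "amap ?I \<in> module_hom K (Hom QC x y) (Hom QC (omap ?I x) (omap ?I y))"
   unfolding module_hom_def induced_ob using 1 2 3 by blast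
 next
  fix x y z A B assume *: "x \<in> Ob QC" "y \<in> Ob QC" "z \<in> Ob QC" "A \<in> arr QC x y" "B \<in> arr QC y z"
  then have ob: "x \<in> Ob T" "y \<in> Ob T" "z \<in> Ob T" by simp_all
  obtain s f where 1: "roof s f" "cd s = x" "cd f = y" "A = cls s f" by (rule Q_arr_cases[OF *(4) ob(1,2)])
  obtain t g where 2: "roof t g" "cd t = y" "cd g = z" "B = cls t g" by (rule Q_arr_cases[OF *(5) ob(2,3)])
  obtain u p where u: "u \<in> Sg" "cd u = dm s" "ar p" "dm p = dm u" "cd p = dm t" "f ** u = t ** p"
   "cls s f = cls (s ** u) (t ** p)" "Comp QC (cls t g) (cls s f) = cls (s ** u) (g ** p)"
   by (rule Q_compose[OF 1(1) 2(1)]) (use 1 2 in auto)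
  note ty = 1(1-3) 2(1-3) u(1-5)
  have "amap ?I (B *q A) = cls (amap F (s ** u)) (amap F (g ** p))"
   unfolding 1(4) 2(4) u(8) by (rule i) (use ty in simp_all)
  also have "... = cls (amap F (s ** u)) (amap F g ** amap F p)" using ty by simp
  also have "... = Comp QC (cls (amap F t) (amap F g)) (cls (amap F (s ** u)) (amap F t ** amap F p))"
   by (rule Q_cmp[symmetric]) (use ty in simp_all)
  also have "cls (amap F (s ** u)) (amap F t ** amap F p) = amap ?I A"
   unfolding 1(4) u(7) using i[of "s ** u" "t ** p"] ty by simp
  finally show "amap ?I (B *q A) = amap ?I B *q amap ?I A" using i[OF 2(1)] 2(4) by simp
 qed
qed

lemma induced_Qm: "[|preserves_Sg F; ar f|] ==> amap (induced_functor T S F) (Qm f) = Qm (amap F f)"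
 using induced_cls[of F "idt (dm f)" f] linear_functor.F_idt[of K T T F "dm f"] linear_functor.F_ar[of K T T F f]
 unfolding preserves_Sg_def Qm_eq linear_functor_def two_lin_categories_def linear_functor_axioms_def
 using lin_category_axioms by simp

end

context lin_category
begin

lemma exr_ng: assumes "exr f (ng g)" "ar g" shows "exr f g"
proof -
 have f: "ar f" "dm g = cd f" using assms unfolding exr_def by auto
 have *: "ng g ** a = zr (dm a) (cd (ng g)) \<longleftrightarrow> g ** a = zr (dm a) (cd g)" if "ar a" "cd a = cd f" for a
 proof -
  have "ng g ** a = ng (g ** a)" "zr (dm a) (cd (ng g)) = ng (zr (dm a) (cd g))" using that f assms(2) by simp_all
  then show ?thesis using ng_inj[of "g ** a" "zr (dm a) (cd g)"] that f assms(2) by simp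
 qed
 have "g ** f = zr (dm f) (cd g)" using assms(1) *[of f] f unfolding exr_def by simp
 moreover have "\<exists>b. ar b & dm b = dm a & cd b = dm f & f ** b = a"
  if "ar a" "cd a = cd f" "g ** a = zr (dm a) (cd g)" for a
  using assms(1) *[of a] that unfolding exr_def by blast
 ultimately show ?thesis unfolding exr_def using f assms(2) by blast
qed

end

context pretriangulated
begin

text \<open>Three rotations put a sign on all three arrows. Negating the identity of the middle
  object cancels two of them, so one sign remains.\<close>

lemma dist_sh: assumes "dist f g h" shows "dist (sha f) (sha g) (ng (sha h))"
proof -
 note t = dist_ar[OF assms]
 have "dist (ng (sha f)) (ng (sha g)) (ng (sha h))"
  using dist_rot[OF dist_rot[OF dist_rot[OF assms]]] t by simp
 then show ?thesis
  by (rule dist_iso[of _ _ _ "idt (sho (dm f))" "ng (idt (sho (cd f)))" "idt (sho (cd g))"]) (use t in simp_all)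
qed

end

context verdier
begin

lemma Sg_conj:
 assumes "is_iso a" "is_iso b" "ar s" "ar t" "dm a = dm s" "cd a = dm t" "dm b = cd s" "cd b = cd t"
  "b ** s = t ** a"
 shows "s \<in> Sg \<longleftrightarrow> t \<in> Sg"
proof
 assume "s \<in> Sg"
 then have "t ** a \<in> Sg" using Sg_cmp[of s b] Sg_iso[OF assms(2)] assms by simp
 then show "t \<in> Sg" by (rule Sg_right) (use Sg_iso assms in simp_all)
next
 assume "t \<in> Sg"
 then have "b ** s \<in> Sg" using Sg_cmp[of a t] Sg_iso[OF assms(1)] assms by simp
 then show "s \<in> Sg" by (rule Sg_left) (use Sg_iso assms in simp_all)
qed

lemma Sg_sha_iff: assumes "ar s" shows "sha s \<in> Sg \<longleftrightarrow> s \<in> Sg"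
proof -
 obtain g h where d: "dist s g h" using dist_ex assms by blast
 show ?thesis using Sg_iff[OF d] Sg_iff[OF dist_sh[OF d]] S_sho_iff dist_ar[OF d] by simp
qed

lemma preserves_Sh: "preserves_Sg (Sh T)"
 unfolding preserves_Sg_def using Sh.F Sg_sha_iff Sg_ar by blast

lemma preserves_Shi: "preserves_Sg (Shi T)"
proof -
 obtain e where e: "nat_iso T T (Sh T \<circ>\<^sub>F Shi T) id_cfun e" using p_shift unfolding quasi_inverse_def by blast
 have e1: "is_iso (e x)" "dm (e x) = sho (shi x)" "cd (e x) = x" if "x \<in> Ob T" for x
  using e that isos_iff[of "sho (shi x)" x "e x"] unfolding nat_iso_def by simp_all
 have "amap (Shi T) s \<in> Sg" if s: "s \<in> Sg" for s
 proof -
  have "s \<in> arr T (dm s) (cd s)" "dm s \<in> Ob T" "cd s \<in> Ob T" using s by simp_all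
  then have "e (cd s) ** sha (amap (Shi T) s) = s ** e (dm s)"
   using e unfolding nat_iso_def comp_cfun_simps by blast
  then have "sha (amap (Shi T) s) \<in> Sg"
   using Sg_conj[of "e (dm s)" "e (cd s)" "sha (amap (Shi T) s)" s] e1 s by simp
  then show ?thesis using Sg_sha_iff s by simp
 qed
 then show ?thesis unfolding preserves_Sg_def using Shi.F by blast
qed

lemma QC_shift: "Sh QC = induced_functor T S (Sh T)" "Shi QC = induced_functor T S (Shi T)"
 by (simp_all add: verdier_quotient_def Let_def)

lemma QSh_functor: "lin_functor K QC QC (Sh QC)" "lin_functor K QC QC (Shi QC)"
 unfolding QC_shift using induced_functor preserves_Sh preserves_Shi by blast+

lemma QSh_ob [simp]: "omap (Sh QC) x = sho x" "omap (Shi QC) x = shi x"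
 by (simp_all add: QC_shift)

lemma QSh_Qm: "ar f ==> amap (Sh QC) (Qm f) = Qm (sha f)" "ar f ==> amap (Shi QC) (Qm f) = Qm (amap (Shi T) f)"
 unfolding QC_shift using induced_Qm preserves_Sh preserves_Shi by blast+

text \<open>The components are the images \<open>Qm (e x)\<close>, and
  \<open>naturality_extends\<close> reduces their naturality to the one known in \<open>T\<close>.
  This is how unit and counit of the shift descend.\<close>

lemma nat_iso_induced:
 assumes H: "lin_functor K QC QC H" "lin_functor K QC QC H'"
  and n: "nat_iso T T F F' e"
  and F: "!!x. x \<in> Ob T ==> omap H x = omap F x & omap F x \<in> Ob T & omap H' x = omap F' x & omap F' x \<in> Ob T"
   "!!f. ar f ==> amap H (Qm f) = Qm (amap F f) & amap H' (Qm f) = Qm (amap F' f)"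
   "!!f. ar f ==> ar (amap F f) & dm (amap F f) = omap F (dm f) & cd (amap F f) = omap F (cd f) &
     ar (amap F' f) & dm (amap F' f) = omap F' (dm f) & cd (amap F' f) = omap F' (cd f)"
 shows "nat_iso QC QC H H' (\<lambda>x. Qm (e x))"
proof -
 have l: "linear_functor K QC QC H" "linear_functor K QC QC H'" using H by unfold_locales
 have e1: "is_iso (e x)" "dm (e x) = omap F x" "cd (e x) = omap F' x" if "x \<in> Ob T" for x
  using n that F(1)[OF that] isos_iff[of "omap F x" "omap F' x" "e x"] unfolding nat_iso_def by simp_all
 have e2: "e (cd f) ** amap F f = amap F' f ** e (dm f)" if "ar f" for f
  using n arI[OF that] ar_Ob[OF that] unfolding nat_iso_def by blast
 have "Qm (e (Q.cd A)) *q amap H A = amap H' A *q Qm (e (Q.dm A))" if A: "Q.ar A" for A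
 proof (rule naturality_extends[OF l Q.lin_category_axioms _ _ A])
  fix f assume f: "ar f"
  have "Qm (e (cd f)) *q Qm (amap F f) = Qm (e (cd f) ** amap F f)"
   by (rule Qf.F_cmp[symmetric]) (use f F(3)[OF f] e1 in simp_all)
  also have "... = Qm (amap F' f) *q Qm (e (dm f))" unfolding e2[OF f]
   by (rule Qf.F_cmp) (use f F(3)[OF f] e1 in simp_all)
  finally show "Qm (e (cd f)) *q amap H (Qm f) = amap H' (Qm f) *q Qm (e (dm f))" using F(2)[OF f] by simp
 qed (use e1 F(1) in simp_all)
 moreover have "Qm (e x) \<in> isos QC (omap H x) (omap H' x)" if "x \<in> Ob QC" for x
  using Q.isos_iff[of "omap H x" "omap H' x" "Qm (e x)"] that e1 F(1) by simp
 ultimately show ?thesis unfolding nat_iso_def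
  using Q.hom_iff unfolding Q.hom_def by (metis (no_types, lifting) mem_Collect_eq)
qed

lemma id_cfun_functor: "lin_functor K QC QC id_cfun"
 using lin_functor_id Q.lin_category_axioms .

lemma Q_shift: "quasi_inverse K QC QC (Sh QC) (Shi QC)"
proof -
 obtain a where a: "nat_iso T T (Shi T \<circ>\<^sub>F Sh T) id_cfun a" using p_shift unfolding quasi_inverse_def by blast
 obtain b where b: "nat_iso T T (Sh T \<circ>\<^sub>F Shi T) id_cfun b" using p_shift unfolding quasi_inverse_def by blast
 have "nat_iso QC QC (Shi QC \<circ>\<^sub>F Sh QC) id_cfun (\<lambda>x. Qm (a x))"
  by (rule nat_iso_induced[OF lin_functor_comp[OF QSh_functor] id_cfun_functor a]) (simp_all add: QSh_Qm)
 moreover have "nat_iso QC QC (Sh QC \<circ>\<^sub>F Shi QC) id_cfun (\<lambda>x. Qm (b x))"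
  by (rule nat_iso_induced[OF lin_functor_comp[OF QSh_functor(2,1)] id_cfun_functor b]) (simp_all add: QSh_Qm)
 ultimately show ?thesis unfolding quasi_inverse_def using QSh_functor by blast
qed

lemma Q_additive: "additive_cat QC"
 unfolding additive_cat_def
proof (intro allI impI)
 fix xs assume "set xs \<subseteq> Ob QC"
 then obtain b where "direct_sum T xs b" using p_additive unfolding additive_cat_def by auto
 from Qf.F_direct_sum[OF this] show "\<exists>b. direct_sum QC xs b" by (auto simp: map_idI)
qed

end

sublocale verdier \<subseteq> QSh: linear_functor K "verdier_quotient T S" "verdier_quotient T S" "Sh (verdier_quotient T S)"
 by unfold_locales (rule QSh_functor)

context verdier
begin

subsection \<open>Triangles of the quotient\<close>

abbreviation qsha where "qsha \<equiv> amap (Sh QC)"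

text \<open>If a fraction with numerator \<open>a\<close> is killed by \<open>Qm g\<close>, then
  \<open>g ** a\<close> is killed by some \<open>u\<close> in \<open>Sg\<close>. The factorization
  of \<open>a ** u\<close> through \<open>f\<close> in \<open>T\<close> then yields one of the
  fraction.\<close>

lemma Q_exr: assumes "dist f g h" shows "Q.exr (Qm f) (Qm g)"
proof -
 note t = dist_ar[OF assms]
 have "Qm g *q Qm f = Q.zr (dm f) (cd g)"
  using dist_zero1[OF assms] t by (simp flip: Qf.F_cmp)
 moreover have "\<exists>B. Q.ar B & Q.dm B = Q.dm A & Q.cd B = dm f & Qm f *q B = A"
  if A: "Q.ar A" "Q.cd A = cd f" "Qm g *q A = Q.zr (Q.dm A) (cd g)" for A
 proof -
  obtain s a where s: "s \<in> Sg" "ar a" "dm a = dm s" "cd s = Q.dm A" "cd a = Q.cd A" "A = Qm a *q Q.iv (Qm s)"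
   by (rule Q_arrE[OF A(1)])
  have ca: "cd a = cd f" using s(5) A(2) by simp
  have "(Qm g *q Qm a) *q Q.iv (Qm s) = Qm g *q A"
   unfolding s(6) by (rule Q.cmp_assoc) (use s(1-3) ca t in simp_all)
  also have "... = Q.zr (cd s) (cd g)" unfolding A(3) s(4) ..
  also have "... = Q.zr (dm s) (cd g) *q Q.iv (Qm s)" using s(1-3) t by simp
  finally have "Qm g *q Qm a = Q.zr (dm s) (cd g)"
   by (rule Q.iso_rcancel[rotated -1]) (use s(1-3) ca t in simp_all)
  then have "Qm (g ** a) = Q.zr (dm (g ** a)) (cd (g ** a))" using s(1-3) ca t by simp
  then obtain u where u: "u \<in> Sg" "cd u = dm (g ** a)" "(g ** a) ** u = zr (dm u) (cd (g ** a))"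
   using Qm_zero_iff[of "g ** a"] s(1-3) ca t by auto
  have cu: "cd u = dm s" using u(2) s(1-3) ca t by simp
  have z: "g ** (a ** u) = zr (dm (a ** u)) (cd g)" using u(3) u(1) cu s(1-3) ca t by simp
  obtain b where b: "ar b" "dm b = dm (a ** u)" "cd b = dm f" "f ** b = a ** u"
   by (rule dist_factor_right[OF assms _ _ z]) (use u(1) cu s(1-3) ca t in simp_all)
  have db: "dm b = dm u" using b(2) u(1) cu s(1-3) by simp
  let ?B = "Qm b *q Q.iv (Qm u) *q Q.iv (Qm s)"
  have "Qm f *q ?B = Qm (f ** b) *q Q.iv (Qm u) *q Q.iv (Qm s)"
   using b(1,3) db u(1) cu s(1-3) t by simp
  also have "... = A" unfolding b(4) s(6) using u(1) cu s(1-3) by simp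
  finally have "Qm f *q ?B = A" .
  moreover have "Q.ar ?B" "Q.dm ?B = Q.dm A" "Q.cd ?B = dm f" using b(1,3) db u(1) cu s(1-4) by simp_all
  ultimately show ?thesis by blast
 qed
 ultimately show ?thesis unfolding Q.exr_def using t by simp
qed

lemma Q_exr3:
 assumes "dist f g h"
 shows "Q.exr (Qm f) (Qm g)" "Q.exr (Qm g) (Qm h)" "Q.exr (Qm h) (Qm (sha f))"
proof -
 show "Q.exr (Qm f) (Qm g)" "Q.exr (Qm g) (Qm h)" using Q_exr assms dist_rot by blast+
 show "Q.exr (Qm h) (Qm (sha f))"
 proof (rule Q.exr_ng)
  show "Q.exr (Qm h) (Q.ng (Qm (sha f)))"
   using Q_exr[OF dist_rot[OF dist_rot[OF assms]]] Qf.F_ng[of "sha f"] dist_ar[OF assms] by simp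
 qed (use dist_ar[OF assms] in simp)
qed

text \<open>Only the exactness of \<open>Hom(w, -)\<close> is used, so that this does not presuppose the
 triangulated structure of the quotient.\<close>

lemma Q_morphism_iso:
 assumes "dist f g h" "dist f' g' h'" "Q.is_iso a" "Q.is_iso b" "Q.ar c"
  "Q.dm a = dm f" "Q.cd a = dm f'" "Q.dm b = cd f" "Q.cd b = cd f'" "Q.dm c = cd g" "Q.cd c = cd g'"
  "b *q Qm f = Qm f' *q a" "c *q Qm g = Qm g' *q b" "qsha a *q Qm h = Qm h' *q c"
 shows "Q.is_iso c"
proof -
 note t = dist_ar[OF assms(1)] dist_ar[OF assms(2)]
 have "qsha b *q Qm (sha f) = qsha (b *q Qm f)" using t assms(3-11) by (simp add: QSh_Qm)
 also have "... = Qm (sha f') *q qsha a" unfolding assms(12) using t assms(3-11) by (simp add: QSh_Qm)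
 finally have s: "qsha b *q Qm (sha f) = Qm (sha f') *q qsha a" .
 show ?thesis
  by (rule Q.five_lemma[OF Q_exr3[OF assms(1)] Q_exr3[OF assms(2)] assms(3,4) _ _ assms(5) _ _ _ _ _ _ _ _ _ _
     assms(12,13,14) s])
   (use t assms(3-11) in simp_all)
qed

lemma Q_arr_over:
 assumes "Q.ar B" "ar f" "Q.dm B = cd f"
 obtains s r f1 b where "s \<in> Sg" "r \<in> Sg" "ar f1" "ar b" "cd s = dm f" "cd r = cd f" "dm f1 = dm s" "cd f1 = dm r"
  "dm b = dm r" "cd b = Q.cd B" "r ** f1 = f ** s" "B = Qm b *q Q.iv (Qm r)"
proof -
 obtain r b where r: "r \<in> Sg" "ar b" "dm b = dm r" "cd r = Q.dm B" "cd b = Q.cd B" "B = Qm b *q Q.iv (Qm r)"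
  by (rule Q_arrE[OF assms(1)])
 obtain s f1 where s: "s \<in> Sg" "cd s = dm f" "ar f1" "dm f1 = dm s" "cd f1 = dm r" "f ** s = r ** f1"
  by (rule ore[of f r]) (use r assms in auto)
 show ?thesis by (rule that[of s r f1 b]) (use r s assms in simp_all)
qed

text \<open>A square of the quotient is represented by two squares over one arrow \<open>k\<close>
  that commute in \<open>T\<close>. The one over \<open>f\<close> comes from Ore; the one over
  \<open>f'\<close> commutes at first only in the quotient and is repaired by refining along
  \<open>v\<close>.\<close>

lemma Q_square:
 assumes A: "Q.ar A" "Q.ar B" "ar f" "ar f'" "Q.dm A = dm f" "Q.cd A = dm f'"
  "Q.dm B = cd f" "Q.cd B = cd f'" "B *q Qm f = Qm f' *q A"
 obtains s r k a b where "s \<in> Sg" "r \<in> Sg" "ar k" "ar a" "ar b" "cd s = dm f" "cd r = cd f" "dm k = dm s" "cd k = dm r"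
  "dm a = dm s" "cd a = dm f'" "dm b = dm r" "cd b = cd f'" "r ** k = f ** s" "b ** k = f' ** a"
  "A = Qm a *q Q.iv (Qm s)" "B = Qm b *q Q.iv (Qm r)"
proof -
 obtain s r f1 b where s: "s \<in> Sg" "r \<in> Sg" "ar f1" "ar b" "cd s = dm f" "cd r = cd f" "dm f1 = dm s" "cd f1 = dm r"
  "dm b = dm r" "cd b = cd f'" "r ** f1 = f ** s" "B = Qm b *q Q.iv (Qm r)"
  by (rule Q_arr_over[of B f]) (use A(1-8) in auto)
 have As: "Q.ar (A *q Qm s)" "Q.dm (A *q Qm s) = dm s" "Q.cd (A *q Qm s) = dm f'" using A(1-8) s(1-10) by simp_all
 obtain u a where u: "u \<in> Sg" "ar a" "dm a = dm u" "cd u = Q.dm (A *q Qm s)" "cd a = Q.cd (A *q Qm s)"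
  "A *q Qm s = Qm a *q Q.iv (Qm u)"
  by (rule Q_arrE[OF As(1)])
 have u': "cd u = dm s" "cd a = dm f'" using u(4,5) As by simp_all
 note ty = A(1-8) s(1-10) u(1-3) u'
 have Asu: "A *q Qm s *q Qm u = Qm a"
 proof -
  have "A *q Qm s *q Qm u = (A *q Qm s) *q Qm u" using ty by simp
  also have "... = Qm a" unfolding u(6) using ty by simp
  finally show ?thesis .
 qed
 have "Qm (f' ** a) = Qm f' *q Qm a" using ty by simp
 also have "... = (Qm f' *q A) *q Qm s *q Qm u" unfolding Asu[symmetric] by (rule Q.cmp_assoc[symmetric]) (use ty in simp_all)
 also have "... = B *q Qm f *q Qm s *q Qm u" unfolding A(9)[symmetric] by (rule Q.cmp_assoc) (use ty in simp_all)
 also have "Qm f *q Qm s *q Qm u = Qm ((f ** s) ** u)" using ty by simp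
 also have "... = Qm r *q Qm f1 *q Qm u" unfolding s(11)[symmetric] using ty by simp
 also have "B *q Qm r *q Qm f1 *q Qm u = Qm (b ** f1 ** u)" unfolding s(12) using ty by simp
 finally have "Qm (f' ** a) = Qm (b ** f1 ** u)" .
 then have "\<exists>v\<in>Sg. cd v = dm (f' ** a) & (f' ** a) ** v = (b ** f1 ** u) ** v"
  by (rule iffD1[OF Qm_eq_iff, rotated -1]) (use ty in simp_all)
 then obtain v where v: "v \<in> Sg" "cd v = dm (f' ** a)" "(f' ** a) ** v = (b ** f1 ** u) ** v" by blast
 have v': "cd v = dm u" using v(2) ty by simp
 let ?s = "s ** u ** v" and ?f = "f1 ** u ** v" and ?a = "a ** v"
 have S: "?s \<in> Sg" "ar ?f" "dm ?s = dm v" "dm ?f = dm v" "cd ?f = dm r" "cd ?s = dm f"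
  "ar ?a" "dm ?a = dm v" "cd ?a = dm f'" using ty v(1) v' by simp_all
 have e1: "r ** ?f = f ** ?s" using pull[OF s(11), of "u ** v"] ty v(1) v' by simp
 have e2: "b ** ?f = f' ** ?a" using v(3) ty v(1) v' by simp
 have AQs: "A *q Qm ?s = Qm ?a"
 proof -
  have "A *q Qm ?s = (A *q Qm s *q Qm u) *q Qm v" using ty v(1) v' by simp
  also have "... = Qm ?a" unfolding Asu using ty v(1) v' by simp
  finally show ?thesis .
 qed
 have AQ: "A = Qm ?a *q Q.iv (Qm ?s)"
 proof -
  have "Qm ?a *q Q.iv (Qm ?s) = A *q Qm ?s *q Q.iv (Qm ?s)"
   unfolding AQs[symmetric] by (rule Q.cmp_assoc) (use ty S in "simp_all del: Qf.F_cmp")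
  also have "... = A" using ty S by (simp del: Qf.F_cmp)
  finally show ?thesis by simp
 qed
 show ?thesis by (rule that[OF S(1) s(2) S(2,7) s(4) S(6) s(6) _ S(5) _ S(9) s(9,10) e1 e2 AQ s(12)]) (use S in simp_all)
qed

text \<open>Both squares over \<open>k\<close> are completed in \<open>T\<close> on the cone of
  \<open>k\<close>: \<open>e\<close> leads to the cone of \<open>f\<close> and becomes invertible,
  \<open>c\<close> leads to the cone of \<open>f'\<close>. The wanted arrow is the fraction with
  numerator \<open>c\<close> and denominator \<open>e\<close>.\<close>

lemma Q_TR3:
 assumes d: "dist f g h" "dist f' g' h'" and A: "Q.ar A" "Q.ar B" "Q.dm A = dm f" "Q.cd A = dm f'"
  "Q.dm B = cd f" "Q.cd B = cd f'" "B *q Qm f = Qm f' *q A"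
 shows "\<exists>D. Q.ar D & Q.dm D = cd g & Q.cd D = cd g' & D *q Qm g = Qm g' *q B & qsha A *q Qm h = Qm h' *q D"
proof -
 note t = dist_ar[OF d(1)] dist_ar[OF d(2)]
 obtain s r k a b where S: "s \<in> Sg" "r \<in> Sg" "ar k" "ar a" "ar b" "cd s = dm f" "cd r = cd f" "dm k = dm s" "cd k = dm r"
  "dm a = dm s" "cd a = dm f'" "dm b = dm r" "cd b = cd f'" and e1: "r ** k = f ** s" and e2: "b ** k = f' ** a"
  and AQ: "A = Qm a *q Q.iv (Qm s)" and BQ: "B = Qm b *q Q.iv (Qm r)"
  by (rule Q_square[OF A(1,2) t(1,7) A(3-7)])
 obtain g1 h1 where d1: "dist k g1 h1" using dist_ex[OF S(3)] by blast
 have t1: "ar g1" "ar h1" "dm g1 = dm r" "dm h1 = cd g1" "cd h1 = sho (dm s)" using dist_ar(2-6)[OF d1] S by simp_all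
 obtain e where e: "ar e" "dm e = cd g1" "cd e = cd g" "e ** g1 = g ** r" "sha s ** h1 = h ** e"
  using dist_morphism[OF d1 d(1) _ _ _ _ _ _ e1] S t by auto
 obtain c where c: "ar c" "dm c = cd g1" "cd c = cd g'" "c ** g1 = g' ** b" "sha a ** h1 = h' ** c"
  using dist_morphism[OF d1 d(2) _ _ _ _ _ _ e2] S t by auto
 note ty' = t S t1 e(1-3) c(1-3)
 have qe1: "Qm e *q Qm g1 = Qm g *q Qm r" using e(4) ty' by (simp flip: Qf.F_cmp)
 have qe2: "Qm (sha s) *q Qm h1 = Qm h *q Qm e" using e(5) ty' by (simp flip: Qf.F_cmp)
 have qc1: "Qm c *q Qm g1 = Qm g' *q Qm b" using c(4) ty' by (simp flip: Qf.F_cmp)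
 have qc2: "Qm (sha a) *q Qm h1 = Qm h' *q Qm c" using c(5) ty' by (simp flip: Qf.F_cmp)
 \<comment> \<open>\<open>s\<close> and \<open>r\<close> are inverted by the quotient functor, so
   the five lemma in the quotient applies to the morphism of triangles that contains
   \<open>e\<close>.\<close>
 have isoe: "Q.is_iso (Qm e)"
 proof (rule Q_morphism_iso[OF d1 d(1), of "Qm s" "Qm r" "Qm e"])
  show "Qm r *q Qm k = Qm f *q Qm s" using e1 ty' by (simp flip: Qf.F_cmp)
  show "qsha (Qm s) *q Qm h1 = Qm h *q Qm e" using qe2 ty' QSh_Qm(1)[of s] by (simp del: Qf.F_cmp)
 qed (use qe1 ty' in "simp_all del: Qf.F_cmp")
 have inv1: "Q.iv (Qm e) *q Qm g = Qm g1 *q Q.iv (Qm r)"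
 proof (rule Q.iso_lcancel[OF isoe])
  have "Qm e *q Qm g1 *q Q.iv (Qm r) = (Qm g *q Qm r) *q Q.iv (Qm r)"
   by (rule Q.pull[OF qe1]) (use ty' in "simp_all del: Qf.F_cmp")
  then show "Qm e *q Q.iv (Qm e) *q Qm g = Qm e *q Qm g1 *q Q.iv (Qm r)"
   using isoe ty' by (simp del: Qf.F_cmp)
 qed (use isoe ty' in "simp_all del: Qf.F_cmp")
 have inv2: "Qm h1 *q Q.iv (Qm e) = Q.iv (Qm (sha s)) *q Qm h"
 proof -
  have ss: "sha s \<in> Sg" using Sg_sha_iff S by simp
  show ?thesis
  proof (rule Q.iso_lcancel[OF Qm_iso[OF ss]])
   have "Qm (sha s) *q Qm h1 *q Q.iv (Qm e) = (Qm h *q Qm e) *q Q.iv (Qm e)"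
    by (rule Q.pull[OF qe2]) (use ty' isoe in "simp_all del: Qf.F_cmp Sh.F_cmp")
   also have "... = Qm (sha s) *q Q.iv (Qm (sha s)) *q Qm h"
    using ty' isoe ss by (simp del: Qf.F_cmp Sh.F_cmp)
   finally show "Qm (sha s) *q Qm h1 *q Q.iv (Qm e) = Qm (sha s) *q Q.iv (Qm (sha s)) *q Qm h" .
  qed (use ty' isoe ss in "simp_all del: Qf.F_cmp Sh.F_cmp")
 qed
 let ?D = "Qm c *q Q.iv (Qm e)"
 have D: "Q.ar ?D" "Q.dm ?D = cd g" "Q.cd ?D = cd g'" using ty' isoe by simp_all
 have D1: "?D *q Qm g = Qm g' *q B"
 proof -
  have "?D *q Qm g = Qm c *q Q.iv (Qm e) *q Qm g" by (rule Q.cmp_assoc) (use ty' isoe in simp_all)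
  also have "... = Qm c *q Qm g1 *q Q.iv (Qm r)" by (simp only: inv1)
  also have "... = (Qm g' *q Qm b) *q Q.iv (Qm r)" by (rule Q.pull[OF qc1]) (use ty' in simp_all)
  also have "... = Qm g' *q B" unfolding BQ by (rule Q.cmp_assoc) (use ty' in simp_all)
  finally show ?thesis .
 qed
 have D2: "qsha A *q Qm h = Qm h' *q ?D"
 proof -
  have "qsha A = qsha (Qm a) *q qsha (Q.iv (Qm s))" by (subst AQ, rule QSh.F_cmp) (use ty' in "simp_all del: Qf.F_cmp")
  also have "... = Qm (sha a) *q Q.iv (Qm (sha s))"
   using QSh_Qm(1)[of a] QSh_Qm(1)[of s] QSh.F_iv[OF Qm_iso[OF S(1)]] S by (simp del: Qf.F_cmp)
  finally have qA: "qsha A = Qm (sha a) *q Q.iv (Qm (sha s))" .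
  have ss: "sha s \<in> Sg" using Sg_sha_iff S by simp
  have "qsha A *q Qm h = Qm (sha a) *q Q.iv (Qm (sha s)) *q Qm h"
   unfolding qA by (rule Q.cmp_assoc) (use ty' ss in "simp_all del: Qf.F_cmp Sh.F_cmp")
  also have "... = Qm (sha a) *q Qm h1 *q Q.iv (Qm e)" by (simp only: inv2)
  also have "... = (Qm h' *q Qm c) *q Q.iv (Qm e)"
   by (rule Q.pull[OF qc2]) (use ty' isoe in "simp_all del: Qf.F_cmp Sh.F_cmp")
  also have "... = Qm h' *q ?D" by (rule Q.cmp_assoc) (use ty' isoe in simp_all)
  finally show ?thesis .
 qed
 show ?thesis using D D1 D2 by blast
qed

end

context pretriangulated
begin

text \<open>Rotating backwards puts the shift of \<open>dm k\<close> in the place of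
  \<open>cd g\<close>; the comparison \<open>e\<close> of the two and the sign of the rotation are
  recorded.\<close>

lemma dist_unrot_ex:
 assumes "dist f g h"
 obtains k l e where "dist k f l" "is_iso e" "dm e = cd l" "cd e = cd g" "e ** l = g" "h ** e = ng (sha k)"
proof -
 note t = dist_ar[OF assms]
 obtain k l where k: "dist k f l" using dist_ex2[OF t(1)] by blast
 note t' = dist_ar[OF k]
 have "\<exists>c. is_iso c & dm c = cd l & cd c = cd g & c ** l = g ** idt (cd f) & sha (idt (dm f)) ** ng (sha k) = h ** c"
  by (rule dist_iso_complete[OF dist_rot[OF k] assms]) (use t in simp_all)
 then obtain c where c: "is_iso c" "dm c = cd l" "cd c = cd g" "c ** l = g ** idt (cd f)"
  "sha (idt (dm f)) ** ng (sha k) = h ** c" by blast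
 have "c ** l = g" using c(4) t by simp
 moreover have "h ** c = ng (sha k)" using c(5)[symmetric] t t'(1,4) by simp
 ultimately show ?thesis using that[OF k c(1-3)] by blast
qed

text \<open>An octahedron is carried from one composable pair to an isomorphic one. The isomorphisms
  \<open>p\<close>, \<open>q\<close>, \<open>r\<close> of the three cones come from TR3 and the five
  lemma, so no octahedral axiom is presupposed.\<close>

lemma octahedron_transfer:
 assumes d: "dist f u u'" "dist g v v'" "dist (g ** f) w w'" "dm g = cd f"
  and d0: "dist f0 u0 u0'" "dist g0 v0 v0'" "dist (g0 ** f0) w0 w0'" "dm g0 = cd f0"
  and i: "is_iso a" "is_iso b" "is_iso c" "dm a = dm f0" "cd a = dm f" "dm b = cd f0" "cd b = cd f" "dm c = cd g0" "cd c = cd g"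
  and sq: "b ** f0 = f ** a" "c ** g0 = g ** b"
  and o: "dist s0 t0 (sha u0 ** v0')" "dm s0 = cd u0" "cd s0 = cd w0" "cd t0 = cd v0"
   "s0 ** u0 = w0 ** g0" "w0' ** s0 = u0'" "t0 ** w0 = v0" "v0' ** t0 = sha f0 ** w0'"
 shows "\<exists>s t. dist s t (sha u ** v') & dm s = cd u & cd s = cd w & cd t = cd v &
   s ** u = w ** g & w' ** s = u' & t ** w = v & v' ** t = sha f ** w'"
proof -
 have T: "ar f" "ar u" "ar u'" "dm u = cd f" "dm u' = cd u" "cd u' = sho (dm f)"
  "ar g" "ar v" "ar v'" "dm v = cd g" "dm v' = cd v" "cd v' = sho (cd f)"
  "ar w" "ar w'" "dm w = cd g" "dm w' = cd w" "cd w' = sho (dm f)" "dm g = cd f"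
  using dist_ar[OF d(1)] dist_ar[OF d(2)] dist_ar[OF d(3)] d(4) by simp_all
 have T0: "ar f0" "ar u0" "ar u0'" "dm u0 = cd f0" "dm u0' = cd u0" "cd u0' = sho (dm f0)"
  "ar g0" "ar v0" "ar v0'" "dm v0 = cd g0" "dm v0' = cd v0" "cd v0' = sho (cd f0)"
  "ar w0" "ar w0'" "dm w0 = cd g0" "dm w0' = cd w0" "cd w0' = sho (dm f0)" "dm g0 = cd f0"
  using dist_ar[OF d0(1)] dist_ar[OF d0(2)] dist_ar[OF d0(3)] d0(4) by simp_all
 have To: "ar s0" "ar t0" "dm t0 = cd w0" using dist_ar[OF o(1)] o(3) by simp_all
 obtain p where p: "is_iso p" "dm p = cd u0" "cd p = cd u" "p ** u0 = u ** b" "sha a ** u0' = u' ** p"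
  using dist_iso_complete[OF d0(1) d(1) i(1,2) i(4-7) sq(1)] by blast
 obtain q where q: "is_iso q" "dm q = cd v0" "cd q = cd v" "q ** v0 = v ** c" "sha b ** v0' = v' ** q"
  using dist_iso_complete[OF d0(2) d(2) i(2,3) _ _ _ _ sq(2)] i T T0 by auto
 have "c ** g0 ** f0 = (g ** b) ** f0" by (rule pull[OF sq(2)]) (simp_all add: T T0 i)
 also have "... = g ** b ** f0" by (rule cmp_assoc) (simp_all add: T T0 i)
 also have "... = (g ** f) ** a" unfolding sq(1) by (rule cmp_assoc[symmetric]) (simp_all add: T T0 i)
 finally have sq3: "c ** g0 ** f0 = (g ** f) ** a" .
 have "\<exists>r. is_iso r & dm r = cd w0 & cd r = cd w & r ** w0 = w ** c & sha a ** w0' = w' ** r"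
  by (rule dist_iso_complete[OF d0(3) d(3) i(1,3) _ _ _ _ sq3]) (simp_all add: T T0 i)
 then obtain r where r: "is_iso r" "dm r = cd w0" "cd r = cd w" "r ** w0 = w ** c" "sha a ** w0' = w' ** r" by blast
 let ?s = "r ** s0 ** iv p" and ?t = "q ** t0 ** iv r"
 note ty = T T0 To i o(2-4) p(1-3) q(1-3) r(1-3)
 have sp: "?s ** p = r ** s0" "?t ** r = q ** t0" by (simp_all add: ty)
 have "dist ?s ?t (sha u ** v')"
 proof (rule dist_iso[OF o(1) p(1) r(1) q(1)])
  have "sha p ** sha u0 ** v0' = sha (p ** u0) ** v0'" by (simp add: ty)
  also have "... = sha u ** sha b ** v0'" unfolding p(4) by (simp add: ty)
  also have "... = (sha u ** v') ** q" unfolding q(5) by (simp add: ty)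
  finally show "sha p ** sha u0 ** v0' = (sha u ** v') ** q" .
 qed (simp_all add: ty)
 moreover have "?s ** u = w ** g"
 proof (rule iso_rcancel[OF i(2)])
  have "(?s ** u) ** b = ?s ** u ** b" by (rule cmp_assoc) (simp_all add: ty)
  also have "... = (?s ** p) ** u0" unfolding p(4)[symmetric] by (rule cmp_assoc[symmetric]) (simp_all add: ty)
  also have "... = r ** s0 ** u0" unfolding sp by (rule cmp_assoc) (simp_all add: ty)
  also have "... = (r ** w0) ** g0" unfolding o(5) by (rule cmp_assoc[symmetric]) (simp_all add: ty)
  also have "... = w ** c ** g0" unfolding r(4) by (rule cmp_assoc) (simp_all add: ty)
  also have "... = (w ** g) ** b" unfolding sq(2) by (rule cmp_assoc[symmetric]) (simp_all add: ty)
  finally show "(?s ** u) ** b = (w ** g) ** b" .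
 qed (simp_all add: ty)
 moreover have "w' ** ?s = u'"
 proof (rule iso_rcancel[OF p(1)])
  have "(w' ** ?s) ** p = w' ** (?s ** p)" by (rule cmp_assoc) (simp_all add: ty)
  also have "... = (w' ** r) ** s0" unfolding sp by (rule cmp_assoc[symmetric]) (simp_all add: ty)
  also have "... = sha a ** w0' ** s0" unfolding r(5)[symmetric] by (rule cmp_assoc) (simp_all add: ty)
  also have "... = u' ** p" unfolding o(6) p(5) ..
  finally show "(w' ** ?s) ** p = u' ** p" .
 qed (simp_all add: ty)
 moreover have "?t ** w = v"
 proof (rule iso_rcancel[OF i(3)])
  have "(?t ** w) ** c = ?t ** w ** c" by (rule cmp_assoc) (simp_all add: ty)
  also have "... = (?t ** r) ** w0" unfolding r(4)[symmetric] by (rule cmp_assoc[symmetric]) (simp_all add: ty)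
  also have "... = q ** t0 ** w0" unfolding sp by (rule cmp_assoc) (simp_all add: ty)
  also have "... = v ** c" unfolding o(7) q(4) ..
  finally show "(?t ** w) ** c = v ** c" .
 qed (simp_all add: ty)
 moreover have "v' ** ?t = sha f ** w'"
 proof (rule iso_rcancel[OF r(1)])
  have "(v' ** ?t) ** r = v' ** (?t ** r)" by (rule cmp_assoc) (simp_all add: ty)
  also have "... = (v' ** q) ** t0" unfolding sp by (rule cmp_assoc[symmetric]) (simp_all add: ty)
  also have "... = sha b ** v0' ** t0" unfolding q(5)[symmetric] by (rule cmp_assoc) (simp_all add: ty)
  also have "... = sha (b ** f0) ** w0'" unfolding o(8) by (simp add: ty)
  also have "... = sha f ** sha a ** w0'" unfolding sq(1) by (simp add: ty)
  also have "... = (sha f ** w') ** r" unfolding r(5) by (rule cmp_assoc[symmetric]) (simp_all add: ty)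
  finally show "(v' ** ?t) ** r = (sha f ** w') ** r" .
 qed (simp_all add: ty)
 moreover have "dm ?s = cd u" "cd ?s = cd w" "cd ?t = cd v" by (simp_all add: ty)
 ultimately show ?thesis by blast
qed

end

context verdier
begin

lemma Q_ar_Ob [simp]: "Q.ar A ==> Q.dm A \<in> Ob T" "Q.ar A ==> Q.cd A \<in> Ob T"
 using Q.ar_Ob[of A] by simp_all

lemma Q_candidate_iff: "candidate QC (Sh QC) x y z (A, B, D) \<longleftrightarrow> Q.ar A & Q.ar B & Q.ar D &
  Q.dm A = x & Q.cd A = y & Q.dm B = y & Q.cd B = z & Q.dm D = z & Q.cd D = sho x"
 unfolding candidate_def by auto

definition qd :: "('m \<times> 'm) set => ('m \<times> 'm) set => ('m \<times> 'm) set => bool" where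
 "qd A B D \<longleftrightarrow> (A, B, D) \<in> Tri QC"

lemma Q_isomorphic: "isomorphic_triangles (quotient_cat T S) F = isomorphic_triangles QC F"
 by (simp add: isomorphic_triangles_def candidate_def isos_def QC_simps quotient_cat_def cong: conj_cong)

lemma qd_eq: "qd A B D \<longleftrightarrow> (\<exists>f g h. dist f g h & isomorphic_triangles QC (Sh QC) (Qm f, Qm g, Qm h) (A, B, D))"
proof -
 have "Tri QC = {t. \<exists>(f, g, h)\<in>Tri T. isomorphic_triangles (quotient_cat T S) (induced_functor T S (Sh T)) (Qm f, Qm g, Qm h) t}"
  by (simp add: verdier_quotient_def Let_def)
 then show ?thesis unfolding qd_def dist_def QC_shift Q_isomorphic by auto
qed

lemma qdE:
 assumes "qd A B D"
 obtains f g h a b c where "dist f g h" "Q.is_iso a" "Q.is_iso b" "Q.is_iso c"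
  "Q.dm a = dm f" "Q.dm b = cd f" "Q.dm c = cd g" "Q.cd a = Q.dm A" "Q.cd b = Q.dm B" "Q.cd c = Q.dm D"
  "Q.ar A" "Q.ar B" "Q.ar D" "Q.dm B = Q.cd A" "Q.dm D = Q.cd B" "Q.cd D = sho (Q.dm A)"
  "b *q Qm f = A *q a" "c *q Qm g = B *q b" "qsha a *q Qm h = D *q c"
proof -
 obtain f g h where d: "dist f g h" "isomorphic_triangles QC (Sh QC) (Qm f, Qm g, Qm h) (A, B, D)"
  using assms unfolding qd_eq by blast
 then obtain x y z x' y' z' a b c where *: "candidate QC (Sh QC) x y z (Qm f, Qm g, Qm h)"
  "candidate QC (Sh QC) x' y' z' (A, B, D)" "a \<in> isos QC x x'" "b \<in> isos QC y y'" "c \<in> isos QC z z'"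
  "b *q Qm f = A *q a" "c *q Qm g = B *q b" "qsha a *q Qm h = D *q c"
  unfolding isomorphic_triangles_def by blast
 have 1: "x = dm f" "y = cd f" "z = cd g" using *(1) dist_ar[OF d(1)] unfolding Q_candidate_iff by auto
 have 2: "Q.ar A" "Q.ar B" "Q.ar D" "Q.dm A = x'" "Q.dm B = y'" "Q.dm D = z'" "Q.cd A = y'" "Q.cd B = z'" "Q.cd D = sho x'"
  using *(2) unfolding Q_candidate_iff by auto
 have "x \<in> Ob QC" "y \<in> Ob QC" "z \<in> Ob QC" using 1 dist_ar[OF d(1)] by simp_all
 moreover have "x' \<in> Ob QC" "y' \<in> Ob QC" "z' \<in> Ob QC" using 2 Q.ar_Ob by metis+
 ultimately have 3: "Q.is_iso a" "Q.dm a = x" "Q.cd a = x'" "Q.is_iso b" "Q.dm b = y" "Q.cd b = y'"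
  "Q.is_iso c" "Q.dm c = z" "Q.cd c = z'" using *(3-5) Q.isos_iff by auto
 show ?thesis by (rule that[OF d(1) 3(1,4,7) _ _ _ _ _ _ _ _ _ _ _ _ *(6-8)]) (use 1 2 3 in simp_all)
qed

lemma qdI:
 assumes "dist f g h" "Q.is_iso a" "Q.is_iso b" "Q.is_iso c"
  "Q.dm a = dm f" "Q.dm b = cd f" "Q.dm c = cd g" "Q.cd a = Q.dm A" "Q.cd b = Q.dm B" "Q.cd c = Q.dm D"
  "Q.ar A" "Q.ar B" "Q.ar D" "Q.dm B = Q.cd A" "Q.dm D = Q.cd B" "Q.cd D = sho (Q.dm A)"
  "b *q Qm f = A *q a" "c *q Qm g = B *q b" "qsha a *q Qm h = D *q c"
 shows "qd A B D"
proof -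
 note t = dist_ar[OF assms(1)]
 have "candidate QC (Sh QC) (dm f) (cd f) (cd g) (Qm f, Qm g, Qm h)"
  "candidate QC (Sh QC) (Q.dm A) (Q.dm B) (Q.dm D) (A, B, D)"
  using assms t unfolding Q_candidate_iff by simp_all
 moreover have "a \<in> isos QC (dm f) (Q.dm A)" "b \<in> isos QC (cd f) (Q.dm B)" "c \<in> isos QC (cd g) (Q.dm D)"
  using assms(2-13) t Q.isos_iff Q.ar_Ob(1)[of A] Q.ar_Ob(1)[of B] Q.ar_Ob(1)[of D] by simp_all
 ultimately have "isomorphic_triangles QC (Sh QC) (Qm f, Qm g, Qm h) (A, B, D)"
  unfolding isomorphic_triangles_def using assms(17-19) by blast
 then show ?thesis using assms(1) unfolding qd_eq by blast
qed

lemma qd_Qm: "dist f g h ==> qd (Qm f) (Qm g) (Qm h)"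
 by (rule qdI[of f g h "Q.idt (dm f)" "Q.idt (cd f)" "Q.idt (cd g)"]) (simp_all add: dist_ar)

lemma qd_ar:
 assumes "qd A B D"
 shows "Q.ar A" "Q.ar B" "Q.ar D" "Q.dm B = Q.cd A" "Q.dm D = Q.cd B" "Q.cd D = sho (Q.dm A)"
 by (rule qdE[OF assms], assumption)+

lemma Q_triangle_iff: "triangle QC x y z A B D \<longleftrightarrow> qd A B D & Q.dm A = x & Q.cd A = y & Q.cd B = z"
 using qd_ar[of A B D] unfolding triangle_def Q_candidate_iff qd_def by auto

lemma qd_isom:
 assumes q: "qd A B D" and i: "Q.is_iso a" "Q.is_iso b" "Q.is_iso c"
  and t: "Q.dm a = Q.dm A" "Q.dm b = Q.dm B" "Q.dm c = Q.dm D" "Q.cd a = Q.dm A'" "Q.cd b = Q.dm B'" "Q.cd c = Q.dm D'"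
  "Q.ar A'" "Q.ar B'" "Q.ar D'" "Q.dm B' = Q.cd A'" "Q.dm D' = Q.cd B'" "Q.cd D' = sho (Q.dm A')"
  and e: "b *q A = A' *q a" "c *q B = B' *q b" "qsha a *q D = D' *q c"
 shows "qd A' B' D'"
proof -
 obtain f g h a0 b0 c0 where d: "dist f g h" and i0: "Q.is_iso a0" "Q.is_iso b0" "Q.is_iso c0"
  and t0: "Q.dm a0 = dm f" "Q.dm b0 = cd f" "Q.dm c0 = cd g" "Q.cd a0 = Q.dm A" "Q.cd b0 = Q.dm B" "Q.cd c0 = Q.dm D"
  "Q.ar A" "Q.ar B" "Q.ar D" "Q.dm B = Q.cd A" "Q.dm D = Q.cd B" "Q.cd D = sho (Q.dm A)"
  and e0: "b0 *q Qm f = A *q a0" "c0 *q Qm g = B *q b0" "qsha a0 *q Qm h = D *q c0"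
  by (rule qdE[OF q])
 note ty = dist_ar[OF d] i t i0 t0
 have sq: "(b *q b0) *q k = k' *q a *q a0" if "b *q A = k' *q a" "b0 *q k = A *q a0"
  "Q.ar a" "Q.ar b" "Q.ar A" "Q.ar k'" "Q.ar a0" "Q.ar b0" "Q.ar k" "Q.dm b = Q.cd A" "Q.dm k' = Q.cd a" "Q.dm a = Q.dm A"
  "Q.dm b0 = Q.cd k" "Q.dm A = Q.cd a0" "Q.cd b0 = Q.cd A" "Q.dm a0 = Q.dm k"
  for a b A k' a0 b0 k
 proof -
  have "(b *q b0) *q k = b *q b0 *q k" by (rule Q.cmp_assoc) (use that(3-) in simp_all)
  also have "... = (b *q A) *q a0" unfolding that(2) by (rule Q.cmp_assoc[symmetric]) (use that(3-) in simp_all)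
  also have "... = k' *q a *q a0" unfolding that(1) by (rule Q.cmp_assoc) (use that(3-) in simp_all)
  finally show ?thesis .
 qed
 show ?thesis
 proof (rule qdI[OF d])
  show "(b *q b0) *q Qm f = A' *q a *q a0" by (rule sq[OF e(1) e0(1)]) (simp_all add: ty)
  show "(c *q c0) *q Qm g = B' *q b *q b0" by (rule sq[OF e(2) e0(2)]) (simp_all add: ty)
  have "(qsha a *q qsha a0) *q Qm h = D' *q c *q c0" by (rule sq[OF e(3) e0(3)]) (simp_all add: ty)
  then show "qsha (a *q a0) *q Qm h = D' *q c *q c0" by (simp add: ty)
 qed (simp_all add: ty)
qed

lemma qd_rot: assumes "qd A B D" shows "qd B D (Q.ng (qsha A))"
proof -
 obtain f g h a b c where d: "dist f g h" and i: "Q.is_iso a" "Q.is_iso b" "Q.is_iso c"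
  and t: "Q.dm a = dm f" "Q.dm b = cd f" "Q.dm c = cd g" "Q.cd a = Q.dm A" "Q.cd b = Q.dm B" "Q.cd c = Q.dm D"
  "Q.ar A" "Q.ar B" "Q.ar D" "Q.dm B = Q.cd A" "Q.dm D = Q.cd B" "Q.cd D = sho (Q.dm A)"
  and e: "b *q Qm f = A *q a" "c *q Qm g = B *q b" "qsha a *q Qm h = D *q c"
  by (rule qdE[OF assms])
 note ty = dist_ar[OF d] i t
 show ?thesis
 proof (rule qdI[OF dist_rot[OF d] i(2,3) QSh.F_iso[OF i(1)] _ _ _ _ _ _ _ _ _ _ _ _ e(2,3)])
  have "qsha b *q Qm (sha f) = qsha (b *q Qm f)" by (simp add: QSh_Qm ty)
  also have "... = qsha A *q qsha a" unfolding e(1) by (simp add: ty)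
  finally have "Q.ng (qsha b *q Qm (sha f)) = Q.ng (qsha A *q qsha a)" by simp
  then show "qsha b *q Qm (ng (sha f)) = Q.ng (qsha A) *q qsha a" by (simp add: ty)
 qed (simp_all add: ty)
qed

lemma qsha_full: "[|x \<in> Ob T; y \<in> Ob T; Q.ar g; Q.dm g = sho x; Q.cd g = sho y|] ==>
  \<exists>f. Q.ar f & Q.dm f = x & Q.cd f = y & qsha f = g"
 using QSh.fullD[OF QSh.equivalenceD(2)[OF Q_shift], of x y g] by simp

lemma qsha_faithful: "[|Q.ar f; Q.ar g; Q.dm g = Q.dm f; Q.cd g = Q.cd f; qsha f = qsha g|] ==> f = g"
 using QSh.faithfulD[OF QSh.equivalenceD(1)[OF Q_shift]] .

text \<open>The underlying triangle of \<open>T\<close> is rotated back. On the new first object the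
  isomorphism is \<open>p\<close>, the desuspension of \<open>c\<close> composed with the comparison
  \<open>m\<close>.\<close>

lemma qd_unrot:
 assumes "qd B D (Q.ng (qsha A))" and A: "Q.ar A" "Q.cd A = Q.dm B" "Q.cd D = sho (Q.dm A)"
 shows "qd A B D"
proof -
 obtain f g h a b c where d: "dist f g h" and i: "Q.is_iso a" "Q.is_iso b" "Q.is_iso c"
  and t: "Q.dm a = dm f" "Q.dm b = cd f" "Q.dm c = cd g" "Q.cd a = Q.dm B" "Q.cd b = Q.dm D" "Q.cd c = Q.dm (Q.ng (qsha A))"
  "Q.ar B" "Q.ar D" "Q.dm D = Q.cd B"
  and e: "b *q Qm f = B *q a" "c *q Qm g = D *q b" "qsha a *q Qm h = Q.ng (qsha A) *q c"
  by (rule qdE[OF assms(1)])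
 have t6: "Q.cd c = sho (Q.dm A)" using t(6) A by simp
 obtain k l m where k: "dist k f l" "is_iso m" "dm m = cd l" "cd m = cd g" "m ** l = g" "h ** m = ng (sha k)"
  by (rule dist_unrot_ex[OF d])
 have k0: "Q.dm A \<in> Ob T" using Q.ar_Ob(1)[OF A(1)] by simp
 have K: "ar k" "cd k = dm f" "ar l" "dm l = cd f" "cd l = sho (dm k)" using dist_ar[OF k(1)] by simp_all
 note ty = dist_ar[OF d] i t(1-5) t6 t(7-9) k(2-4) K A k0
 obtain p where p: "Q.ar p" "Q.dm p = dm k" "Q.cd p = Q.dm A" "qsha p = c *q Qm m"
  using qsha_full[of "dm k" "Q.dm A" "c *q Qm m"] ty by auto
 have pi: "Q.is_iso p"
  by (rule QSh.ff_reflects_iso[OF QSh.equivalenceD(2)[OF Q_shift] QSh.equivalenceD(1)[OF Q_shift] p(1)])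
   (use ty p(4) in simp)
 show ?thesis
 proof (rule qdI[OF k(1) pi i(1,2)])
  show "a *q Qm k = A *q p"
  proof (rule qsha_faithful)
   have "Q.ng (qsha A *q c *q Qm m) = (Q.ng (qsha A) *q c) *q Qm m" by (simp add: ty)
   also have "... = qsha a *q Qm (h ** m)" unfolding e(3)[symmetric] by (simp add: ty)
   also have "... = Q.ng (qsha a *q Qm (sha k))" unfolding k(6) by (simp add: ty)
   finally have "qsha A *q c *q Qm m = qsha a *q Qm (sha k)"
    by (rule iffD1[OF Q.ng_inj, rotated -1]) (simp_all add: ty)
   then show "qsha (a *q Qm k) = qsha (A *q p)" using ty p by (simp add: QSh_Qm)
  qed (use ty p in simp_all)
  show "b *q Qm f = B *q a" by (rule e(1))
  have "qsha p *q Qm l = c *q Qm (m ** l)" unfolding p(4) by (simp add: ty)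
  then show "qsha p *q Qm l = D *q b" unfolding k(5) e(2) .
 qed (use ty p(1-3) in simp_all)
qed

lemma qd_ex: assumes "Q.ar A" shows "\<exists>B D. qd A B D"
proof -
 obtain s a where s: "s \<in> Sg" "ar a" "dm a = dm s" "cd s = Q.dm A" "cd a = Q.cd A" "A = Qm a *q Q.iv (Qm s)"
  by (rule Q_arrE[OF assms])
 obtain g h where d: "dist a g h" using dist_ex[OF s(2)] by blast
 note t = dist_ar[OF d]
 have "A *q Qm s = Qm a" unfolding s(6) using s(1-3) by simp
 then have "qd A (Qm g) (Qm (sha s) *q Qm h)"
  by - (rule qdI[OF d, of "Qm s" "Q.idt (cd a)" "Q.idt (cd g)"], simp_all add: QSh_Qm t s(1-5) assms)
 then show ?thesis by blast
qed

lemma qd_TR3: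
 assumes q: "qd A B D" "qd A' B' D'" and x: "Q.ar x" "Q.ar y" "Q.dm x = Q.dm A" "Q.cd x = Q.dm A'"
  "Q.dm y = Q.cd A" "Q.cd y = Q.cd A'" "y *q A = A' *q x"
 shows "\<exists>z. Q.ar z & Q.dm z = Q.cd B & Q.cd z = Q.cd B' & z *q B = B' *q y & qsha x *q D = D' *q z"
proof -
 obtain f g h a b c where d: "dist f g h" and i: "Q.is_iso a" "Q.is_iso b" "Q.is_iso c"
  and t: "Q.dm a = dm f" "Q.dm b = cd f" "Q.dm c = cd g" "Q.cd a = Q.dm A" "Q.cd b = Q.dm B" "Q.cd c = Q.dm D"
  "Q.ar A" "Q.ar B" "Q.ar D" "Q.dm B = Q.cd A" "Q.dm D = Q.cd B" "Q.cd D = sho (Q.dm A)"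
  and e: "b *q Qm f = A *q a" "c *q Qm g = B *q b" "qsha a *q Qm h = D *q c"
  by (rule qdE[OF q(1)])
 obtain f' g' h' a' b' c' where d': "dist f' g' h'" and i': "Q.is_iso a'" "Q.is_iso b'" "Q.is_iso c'"
  and t': "Q.dm a' = dm f'" "Q.dm b' = cd f'" "Q.dm c' = cd g'" "Q.cd a' = Q.dm A'" "Q.cd b' = Q.dm B'" "Q.cd c' = Q.dm D'"
  "Q.ar A'" "Q.ar B'" "Q.ar D'" "Q.dm B' = Q.cd A'" "Q.dm D' = Q.cd B'" "Q.cd D' = sho (Q.dm A')"
  and e': "b' *q Qm f' = A' *q a'" "c' *q Qm g' = B' *q b'" "qsha a' *q Qm h' = D' *q c'"
  by (rule qdE[OF q(2)])
 note ty = dist_ar[OF d] i t dist_ar[OF d'] i' t' x(1-6)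
 let ?x = "Q.iv a' *q x *q a" and ?y = "Q.iv b' *q y *q b"
 have inv: "Q.iv v *q k' = k *q Q.iv u" if "v *q k = k' *q u" "Q.is_iso u" "Q.is_iso v" "Q.ar k" "Q.ar k'"
  "Q.dm v = Q.cd k" "Q.dm k' = Q.cd u" "Q.dm u = Q.dm k" "Q.cd v = Q.cd k'" for u v k k'
 proof (rule Q.iso_lcancel[OF that(3)])
  have "v *q k *q Q.iv u = (k' *q u) *q Q.iv u" by (rule Q.pull[OF that(1)]) (use that(2-) in simp_all)
  then show "v *q Q.iv v *q k' = v *q k *q Q.iv u" using that(2-) by simp
 qed (use that(2-) in simp_all)
 have "?y *q Qm f = Q.iv b' *q y *q b *q Qm f" by (simp add: ty)
 also have "... = Q.iv b' *q (y *q A) *q a" unfolding e(1) by (simp add: ty)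
 also have "... = (Q.iv b' *q A') *q x *q a" unfolding x(7) by (simp add: ty)
 also have "Q.iv b' *q A' = Qm f' *q Q.iv a'" by (rule inv[OF e'(1)]) (simp_all add: ty)
 also have "(Qm f' *q Q.iv a') *q x *q a = Qm f' *q ?x" by (simp add: ty)
 finally have sq: "?y *q Qm f = Qm f' *q ?x" .
 have "\<exists>z. Q.ar z & Q.dm z = cd g & Q.cd z = cd g' & z *q Qm g = Qm g' *q ?y & qsha ?x *q Qm h = Qm h' *q z"
  by (rule Q_TR3[OF d d' _ _ _ _ _ _ sq]) (simp_all add: ty)
 then obtain z where z: "Q.ar z" "Q.dm z = cd g" "Q.cd z = cd g'" "z *q Qm g = Qm g' *q ?y" "qsha ?x *q Qm h = Qm h' *q z"
  by blast
 note ty' = ty z(1-3)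
 let ?z = "c' *q z *q Q.iv c"
 have "?z *q B = c' *q z *q Q.iv c *q B" by (simp add: ty')
 also have "Q.iv c *q B = Qm g *q Q.iv b" by (rule inv[OF e(2)]) (simp_all add: ty')
 also have "c' *q z *q Qm g *q Q.iv b = c' *q (z *q Qm g) *q Q.iv b" by (simp add: ty')
 also have "... = (c' *q Qm g') *q Q.iv b' *q y" unfolding z(4) by (simp add: ty')
 also have "... = B' *q y" unfolding e'(2) by (simp add: ty')
 finally have z1: "?z *q B = B' *q y" .
 have "qsha x *q D = qsha (a' *q ?x) *q Q.iv (qsha a) *q D" by (simp add: ty')
 also have "Q.iv (qsha a) *q D = Qm h *q Q.iv c" by (rule inv[OF e(3)]) (simp_all add: ty')
 also have "qsha (a' *q ?x) *q Qm h *q Q.iv c = qsha a' *q (qsha ?x *q Qm h) *q Q.iv c" by (simp add: ty')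
 also have "... = (qsha a' *q Qm h') *q z *q Q.iv c" unfolding z(5) by (simp add: ty')
 also have "... = D' *q ?z" unfolding e'(3) by (simp add: ty')
 finally have z2: "qsha x *q D = D' *q ?z" .
 have "Q.ar ?z" "Q.dm ?z = Q.cd B" "Q.cd ?z = Q.cd B'" by (simp_all add: ty')
 then show ?thesis using z1 z2 by blast
qed

lemma qd_idt: assumes "x \<in> Ob T" "zero_object QC z" shows "qd (Q.idt x) (Q.zr x z) (Q.zr z (sho x))"
proof -
 obtain n where n: "zero_object T n" using zero_ex by blast
 have n': "n \<in> Ob T" using zero_objectD(1)[OF n] .
 have z: "z \<in> Ob T" using Q.zero_objectD(1)[OF assms(2)] by simp
 have "zero_object QC n" using Qf.F_zero[OF n] by simp
 then obtain c where c: "Q.is_iso c" "Q.dm c = n" "Q.cd c = z"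
  using Q.zero_objects_isom[OF _ assms(2)] unfolding Q.isom_def by blast
 show ?thesis
  by (rule qdI[OF dist_idt[OF assms(1) n], of "Q.idt x" "Q.idt x" c]) (use c z n' assms(1) in simp_all)
qed

lemma Q_pretriangulated: "pretriangulated K QC"
proof (rule pretriangulated.intro[OF Q_lin_category pretriangulated_axioms.intro])
 show "additive_cat QC" by (rule Q_additive)
 show "quasi_inverse K QC QC (Sh QC) (Shi QC)" by (rule Q_shift)
next
 fix t assume "t \<in> Tri QC"
 then obtain A B D where t: "t = (A, B, D)" "qd A B D" by (cases t) (auto simp: qd_def)
 then have "candidate QC (Sh QC) (Q.dm A) (Q.cd A) (Q.cd B) t" using qd_ar[OF t(2)] by (simp add: Q_candidate_iff)
 then show "\<exists>x y z. candidate QC (Sh QC) x y z t" by blast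
next
 fix x z assume "x \<in> Ob QC" "zero_object QC z"
 then show "triangle QC x x z (Id QC x) \<zero>\<^bsub>Hom QC x z\<^esub> \<zero>\<^bsub>Hom QC z (omap (Sh QC) x)\<^esub>"
  using qd_idt[of x z] Q.zero_objectD(1)[of z] by (simp add: Q_triangle_iff Q.zr_eq)
next
 fix t t' assume t: "t \<in> Tri QC" "isomorphic_triangles QC (Sh QC) t t'"
 obtain A B D A' B' D' where tt: "t = (A, B, D)" "t' = (A', B', D')" by (cases t, cases t') auto
 obtain x y z x' y' z' a b c where *: "candidate QC (Sh QC) x y z (A, B, D)"
  "candidate QC (Sh QC) x' y' z' (A', B', D')" "a \<in> isos QC x x'" "b \<in> isos QC y y'" "c \<in> isos QC z z'"
  "b *q A = A' *q a" "c *q B = B' *q b" "qsha a *q D = D' *q c"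
  using t(2) unfolding isomorphic_triangles_def tt by blast
 have 1: "Q.ar A" "Q.ar B" "Q.ar D" "Q.dm A = x" "Q.dm B = y" "Q.dm D = z"
  using *(1) unfolding Q_candidate_iff by auto
 have 2: "Q.ar A'" "Q.ar B'" "Q.ar D'" "Q.dm A' = x'" "Q.dm B' = y'" "Q.dm D' = z'" "Q.cd A' = y'" "Q.cd B' = z'" "Q.cd D' = sho x'"
  using *(2) unfolding Q_candidate_iff by auto
 have "x \<in> Ob QC" "y \<in> Ob QC" "z \<in> Ob QC" "x' \<in> Ob QC" "y' \<in> Ob QC" "z' \<in> Ob QC" using 1 2 Q.ar_Ob by metis+
 then have 3: "Q.is_iso a" "Q.dm a = x" "Q.cd a = x'" "Q.is_iso b" "Q.dm b = y" "Q.cd b = y'"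
  "Q.is_iso c" "Q.dm c = z" "Q.cd c = z'" using *(3-5) Q.isos_iff by auto
 have "qd A B D" using t(1) by (simp add: qd_def tt)
 then have "qd A' B' D'" by (rule qd_isom[OF _ 3(1,4,7) _ _ _ _ _ _ _ _ _ _ _ _ *(6-8)]) (use 1 2 3 in simp_all)
 then show "t' \<in> Tri QC" by (simp add: qd_def tt)
next
 fix x y A assume *: "x \<in> Ob QC" "y \<in> Ob QC" "A \<in> arr QC x y"
 then have "Q.ar A" "Q.dm A = x" "Q.cd A = y" by simp_all
 then show "\<exists>z B D. triangle QC x y z A B D" using qd_ex[of A] by (auto simp: Q_triangle_iff)
next
 fix x y z A B D assume "candidate QC (Sh QC) x y z (A, B, D)"
 then have 1: "Q.ar A" "Q.ar B" "Q.ar D" "Q.dm A = x" "Q.cd A = y" "Q.dm B = y" "Q.dm D = z" "Q.cd B = z" "Q.cd D = sho x"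
  unfolding Q_candidate_iff by auto
 have n: "\<ominus>\<^bsub>Hom QC (omap (Sh QC) x) (omap (Sh QC) y)\<^esub> qsha A = Q.ng (qsha A)"
  by (rule Q.ng_eq) (use 1 in simp_all)
 have "qd A B D \<longleftrightarrow> qd B D (Q.ng (qsha A))" using qd_rot[of A B D] qd_unrot[of B D A] 1 by auto
 then show "triangle QC x y z A B D \<longleftrightarrow>
   triangle QC y z (omap (Sh QC) x) B D (\<ominus>\<^bsub>Hom QC (omap (Sh QC) x) (omap (Sh QC) y)\<^esub> qsha A)"
  unfolding n using 1 by (simp add: Q_triangle_iff)
next
 fix x y z A B D x' y' z' A' B' D' a b
 assume *: "triangle QC x y z A B D" "triangle QC x' y' z' A' B' D'" "a \<in> arr QC x x'" "b \<in> arr QC y y'"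
  "b *q A = A' *q a"
 have q: "qd A B D" "Q.dm A = x" "Q.cd A = y" "Q.cd B = z" "qd A' B' D'" "Q.dm A' = x'" "Q.cd A' = y'" "Q.cd B' = z'"
  using *(1,2) unfolding Q_triangle_iff by auto
 have ob: "x \<in> Ob QC" "y \<in> Ob QC" "z \<in> Ob QC" "x' \<in> Ob QC" "y' \<in> Ob QC" "z' \<in> Ob QC"
  using qd_ar[OF q(1)] qd_ar[OF q(5)] q Q.ar_Ob by metis+
 have ab: "Q.ar a" "Q.dm a = x" "Q.cd a = x'" "Q.ar b" "Q.dm b = y" "Q.cd b = y'" using *(3,4) ob by simp_all
 obtain c where c: "Q.ar c" "Q.dm c = z" "Q.cd c = z'" "c *q B = B' *q b" "qsha a *q D = D' *q c"
  using qd_TR3[OF q(1,5) ab(1,4) _ _ _ _ *(5)] q ab by auto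
 have "c \<in> arr QC z z'" using c(1-3) ob by simp
 then show "\<exists>c\<in>arr QC z z'. c *q B = B' *q b & qsha a *q D = D' *q c" using c(4,5) by blast
qed

end

sublocale verdier \<subseteq> QT: pretriangulated K "verdier_quotient T S"
 by (rule Q_pretriangulated)

context verdier
begin

lemma QT_dist: "QT.dist = qd"
 by (intro ext) (simp add: QT.dist_def qd_def)

text \<open>A composable pair of the quotient is isomorphic to the image of one in \<open>T\<close>:
  \<open>B\<close> is a fraction with denominator \<open>r\<close>, and r^{-1} A is one with
  denominator \<open>s\<close>. The octahedron of the numerators is transported along
  \<open>s\<close>, \<open>r\<close> and an identity.\<close>

lemma Q_triangulated: "triangulated_category K QC"
proof (rule triangulated_category.intro[OF Q_lin_category triangulated_category_axioms.intro])
 fix x y a A U U' z b B V V' c W W'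
 assume *: "triangle QC x y a A U U'" "triangle QC y z b B V V'" "triangle QC x z c (B *q A) W W'"
 have q: "qd A U U'" "Q.dm A = x" "Q.cd A = y" "Q.cd U = a" "qd B V V'" "Q.dm B = y" "Q.cd B = z" "Q.cd V = b"
  "qd (B *q A) W W'" "Q.cd W = c"
  using * unfolding Q_triangle_iff by auto
 have A: "Q.ar A" and B: "Q.ar B" using qd_ar q by auto
 obtain r g where r: "r \<in> Sg" "ar g" "dm g = dm r" "cd r = Q.dm B" "cd g = Q.cd B" "B = Qm g *q Q.iv (Qm r)"
  by (rule Q_arrE[OF B])
 have A': "Q.ar (Q.iv (Qm r) *q A)" "Q.dm (Q.iv (Qm r) *q A) = x" "Q.cd (Q.iv (Qm r) *q A) = dm r"
  using A q r(1-5) by simp_all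
 obtain s f where s: "s \<in> Sg" "ar f" "dm f = dm s" "cd s = Q.dm (Q.iv (Qm r) *q A)" "cd f = Q.cd (Q.iv (Qm r) *q A)"
  "Q.iv (Qm r) *q A = Qm f *q Q.iv (Qm s)"
  by (rule Q_arrE[OF A'(1)])
 have s': "cd s = x" "cd f = dm r" using s(4,5) A' by simp_all
 have r': "cd r = y" "cd g = z" using r(4,5) q by simp_all
 have z: "z \<in> Ob T" using ar_Ob(2)[OF r(2)] r'(2) by simp
 note ty = A B q(2,3,6,7) r(1-3) r' s(1-3) s' z
 have sq1: "Qm r *q Qm f = A *q Qm s"
 proof -
  have "Qm r *q Qm f = Qm r *q (Qm f *q Q.iv (Qm s)) *q Qm s" by (simp add: ty)
  also have "... = A *q Qm s" unfolding s(6)[symmetric] by (simp add: ty)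
  finally show ?thesis .
 qed
 have sq2: "Q.idt z *q Qm g = B *q Qm r" unfolding r(6) by (simp add: ty)
 obtain u u' where u: "dist f u u'" using dist_ex[OF s(2)] by blast
 obtain v v' where v: "dist g v v'" using dist_ex[OF r(2)] by blast
 obtain w w' where w: "dist (g ** f) w w'" using dist_ex[of "g ** f"] ty by auto
 obtain s0 t0 where o: "dist s0 t0 (sha u ** v')" "ar s0" "ar t0" "dm s0 = cd u" "cd s0 = cd w" "dm t0 = cd w" "cd t0 = cd v"
  "s0 ** u = w ** g" "w' ** s0 = u'" "t0 ** w = v" "v' ** t0 = sha f ** w'"
  by (rule octahedron[OF u v w]) (simp_all add: ty)
 have U: "ar u" "ar u'" "dm u = cd f" "dm u' = cd u" "cd u' = sho (dm s)" "ar v" "ar v'" "dm v = cd g" "dm v' = cd v"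
  "cd v' = sho (dm r)" "ar w" "ar w'" "dm w = cd g" "dm w' = cd w" "cd w' = sho (dm s)"
  using dist_ar[OF u] dist_ar[OF v] dist_ar[OF w] ty by simp_all
 note ty' = ty U o(2-7)
 have "\<exists>s t. qd s t (qsha U *q V') & Q.dm s = Q.cd U & Q.cd s = Q.cd W & Q.cd t = Q.cd V &
   s *q U = W *q B & W' *q s = U' & t *q W = V & V' *q t = qsha A *q W'"
 proof (rule QT.octahedron_transfer[of A U U' B V V' W W' "Qm f" "Qm u" "Qm u'" "Qm g" "Qm v" "Qm v'" "Qm w" "Qm w'"
   "Qm s" "Qm r" "Q.idt z" "Qm s0" "Qm t0", unfolded QT_dist, OF q(1,5,9)])
  show "qd (Qm f) (Qm u) (Qm u')" "qd (Qm g) (Qm v) (Qm v')" using qd_Qm u v by blast+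
  show "qd (Qm g *q Qm f) (Qm w) (Qm w')" using qd_Qm[OF w] ty by simp
  show "Qm r *q Qm f = A *q Qm s" "Q.idt z *q Qm g = B *q Qm r" by (rule sq1, rule sq2)
  show "qd (Qm s0) (Qm t0) (qsha (Qm u) *q Qm v')" using qd_Qm[OF o(1)] ty' by (simp add: QSh_Qm)
  show "Qm s0 *q Qm u = Qm w *q Qm g" using o(8) ty' by (simp flip: Qf.F_cmp)
  show "Qm w' *q Qm s0 = Qm u'" using o(9) ty' by (simp flip: Qf.F_cmp)
  show "Qm t0 *q Qm w = Qm v" using o(10) ty' by (simp flip: Qf.F_cmp)
  show "Qm v' *q Qm t0 = qsha (Qm f) *q Qm w'" using o(11) ty' by (simp add: QSh_Qm flip: Qf.F_cmp)
 qed (simp_all add: ty')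
 then show "\<exists>s t. triangle QC a c b s t (qsha U *q V') & s *q U = W *q B & W' *q s = U' &
   t *q W = V & V' *q t = qsha A *q W'"
  unfolding Q_triangle_iff q(4,8,10) by blast
qed (fact QT.p_additive QT.p_shift QT.p_tri_candidate QT.p_TR1_id QT.p_TR1_iso QT.p_TR1_ex QT.p_TR2 QT.p_TR3)+

end

section \<open>Thick subcategories and split triangles\<close>

lemma full_subcat_simps [simp]:
 "Ob (full_subcat C P) = P" "Hom (full_subcat C P) = Hom C" "Comp (full_subcat C P) = Comp C"
 "Id (full_subcat C P) = Id C"
 by (simp_all add: full_subcat_def)

lemma direct_sum_full_subcat:
 "P \<subseteq> Ob C ==> direct_sum (full_subcat C P) xs b \<longleftrightarrow> set xs \<subseteq> P & b \<in> P & direct_sum C xs b"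
 unfolding direct_sum_def full_subcat_simps by blast

context triangulated_category
begin

lemma thickI:
 assumes "R \<subseteq> Ob T" "!!z. zero_object T z ==> z \<in> R" "!!x. x \<in> R ==> sho x \<in> R" "!!x. x \<in> R ==> shi x \<in> R"
  "!!x y z. [|tr x y z; x \<in> R; y \<in> R|] ==> z \<in> R" "!!x y. [|retr x y; y \<in> R|] ==> x \<in> R"
 shows "thick T R"
 unfolding thick_def
proof (intro conjI allI impI ballI)
 show "R \<noteq> {}" using assms(2) zero_ex by blast
 fix x y z f g h assume "triangle T x y z f g h & x \<in> R & y \<in> R"
 then show "z \<in> R" using assms(5)[of x y z] unfolding tr_def by blast
next
 fix x y b assume "direct_sum T [x, y] b & b \<in> R"
 then show "x \<in> R" "y \<in> R" using assms(6) direct_sum_retr by blast+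
qed (use assms in auto)

text \<open>Vanishing of \<open>h\<close> gives a section \<open>s\<close> of \<open>g\<close> and
  makes \<open>f\<close> a monomorphism. The idempotent 1 - s g factors through \<open>f\<close>,
  and the factor \<open>p\<close> is the retraction of \<open>f\<close>.\<close>

lemma split_direct_sum:
 assumes d: "dist f g h" and h: "h = zr (cd g) (sho (dm f))"
 shows "direct_sum T [dm f, cd g] (cd f)"
proof -
 note t = dist_ar[OF d]
 have "h ** idt (cd g) = zr (cd g) (sho (dm f))" using h t by simp
 then obtain s where s: "ar s" "dm s = cd g" "cd s = cd f" "g ** s = idt (cd g)"
  by - (rule exrE[OF dist_exr(2)[OF d], of "idt (cd g)"], use t in auto)
 let ?e = "idt (cd f) \<boxplus> ng (s ** g)"
 have e: "ar ?e" "dm ?e = cd f" "cd ?e = cd f" by (simp_all add: t s(1-3))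
 have "g ** s ** g = g" using pull[OF s(4), of g] by (simp add: t s(1-3))
 then have "g ** ?e = zr (dm ?e) (cd g)" by (simp add: cmp_pl t s(1-3))
 then obtain p where p: "ar p" "dm p = dm ?e" "cd p = dm f" "f ** p = ?e"
  by - (rule dist_factor_right[OF d, of ?e], simp_all add: e)
 have pd: "dm p = cd f" using p(2) e by simp
 have mono: "a = zr (dm a) (dm f)" if a: "ar a" "cd a = dm f" "f ** a = zr (dm a) (cd f)" for a
 proof -
  have "sha f ** sha a = zr (dm (sha a)) (cd (sha f))" using a t by (simp flip: Sh.F_cmp)
  then obtain b where b: "ar b" "dm b = dm (sha a)" "cd b = dm h" "h ** b = sha a"
   by - (rule exrE[OF dist_exr(3)[OF d], of "sha a"], simp_all add: a t)
  have "h ** b = sha (zr (dm a) (dm f))" unfolding h using b a t by simp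
  then have "sha a = sha (zr (dm a) (dm f))" unfolding b(4) .
  then show ?thesis by (rule sh_faithful[rotated -1]) (simp_all add: a t)
 qed
 have ef: "?e ** f = f" using dist_zero1[OF d] by (simp add: pl_cmp t s(1-3))
 have es: "?e ** s = zr (cd g) (cd f)" by (simp add: pl_cmp t s)
 have "f ** (p ** f \<boxplus> ng (idt (dm f))) = (f ** p) ** f \<boxplus> ng f" by (simp add: cmp_pl t p(1,3) pd)
 also have "... = zr (dm f) (cd f)" unfolding p(4) ef using t by simp
 finally have "p ** f \<boxplus> ng (idt (dm f)) = zr (dm f) (dm f)"
  using mono[of "p ** f \<boxplus> ng (idt (dm f))"] by (simp add: t p(1,3) pd)
 then have pf: "p ** f = idt (dm f)" using diff_zr[of "p ** f" "idt (dm f)"] by (simp add: t p(1,3) pd)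
 have "f ** p ** s = (f ** p) ** s" by (simp add: t p(1,3) pd s(1-3))
 also have "... = zr (cd g) (cd f)" unfolding p(4) es ..
 finally have ps: "p ** s = zr (cd g) (dm f)" using mono[of "p ** s"] by (simp add: t p(1,3) pd s(1-3))
 have "(f ** p) \<boxplus> (s ** g) = idt (cd f)" unfolding p(4)
  using pl_assoc[of "idt (cd f)" "ng (s ** g)" "s ** g"] by (simp add: t s(1-3))
 then show ?thesis unfolding direct_sum_two
  using t p(1,3) pd s pf ps dist_zero1[OF d]
  by (intro conjI exI[of _ f] exI[of _ s] exI[of _ p] exI[of _ g]; simp)
qed

lemma direct_sum_unique:
 assumes "direct_sum T [x, y] b" "direct_sum T [x, y] c" shows "b \<simeq> c"
proof -
 obtain i j p q where 1: "ar i" "ar j" "ar p" "ar q" "dm i = x" "cd i = b" "dm j = y" "cd j = b" "dm p = b" "cd p = x"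
  "dm q = b" "cd q = y" "p ** i = idt x" "q ** j = idt y" "p ** j = zr y x" "q ** i = zr x y" "(i ** p) \<boxplus> (j ** q) = idt b"
  using assms(1) unfolding direct_sum_two hom_iff by blast
 obtain i' j' p' q' where 2: "ar i'" "ar j'" "ar p'" "ar q'" "dm i' = x" "cd i' = c" "dm j' = y" "cd j' = c" "dm p' = c" "cd p' = x"
  "dm q' = c" "cd q' = y" "p' ** i' = idt x" "q' ** j' = idt y" "p' ** j' = zr y x" "q' ** i' = zr x y" "(i' ** p') \<boxplus> (j' ** q') = idt c"
  using assms(2) unfolding direct_sum_two hom_iff by blast
 have ob: "x \<in> Ob T" "y \<in> Ob T" "b \<in> Ob T" "c \<in> Ob T" using assms unfolding direct_sum_two by auto
 note ty = 1(1-12) 2(1-12) ob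
 have *: "((i' ** p) \<boxplus> (j' ** q)) ** ((i ** p') \<boxplus> (j ** q')) = (i' ** p') \<boxplus> (j' ** q')"
  if "ar i" "ar j" "ar p" "ar q" "dm i = x" "cd i = b" "dm j = y" "cd j = b" "dm p = b" "cd p = x"
  "dm q = b" "cd q = y" "p ** i = idt x" "q ** j = idt y" "p ** j = zr y x" "q ** i = zr x y"
  "ar i'" "ar j'" "ar p'" "ar q'" "dm i' = x" "cd i' = c" "dm j' = y" "cd j' = c" "dm p' = c" "cd p' = x"
  "dm q' = c" "cd q' = y" "b \<in> Ob T" "c \<in> Ob T" for i j p q i' j' p' q' b c
 proof -
  have a: "p ** i ** p' = p'" "q ** j ** q' = q'" "p ** j ** q' = zr c x" "q ** i ** p' = zr c y"
   using pull[OF that(13), of p'] pull[OF that(14), of q'] pull[OF that(15), of q'] pull[OF that(16), of p']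
   by (simp_all add: that(1-12) that(17-) ob)
  show ?thesis by (simp add: cmp_pl pl_cmp a that(1-12) that(17-) ob)
 qed
 show ?thesis
 proof (rule isomI)
  show "is_iso ((i' ** p) \<boxplus> (j' ** q))"
  proof (rule isoI[of _ "(i ** p') \<boxplus> (j ** q')"])
   have "((i' ** p) \<boxplus> (j' ** q)) ** ((i ** p') \<boxplus> (j ** q')) = (i' ** p') \<boxplus> (j' ** q')"
    by (rule *) (fact 1 2 ob)+
   then show "((i' ** p) \<boxplus> (j' ** q)) ** ((i ** p') \<boxplus> (j ** q')) = idt (cd ((i' ** p) \<boxplus> (j' ** q)))"
    unfolding 2(17) by (simp add: ty)
   have "((i ** p') \<boxplus> (j ** q')) ** ((i' ** p) \<boxplus> (j' ** q)) = (i ** p) \<boxplus> (j ** q)"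
    by (rule *) (fact 1 2 ob)+
   then show "((i ** p') \<boxplus> (j ** q')) ** ((i' ** p) \<boxplus> (j' ** q)) = idt (dm ((i' ** p) \<boxplus> (j' ** q)))"
    unfolding 1(17) by (simp add: ty)
  qed (simp_all add: ty)
 qed (simp_all add: ty)
qed

lemma tr_split_direct_sum:
 assumes "tr x y z" "hz z (sho x)" shows "direct_sum T [x, z] y"
proof -
 obtain f g h where d: "dist f g h" "dm f = x" "cd f = y" "cd g = z" using assms(1) by (rule trE)
 have "h = zr z (sho x)" by (rule hzD[OF assms(2)]) (use dist_ar[OF d(1)] d in auto)
 then show ?thesis using split_direct_sum[OF d(1)] d by simp
qed

end

section \<open>Vanishing of Hom between an object and the shifts of M\<close>

sublocale relative_serre_quadruple \<subseteq> verdier K T S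
 by unfold_locales (rule RS0_thick)

context relative_serre_quadruple
begin

text \<open>Vanishing is recorded degree by degree. The two halves of the t-structure are given by
  \<open>kr\<close> in a range of degrees (\<open>rperp_shifts\<close>), the classes
  \<open>Uo\<close> and \<open>Vo\<close> by \<open>kl\<close>.\<close>

definition kl :: "'o => int => bool" where
 "kl t i \<longleftrightarrow> (\<forall>m\<in>M. hz t (sft i m))"

definition kr :: "'o => int => bool" where
 "kr t i \<longleftrightarrow> (\<forall>m\<in>M. hz (sft i m) t)"

lemma M_Ob: "m \<in> M ==> m \<in> Ob T"
 using RS2_silting unfolding silting_def by blast

lemma M_hz: assumes "m \<in> M" "m' \<in> M" "i < j" shows "hz (sft i m) (sft j m')"
proof -
 have "sft (j - i) m' \<in> shifts T M {0<..}" unfolding shifts_def using assms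
  by (intro CollectI exI[of _ "j - i"] exI[of _ m']) simp
 then have "hz m (sft (j - i) m')" using RS2_silting assms(1) hom_zero_iff[of M] unfolding silting_def by blast
 then show ?thesis using hz_sft_sft[of m m' i j] M_Ob assms by simp
qed

lemma thick_induct:
 assumes "thick T R" "!!m. m \<in> M ==> m \<in> R" "t \<in> Ob T" shows "t \<in> R"
 using RS2_silting assms unfolding silting_def thick_closure_def by blast

lemma kl_sft: "t \<in> Ob T ==> kl (sft j t) i \<longleftrightarrow> kl t (i - j)"
 unfolding kl_def using hz_sft_sft M_Ob by simp

lemma kr_sft: assumes "t \<in> Ob T" shows "kr (sft j t) i \<longleftrightarrow> kr t (i - j)"
proof -
 have "hz (sft i m) (sft j t) \<longleftrightarrow> hz (sft (i - j) m) t" if "m \<in> M" for m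
  using hz_sft_sft[of m t i j] hz_sft_left[of m t "i - j"] M_Ob[OF that] assms by simp
 then show ?thesis unfolding kr_def by blast
qed

lemma kl_sho: "t \<in> Ob T ==> kl (sho t) i \<longleftrightarrow> kl t (i - 1)" and kr_sho: "t \<in> Ob T ==> kr (sho t) i \<longleftrightarrow> kr t (i - 1)"
 and kl_shi: "t \<in> Ob T ==> kl (shi t) i \<longleftrightarrow> kl t (i + 1)" and kr_shi: "t \<in> Ob T ==> kr (shi t) i \<longleftrightarrow> kr t (i + 1)"
 using kl_sft[of t 1 i] kr_sft[of t 1 i] kl_sft[of t "-1" i] kr_sft[of t "-1" i] by simp_all

lemma kl_isom: "x \<simeq> y ==> kl x i ==> kl y i" and kr_isom: "x \<simeq> y ==> kr x i ==> kr y i"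
 unfolding kl_def kr_def using hz_isom_left hz_isom_right M_Ob sft_Ob by blast+

lemma kl_mid: "[|tr x y z; kl x i; kl z i|] ==> kl y i" and kr_mid: "[|tr x y z; kr x i; kr z i|] ==> kr y i"
 unfolding kl_def kr_def using tr_hz_mid tr_hz_mid2 M_Ob sft_Ob by blast+

lemma kl_cone: "[|tr x y z; kl y i; kl x (i - 1)|] ==> kl z i" and kr_cone: "[|tr x y z; kr y i; kr x (i - 1)|] ==> kr z i"
 using kl_mid[OF tr_rot] kr_mid[OF tr_rot] kl_sho kr_sho tr_Ob by blast+

lemma kr_fiber: "[|tr x y z; kr y i; kr z (i + 1)|] ==> kr x i"
 using kr_mid[OF tr_unrot] kr_shi tr_Ob by blast

lemma kl_retr: "[|retr x y; kl y i|] ==> kl x i" and kr_retr: "[|retr x y; kr y i|] ==> kr x i"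
 unfolding kl_def kr_def using retr_hz_left retr_hz_right M_Ob sft_Ob by blast+

lemma kl_zero: "zero_object T z ==> kl z i" and kr_zero: "zero_object T z ==> kr z i"
 unfolding kl_def kr_def using zero_objectD M_Ob sft_Ob by blast+

lemma M_kl: "[|m \<in> M; i > 0|] ==> kl m i" and M_kr: "[|m \<in> M; i < 0|] ==> kr m i"
 unfolding kl_def kr_def using M_hz[of m _ 0 i] M_hz[of _ m i 0] by simp_all

text \<open>A bound moves by one under shifts, and a cone inherits a bound from its two sources, so
  the objects that have one form a thick subcategory. It contains \<open>M\<close>, which
  generates.\<close>

lemma kl_bounded: assumes "t \<in> Ob T" shows "\<exists>n. \<forall>i>n. kl t i"
proof -
 let ?R = "{t \<in> Ob T. \<exists>n. \<forall>i>n. kl t i}"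
 have "thick T ?R"
 proof (rule thickI)
  fix x assume "x \<in> ?R"
  then obtain n where x: "x \<in> Ob T" "\<forall>i>n. kl x i" by blast
  have "\<forall>i>n + 1. kl (sho x) i" "\<forall>i>n - 1. kl (shi x) i" using x kl_sho kl_shi by simp_all
  then show "sho x \<in> ?R" "shi x \<in> ?R" using x(1) Sh.F_ob Shi.F_ob by blast+
 next
  fix x y z assume *: "tr x y z" "x \<in> ?R" "y \<in> ?R"
  then obtain a b where "\<forall>i>a. kl x i" "\<forall>i>b. kl y i" by blast
  then have "\<forall>i>max (a + 1) b. kl z i" using kl_cone[OF *(1)] by simp
  then show "z \<in> ?R" using tr_Ob[OF *(1)] by blast
 next
  fix x y assume "retr x y" "y \<in> ?R"
  then show "x \<in> ?R" using kl_retr retr_Ob by blast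
 qed (use kl_zero zero_objectD in auto)
 moreover have "m \<in> ?R" if "m \<in> M" for m using M_kl M_Ob that by blast
 ultimately show ?thesis using thick_induct[of ?R t] assms by blast
qed

lemma kr_bounded: assumes "t \<in> Ob T" shows "\<exists>n. \<forall>i<n. kr t i"
proof -
 let ?R = "{t \<in> Ob T. \<exists>n. \<forall>i<n. kr t i}"
 have "thick T ?R"
 proof (rule thickI)
  fix x assume "x \<in> ?R"
  then obtain n where x: "x \<in> Ob T" "\<forall>i<n. kr x i" by blast
  have "\<forall>i<n + 1. kr (sho x) i" "\<forall>i<n - 1. kr (shi x) i" using x kr_sho kr_shi by simp_all
  then show "sho x \<in> ?R" "shi x \<in> ?R" using x(1) Sh.F_ob Shi.F_ob by blast+
 next
  fix x y z assume *: "tr x y z" "x \<in> ?R" "y \<in> ?R"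
  then obtain a b where "\<forall>i<a. kr x i" "\<forall>i<b. kr y i" by blast
  then have "\<forall>i<min a b. kr z i" using kr_cone[OF *(1)] by simp
  then show "z \<in> ?R" using tr_Ob[OF *(1)] by blast
 next
  fix x y assume "retr x y" "y \<in> ?R"
  then show "x \<in> ?R" using kr_retr retr_Ob by blast
 qed (use kr_zero zero_objectD in auto)
 moreover have "m \<in> ?R" if "m \<in> M" for m using M_kr M_Ob that by blast
 ultimately show ?thesis using thick_induct[of ?R t] assms by blast
qed

subsection \<open>The weight structure\<close>

text \<open>Weight \<open>i\<close> is the degree of M[i]. \<open>wdec\<close> collects the objects
  that can be cut at every weight; asking for all \<open>k\<close> at once is what makes it closed
  under shifts.\<close>

definition wle :: "int => 'o set" where "wle k = filt (shifts T M {..k})"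
definition wgt :: "int => 'o set" where "wgt k = filt (shifts T M {k<..})"
definition wdec :: "'o set" where "wdec = (\<Inter>k. star T (wle k) (wgt k))"

lemma shiftsE: assumes "a \<in> shifts T M I" obtains i m where "i \<in> I" "m \<in> M" "a = sft i m" "a \<in> Ob T"
 using assms M_Ob sft_Ob unfolding shifts_def by blast

lemma shiftsI: "[|i \<in> I; m \<in> M|] ==> sft i m \<in> shifts T M I"
 unfolding shifts_def by blast

lemma shifts_filt: "[|i \<in> I; m \<in> M|] ==> sft i m \<in> filt (shifts T M I)"
 using filt_base[OF shiftsI] M_Ob by simp

lemma wle_hz: assumes "x \<in> wle i" "w \<in> Ob T" "!!j. j \<le> i ==> kr w j" shows "hz x w"
 by (rule filt_hz_left[OF assms(1)[unfolded wle_def] assms(2)]) (use assms(3) in "auto elim!: shiftsE simp: kr_def")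

lemma wgt_hz: assumes "x \<in> wgt i" "w \<in> Ob T" "!!j. j > i ==> kl w j" shows "hz w x"
 by (rule filt_hz_right[OF assms(1)[unfolded wgt_def] assms(2)]) (use assms(3) in "auto elim!: shiftsE simp: kl_def")

lemma filt_kl: assumes "x \<in> filt (shifts T M I)" "!!i. i \<in> I ==> i < j" shows "kl x j"
 unfolding kl_def
proof
 fix m assume m: "m \<in> M"
 show "hz x (sft j m)" by (rule filt_hz_left[OF assms(1)]) (use m M_hz assms(2) M_Ob in "auto elim!: shiftsE")
qed

lemma wle_wgt: assumes "x \<in> wle i" "y \<in> wgt j" "i \<le> j" shows "hz x y"
proof (rule wgt_hz[OF assms(2)])
 show "x \<in> Ob T" using assms(1) filt_Ob unfolding wle_def by blast
 fix k assume "k > j"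
 then show "kl x k" using filt_kl[OF assms(1)[unfolded wle_def]] assms(3) by simp
qed

lemma sft_filt_shifts:
 assumes "x \<in> filt (shifts T M I)" "!!i. i \<in> I ==> i + k \<in> J" shows "sft k x \<in> filt (shifts T M J)"
proof (rule filt_sft[OF assms(1)])
 fix a assume "a \<in> shifts T M I"
 then obtain i m where a: "i \<in> I" "m \<in> M" "a = sft i m" by (rule shiftsE)
 have "sft (i + k) m \<in> filt (shifts T M J)" using shifts_filt assms(2) a by blast
 moreover have "sft (i + k) m \<simeq> sft k a" using sft_sft[of m k i] isom_sym M_Ob a by (simp add: add.commute)
 ultimately show "sft k a \<in> filt (shifts T M J)" using repleteD[OF filt_replete] by blast
qed

lemma wdec_ext: "ext_closed wdec"
proof -
 have *: "ext_closed (star T (wle k) (wgt k))" for k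
 proof (rule ext_closed_star)
  fix a b assume *: "a \<in> wle k" "b \<in> wgt k"
  have "sft 1 b \<in> wgt k" unfolding wgt_def by (rule sft_filt_shifts[OF *(2)[unfolded wgt_def]]) simp
  then show "hz a (sho b)" using wle_wgt[OF *(1)] by simp
 qed (simp_all add: wle_def wgt_def filt_ext)
 have **: "y \<in> star T (wle k) (wgt k)" if "x \<in> wdec" "z \<in> wdec" "tr x y z" for x y z k
  by (rule ext_closedD[OF * _ _ that(3)]) (use that(1,2) in "auto simp: wdec_def")
 show ?thesis unfolding ext_closed_def
 proof (intro ballI allI impI)
  fix x z y assume xyz: "x \<in> wdec" "z \<in> wdec" "tr x y z"
  show "y \<in> wdec" unfolding wdec_def
  proof
   fix k show "y \<in> star T (wle k) (wgt k)" by (rule **[OF xyz])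
  qed
 qed
qed

lemma wdec_sft: assumes "x \<in> wdec" shows "sft i x \<in> wdec"
 unfolding wdec_def
proof
 fix k
 have "x \<in> star T (wle (k - i)) (wgt (k - i))" using assms unfolding wdec_def by blast
 then obtain a b where ab: "a \<in> wle (k - i)" "b \<in> wgt (k - i)" "tr a x b" by (auto simp: star_iff)
 have "sft i a \<in> wle k" unfolding wle_def by (rule sft_filt_shifts[OF ab(1)[unfolded wle_def]]) simp
 moreover have "sft i b \<in> wgt k" unfolding wgt_def by (rule sft_filt_shifts[OF ab(2)[unfolded wgt_def]]) simp
 ultimately show "sft i x \<in> star T (wle k) (wgt k)" using tr_sft[OF ab(3), of i] unfolding star_iff by blast
qed

lemma M_wdec: assumes "m \<in> M" shows "m \<in> wdec"
 unfolding wdec_def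
proof
 fix k
 obtain z where z: "zero_object T z" using zero_ex by blast
 have z': "z \<in> wle k" "z \<in> wgt k" unfolding wle_def wgt_def using filt.zero[OF z] by blast+
 show "m \<in> star T (wle k) (wgt k)"
 proof (cases "0 \<le> k")
  case True
  then have "m \<in> wle k" unfolding wle_def using shifts_filt[of 0 "{..k}" m] assms by simp
  then show ?thesis using isom_tr[OF isom_refl z, of m] M_Ob[OF assms] z' unfolding star_iff by blast
 next
  case False
  then have "m \<in> wgt k" unfolding wgt_def using shifts_filt[of 0 "{k<..}" m] assms by simp
  then show ?thesis using isom_tr2[OF isom_refl z, of m] M_Ob[OF assms] z' unfolding star_iff by blast
 qed
qed

text \<open>Closure of \<open>wdec\<close> under retracts is not at hand, so the thick subcategory
  consists of the retracts of its objects; \<open>retr_cone\<close> closes it under cones.\<close>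

lemma retr_wdec: assumes "t \<in> Ob T" shows "\<exists>e\<in>wdec. retr t e"
proof -
 let ?R = "{t \<in> Ob T. \<exists>e\<in>wdec. retr t e}"
 have sh: "sho x \<in> wdec" "shi x \<in> wdec" if "x \<in> wdec" for x using wdec_sft[OF that, of 1] wdec_sft[OF that, of "-1"] by simp_all
 have "thick T ?R"
 proof (rule thickI)
  fix z assume z: "zero_object T z"
  have "z \<in> wdec" unfolding wdec_def
  proof
   fix k
   have "z \<in> wle k" "z \<in> wgt k" unfolding wle_def wgt_def using filt.zero[OF z] by blast+
   then show "z \<in> star T (wle k) (wgt k)"
    using isom_tr[OF isom_refl z, of z] zero_objectD(1)[OF z] unfolding star_iff by blast
  qed
  then show "z \<in> ?R" using isom_retr[OF isom_refl, of z] zero_objectD(1)[OF z] by blast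
 next
  fix x assume "x \<in> ?R"
  then show "sho x \<in> ?R" "shi x \<in> ?R" using sh retr_sho retr_shi retr_Ob by blast+
 next
  fix x y z assume *: "tr x y z" "x \<in> ?R" "y \<in> ?R"
  then obtain a b where ab: "a \<in> wdec" "retr x a" "b \<in> wdec" "retr y b" by blast
  then obtain c where c: "tr a b c" "retr z c" using retr_cone[OF *(1)] by blast
  have "c \<in> wdec" using ext_closedD[OF wdec_ext ab(3) sh(1)[OF ab(1)] tr_rot[OF c(1)]] .
  then show "z \<in> ?R" using c(2) retr_Ob by blast
 next
  fix x y assume "retr x y" "y \<in> ?R"
  then show "x \<in> ?R" using retr_trans retr_Ob by blast
 qed auto
 moreover have "m \<in> ?R" if "m \<in> M" for m using M_wdec[OF that] isom_retr[OF isom_refl, of m] M_Ob[OF that] by blast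
 ultimately show ?thesis using thick_induct[of ?R t] assms by blast
qed

definition Uo :: "'o set" where "Uo = {t \<in> Ob T. \<forall>i>0. kl t i}"
definition Vo :: "'o set" where "Vo = {s \<in> S. \<forall>i\<le>0. kl s i}"

text \<open>Cut \<open>e\<close> at weight 0. The inclusion of \<open>t\<close> dies in the part of
  positive weight and hence lifts to the part of weight at most 0, of which \<open>t\<close> is then
  a retract.\<close>

lemma Uo_retr_wle: assumes "t \<in> Uo" shows "\<exists>e\<in>wle 0. retr t e"
proof -
 have t: "t \<in> Ob T" "!!i. i > 0 ==> kl t i" using assms unfolding Uo_def by auto
 obtain e where e: "e \<in> wdec" "retr t e" using retr_wdec[OF t(1)] by blast
 then have "e \<in> star T (wle 0) (wgt 0)" unfolding wdec_def by blast
 then obtain a b where ab: "a \<in> wle 0" "b \<in> wgt 0" "tr a e b" by (auto simp: star_iff)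
 obtain f g h where d: "dist f g h" "dm f = a" "cd f = e" "cd g = b" using ab(3) by (rule trE)
 note d' = dist_ar[OF d(1)]
 obtain i p where r: "ar i" "ar p" "dm i = t" "cd i = e" "dm p = e" "cd p = t" "p ** i = idt t"
  using e(2) unfolding retr_def by blast
 have "hz t b" by (rule wgt_hz[OF ab(2) t])
 then have "g ** i = zr (dm i) (cd g)" using d' d r hzD[of t b "g ** i"] by simp
 then obtain j where j: "ar j" "dm j = dm i" "cd j = dm f" "f ** j = i"
  by - (rule dist_factor_right[OF d(1), of i], use r d in auto)
 have "(p ** f) ** j = idt t" using r d d' j by simp
 then have "retr t a" unfolding retr_def
  by (intro exI[of _ j] exI[of _ "p ** f"]) (use r d d' j in simp)
 then show ?thesis using ab(1) by blast
qed

text \<open>\<open>M\<close> need not be closed under isomorphism. Its closure is closed under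
  extensions, because Hom(M, M[1]) = 0 splits them into direct sums, which \<open>M\<close> contains
  up to isomorphism.\<close>

definition Mi :: "'o set" where "Mi = {x. \<exists>m\<in>M. x \<simeq> m}"

lemma Mi_direct_sum: assumes "set xs \<subseteq> M" shows "\<exists>b\<in>M. direct_sum T xs b"
proof -
 have "additive_cat (full_subcat T M)" using RS2_dualizing unfolding dualizing_variety_def by blast
 then obtain b where "direct_sum (full_subcat T M) xs b" using assms unfolding additive_cat_def by auto
 then show ?thesis using direct_sum_full_subcat[of M T xs b] M_Ob by blast
qed

lemma Mi_zero: "zero_object T z ==> z \<in> Mi"
 unfolding Mi_def using Mi_direct_sum[of "[]"] direct_sum_empty zero_objects_isom by fastforce

lemma Mi_ext: "ext_closed Mi"
 unfolding ext_closed_def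
proof (intro ballI allI impI)
 fix x z y assume *: "x \<in> Mi" "z \<in> Mi" "tr x y z"
 then obtain m n where mn: "m \<in> M" "x \<simeq> m" "n \<in> M" "z \<simeq> n" unfolding Mi_def by blast
 have t: "tr m y n" using tr_isom[OF *(3) mn(2) isom_refl mn(4)] tr_Ob[OF *(3)] by blast
 have "hz n (sho m)" using M_hz[OF mn(3,1), of 0 1] by simp
 then have 1: "direct_sum T [m, n] y" using tr_split_direct_sum[OF t] by blast
 obtain b where b: "b \<in> M" "direct_sum T [m, n] b" using Mi_direct_sum[of "[m, n]"] mn by auto
 then show "y \<in> Mi" unfolding Mi_def using direct_sum_unique[OF 1] by blast
qed

text \<open>The top weight is split off. The right-hand side contains all generators, and it is
  closed under extensions because objects of negative weight have no arrows to M[1].\<close>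

lemma wle_star: "wle 0 \<subseteq> star T (wle (- 1)) Mi"
 unfolding wle_def[of 0]
proof (rule filt_subset)
 obtain z where z: "zero_object T z" using zero_ex by blast
 fix a assume "a \<in> shifts T M {..0}"
 then obtain i m where a: "i \<le> 0" "m \<in> M" "a = sft i m" "a \<in> Ob T" by (rule shiftsE) simp
 show "a \<in> star T (wle (- 1)) Mi"
 proof (cases "i = 0")
  case True
  then have "a \<in> Mi" unfolding Mi_def using a isom_refl[of m] True
   by (intro CollectI bexI[of _ m]) auto
  then show ?thesis using isom_tr2[OF isom_refl z, of a] a(4) filt.zero[OF z] unfolding star_iff wle_def by blast
 next
  case False
  then have "a \<in> wle (-1)" unfolding wle_def a(3) using a by (intro shifts_filt) auto
  then show ?thesis using isom_tr[OF isom_refl z, of a] a(4) Mi_zero[OF z] unfolding star_iff by blast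
 qed
next
 show "ext_closed (star T (wle (- 1)) Mi)"
 proof (rule ext_closed_star)
  fix a b assume *: "a \<in> wle (-1)" "b \<in> Mi"
  then obtain m where m: "m \<in> M" "b \<simeq> m" unfolding Mi_def by blast
  have "hz a (sft 1 m)" using filt_kl[OF *(1)[unfolded wle_def], of 1] m(1) unfolding kl_def by auto
  then show "hz a (sho b)" using hz_isom_right[OF isom_sym[OF sho_isom[OF m(2)]], of a] filt_Ob *(1) unfolding wle_def by auto
 qed (simp_all add: Mi_ext, simp add: wle_def filt_ext)
next
 fix z assume z: "zero_object T z"
 show "z \<in> star T (wle (- 1)) Mi"
  using isom_tr[OF isom_refl z, of z] zero_objectD(1)[OF z] Mi_zero[OF z] filt.zero[OF z] unfolding star_iff wle_def by blast
qed

definition left_approx :: "'m => bool" where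
 "left_approx f \<longleftrightarrow> ar f & cd f \<in> M &
  (\<forall>a. ar a & dm a = dm f & cd a \<in> M --> (\<exists>b. ar b & dm b = cd f & cd b = cd a & b ** f = a))"

text \<open>\<open>t\<close> is a retract of some \<open>e\<close> of weight at most 0. The arrow
  from \<open>e\<close> to its part of weight 0 is an approximation, since its fibre has weight at
  most -1 and no arrows to \<open>M\<close>. This restricts to \<open>t\<close> because every arrow
  out of \<open>t\<close> extends to \<open>e\<close> along the retraction.\<close>

lemma left_approx_ex: assumes "t \<in> Uo" shows "\<exists>f. left_approx f & dm f = t"
proof -
 obtain e where e: "e \<in> wle 0" "retr t e" using Uo_retr_wle[OF assms] by blast
 then have "e \<in> star T (wle (-1)) Mi" using wle_star by blast
 then obtain a b where ab: "a \<in> wle (-1)" "b \<in> Mi" "tr a e b" by (auto simp: star_iff)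
 then obtain m where m: "m \<in> M" "b \<simeq> m" unfolding Mi_def by blast
 have "tr a e m" using tr_isom[OF ab(3) isom_refl isom_refl m(2)] tr_Ob[OF ab(3)] by blast
 then obtain f g h where d: "dist f g h" "dm f = a" "cd f = e" "cd g = m" by (rule trE)
 note d' = dist_ar[OF d(1)]
 obtain i p where r: "ar i" "ar p" "dm i = t" "cd i = e" "dm p = e" "cd p = t" "p ** i = idt t"
  using e(2) unfolding retr_def by blast
 have "left_approx (g ** i)" unfolding left_approx_def
 proof (intro conjI allI impI)
  fix k assume k: "ar k & dm k = dm (g ** i) & cd k \<in> M"
  have k': "ar k" "dm k = t" using k r d d' by auto
  have "hz a (cd k)" using filt_kl[OF ab(1)[unfolded wle_def], of 0] k unfolding kl_def by auto
  then have "k ** p ** f = zr a (cd k)" by (rule hzD) (simp_all add: k' r d d')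
  then obtain l where l: "ar l" "dm l = cd g" "cd l = cd (k ** p)" "l ** g = k ** p"
   by - (rule dist_factor_left[OF d(1), of "k ** p"], simp_all add: k' r d d')
  have "l ** g ** i = (k ** p) ** i" by (rule pull[OF l(4)]) (simp_all add: l(1-2) k' r(1-6) d d')
  also have "... = k" by (simp add: k' r)
  finally show "\<exists>b. ar b & dm b = cd (g ** i) & cd b = cd k & b ** g ** i = k"
   using l(1-3) by (intro exI[of _ l]) (simp add: k' r(1-6) d d')
 qed (simp_all add: r(1-6) d d' m)
 then show ?thesis using r d d' by (intro exI[of _ "g ** i"]) simp
qed

text \<open>In degrees above 1 the long exact sequence suffices. In degree 1 an arrow from the cone
  to M[1] comes from an arrow of \<open>t\<close> to \<open>M\<close>; the latter extends along
  \<open>f\<close>, so the former is zero. Hence approximations can be iterated.\<close>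

lemma left_approx_cone:
 assumes "t \<in> Uo" "left_approx f" "dm f = t" "dist f g h" shows "cd g \<in> Uo"
proof -
 note d = dist_ar[OF assms(4)]
 have t: "t \<in> Ob T" "!!i. i > 0 ==> kl t i" using assms unfolding Uo_def by auto
 have m: "cd f \<in> M" using assms(2) unfolding left_approx_def by blast
 have T: "tr t (cd f) (cd g)" by (rule trI[OF assms(4)]) (use assms in auto)
 have 1: "kl (cd g) i" if "i > 1" for i using kl_cone[OF T M_kl[OF m]] t(2) that by simp
 have "hz (cd g) (sft 1 n)" if n: "n \<in> M" for n
 proof (rule hzI)
  fix a assume a: "ar a" "dm a = cd g" "cd a = sft 1 n"
  have n': "n \<in> Ob T" using M_Ob n .
  have ca: "cd a = sho n" using a by simp
  have "hz (cd f) (sho n)" using M_hz[OF m n, of 0 1] by simp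
  then have "a ** g = zr (cd f) (sho n)" by (rule hzD) (simp_all add: a(1,2) ca d)
  then obtain b where b: "ar b" "dm b = cd h" "cd b = cd a" "b ** h = a"
   by - (rule dist_factor_left[OF dist_rot[OF assms(4)], of a], simp_all add: a(1,2) ca d)
  obtain b' where b': "ar b'" "dm b' = dm f" "cd b' = n" "sha b' = b"
   using sh_full[of "dm f" n b] b ca n' d by auto
  obtain l where l: "ar l" "dm l = cd f" "cd l = n" "l ** f = b'"
   using assms(2) b' n unfolding left_approx_def by blast
  have "b = sha l ** sha f" unfolding b'(4)[symmetric] l(4)[symmetric] using l(1-3) d by simp
  then have "a = (sha l ** sha f) ** h" using b(4) by simp
  also have "... = sha l ** sha f ** h" by (rule cmp_assoc) (simp_all add: l(1-3) d)
  also have "... = zr (cd g) (sft 1 n)" unfolding dist_zero3[OF assms(4)] using l d by simp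
  finally show "a = zr (cd g) (sft 1 n)" .
 qed (use d M_Ob n in auto)
 then have "kl (cd g) 1" unfolding kl_def by blast
 then have "kl (cd g) i" if "i > 0" for i using 1[of i] that by (cases "i = 1") auto
 then show ?thesis unfolding Uo_def using d by simp
qed

text \<open>\<open>u\<close> is a retract of an object filtered by M[j] with j at most 0, and these
  are the degrees in which arrows out of \<open>v\<close> vanish.\<close>

lemma hz_Vo_Uo: assumes "v \<in> Vo" "u \<in> Uo" shows "hz v u"
proof -
 obtain e where e: "e \<in> wle 0" "retr u e" using Uo_retr_wle[OF assms(2)] by blast
 have v: "v \<in> Ob T" "!!i. i \<le> 0 ==> kl v i" using assms(1) S_Ob unfolding Vo_def by auto
 have "hz v e" by (rule filt_hz_right[OF e(1)[unfolded wle_def] v(1)]) (use v(2) in "auto elim!: shiftsE simp: kl_def")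
 then show ?thesis using retr_hz_right[OF e(2) v(1)] by blast
qed

lemma hz_Uo: assumes "u \<in> Uo" "w \<in> Ob T" "!!j. j \<le> 0 ==> kr w j" shows "hz u w"
proof -
 obtain e where e: "e \<in> wle 0" "retr u e" using Uo_retr_wle[OF assms(1)] by blast
 show ?thesis using retr_hz_left[OF e(2) assms(2) wle_hz[OF e(1) assms(2,3)]] .
qed

end

subsection \<open>Duality of vector spaces\<close>

locale vspace = vectorspace K V for K :: "('k, 'r) ring_scheme" and V :: "('k, 'v) module"
begin

lemma dual_iff: "\<phi> \<in> carrier (dual K V) \<longleftrightarrow> \<phi> \<in> carrier V \<rightarrow>\<^sub>E carrier K &
  (\<forall>v\<in>carrier V. \<forall>w\<in>carrier V. \<phi> (v \<oplus>\<^bsub>V\<^esub> w) = \<phi> v \<oplus>\<^bsub>K\<^esub> \<phi> w) &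
  (\<forall>a\<in>carrier K. \<forall>v\<in>carrier V. \<phi> (a \<odot>\<^bsub>V\<^esub> v) = a \<otimes>\<^bsub>K\<^esub> \<phi> v)"
 unfolding dual_def by simp

lemma dual_add:
 assumes "\<phi> \<in> carrier (dual K V)" "\<psi> \<in> carrier (dual K V)"
 shows "(\<lambda>v\<in>carrier V. \<phi> v \<oplus>\<^bsub>K\<^esub> \<psi> v) \<in> carrier (dual K V)"
 using assms unfolding dual_iff by (auto simp: PiE_iff R.r_distr R.a_ac)

lemma dual_finsum:
 assumes "\<phi> \<in> carrier (dual K V)" "finite B" "B \<subseteq> carrier V" "a \<in> B \<rightarrow> carrier K"
 shows "\<phi> (\<Oplus>\<^bsub>V\<^esub>b\<in>B. a b \<odot>\<^bsub>V\<^esub> b) = (\<Oplus>\<^bsub>K\<^esub>b\<in>B. a b \<otimes>\<^bsub>K\<^esub> \<phi> b)"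
 using assms(2-)
proof (induction B)
 case empty
 have "\<phi> (\<zero>\<^bsub>K\<^esub> \<odot>\<^bsub>V\<^esub> \<zero>\<^bsub>V\<^esub>) = \<zero>\<^bsub>K\<^esub> \<otimes>\<^bsub>K\<^esub> \<phi> \<zero>\<^bsub>V\<^esub>" "\<phi> \<zero>\<^bsub>V\<^esub> \<in> carrier K" using assms(1) M.zero_closed unfolding dual_iff by blast+
 then show ?case by simp
next
 case (insert x B)
 have \<phi>: "\<phi> x \<in> carrier K" "\<phi> \<in> B \<rightarrow> carrier K" using assms(1) insert.prems unfolding dual_iff by auto
 have x: "x \<in> carrier V" "a x \<in> carrier K" and B: "B \<subseteq> carrier V" "a \<in> B \<rightarrow> carrier K" using insert.prems by auto
 have f: "(\<lambda>b. a b \<odot>\<^bsub>V\<^esub> b) \<in> B \<rightarrow> carrier V" "(\<lambda>b. a b \<otimes>\<^bsub>K\<^esub> \<phi> b) \<in> B \<rightarrow> carrier K" using B \<phi> by auto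
 have "\<phi> (a x \<odot>\<^bsub>V\<^esub> x \<oplus>\<^bsub>V\<^esub> (\<Oplus>\<^bsub>V\<^esub>b\<in>B. a b \<odot>\<^bsub>V\<^esub> b)) = \<phi> (a x \<odot>\<^bsub>V\<^esub> x) \<oplus>\<^bsub>K\<^esub> \<phi> (\<Oplus>\<^bsub>V\<^esub>b\<in>B. a b \<odot>\<^bsub>V\<^esub> b)"
  "\<phi> (a x \<odot>\<^bsub>V\<^esub> x) = a x \<otimes>\<^bsub>K\<^esub> \<phi> x"
  using assms(1) x M.finsum_closed[OF f(1)] smult_closed unfolding dual_iff by blast+
 then show ?case using insert x f \<phi> by simp
qed

lemma dual_basis:
 assumes fin_dim
 obtains A c where "finite A" "A \<subseteq> carrier V" "!!b. b \<in> A ==> c b \<in> carrier (dual K V)"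
  "!!v. v \<in> carrier V ==> v = (\<Oplus>\<^bsub>V\<^esub>b\<in>A. c b v \<odot>\<^bsub>V\<^esub> b)"
proof -
 obtain A where A: "finite A" "basis A" using finite_basis_exists[OF assms] by blast
 then have AV: "A \<subseteq> carrier V" unfolding basis_def by blast
 let ?P = "\<lambda>v a. a \<in> A \<rightarrow>\<^sub>E carrier K & lincomb a A = v"
 have ex1: "\<exists>!a. ?P v a" if "v \<in> carrier V" for v using basis_criterion[OF A(1) AV] A(2) that by blast
 define co where "co v = (THE a. ?P v a)" for v
 have co: "co v \<in> A \<rightarrow>\<^sub>E carrier K" "lincomb (co v) A = v" if "v \<in> carrier V" for v
  using theI'[OF ex1[OF that]] unfolding co_def by blast+
 have eq: "b \<in> A ==> co v b = a b" if "v \<in> carrier V" "a \<in> A \<rightarrow> carrier K" "lincomb a A = v" for v a b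
 proof -
  have l: "lincomb (restrict a A) A = lincomb a A" unfolding lincomb_def
   by (rule M.finsum_cong') (use that(2) AV in auto)
  have "?P v (restrict a A)" using that(2,3) l by auto
  then show "b \<in> A ==> co v b = a b" using ex1[OF that(1)] co[OF that(1)] by (metis restrict_apply')
 qed
 define c where "c b = (\<lambda>v\<in>carrier V. co v b)" for b
 show thesis
 proof (rule that[OF A(1) AV, of c])
  fix b assume b: "b \<in> A"
  have 1: "co (v \<oplus>\<^bsub>V\<^esub> w) b = co v b \<oplus>\<^bsub>K\<^esub> co w b" if "v \<in> carrier V" "w \<in> carrier V" for v w
  proof (rule eq[OF _ _ _ b, of "v \<oplus>\<^bsub>V\<^esub> w" "\<lambda>b. co v b \<oplus>\<^bsub>K\<^esub> co w b"])
   have p: "co v \<in> A \<rightarrow> carrier K" "co w \<in> A \<rightarrow> carrier K" using co that by (auto simp: PiE_iff)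
   show "lincomb (\<lambda>b. co v b \<oplus>\<^bsub>K\<^esub> co w b) A = v \<oplus>\<^bsub>V\<^esub> w"
    using lincomb_sum[OF A(1) AV p] co(2)[OF that(1)] co(2)[OF that(2)] by simp
   show "(\<lambda>b. co v b \<oplus>\<^bsub>K\<^esub> co w b) \<in> A \<rightarrow> carrier K" using p by auto
  qed (use that in auto)
  have 2: "co (a \<odot>\<^bsub>V\<^esub> v) b = a \<otimes>\<^bsub>K\<^esub> co v b" if "a \<in> carrier K" "v \<in> carrier V" for a v
  proof (rule eq[OF _ _ _ b, of "a \<odot>\<^bsub>V\<^esub> v" "\<lambda>b. a \<otimes>\<^bsub>K\<^esub> co v b"])
   have p: "co v \<in> A \<rightarrow> carrier K" using co that by (auto simp: PiE_iff)
   show "lincomb (\<lambda>b. a \<otimes>\<^bsub>K\<^esub> co v b) A = a \<odot>\<^bsub>V\<^esub> v"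
    using lincomb_smult[OF AV p that(1)] co(2)[OF that(2)] by simp
   show "(\<lambda>b. a \<otimes>\<^bsub>K\<^esub> co v b) \<in> A \<rightarrow> carrier K" using p that by auto
  qed (use that in auto)
  have 3: "co v b \<in> carrier K" if "v \<in> carrier V" for v using co(1)[OF that] b by auto
  show "c b \<in> carrier (dual K V)" unfolding dual_iff c_def using 1 2 3 by simp
 next
  fix v assume v: "v \<in> carrier V"
  have "(\<Oplus>\<^bsub>V\<^esub>b\<in>A. c b v \<odot>\<^bsub>V\<^esub> b) = lincomb (co v) A" unfolding lincomb_def c_def using v by simp
  then show "v = (\<Oplus>\<^bsub>V\<^esub>b\<in>A. c b v \<odot>\<^bsub>V\<^esub> b)" using co[OF v] by simp
 qed
qed

lemma dual_separates:
 assumes fin_dim "v \<in> carrier V" "!!\<phi>. \<phi> \<in> carrier (dual K V) ==> \<phi> v = \<zero>\<^bsub>K\<^esub>" shows "v = \<zero>\<^bsub>V\<^esub>"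
proof -
 obtain A c where A: "finite A" "A \<subseteq> carrier V" "!!b. b \<in> A ==> c b \<in> carrier (dual K V)"
  "!!v. v \<in> carrier V ==> v = (\<Oplus>\<^bsub>V\<^esub>b\<in>A. c b v \<odot>\<^bsub>V\<^esub> b)" using dual_basis[OF assms(1)] by blast
 have "(\<Oplus>\<^bsub>V\<^esub>b\<in>A. c b v \<odot>\<^bsub>V\<^esub> b) = (\<Oplus>\<^bsub>V\<^esub>b\<in>A. \<zero>\<^bsub>V\<^esub>)"
  by (rule M.finsum_cong') (use assms(3)[OF A(3)] A(2) in "auto simp: subset_iff")
 then show ?thesis using A(4)[OF assms(2)] by simp
qed

text \<open>Surjectivity of the evaluation map onto the bidual. The preimage is the vector whose
  coordinates are the values of \<Psi> on the coordinate functionals.\<close>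

lemma dual_reflexive:
 assumes fin_dim
  and cl: "!!\<phi>. \<phi> \<in> carrier (dual K V) ==> \<Psi> \<phi> \<in> carrier K"
  and pl: "!!\<phi> \<psi>. [|\<phi> \<in> carrier (dual K V); \<psi> \<in> carrier (dual K V)|] ==> \<Psi> (\<lambda>v\<in>carrier V. \<phi> v \<oplus>\<^bsub>K\<^esub> \<psi> v) = \<Psi> \<phi> \<oplus>\<^bsub>K\<^esub> \<Psi> \<psi>"
  and sm: "!!a \<phi>. [|a \<in> carrier K; \<phi> \<in> carrier (dual K V)|] ==> \<Psi> (\<lambda>v\<in>carrier V. a \<otimes>\<^bsub>K\<^esub> \<phi> v) = a \<otimes>\<^bsub>K\<^esub> \<Psi> \<phi>"
 shows "\<exists>v\<in>carrier V. \<forall>\<phi>\<in>carrier (dual K V). \<Psi> \<phi> = \<phi> v"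
proof -
 obtain A c where A: "finite A" "A \<subseteq> carrier V" "!!b. b \<in> A ==> c b \<in> carrier (dual K V)"
  "!!v. v \<in> carrier V ==> v = (\<Oplus>\<^bsub>V\<^esub>b\<in>A. c b v \<odot>\<^bsub>V\<^esub> b)" using dual_basis[OF assms(1)] by blast
 have c: "c b v \<in> carrier K" if "b \<in> A" "v \<in> carrier V" for b v using A(3)[OF that(1)] that(2) unfolding dual_iff by auto
 let ?v = "\<Oplus>\<^bsub>V\<^esub>b\<in>A. \<Psi> (c b) \<odot>\<^bsub>V\<^esub> b"
 have \<Psi>: "(\<lambda>b. \<Psi> (c b)) \<in> A \<rightarrow> carrier K" using A(3) cl by auto
 have "?v \<in> carrier V" by (rule M.finsum_closed) (use A cl in auto)
 moreover have "\<Psi> \<phi> = \<phi> ?v" if \<phi>: "\<phi> \<in> carrier (dual K V)" for \<phi>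
 proof -
  have \<phi>K: "\<phi> v \<in> carrier K" if "v \<in> carrier V" for v using \<phi> that unfolding dual_iff by auto
  let ?s = "\<lambda>B. \<lambda>v\<in>carrier V. \<Oplus>\<^bsub>K\<^esub>b\<in>B. \<phi> b \<otimes>\<^bsub>K\<^esub> c b v"
  \<comment> \<open>\<Psi> is additive for two functionals at a time, so its value on the coordinate
    expansion of \<phi> is found by induction over the partial sums.\<close>
  have "?s B \<in> carrier (dual K V) & \<Psi> (?s B) = (\<Oplus>\<^bsub>K\<^esub>b\<in>B. \<phi> b \<otimes>\<^bsub>K\<^esub> \<Psi> (c b))" if "finite B" "B \<subseteq> A" for B
   using that
  proof (induction B)
   case empty
   have z: "(\<lambda>v\<in>carrier V. \<zero>\<^bsub>K\<^esub>) \<in> carrier (dual K V)" unfolding dual_iff by simp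
   have "\<Psi> (\<lambda>v\<in>carrier V. \<zero>\<^bsub>K\<^esub>) = \<Psi> (\<lambda>v\<in>carrier V. \<zero>\<^bsub>K\<^esub> \<otimes>\<^bsub>K\<^esub> (\<lambda>v\<in>carrier V. \<zero>\<^bsub>K\<^esub>) v)" by (rule arg_cong[of _ _ \<Psi>]) auto
   also have "... = \<zero>\<^bsub>K\<^esub>" using sm[OF _ z, of "\<zero>\<^bsub>K\<^esub>"] cl[OF z] by simp
   finally show ?case using z unfolding R.finsum_empty by blast
  next
   case (insert x B)
   have IH: "?s B \<in> carrier (dual K V)" "\<Psi> (?s B) = (\<Oplus>\<^bsub>K\<^esub>b\<in>B. \<phi> b \<otimes>\<^bsub>K\<^esub> \<Psi> (c b))" using insert.IH insert.prems by blast+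
   have x: "x \<in> A" "x \<in> carrier V" "\<phi> x \<in> carrier K" using insert.prems A(2) \<phi>K by auto
   let ?t = "\<lambda>v\<in>carrier V. \<phi> x \<otimes>\<^bsub>K\<^esub> c x v"
   have t: "?t \<in> carrier (dual K V)" "\<Psi> ?t = \<phi> x \<otimes>\<^bsub>K\<^esub> \<Psi> (c x)"
    using A(3)[OF x(1)] x(3) sm[OF x(3) A(3)[OF x(1)]] unfolding dual_iff by (auto simp: r_distr m_lcomm PiE_iff)
   have "(\<Oplus>\<^bsub>K\<^esub>b\<in>insert x B. \<phi> b \<otimes>\<^bsub>K\<^esub> c b v) = ?t v \<oplus>\<^bsub>K\<^esub> ?s B v" if "v \<in> carrier V" for v
    using insert x that c \<phi>K A(2) by (simp add: subset_iff)
   then have e: "?s (insert x B) = (\<lambda>v\<in>carrier V. ?t v \<oplus>\<^bsub>K\<^esub> ?s B v)" by (intro restrict_ext) simp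
   have "(\<lambda>v\<in>carrier V. ?t v \<oplus>\<^bsub>K\<^esub> ?s B v) \<in> carrier (dual K V)" by (rule dual_add[OF t(1) IH(1)])
   moreover have "(\<Oplus>\<^bsub>K\<^esub>b\<in>insert x B. \<phi> b \<otimes>\<^bsub>K\<^esub> \<Psi> (c b)) = \<Psi> ?t \<oplus>\<^bsub>K\<^esub> \<Psi> (?s B)"
    unfolding t(2) IH(2) using insert x cl A(2,3) \<phi>K by (simp add: subset_iff)
   ultimately show ?case unfolding e using pl[OF t(1) IH(1)] by metis
  qed
  then have 1: "\<Psi> (?s A) = (\<Oplus>\<^bsub>K\<^esub>b\<in>A. \<phi> b \<otimes>\<^bsub>K\<^esub> \<Psi> (c b))" using A(1) by simp
  have "?s A v = \<phi> v" if v: "v \<in> carrier V" for v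
  proof -
   have "\<phi> v = \<phi> (\<Oplus>\<^bsub>V\<^esub>b\<in>A. c b v \<odot>\<^bsub>V\<^esub> b)" using A(4)[OF v] by simp
   also have "... = (\<Oplus>\<^bsub>K\<^esub>b\<in>A. c b v \<otimes>\<^bsub>K\<^esub> \<phi> b)" by (rule dual_finsum[OF \<phi> A(1,2)]) (use c v in auto)
   also have "... = (\<Oplus>\<^bsub>K\<^esub>b\<in>A. \<phi> b \<otimes>\<^bsub>K\<^esub> c b v)" by (rule R.finsum_cong') (use c v \<phi>K A(2) R.m_comm in auto)
   finally show ?thesis using v by simp
  qed
  then have "?s A = \<phi>" using \<phi> unfolding dual_iff by (intro extensionalityI[of _ "carrier V"]) (auto simp: PiE_iff)
  then have "\<Psi> \<phi> = (\<Oplus>\<^bsub>K\<^esub>b\<in>A. \<phi> b \<otimes>\<^bsub>K\<^esub> \<Psi> (c b))" using 1 by simp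
  also have "... = (\<Oplus>\<^bsub>K\<^esub>b\<in>A. \<Psi> (c b) \<otimes>\<^bsub>K\<^esub> \<phi> b)" by (rule R.finsum_cong') (use cl \<phi>K A(2,3) R.m_comm in auto)
  also have "... = \<phi> ?v" using dual_finsum[OF \<phi> A(1,2) \<Psi>] by (rule sym)
  finally show ?thesis .
 qed
 ultimately show ?thesis by blast
qed

end

section \<open>Linear functionals on Hom-spaces\<close>

context lin_category
begin

text \<open>Functionals as functions on arrows, without the extensionality imposed by
  \<open>dual\<close>, so that composing with an arrow on either side gives a functional without a
  new restriction. \<open>linfun_dual\<close> is the translation.\<close>

definition linfun :: "'o => 'o => ('m => 'k) => bool" where
 "linfun x y \<phi> \<longleftrightarrow> (\<forall>f\<in>hom x y. \<phi> f \<in> carrier K & (\<forall>g\<in>hom x y. \<phi> (f \<boxplus> g) = \<phi> f \<oplus> \<phi> g) &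
  (\<forall>a\<in>carrier K. \<phi> (sm a f) = a \<otimes> \<phi> f))"

lemma linfunD:
 assumes "linfun x y \<phi>" "ar f" "dm f = x" "cd f = y"
 shows "\<phi> f \<in> carrier K" "a \<in> carrier K ==> \<phi> (sm a f) = a \<otimes> \<phi> f"
  "[|ar g; dm g = x; cd g = y|] ==> \<phi> (f \<boxplus> g) = \<phi> f \<oplus> \<phi> g"
 using assms unfolding linfun_def by auto

lemma linfunI:
 assumes "!!f. [|ar f; dm f = x; cd f = y|] ==> \<phi> f \<in> carrier K"
  "!!f g. [|ar f; dm f = x; cd f = y; ar g; dm g = x; cd g = y|] ==> \<phi> (f \<boxplus> g) = \<phi> f \<oplus> \<phi> g"
  "!!a f. [|a \<in> carrier K; ar f; dm f = x; cd f = y|] ==> \<phi> (sm a f) = a \<otimes> \<phi> f"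
 shows "linfun x y \<phi>"
 using assms unfolding linfun_def by simp

lemma linfun_zr: assumes "linfun x y \<phi>" "x \<in> Ob C" "y \<in> Ob C" shows "\<phi> (zr x y) = \<zero>"
proof -
 have "\<phi> (zr x y) \<in> carrier K" "\<phi> (zr x y \<boxplus> zr x y) = \<phi> (zr x y) \<oplus> \<phi> (zr x y)"
  using linfunD[OF assms(1), of "zr x y"] assms(2-) by auto
 then show ?thesis using assms(2-) by simp
qed

lemma linfun_ng: assumes "linfun x y \<phi>" "ar f" "dm f = x" "cd f = y" shows "\<phi> (ng f) = \<ominus> \<phi> f"
 using linfunD(2)[OF assms, of "\<ominus> \<one>"] linfunD(1)[OF assms] ng_sm[OF assms(2)] by (simp add: l_minus)

lemma linfun_diff: assumes "linfun x y \<phi>" "ar f" "dm f = x" "cd f = y" "ar g" "dm g = x" "cd g = y" "\<phi> (f \<boxplus> ng g) = \<zero>"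
 shows "\<phi> f = \<phi> g"
proof -
 have k: "\<phi> f \<in> carrier K" "\<phi> g \<in> carrier K" using linfunD(1)[OF assms(1-4)] linfunD(1)[OF assms(1,5-7)] by auto
 have "\<phi> f \<oplus> \<ominus> \<phi> g = \<zero>" using linfunD(3)[OF assms(1-4), of "ng g"] linfun_ng[OF assms(1,5-7)] assms(5-) by simp
 then show ?thesis using sum_zero_eq_neg[of "\<phi> f" "\<ominus> \<phi> g"] k by simp
qed

lemma linfun_cmp_left: "[|linfun x z \<phi>; ar h; dm h = y; cd h = z|] ==> linfun x y (\<lambda>f. \<phi> (h ** f))"
 by (rule linfunI) (simp_all add: cmp_pl cmp_sm linfunD)

lemma linfun_cmp_right: "[|linfun x z \<phi>; ar h; dm h = x; cd h = y|] ==> linfun y z (\<lambda>f. \<phi> (f ** h))"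
 by (rule linfunI) (simp_all add: pl_cmp sm_cmp linfunD)

lemma hom_vspace: "[|x \<in> Ob C; y \<in> Ob C|] ==> vspace K (Hom C x y)"
 unfolding vspace_def using hom_vectorspace .

lemma linfun_dual: assumes "x \<in> Ob C" "y \<in> Ob C"
 shows "\<phi> \<in> carrier (dual K (Hom C x y)) \<longleftrightarrow> linfun x y \<phi> & \<phi> \<in> extensional (arr C x y)"
 unfolding vspace.dual_iff[OF hom_vspace[OF assms]] linfun_def PiE_iff
 using assms by (auto simp: pl_eq sm_eq)

lemma linfun_restrict: assumes "x \<in> Ob C" "y \<in> Ob C" "linfun x y \<phi>"
 shows "restrict \<phi> (arr C x y) \<in> carrier (dual K (Hom C x y))"
 unfolding linfun_dual[OF assms(1,2)] using assms by (auto intro!: linfunI simp: linfunD)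

end

context relative_serre_quadruple
begin

subsection \<open>Serre duality as a trace form\<close>

abbreviation sso :: "'o => 'o" where "sso \<equiv> omap \<SS>"

lemma SS_functor: "lin_functor K (full_tri_subcat T S) (full_tri_subcat T S) \<SS>"
 using RS1_equivalence unfolding triangle_equivalence_def triangle_functor_def by blast

lemma sso_S [simp]: "x \<in> S ==> sso x \<in> S"
 using SS_functor unfolding lin_functor_def full_tri_subcat_def by simp

lemma sso_Ob [simp]: "x \<in> S ==> sso x \<in> Ob T"
 using S_Ob by simp

lemma ssa:
 assumes "ar f" "dm f \<in> S" "cd f \<in> S"
 shows "ar (amap \<SS> f)" "dm (amap \<SS> f) = sso (dm f)" "cd (amap \<SS> f) = sso (cd f)"
proof -
 have "amap \<SS> \<in> module_hom K (Hom T (dm f) (cd f)) (Hom T (sso (dm f)) (sso (cd f)))"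
  using SS_functor assms unfolding lin_functor_def full_tri_subcat_def by simp
 then have "amap \<SS> f \<in> arr T (sso (dm f)) (sso (cd f))" using assms arI unfolding module_hom_def by auto
 then show "ar (amap \<SS> f)" "dm (amap \<SS> f) = sso (dm f)" "cd (amap \<SS> f) = sso (cd f)" using assms by simp_all
qed

lemma ssa_idt: "x \<in> S ==> amap \<SS> (idt x) = idt (sso x)"
 using SS_functor unfolding lin_functor_def full_tri_subcat_def by simp

definition et :: "'o => 'o => ('m => 'k) => 'm" where
 "et = (SOME \<eta>.
  (\<forall>x\<in>S. \<forall>y\<in>Ob T. \<eta> x y \<in> module_hom K (dual K (Hom T x y)) (Hom T y (sso x)) &
   bij_betw (\<eta> x y) (carrier (dual K (Hom T x y))) (arr T y (sso x))) &
  (\<forall>x\<in>S. \<forall>x'\<in>S. \<forall>y\<in>Ob T. \<forall>y'\<in>Ob T. \<forall>a\<in>arr T x x'. \<forall>b\<in>arr T y' y. \<forall>\<phi>\<in>carrier (dual K (Hom T x y)).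
   \<eta> x' y' (\<lambda>g\<in>arr T x' y'. \<phi> ((b ** g) ** a)) = (amap \<SS> a ** \<eta> x y \<phi>) ** b))"

lemma et:
 assumes "x \<in> S" "y \<in> Ob T"
 shows "et x y \<in> module_hom K (dual K (Hom T x y)) (Hom T y (sso x))"
  "bij_betw (et x y) (carrier (dual K (Hom T x y))) (arr T y (sso x))"
  "[|ar a; dm a = x; cd a \<in> S; ar b; cd b = y; \<phi> \<in> carrier (dual K (Hom T x y))|] ==>
   et (cd a) (dm b) (\<lambda>g\<in>arr T (cd a) (dm b). \<phi> ((b ** g) ** a)) = (amap \<SS> a ** et x y \<phi>) ** b"
 using someI_ex[OF RS1_serre[unfolded serre_duality_def]] assms S_Ob
 unfolding et_def[symmetric] by simp_all

lemma et_ar: assumes "x \<in> S" "y \<in> Ob T" "\<phi> \<in> carrier (dual K (Hom T x y))"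
 shows "ar (et x y \<phi>)" "dm (et x y \<phi>) = y" "cd (et x y \<phi>) = sso x"
proof -
 have "et x y \<phi> \<in> arr T y (sso x)" using bij_betwE[OF et(2)[OF assms(1,2)]] assms(3) by blast
 then show "ar (et x y \<phi>)" "dm (et x y \<phi>) = y" "cd (et x y \<phi>) = sso x" using assms by simp_all
qed

lemma et_surj: assumes "x \<in> S" "ar h" "cd h = sso x"
 obtains \<phi> where "\<phi> \<in> carrier (dual K (Hom T x (dm h)))" "et x (dm h) \<phi> = h"
proof -
 have d: "dm h \<in> Ob T" using assms(2) by simp
 have "h \<in> arr T (dm h) (sso x)" unfolding arr_iff[OF d sso_Ob[OF assms(1)]] using assms(2,3) by blast
 then have "h \<in> et x (dm h) ` carrier (dual K (Hom T x (dm h)))"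
  using bij_betw_imp_surj_on[OF et(2)[OF assms(1) d]] by blast
 then show thesis by (rule imageE) (rule that, assumption, erule sym)
qed

text \<open>Under Serre duality \<open>h\<close> corresponds to a functional on the endomorphisms of
  \<open>x\<close>, and this is its value at the identity. The whole duality is recovered from this
  one form (\<open>tau_et\<close>).\<close>

definition tau :: "'o => 'm => 'k" where
 "tau x h = the_inv_into (carrier (dual K (Hom T x x))) (et x x) h (idt x)"

lemma tau_et_id: "[|x \<in> S; \<phi> \<in> carrier (dual K (Hom T x x))|] ==> tau x (et x x \<phi>) = \<phi> (idt x)"
 unfolding tau_def using the_inv_into_f_f[OF bij_betw_imp_inj_on[OF et(2)]] S_Ob by metis

text \<open>Naturality in the second argument, taken along \<open>g\<close>, moves the functional
  from Hom(x, y) to the endomorphisms of \<open>x\<close>, where it is evaluated at the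
  identity.\<close>

lemma tau_et: assumes "x \<in> S" "\<phi> \<in> carrier (dual K (Hom T x y))" "ar g" "dm g = x" "cd g = y"
 shows "tau x (et x y \<phi> ** g) = \<phi> g"
proof -
 have xy: "x \<in> Ob T" "y \<in> Ob T" using assms by auto
 note e = et_ar[OF assms(1) xy(2) assms(2)]
 let ?\<psi> = "\<lambda>f\<in>arr T x x. \<phi> ((g ** f) ** idt x)"
 have "linfun x y \<phi>" using assms(2) linfun_dual[OF xy] by blast
 then have "linfun x x (\<lambda>f. \<phi> ((g ** f) ** idt x))"
  by (intro linfunI) (simp_all add: assms xy linfunD cmp_pl cmp_sm pl_cmp sm_cmp)
 then have \<psi>: "?\<psi> \<in> carrier (dual K (Hom T x x))" by (rule linfun_restrict[OF xy(1) xy(1)])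
 have "et (cd (idt x)) (dm g) (\<lambda>f\<in>arr T (cd (idt x)) (dm g). \<phi> ((g ** f) ** idt x)) = (amap \<SS> (idt x) ** et x y \<phi>) ** g"
  by (rule et(3)[OF assms(1) xy(2)]) (simp_all add: assms xy)
 then have "et x x ?\<psi> = et x y \<phi> ** g" using e by (simp add: ssa_idt assms xy)
 then show ?thesis using tau_et_id[OF assms(1) \<psi>] assms xy by simp
qed

lemma tau_linfun: assumes "x \<in> S" shows "linfun x (sso x) (tau x)"
proof (rule linfunI)
 have x: "x \<in> Ob T" using assms S_Ob by simp
 note m = et(1)[OF assms x]
 { fix f assume f: "ar f" "dm f = x" "cd f = sso x"
  then obtain \<phi> where \<phi>: "\<phi> \<in> carrier (dual K (Hom T x x))" "et x x \<phi> = f"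
   using et_surj[OF assms, of f] by auto
  have \<phi>l: "linfun x x \<phi>" using \<phi>(1) linfun_dual[OF x x] by blast
  have tf: "tau x f = \<phi> (idt x)" using tau_et_id[OF assms \<phi>(1)] \<phi>(2) by simp
  then show "tau x f \<in> carrier K" using linfunD(1)[OF \<phi>l] x by simp
  { fix g assume g: "ar g" "dm g = x" "cd g = sso x"
   then obtain \<psi> where \<psi>: "\<psi> \<in> carrier (dual K (Hom T x x))" "et x x \<psi> = g"
    using et_surj[OF assms, of g] by auto
   have \<psi>l: "linfun x x \<psi>" using \<psi>(1) linfun_dual[OF x x] by blast
   let ?p = "\<lambda>v\<in>arr T x x. \<phi> v \<oplus> \<psi> v"
   have p: "?p \<in> carrier (dual K (Hom T x x))"
    by (rule linfun_restrict[OF x x], rule linfunI)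
     (simp_all add: linfunD[OF \<phi>l] linfunD[OF \<psi>l] r_distr a_ac)
   have "et x x ?p = f \<boxplus> g" using m \<phi> \<psi> f g x pl_eq[of f x "sso x"] unfolding module_hom_def dual_def by simp
   then show "tau x (f \<boxplus> g) = tau x f \<oplus> tau x g"
    using tau_et_id[OF assms p] tau_et_id[OF assms \<psi>(1)] tf \<psi>(2) x by simp }
  fix a assume a: "a \<in> carrier K"
  let ?p = "\<lambda>v\<in>arr T x x. a \<otimes> \<phi> v"
  have p: "?p \<in> carrier (dual K (Hom T x x))"
   by (rule linfun_restrict[OF x x], rule linfunI) (simp_all add: linfunD[OF \<phi>l] r_distr m_lcomm a)
  have "et x x ?p = sm a f" using m \<phi> f x a sm_eq[of f x "sso x"] unfolding module_hom_def dual_def by simp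
  then show "tau x (sm a f) = a \<otimes> tau x f" using tau_et_id[OF assms p] tf x by simp }
qed

text \<open>\<^term>\<open>tau\<close> is the trace form of the Serre duality on \<open>S\<close>.\<close>

lemma tau_cyclic:
 assumes "ar a" "dm a \<in> S" "cd a \<in> S" "ar h" "dm h = cd a" "cd h = sso (dm a)"
 shows "tau (cd a) (amap \<SS> a ** h) = tau (dm a) (h ** a)"
proof -
 let ?x = "dm a" and ?y = "cd a"
 have ob: "?x \<in> Ob T" "?y \<in> Ob T" using assms by auto
 obtain \<phi> where \<phi>: "\<phi> \<in> carrier (dual K (Hom T ?x ?y))" "et ?x ?y \<phi> = h"
  using et_surj[OF assms(2,4,6)] assms(5) by auto
 have \<phi>l: "linfun ?x ?y \<phi>" using \<phi>(1) linfun_dual[OF ob] by blast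
 have p: "(\<lambda>f\<in>arr T ?y ?y. \<phi> ((idt ?y ** f) ** a)) \<in> carrier (dual K (Hom T ?y ?y))"
  by (rule linfun_restrict[OF ob(2) ob(2)], rule linfunI)
   (simp_all add: assms(1) ob linfunD[OF \<phi>l] cmp_pl cmp_sm pl_cmp sm_cmp)
 have "et ?y ?y (\<lambda>f\<in>arr T ?y ?y. \<phi> ((idt ?y ** f) ** a)) = (amap \<SS> a ** h) ** idt ?y"
  using et(3)[OF assms(2) ob(2) assms(1) refl assms(3), of "idt ?y" \<phi>] \<phi> ob by simp
 also have "... = amap \<SS> a ** h" using assms ob ssa[OF assms(1-3)] by simp
 finally have "tau ?y (amap \<SS> a ** h) = \<phi> a" using tau_et_id[OF assms(3) p] ob assms(1) by simp
 then show ?thesis using tau_et[OF assms(2) \<phi>(1) assms(1)] \<phi>(2) by simp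
qed

lemma serre_rep:
 assumes "x \<in> S" "y \<in> Ob T" "linfun x y \<phi>"
 obtains h where "ar h" "dm h = y" "cd h = sso x" "!!g. [|ar g; dm g = x; cd g = y|] ==> \<phi> g = tau x (h ** g)"
proof -
 have x: "x \<in> Ob T" using assms S_Ob by simp
 have p: "restrict \<phi> (arr T x y) \<in> carrier (dual K (Hom T x y))" using linfun_restrict[OF x assms(2,3)] .
 show thesis by (rule that[OF et_ar[OF assms(1,2) p]]) (use tau_et[OF assms(1) p] x assms(2) in simp)
qed

lemma serre_nondeg_left:
 assumes "x \<in> S" "ar h" "cd h = sso x" "!!g. [|ar g; dm g = x; cd g = dm h|] ==> tau x (h ** g) = \<zero>"
 shows "h = zr (dm h) (sso x)"
proof -
 have x: "x \<in> Ob T" using assms S_Ob by simp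
 have y: "dm h \<in> Ob T" using assms by simp
 obtain \<phi> where \<phi>: "\<phi> \<in> carrier (dual K (Hom T x (dm h)))" "et x (dm h) \<phi> = h" using et_surj[OF assms(1-3)] .
 have 0: "\<phi> v = \<zero>" if "v \<in> arr T x (dm h)" for v
  using tau_et[OF assms(1) \<phi>(1), of v] assms(4)[of v] that x y \<phi>(2) by simp
 \<comment> \<open>A functional that vanishes equals its own double; linearity of \<open>et\<close>
   turns this into \<open>h \<boxplus> h = h\<close>.\<close>
 have e: "\<phi> = (\<lambda>v\<in>arr T x (dm h). \<phi> v \<oplus> \<phi> v)"
 proof (rule extensionalityI[of _ "arr T x (dm h)"])
  show "\<phi> \<in> extensional (arr T x (dm h))" using \<phi>(1) linfun_dual[OF x y] by blast
 qed (simp_all add: 0)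
 have "et x (dm h) (\<lambda>v\<in>arr T x (dm h). \<phi> v \<oplus> \<phi> v) = et x (dm h) \<phi> \<boxplus> et x (dm h) \<phi>"
  using et(1)[OF assms(1) y] \<phi>(1) pl_eq[OF et_ar[OF assms(1) y \<phi>(1)]] unfolding module_hom_def dual_def by simp
 then have "h \<boxplus> h = h" unfolding e[symmetric] \<phi>(2) by (rule sym)
 then show ?thesis using zr_unique[OF assms(2)] assms(3) by simp
qed

lemma hom_fin_dim: "[|x \<in> Ob T; y \<in> Ob T|] ==> vectorspace.fin_dim K (Hom T x y)"
 using RS0_hom_finite unfolding hom_finite_def by blast

lemma serre_nondeg_right:
 assumes "x \<in> S" "ar g" "dm g = x" "!!h. [|ar h; dm h = cd g; cd h = sso x|] ==> tau x (h ** g) = \<zero>"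
 shows "g = zr x (cd g)"
proof -
 have ob: "x \<in> Ob T" "cd g \<in> Ob T" using assms by auto
 show ?thesis unfolding zr_def
 proof (rule vspace.dual_separates[OF hom_vspace[OF ob] hom_fin_dim[OF ob]])
  fix \<phi> assume \<phi>: "\<phi> \<in> carrier (dual K (Hom T x (cd g)))"
  show "\<phi> g = \<zero>" using tau_et[OF assms(1) \<phi> assms(2,3) refl] assms(4)[OF et_ar[OF assms(1) ob(2) \<phi>]] by simp
 qed (use assms ob in simp)
qed

text \<open>The functional lives on the dual side Hom(y, sso x), so it is a point of the bidual of
  Hom(x, y); finite dimension turns it into an arrow.\<close>

lemma serre_rep2:
 assumes "x \<in> S" "y \<in> Ob T" "linfun y (sso x) \<Psi>"
 obtains g where "ar g" "dm g = x" "cd g = y" "!!h. [|ar h; dm h = y; cd h = sso x|] ==> \<Psi> h = tau x (h ** g)"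
proof -
 have x: "x \<in> Ob T" using assms S_Ob by simp
 note e = et_ar[OF assms(1,2)] and m = et(1)[OF assms(1,2)]
 have "\<exists>g\<in>arr T x y. \<forall>\<phi>\<in>carrier (dual K (Hom T x y)). \<Psi> (et x y \<phi>) = \<phi> g"
 proof (rule vspace.dual_reflexive[OF hom_vspace[OF x assms(2)] hom_fin_dim[OF x assms(2)]])
  fix \<phi> assume p: "\<phi> \<in> carrier (dual K (Hom T x y))"
  show "\<Psi> (et x y \<phi>) \<in> carrier K" using linfunD(1)[OF assms(3) e[OF p]] .
  { fix \<psi> assume q: "\<psi> \<in> carrier (dual K (Hom T x y))"
   have "et x y (\<lambda>v\<in>arr T x y. \<phi> v \<oplus> \<psi> v) = et x y \<phi> \<boxplus> et x y \<psi>"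
    using m p q pl_eq[OF e[OF p]] unfolding module_hom_def dual_def by simp
   then show "\<Psi> (et x y (\<lambda>v\<in>arr T x y. \<phi> v \<oplus> \<psi> v)) = \<Psi> (et x y \<phi>) \<oplus> \<Psi> (et x y \<psi>)"
    using linfunD(3)[OF assms(3) e[OF p] e[OF q]] by simp }
  fix a assume a: "a \<in> carrier K"
  have "et x y (\<lambda>v\<in>arr T x y. a \<otimes> \<phi> v) = sm a (et x y \<phi>)"
   using m p a sm_eq[OF e[OF p]] unfolding module_hom_def dual_def by simp
  then show "\<Psi> (et x y (\<lambda>v\<in>arr T x y. a \<otimes> \<phi> v)) = a \<otimes> \<Psi> (et x y \<phi>)"
   using linfunD(2)[OF assms(3) e[OF p] a] by simp
 qed
 then obtain g where g: "ar g" "dm g = x" "cd g = y" "!!\<phi>. \<phi> \<in> carrier (dual K (Hom T x y)) ==> \<Psi> (et x y \<phi>) = \<phi> g"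
  using x assms(2) by auto
 show thesis
 proof (rule that[OF g(1-3)])
  fix h assume h: "ar h" "dm h = y" "cd h = sso x"
  then obtain \<phi> where \<phi>: "\<phi> \<in> carrier (dual K (Hom T x y))" "et x y \<phi> = h" using et_surj[OF assms(1), of h] by auto
  show "\<Psi> h = tau x (h ** g)" using g(4)[OF \<phi>(1)] tau_et[OF assms(1) \<phi>(1) g(1-3)] \<phi>(2) by simp
 qed
qed

lemma serre_hz: assumes "x \<in> S" "y \<in> Ob T" shows "hz x y \<longleftrightarrow> hz y (sso x)"
proof
 have x: "x \<in> Ob T" using assms S_Ob by simp
 note t = linfun_zr[OF tau_linfun[OF assms(1)] x sso_Ob[OF assms(1)]]
 { assume "hz x y"
  then have "tau x (h ** g) = \<zero>" if "ar h" "dm h = y" "cd h = sso x" "ar g" "dm g = x" "cd g = y" for h g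
   using hzD[of x y g] that t x by simp
  then show "hz y (sso x)" using serre_nondeg_left[OF assms(1)] x assms by (intro hzI) auto }
 assume "hz y (sso x)"
 then have "tau x (h ** g) = \<zero>" if "ar h" "dm h = y" "cd h = sso x" "ar g" "dm g = x" "cd g = y" for h g
  using hzD[of y "sso x" h] that t x assms by simp
 then show "hz x y" using serre_nondeg_right[OF assms(1)] x assms by (intro hzI) auto
qed

end

subsection \<open>The dualizing condition\<close>

lemma (in vspace) dual_zero: "\<phi> \<in> carrier (dual K V) ==> \<phi> \<zero>\<^bsub>V\<^esub> = \<zero>\<^bsub>K\<^esub>"
 using dual_finsum[of \<phi> "{}"] by simp

definition transport_module :: "('v => 'w) => ('k, 'v) module => ('k, 'w) module" where
 "transport_module e V = \<lparr>carrier = e ` carrier V, mult = undefined, one = undefined, zero = e \<zero>\<^bsub>V\<^esub>,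
  add = (\<lambda>u v. e (the_inv e u \<oplus>\<^bsub>V\<^esub> the_inv e v)), smult = (\<lambda>a u. e (a \<odot>\<^bsub>V\<^esub> the_inv e u))\<rparr>"

lemma transport_module_vectorspace:
 fixes K :: "('k, 'r) ring_scheme" and V :: "('k, 'v) module"
 assumes "vectorspace K V" "inj e" shows "vectorspace K (transport_module e V)"
proof -
 interpret vectorspace K V by fact
 note [simp] = transport_module_def the_inv_f_f[OF assms(2)]
 have "module K (transport_module e V)"
 proof (rule moduleI)
  show "abelian_group (transport_module e V)"
  proof (rule abelian_groupI)
   fix x assume "x \<in> carrier (transport_module e V)"
   then show "\<exists>y\<in>carrier (transport_module e V). y \<oplus>\<^bsub>transport_module e V\<^esub> x = \<zero>\<^bsub>transport_module e V\<^esub>"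
    by (auto intro!: bexI[of _ "\<ominus>\<^bsub>V\<^esub> _"] simp: M.l_neg)
  qed (auto simp: M.a_ac)
 qed (auto simp: smult_l_distr smult_r_distr smult_assoc1 R.is_cring)
 then show ?thesis using vectorspace_axioms unfolding vectorspace_def by blast
qed

lemma fp_cat_isoE:
 assumes "\<epsilon> \<in> isos (fp_cat K C) A B"
 obtains \<eta> \<eta>' where "vnat_trans K C A B \<eta>" "vnat_trans K C B A \<eta>'"
  "!!x v. [|x \<in> Ob C; v \<in> carrier (vob A x)|] ==> \<eta>' x (\<eta> x v) = v"
  "!!x v. [|x \<in> Ob C; v \<in> carrier (vob B x)|] ==> \<eta> x (\<eta>' x v) = v"
proof -
 obtain \<delta> where e: "\<epsilon> \<in> arr (fp_cat K C) A B" "\<delta> \<in> arr (fp_cat K C) B A"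
  "\<delta> \<cdot>\<^bsub>fp_cat K C\<^esub> \<epsilon> = Id (fp_cat K C) A" "\<epsilon> \<cdot>\<^bsub>fp_cat K C\<^esub> \<delta> = Id (fp_cat K C) B"
  using assms unfolding isos_def by blast
 obtain \<eta> where \<eta>: "\<epsilon> = (A, B, vext C A \<eta>)" "vnat_trans K C A B \<eta>" using e(1) unfolding fp_cat_def by auto
 obtain \<eta>' where \<eta>': "\<delta> = (B, A, vext C B \<eta>')" "vnat_trans K C B A \<eta>'" using e(2) unfolding fp_cat_def by auto
 have *: "g x (f x v) = v"
  if "vext C U (\<lambda>x v. vext C W g x (vext C U f x v)) = vext C U (\<lambda>x v. v)" "vnat_trans K C U W f" "x \<in> Ob C" "v \<in> carrier (vob U x)"
  for U W :: "('a, 'b, 'c, 'd) vfun" and f g x v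
 proof -
  have "f x v \<in> carrier (vob W x)" using that(2-) unfolding vnat_trans_def module_hom_def by blast
  then show ?thesis using fun_cong[OF fun_cong[OF that(1), of x], of v] that(3,4) unfolding vext_def by simp
 qed
 have 1: "vext C A (\<lambda>x v. vext C B \<eta>' x (vext C A \<eta> x v)) = vext C A (\<lambda>x v. v)"
  using e(3) unfolding \<eta>(1) \<eta>'(1) by (simp add: fp_cat_def)
 have 2: "vext C B (\<lambda>x v. vext C A \<eta> x (vext C B \<eta>' x v)) = vext C B (\<lambda>x v. v)"
  using e(4) unfolding \<eta>(1) \<eta>'(1) by (simp add: fp_cat_def)
 show thesis
  by (rule that[OF \<eta>(2) \<eta>'(2)]) (rule *[OF 1 \<eta>(2)], assumption+, rule *[OF 2 \<eta>'(2)], assumption+)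
qed

context relative_serre_quadruple
begin

abbreviation MC :: "('o, 'm, 'k, 'z) tricat_scheme" where "MC \<equiv> full_subcat T M"

lemma src_op_MC: assumes "ar a" "dm a \<in> M" "cd a \<in> M" shows "src (opcat MC) a = cd a"
 unfolding src_def
proof (rule the_equality)
 show "cd a \<in> Ob (opcat MC) & (\<exists>y\<in>Ob (opcat MC). a \<in> arr (opcat MC) (cd a) y)"
  unfolding opcat_def using assms M_Ob by (auto intro!: bexI[of _ "dm a"])
 fix x assume "x \<in> Ob (opcat MC) & (\<exists>y\<in>Ob (opcat MC). a \<in> arr (opcat MC) x y)"
 then obtain y where "x \<in> M" "y \<in> M" "a \<in> arr T y x" unfolding opcat_def by auto
 then show "x = cd a" using M_Ob by simp
qed

text \<open>The values of \<^term>\<open>hom_functor T t\<close> are moved to the type that \<^const>\<open>dualizing_variety\<close>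
 prescribes for covariant functors.\<close>

definition emb :: "'m => 'm set => 'k" where
 "emb f = (\<lambda>A. if A = {f} then \<one> else \<zero>)"

lemma emb_inj: "inj emb"
proof
 fix f g assume "emb f = emb g"
 then have "emb f {f} = emb g {f}" by simp
 then show "f = g" unfolding emb_def by (auto split: if_splits)
qed

lemma the_inv_emb [simp]: "the_inv emb (emb f) = f"
 using the_inv_f_f[OF emb_inj] .

definition emb_hom :: "'o => ('o, 'm, 'k, 'm set => 'k) vfun" where
 "emb_hom t = \<lparr>vob = (\<lambda>m. transport_module emb (Hom T t m)), vmap = (\<lambda>a u. emb (a ** the_inv emb u))\<rparr>"

lemma emb_hom_functor: assumes "t \<in> Ob T" shows "vect_functor K MC (emb_hom t)"
 unfolding vect_functor_def
proof (intro conjI ballI)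
 note [simp] = emb_hom_def transport_module_def module_hom_def assms M_Ob pl_eq sm_eq
 show "vectorspace K (vob (emb_hom t) x)" if "x \<in> Ob MC" for x
  using transport_module_vectorspace[OF hom_vectorspace emb_inj, of t x] assms that M_Ob by (simp add: emb_hom_def)
qed (auto simp: emb_hom_def transport_module_def module_hom_def assms M_Ob pl_eq sm_eq cmp_pl cmp_sm pl_cmp sm_cmp)

text \<open>A left approximation of \<open>t\<close> and one of its cone give the presentation.
  Surjectivity is the first approximation; exactness is factorization through the cone followed by
  the second.\<close>

lemma emb_hom_fp: assumes "t \<in> Uo" shows "fin_presented K MC (emb_hom t)"
proof -
 have t: "t \<in> Ob T" using assms unfolding Uo_def by blast
 obtain f0 where f0: "left_approx f0" "dm f0 = t" using left_approx_ex[OF assms] by blast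
 have a0: "ar f0" "cd f0 \<in> M" using f0 unfolding left_approx_def by auto
 obtain g0 h0 where d: "dist f0 g0 h0" using dist_ex[OF a0(1)] by blast
 note d' = dist_ar[OF d]
 obtain f1 where f1: "left_approx f1" "dm f1 = cd g0" using left_approx_ex[OF left_approx_cone[OF assms f0 d]] by blast
 have a1: "ar f1" "cd f1 \<in> M" using f1 unfolding left_approx_def by auto
 note ty = a0(1) a1(1) f0(2) f1(2) d' M_Ob t
 let ?q = "\<lambda>x g. g ** f1 ** g0" and ?p = "\<lambda>x g. emb (g ** f0)"
 have "vnat_trans K MC (hom_functor MC (cd f1)) (hom_functor MC (cd f0)) ?q"
  unfolding vnat_trans_def hom_functor_def
  by (auto simp: module_hom_def ty pl_eq sm_eq pl_cmp sm_cmp)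
 moreover have "vnat_trans K MC (hom_functor MC (cd f0)) (emb_hom t) ?p"
  unfolding vnat_trans_def hom_functor_def
  by (auto simp: module_hom_def emb_hom_def transport_module_def ty pl_eq sm_eq pl_cmp sm_cmp)
 moreover have "?q x ` arr MC (cd f1) x = {g \<in> arr MC (cd f0) x. ?p x g = \<zero>\<^bsub>vob (emb_hom t) x\<^esub>} &
    ?p x ` arr MC (cd f0) x = carrier (vob (emb_hom t) x)" if x: "x \<in> Ob MC" for x
 proof
  have xM: "x \<in> M" "x \<in> Ob T" using x M_Ob by auto
  have *: "emb f = emb g \<longleftrightarrow> f = g" for f g using emb_inj unfolding inj_def by blast
  show "?q x ` arr MC (cd f1) x = {g \<in> arr MC (cd f0) x. ?p x g = \<zero>\<^bsub>vob (emb_hom t) x\<^esub>}"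
  proof (intro equalityI subsetI)
   fix k assume "k \<in> ?q x ` arr MC (cd f1) x"
   then obtain g where g: "ar g" "dm g = cd f1" "cd g = x" "k = g ** f1 ** g0" using xM by (auto simp: ty)
   have "k ** f0 = g ** f1 ** g0 ** f0" unfolding g(4) by (simp add: g(1-3) ty)
   also have "... = zr t x" unfolding dist_zero1[OF d] by (simp add: g(1-3) ty xM)
   finally show "k \<in> {g \<in> arr MC (cd f0) x. ?p x g = \<zero>\<^bsub>vob (emb_hom t) x\<^esub>}"
    using g xM ty by (simp add: emb_hom_def transport_module_def zr_eq)
  next
   fix g assume "g \<in> {g \<in> arr MC (cd f0) x. ?p x g = \<zero>\<^bsub>vob (emb_hom t) x\<^esub>}"
   then have g: "ar g" "dm g = cd f0" "cd g = x" "g ** f0 = zr t x"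
    using xM ty by (auto simp: emb_hom_def transport_module_def zr_eq *)
   obtain l where l: "ar l" "dm l = cd g0" "cd l = cd g" "l ** g0 = g"
    by (rule dist_factor_left[OF d, of g]) (use g d' f0(2) in auto)
   obtain b where b: "ar b" "dm b = cd f1" "cd b = cd l" "b ** f1 = l"
    using f1 l(1-3) g(1-3) xM unfolding left_approx_def by metis
   have "b ** f1 ** g0 = l ** g0" by (rule pull[OF b(4)]) (simp_all add: b(1-3) ty)
   then show "g \<in> ?q x ` arr MC (cd f1) x" unfolding l(4) using b(1-3) l(1-3) g(1-3) ty xM
    by (intro image_eqI[of _ _ b]) auto
  qed
  show "?p x ` arr MC (cd f0) x = carrier (vob (emb_hom t) x)"
  proof (intro equalityI subsetI)
   fix u assume "u \<in> carrier (vob (emb_hom t) x)"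
   then obtain f where f: "ar f" "dm f = t" "cd f = x" "u = emb f" using xM t by (auto simp: emb_hom_def transport_module_def)
   then obtain b where "ar b" "dm b = cd f0" "cd b = cd f" "b ** f0 = f" using f0 xM unfolding left_approx_def by metis
   then show "u \<in> ?p x ` arr MC (cd f0) x" using f xM ty by auto
  qed (use xM ty in "auto simp: emb_hom_def transport_module_def")
 qed
 ultimately have "\<exists>m0\<in>Ob MC. \<exists>m1\<in>Ob MC. \<exists>q p. vnat_trans K MC (hom_functor MC m1) (hom_functor MC m0) q &
   vnat_trans K MC (hom_functor MC m0) (emb_hom t) p &
   (\<forall>x\<in>Ob MC. q x ` arr MC m1 x = {g \<in> arr MC m0 x. p x g = \<zero>\<^bsub>vob (emb_hom t) x\<^esub>} &
    p x ` arr MC m0 x = carrier (vob (emb_hom t) x))"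
  by - (rule bexI[of _ "cd f0"], rule bexI[of _ "cd f1"], rule exI[of _ ?q], rule exI[of _ ?p], use a0(2) a1(2) in simp_all)
 then show ?thesis unfolding fin_presented_def using emb_hom_functor[OF t] by blast
qed

text \<open>The properties say that \<kappa> identifies Hom(t, m), naturally in \<open>m\<close>,
  with the functionals on Hom(m, cd r) that vanish on the image of Hom(m, r). In other words, Hom(t,
  -) on \<open>M\<close> is the dual of the cokernel of Hom(-, r). The elementary form keeps functor
  categories out of what follows.\<close>

lemma dualizing_presentation:
 assumes "t \<in> Uo"
 obtains r \<kappa> where "ar r" "dm r \<in> M" "cd r \<in> M"
  "!!f. [|ar f; dm f = t; cd f \<in> M|] ==> linfun (cd f) (cd r) (\<kappa> f)"
  "!!f g. [|ar f; dm f = t; cd f \<in> M; ar g; dm g = cd f; cd g = dm r|] ==> \<kappa> f (r ** g) = \<zero>"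
  "!!m \<phi>. [|m \<in> M; linfun m (cd r) \<phi>; \<forall>g. ar g & dm g = m & cd g = dm r --> \<phi> (r ** g) = \<zero>|] ==>
   \<exists>f. ar f & dm f = t & cd f = m & (\<forall>g. ar g & dm g = m & cd g = cd r --> \<kappa> f g = \<phi> g)"
  "!!f f'. [|ar f; dm f = t; cd f \<in> M; ar f'; dm f' = t; cd f' = cd f;
   \<forall>g. ar g & dm g = cd f & cd g = cd r --> \<kappa> f g = \<kappa> f' g|] ==> f = f'"
  "!!f a g. [|ar f; dm f = t; cd f \<in> M; ar a; dm a = cd f; cd a \<in> M; ar g; dm g = cd a; cd g = cd r|] ==>
   \<kappa> (a ** f) g = \<kappa> f (g ** a)"
proof -
 have t: "t \<in> Ob T" using assms unfolding Uo_def by blast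
 let ?A = "fp_cat K (opcat MC) :: (('o, 'm, 'k, 'm set) vfun, ('o, 'm, 'k, 'm set) vnat, 'k) lincat"
 let ?B = "fp_cat K MC :: (('o, 'm, 'k, 'm set => 'k) vfun, ('o, 'm, 'k, 'm set => 'k) vnat, 'k) lincat"
 have F: "emb_hom t \<in> Ob ?B" unfolding fp_cat_def using emb_hom_fp[OF assms] by simp
 \<comment> \<open>A quasi-inverse of the duality, applied to Hom(t, -), gives a finitely presented
   contravariant functor \<open>G\<close> whose dual is Hom(t, -) up to the isomorphisms \<eta> and
   \<eta>'.\<close>
 obtain H where H: "quasi_inverse K (opcat ?A) ?B (dual_functor K (opcat MC)) H"
  using RS2_dualizing unfolding dualizing_variety_def cat_equivalence_def by blast
 obtain \<epsilon> where \<epsilon>: "nat_iso ?B ?B (dual_functor K (opcat MC) \<circ>\<^sub>F H) id_cfun \<epsilon>"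
  using H unfolding quasi_inverse_def by blast
 define G where "G = omap H (emb_hom t)"
 have "G \<in> Ob (opcat ?A)" unfolding G_def using H F unfolding quasi_inverse_def lin_functor_def by blast
 then have G: "fin_presented K (opcat MC) G" unfolding opcat_def fp_cat_def by simp
 have "\<epsilon> (emb_hom t) \<in> isos ?B (dual_vfun K (opcat MC) G) (emb_hom t)"
  using \<epsilon> F unfolding nat_iso_def G_def by (auto simp: dual_functor_def id_cfun_def)
 then obtain \<eta> \<eta>' where e1: "vnat_trans K MC (dual_vfun K (opcat MC) G) (emb_hom t) \<eta>"
  and e2: "vnat_trans K MC (emb_hom t) (dual_vfun K (opcat MC) G) \<eta>'"
  and e3: "!!x v. [|x \<in> Ob MC; v \<in> carrier (vob (dual_vfun K (opcat MC) G) x)|] ==> \<eta>' x (\<eta> x v) = v"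
  and e4: "!!x v. [|x \<in> Ob MC; v \<in> carrier (vob (emb_hom t) x)|] ==> \<eta> x (\<eta>' x v) = v"
  by (rule fp_cat_isoE) (rule that, assumption+)
 have vG: "vect_functor K (opcat MC) G" using G unfolding fin_presented_def by blast
 obtain n0 n1 q p where n: "n0 \<in> M" "n1 \<in> M"
  and q: "vnat_trans K (opcat MC) (hom_functor (opcat MC) n1) (hom_functor (opcat MC) n0) q"
  and p: "vnat_trans K (opcat MC) (hom_functor (opcat MC) n0) G p"
  and ex: "!!x. x \<in> M ==> q x ` arr T x n1 = {g \<in> arr T x n0. p x g = \<zero>\<^bsub>vob G x\<^esub>}"
  and sur: "!!x. x \<in> M ==> p x ` arr T x n0 = carrier (vob G x)"
  using G unfolding fin_presented_def by (auto simp: opcat_def)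
 have vs: "vspace K (vob G x)" if "x \<in> M" for x
  using vG that unfolding vect_functor_def vspace_def by (simp add: opcat_def)
 \<comment> \<open>Yoneda: the transformation \<open>q\<close> between representable functors is
   composition with the image of the identity.\<close>
 define r where "r = q n1 (idt n1)"
 have "r \<in> q n1 ` arr T n1 n1" unfolding r_def using n M_Ob by simp
 then have r: "ar r" "dm r = n1" "cd r = n0" unfolding ex[OF n(2)] using n M_Ob by auto
 have qr: "q x g = r ** g" if "x \<in> M" "ar g" "dm g = x" "cd g = n1" for x g
 proof -
  have "g \<in> arr (opcat MC) n1 x" "idt n1 \<in> carrier (vob (hom_functor (opcat MC) n1) n1)"
   using that n M_Ob by (simp_all add: opcat_def hom_functor_def)
  then have "q x (vmap (hom_functor (opcat MC) n1) g (idt n1)) = vmap (hom_functor (opcat MC) n0) g (q n1 (idt n1))"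
   using q that(1) n(2) unfolding vnat_trans_def by (simp add: opcat_def)
  then show ?thesis using that n M_Ob unfolding r_def by (simp add: opcat_def hom_functor_def)
 qed
 have ph: "p x \<in> module_hom K (Hom T x n0) (vob G x)" if "x \<in> M" for x
  using p that unfolding vnat_trans_def by (simp add: opcat_def hom_functor_def)
 have p1: "p x g \<in> carrier (vob G x)" "ar g' ==> dm g' = x ==> cd g' = n0 ==> p x (g \<boxplus> g') = p x g \<oplus>\<^bsub>vob G x\<^esub> p x g'"
  "a \<in> carrier K ==> p x (sm a g) = a \<odot>\<^bsub>vob G x\<^esub> p x g"
  if "x \<in> M" "ar g" "dm g = x" "cd g = n0" for x g g' a
 proof -
  have g: "g \<in> arr T x n0" using that n M_Ob by simp
  note h = ph[OF that(1), unfolded module_hom_def]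
  show "p x g \<in> carrier (vob G x)" using h g by blast
  show "p x (g \<boxplus> g') = p x g \<oplus>\<^bsub>vob G x\<^esub> p x g'" if "ar g'" "dm g' = x" "cd g' = n0"
  proof -
   have "g' \<in> arr T x n0" using that \<open>x \<in> M\<close> n M_Ob by simp
   then show ?thesis using h g unfolding pl_eq[OF \<open>ar g\<close> \<open>dm g = x\<close> \<open>cd g = n0\<close>, symmetric] by blast
  qed
  show "a \<in> carrier K ==> p x (sm a g) = a \<odot>\<^bsub>vob G x\<^esub> p x g"
   using h g unfolding sm_eq[OF that(2-4), symmetric] by blast
 qed
 have pn: "p x (g ** a) = vmap G a (p (dm g) g)" if "ar a" "dm a = x" "x \<in> M" "ar g" "dm g = cd a" "cd a \<in> M" "cd g = n0" for x a g
 proof -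
  have "a \<in> arr (opcat MC) (cd a) x" "g \<in> carrier (vob (hom_functor (opcat MC) n0) (cd a))"
   using that n M_Ob by (simp_all add: opcat_def hom_functor_def)
  then have "p x (vmap (hom_functor (opcat MC) n0) a g) = vmap G a (p (cd a) g)"
   using p that(3,6) unfolding vnat_trans_def by (simp add: opcat_def)
  then show ?thesis using that by (simp add: opcat_def hom_functor_def)
 qed
 have psur: "\<exists>g. ar g & dm g = x & cd g = n0 & p x g = u" if "x \<in> M" "u \<in> carrier (vob G x)" for x u
 proof -
  have "u \<in> p x ` arr T x n0" unfolding sur[OF that(1)] by (rule that(2))
  then show ?thesis using that(1) M_Ob n by auto
 qed
 have pex: "\<exists>l. ar l & dm l = x & cd l = n1 & r ** l = g"
  if "x \<in> M" "ar g" "dm g = x" "cd g = n0" "p x g = \<zero>\<^bsub>vob G x\<^esub>" for x g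
 proof -
  have "g \<in> q x ` arr T x n1" unfolding ex[OF that(1)] using that n M_Ob by simp
  then show ?thesis using qr[OF that(1)] that n M_Ob by auto
 qed
 have pz: "p x (r ** l) = \<zero>\<^bsub>vob G x\<^esub>" if "x \<in> M" "ar l" "dm l = x" "cd l = n1" for x l
 proof -
  have "q x l \<in> q x ` arr T x n1" using that n M_Ob by simp
  then show ?thesis unfolding ex[OF that(1)] using qr[OF that] by simp
 qed
 define \<kappa> where "\<kappa> f g = \<eta>' (cd f) (emb f) (p (cd f) g)" for f g
 have \<eta>d: "\<eta>' (cd f) (emb f) \<in> carrier (dual K (vob G (cd f)))" "emb f \<in> carrier (vob (emb_hom t) (cd f))"
  if "ar f" "dm f = t" "cd f \<in> M" for f
 proof -
  show c: "emb f \<in> carrier (vob (emb_hom t) (cd f))"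
   unfolding emb_hom_def transport_module_def using that t M_Ob by simp
  then show "\<eta>' (cd f) (emb f) \<in> carrier (dual K (vob G (cd f)))"
   using e2 that(3) unfolding vnat_trans_def module_hom_def by (auto simp: dual_vfun_def)
 qed
 show thesis
 proof (rule that[of r \<kappa>])
  fix f assume f: "ar f" "dm f = t" "cd f \<in> M"
  note di = vspace.dual_iff[OF vs[OF f(3)]] and d = \<eta>d(1)[OF f]
  show "linfun (cd f) (cd r) (\<kappa> f)"
   unfolding \<kappa>_def r(3) by (rule linfunI) (use d f p1 in "auto simp: di")
  { fix g assume g: "ar g" "dm g = cd f" "cd g = dm r"
   show "\<kappa> f (r ** g) = \<zero>" unfolding \<kappa>_def
    using pz[OF f(3) g(1,2)] g r vspace.dual_zero[OF vs[OF f(3)] d] by simp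
  }
  { fix a g assume a: "ar a" "dm a = cd f" "cd a \<in> M" and g: "ar g" "dm g = cd a" "cd g = cd r"
   have pg: "p (cd a) g \<in> carrier (vob G (cd a))" using p1(1)[OF a(3) g(1,2)] g r by simp
   have "a \<in> arr MC (cd f) (cd a)" using a f M_Ob by simp
   then have "\<eta>' (cd a) (vmap (emb_hom t) a (emb f)) = vmap (dual_vfun K (opcat MC) G) a (\<eta>' (cd f) (emb f))"
    using e2 \<eta>d(2)[OF f] f(3) a(3) unfolding vnat_trans_def by simp
   then have "\<eta>' (cd a) (emb (a ** f)) (p (cd a) g) = \<eta>' (cd f) (emb f) (vmap G a (p (cd a) g))"
    using src_op_MC[OF a(1) _ a(3)] a f pg by (simp add: emb_hom_def dual_vfun_def)
   then show "\<kappa> (a ** f) g = \<kappa> f (g ** a)"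
    unfolding \<kappa>_def using pn[OF a(1,2) f(3) g(1,2) a(3)] a f g r by simp }
  { fix f' assume f': "ar f'" "dm f' = t" "cd f' = cd f" and eq: "\<forall>g. ar g & dm g = cd f & cd g = cd r --> \<kappa> f g = \<kappa> f' g"
   have d': "\<eta>' (cd f) (emb f') \<in> carrier (dual K (vob G (cd f)))" "emb f' \<in> carrier (vob (emb_hom t) (cd f))"
    using \<eta>d[of f'] f f' by auto
   have "\<eta>' (cd f) (emb f) = \<eta>' (cd f) (emb f')"
   proof (rule extensionalityI)
    show "\<eta>' (cd f) (emb f) \<in> extensional (carrier (vob G (cd f)))" "\<eta>' (cd f) (emb f') \<in> extensional (carrier (vob G (cd f)))"
     using d d' unfolding di PiE_def by auto
    fix u assume "u \<in> carrier (vob G (cd f))"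
    then show "\<eta>' (cd f) (emb f) u = \<eta>' (cd f) (emb f') u"
     using psur[OF f(3)] eq r(3) unfolding \<kappa>_def f'(3) by blast
   qed
   then have e: "\<eta> (cd f) (\<eta>' (cd f) (emb f)) = \<eta> (cd f) (\<eta>' (cd f) (emb f'))" by (rule arg_cong)
   have c: "cd f \<in> Ob MC" using f(3) by simp
   from e have "emb f = emb f'" unfolding e4[OF c \<eta>d(2)[OF f]] e4[OF c d'(2)] .
   then show "f = f'" using emb_inj unfolding inj_def by blast }
 next
  fix m \<phi> assume m: "m \<in> M" and \<phi>: "linfun m (cd r) \<phi>" and \<phi>r: "\<forall>g. ar g & dm g = m & cd g = dm r --> \<phi> (r ** g) = \<zero>"
  note di = vspace.dual_iff[OF vs[OF m]]
  interpret V: vspace K "vob G m" by (rule vs[OF m])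
  \<comment> \<open>\<phi> descends along the surjection \<open>p m\<close>: two preimages of one
    element differ by an arrow through \<open>r\<close>, on which \<phi> vanishes.\<close>
  have wd: "\<phi> g = \<phi> g'" if g: "ar g" "dm g = m" "cd g = n0" and g': "ar g'" "dm g' = m" "cd g' = n0" and e: "p m g = p m g'" for g g'
  proof (rule linfun_diff[OF \<phi> g(1,2) _ g'(1,2)])
   have "p m (ng g') = \<ominus>\<^bsub>vob G m\<^esub> p m g'"
    using p1(3)[OF m g'] ng_sm[OF g'(1)] V.smult_l_minus[of \<one>] p1(1)[OF m g'] by simp
   then have "p m (g \<boxplus> ng g') = \<zero>\<^bsub>vob G m\<^esub>"
    using p1(2)[OF m g, of "ng g'"] g' e p1(1)[OF m g'] by (simp add: V.M.r_neg)
   then obtain l where l: "ar l" "dm l = m" "cd l = n1" "r ** l = g \<boxplus> ng g'"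
    using pex[OF m, of "g \<boxplus> ng g'"] g g' by auto
   show "\<phi> (g \<boxplus> ng g') = \<zero>" using \<phi>r l r by auto
  qed (use g g' r in auto)
  define c where "c u = (SOME g. ar g & dm g = m & cd g = n0 & p m g = u)" for u
  have c: "ar (c u)" "dm (c u) = m" "cd (c u) = n0" "p m (c u) = u" if "u \<in> carrier (vob G m)" for u
   using someI_ex[OF psur[OF m that]] unfolding c_def by auto
  have cg: "\<phi> (c (p m g)) = \<phi> g" if "ar g" "dm g = m" "cd g = n0" for g
   using wd[OF c(1-3) that c(4)] p1(1)[OF m that] by blast
  have \<psi>: "(\<lambda>u\<in>carrier (vob G m). \<phi> (c u)) \<in> carrier (dual K (vob G m))" (is "?\<psi> \<in> _")
  proof -
   have "\<phi> (c u) \<in> carrier K" if "u \<in> carrier (vob G m)" for u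
    using linfunD(1)[OF \<phi> c(1,2)[OF that]] c(3)[OF that] r by simp
   moreover have "\<phi> (c (u \<oplus>\<^bsub>vob G m\<^esub> v)) = \<phi> (c u) \<oplus> \<phi> (c v)" if u: "u \<in> carrier (vob G m)" and v: "v \<in> carrier (vob G m)" for u v
    using cg[of "c u \<boxplus> c v"] p1(2)[OF m c(1-3)[OF u] c(1-3)[OF v]] c[OF u] c[OF v]
     linfunD(3)[OF \<phi> c(1,2)[OF u] _ c(1,2)[OF v]] r by simp
   moreover have "\<phi> (c (a \<odot>\<^bsub>vob G m\<^esub> v)) = a \<otimes> \<phi> (c v)" if a: "a \<in> carrier K" and v: "v \<in> carrier (vob G m)" for a v
    using cg[of "sm a (c v)"] p1(3)[OF m c(1-3)[OF v] a] c[OF v] a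
     linfunD(2)[OF \<phi> c(1,2)[OF v] _ a] r by simp
   ultimately show ?thesis unfolding di by simp
  qed
  have "\<eta> m ?\<psi> \<in> carrier (vob (emb_hom t) m)"
   using e1 \<psi> m unfolding vnat_trans_def module_hom_def by (auto simp: dual_vfun_def)
  then obtain f where f: "ar f" "dm f = t" "cd f = m" "\<eta> m ?\<psi> = emb f"
   unfolding emb_hom_def transport_module_def using t M_Ob[OF m] by auto
  have "\<eta>' m (emb f) = ?\<psi>" using e3[of m ?\<psi>] m \<psi> f(4) by (simp add: dual_vfun_def)
  then have "\<kappa> f g = \<phi> g" if "ar g" "dm g = m" "cd g = n0" for g
   unfolding \<kappa>_def f(3) using cg[OF that] p1(1)[OF m that] by simp
  then show "\<exists>f. ar f & dm f = t & cd f = m & (\<forall>g. ar g & dm g = m & cd g = cd r --> \<kappa> f g = \<phi> g)"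
   using f r by blast
 qed (use r n in auto)
qed

end

text \<open>An arrow killed by \<open>f\<close> factors, after one shift, through
  \<open>cd g\<close>; the last hypothesis makes that factor zero. So composition with
  \<open>f\<close> detects vanishing here.\<close>

lemma (in pretriangulated) fiber_cancel:
 assumes "dist f g h" "ar b" "cd b = dm f" "f ** b = zr (dm b) (cd f)" "hz (sho (dm b)) (cd g)"
 shows "b = zr (dm b) (dm f)"
proof -
 note d = dist_ar[OF assms(1)]
 have "sha f ** sha b = sha (f ** b)" using assms(2,3) d by simp
 also have "... = zr (dm (sha b)) (cd (sha f))" unfolding assms(4) using assms(2) d by simp
 finally obtain x where x: "ar x" "dm x = dm (sha b)" "cd x = dm h" "h ** x = sha b"
  by - (rule exrE[OF dist_exr(3)[OF assms(1)], of "sha b"], simp_all add: assms(2,3) d)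
 have "x = zr (sho (dm b)) (cd g)" by (rule hzD[OF assms(5)]) (use x assms(2) d in auto)
 then have "sha b = sha (zr (dm b) (dm f))" using x(4)[symmetric] assms(2) d by simp
 then show ?thesis by (rule sh_faithful[rotated -1]) (use assms(2,3) d in auto)
qed

context relative_serre_quadruple
begin

subsection \<open>The t-structure and its heart\<close>

lemma rperp_shifts: "rperp T (shifts T M I) = {t \<in> Ob T. \<forall>i\<in>I. kr t i}"
proof -
 have "hom_zero T (shifts T M I) {t} \<longleftrightarrow> (\<forall>a\<in>shifts T M I. hz a t)" for t
  by (rule trans[OF hom_zero_iff]) simp
 moreover have "(\<forall>a\<in>shifts T M I. hz a t) \<longleftrightarrow> (\<forall>i\<in>I. kr t i)" for t unfolding shifts_def kr_def by auto
 ultimately show ?thesis unfolding rperp_def by simp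
qed

lemma sft_S: "x \<in> S ==> sft i x \<in> S"
proof (induction i rule: int_induct[of _ 0])
 case (step1 i)
 then show ?case using S_isom[OF S_sho sho_sft] S_Ob by blast
next
 case (step2 i)
 then show ?case using S_isom[OF S_shi shi_sft] S_Ob by blast
qed simp

text \<open>The given t-structure translated by \<open>k\<close>, so that truncation is available at
  every degree.\<close>

lemma t_truncation:
 assumes "t \<in> Ob T"
 obtains a b where "tr a t b" "!!i. i < k ==> kr a i" "!!i. i \<ge> k ==> kr b i" "b \<in> S"
proof -
 have "star T (rperp T (shifts T M {..<0})) (rperp T (shifts T M {0..})) = Ob T"
  using RS2_t_structure unfolding t_structure_def torsion_pair_def by (elim conjE)
 then have "sft (- k) t \<in> star T (rperp T (shifts T M {..<0})) (rperp T (shifts T M {0..}))"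
  using sft_Ob[OF assms] by (rule subst[OF sym])
 then obtain a b where ab: "a \<in> rperp T (shifts T M {..<0})" "b \<in> rperp T (shifts T M {0..})" "tr a (sft (- k) t) b"
  unfolding star_iff by blast
 have bS: "b \<in> S" using ab(2) RS2_subset by blast
 have a: "a \<in> Ob T" "!!i. i < 0 ==> kr a i" and b: "b \<in> Ob T" "!!i. i \<ge> 0 ==> kr b i" using ab(1,2) unfolding rperp_shifts by auto
 have "tr (sft k a) (sft k (sft (- k) t)) (sft k b)" using tr_sft[OF ab(3)] .
 then have "tr (sft k a) t (sft k b)" using tr_isom[OF _ isom_refl sft_neg_cancel(2)[OF assms] isom_refl] a(1) b(1) by simp
 then show thesis by (rule that) (use a b sft_S[OF bS] kr_sft in auto)
qed

lemma t_hz: assumes "a \<in> Ob T" "b \<in> Ob T" "!!i. i < k ==> kr a i" "!!i. i \<ge> k ==> kr b i" shows "hz a b"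
proof -
 have "sft (- k) a \<in> rperp T (shifts T M {..<0})" "sft (- k) b \<in> rperp T (shifts T M {0..})"
  using assms kr_sft unfolding rperp_shifts by auto
 then have "hz (sft (- k) a) (sft (- k) b)"
  using hom_zero_iff[of "rperp T (shifts T M {..<0})" "rperp T (shifts T M {0..})"] RS2_t_structure
  unfolding t_structure_def torsion_pair_def by blast
 then show ?thesis using assms by simp
qed

text \<open>\<open>cd h\<close> is the part in degree 0 of the cone of \<open>r\<close>. The
  discarded part \<open>a\<close> receives no arrows from \<open>M\<close>, nor does a[1], and
  \<open>M\<close> has no arrows to the shift of \<open>dm r\<close>; hence Hom(M, cd h) is the
  cokernel of Hom(M, r).\<close>

lemma heart_presentation:
 assumes "ar r" "dm r \<in> M" "cd r \<in> M"
 obtains h where "ar h" "dm h = cd r" "cd h \<in> S" "!!i. i \<noteq> 0 ==> kr (cd h) i" "h ** r = zr (dm r) (cd h)"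
  "!!k. [|ar k; dm k \<in> M; cd k = cd h|] ==> \<exists>g. ar g & dm g = dm k & cd g = cd r & h ** g = k"
  "!!g. [|ar g; dm g \<in> M; cd g = cd r; h ** g = zr (dm g) (cd h)|] ==> \<exists>l. ar l & dm l = dm g & cd l = dm r & r ** l = g"
proof -
 obtain e e' where d: "dist r e e'" using dist_ex[OF assms(1)] by blast
 note d' = dist_ar[OF d]
 \<comment> \<open>The cone lives in degrees at least 0, so cutting at 1 leaves exactly degree 0 in
   \<open>b\<close>.\<close>
 obtain a b where ab: "tr a (cd e) b" "!!i. i < 1 ==> kr a i" "!!i. i \<ge> 1 ==> kr b i" "b \<in> S"
  by (rule t_truncation[of "cd e" 1]) (use d' in auto)
 obtain f q w where t: "dist f q w" "dm f = a" "cd f = cd e" "cd q = b" using ab(1) by (rule trE)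
 note t' = dist_ar[OF t(1)]
 note ty = d' t' t(2-4) assms
 have ob: "a \<in> Ob T" "b \<in> Ob T" using tr_Ob[OF ab(1)] by auto
 have ce: "kr (cd e) i" if "i < 0" for i
  by (rule kr_cone[of "dm r" "cd r"]) (use trI[OF d] M_kr assms that in auto)
 have b0: "kr b i" if "i < 0" for i by (rule kr_cone[OF ab(1) ce[OF that] ab(2)]) (use that in simp)
 have ma: "hz m a" "hz m (sho a)" if "m \<in> M" for m
  using ab(2)[of 0] ab(2)[of "-1"] kr_sho[OF ob(1), of 0] that unfolding kr_def by auto
 have mn: "hz m (sho (dm r))" if "m \<in> M" for m using M_hz[OF that assms(2), of 0 1] by simp
 show thesis
 proof (rule that[of "q ** e"])
  fix i :: int assume "i \<noteq> 0"
  then show "kr (cd (q ** e)) i" using b0[of i] ab(3)[of i] ty by (cases "i < 0") auto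
 next
  have "q ** e ** r = zr (dm r) b" unfolding dist_zero1[OF d] by (simp add: ty)
  then show "(q ** e) ** r = zr (dm r) (cd (q ** e))" by (simp add: ty)
 next
  fix k assume k: "ar k" "dm k \<in> M" "cd k = cd (q ** e)"
  have kc: "cd k = cd q" using k ty by simp
  have "w ** k = zr (dm k) (cd w)" using hzD[OF ma(2)[OF k(2)], of "w ** k"] k(1) kc ty by simp
  then obtain k1 where k1: "ar k1" "dm k1 = dm k" "cd k1 = dm q" "q ** k1 = k"
   by - (rule exrE[OF dist_exr(2)[OF t(1)], of k], simp_all add: k(1) kc)
  have "e' ** k1 = zr (dm k1) (cd e')" using hzD[OF mn[OF k(2)], of "e' ** k1"] k1(1-3) ty by simp
  then obtain g where g: "ar g" "dm g = dm k1" "cd g = dm e" "e ** g = k1"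
   by - (rule exrE[OF dist_exr(2)[OF d], of k1], simp_all add: k1(1-3) ty)
  have "q ** e ** g = k" unfolding g(4) k1(4) ..
  then show "\<exists>g. ar g & dm g = dm k & cd g = cd r & (q ** e) ** g = k"
   by (intro exI[of _ g]) (simp add: g(1-3) k1(2) ty)
 next
  fix g assume g: "ar g" "dm g \<in> M" "cd g = cd r" "(q ** e) ** g = zr (dm g) (cd (q ** e))"
  have "q ** e ** g = zr (dm g) (cd q)" using g ty by simp
  then obtain x where x: "ar x" "dm x = dm g" "cd x = dm f" "f ** x = e ** g"
   by - (rule exrE[OF dist_exr(1)[OF t(1)], of "e ** g"], simp_all add: g(1-3) ty)
  have x0: "x = zr (dm g) a" using hzD[OF ma(1)[OF g(2)], of x] x ty by simp
  have "e ** g = zr (dm g) (cd e)" using x(4) unfolding x0 using ty g(1) by simp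
  then obtain l where "ar l" "dm l = dm g" "cd l = dm r" "r ** l = g"
   by - (rule exrE[OF dist_exr(1)[OF d], of g], simp_all add: g(1-3) ty)
  then show "\<exists>l. ar l & dm l = dm g & cd l = dm r & r ** l = g" by blast
 qed (use ty ab(4) in auto)
qed

lemma SS_dense: assumes "x \<in> S" obtains v u where "v \<in> S" "is_iso u" "dm u = x" "cd u = sso v"
proof -
 obtain G \<epsilon> where G: "lin_functor K (full_tri_subcat T S) (full_tri_subcat T S) G"
  and \<epsilon>: "nat_iso (full_tri_subcat T S) (full_tri_subcat T S) (\<SS> \<circ>\<^sub>F G) id_cfun \<epsilon>"
  using RS1_equivalence unfolding triangle_equivalence_def cat_equivalence_def quasi_inverse_def by blast
 have v: "omap G x \<in> S" using G assms unfolding lin_functor_def full_tri_subcat_def by simp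
 have "\<epsilon> x \<in> isos T (sso (omap G x)) x"
  using \<epsilon> assms unfolding nat_iso_def full_tri_subcat_def isos_def by (simp add: id_cfun_def)
 then have "is_iso (\<epsilon> x)" "dm (\<epsilon> x) = sso (omap G x)" "cd (\<epsilon> x) = x" using isos_iff v assms S_Ob by simp_all
 then show thesis using that[OF v, of "iv (\<epsilon> x)"] by simp
qed

section \<open>The decomposition T = V * U\<close>

lemma kl_iff_kr_sso: "v \<in> S ==> kl v i \<longleftrightarrow> kr (sso v) i"
 unfolding kl_def kr_def using serre_hz M_Ob sft_Ob by blast

text \<open>\<open>v\<close> is chosen with \<open>sso v\<close> isomorphic to the heart object
  \<open>cd h\<close>. Combining \<kappa> with Serre duality gives bijections between Hom(t, m) and
  Hom(v, m), natural in \<open>m\<close>. They are realized as composition with one arrow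
  \<open>g : v -> t\<close>, whose cone then has the required vanishing.\<close>

lemma Uo_step:
 assumes "t \<in> Uo" shows "\<exists>v c. tr v t c & sho v \<in> Vo & sho c \<in> Uo"
proof -
 have t: "t \<in> Ob T" "!!i. i > 0 ==> kl t i" using assms unfolding Uo_def by auto
 obtain r \<kappa> where r: "ar r" "dm r \<in> M" "cd r \<in> M"
  and \<kappa>1: "!!f. [|ar f; dm f = t; cd f \<in> M|] ==> linfun (cd f) (cd r) (\<kappa> f)"
  and \<kappa>2: "!!f g. [|ar f; dm f = t; cd f \<in> M; ar g; dm g = cd f; cd g = dm r|] ==> \<kappa> f (r ** g) = \<zero>"
  and \<kappa>3: "!!m \<phi>. [|m \<in> M; linfun m (cd r) \<phi>; \<forall>g. ar g & dm g = m & cd g = dm r --> \<phi> (r ** g) = \<zero>|] ==>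
   \<exists>f. ar f & dm f = t & cd f = m & (\<forall>g. ar g & dm g = m & cd g = cd r --> \<kappa> f g = \<phi> g)"
  and \<kappa>4: "!!f f'. [|ar f; dm f = t; cd f \<in> M; ar f'; dm f' = t; cd f' = cd f;
   \<forall>g. ar g & dm g = cd f & cd g = cd r --> \<kappa> f g = \<kappa> f' g|] ==> f = f'"
  and \<kappa>5: "!!f a g. [|ar f; dm f = t; cd f \<in> M; ar a; dm a = cd f; cd a \<in> M; ar g; dm g = cd a; cd g = cd r|] ==>
   \<kappa> (a ** f) g = \<kappa> f (g ** a)"
  by (rule dualizing_presentation[OF assms]) (rule that, assumption+)
 obtain h where h: "ar h" "dm h = cd r" "cd h \<in> S" and hk: "!!i. i \<noteq> 0 ==> kr (cd h) i" and hr: "h ** r = zr (dm r) (cd h)"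
  and hs: "!!k. [|ar k; dm k \<in> M; cd k = cd h|] ==> \<exists>g. ar g & dm g = dm k & cd g = cd r & h ** g = k"
  and hx: "!!g. [|ar g; dm g \<in> M; cd g = cd r; h ** g = zr (dm g) (cd h)|] ==> \<exists>l. ar l & dm l = dm g & cd l = dm r & r ** l = g"
  by (rule heart_presentation[OF r]) (rule that, assumption+)
 obtain v u where v: "v \<in> S" and u: "is_iso u" "dm u = cd h" "cd u = sso v" by (rule SS_dense[OF h(3)])
 have vO: "v \<in> Ob T" using v S_Ob by simp
 define p where "p = u ** h"
 have p: "ar p" "dm p = cd r" "cd p = sso v" unfolding p_def using u h by simp_all
 have "u ** h ** r = zr (dm r) (sso v)" unfolding hr using u r h by simp
 then have pr: "p ** r = zr (dm r) (sso v)" unfolding p_def using u h r by simp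
 have ps: "\<exists>g. ar g & dm g = dm k & cd g = cd r & p ** g = k" if k: "ar k" "dm k \<in> M" "cd k = sso v" for k
 proof -
  obtain g where g: "ar g" "dm g = dm k" "cd g = cd r" "h ** g = iv u ** k" using hs[of "iv u ** k"] k u by auto
  have "u ** h ** g = (u ** iv u) ** k" unfolding g(4) using u k by simp
  also have "... = k" using u k by (simp del: cmp_assoc)
  finally show ?thesis unfolding p_def using g(1-3) u h by (intro exI[of _ g]) simp
 qed
 have px: "\<exists>l. ar l & dm l = dm g & cd l = dm r & r ** l = g"
  if g: "ar g" "dm g \<in> M" "cd g = cd r" "p ** g = zr (dm g) (sso v)" for g
 proof (rule hx[OF g(1-3)])
  have "u ** h ** g = u ** zr (dm g) (cd h)" using g(4) unfolding p_def using u h g(1-3) by simp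
  then show "h ** g = zr (dm g) (cd h)" by (rule iso_lcancel[OF u(1), rotated -1]) (use u h g(1-3) in auto)
 qed
 have vk: "kl v i" if "i \<noteq> 0" for i
  using kl_iff_kr_sso[OF v] kr_isom[OF isomI[OF u] hk[OF that]] by blast
 note \<tau> = tau_linfun[OF v]
 \<comment> \<open>\<open>f\<close> and \<theta> are related if they induce the same functional on
   Hom(m, cd r), one through \<kappa> and the other through the trace form. The facts proved next
   make this a natural bijection.\<close>
 define R where "R f \<theta> \<longleftrightarrow> ar \<theta> & dm \<theta> = v & cd \<theta> = cd f &
  (\<forall>g. ar g & dm g = cd f & cd g = cd r --> \<kappa> f g = tau v ((p ** g) ** \<theta>))" for f \<theta>
 have R_lin: "linfun m (cd r) (\<lambda>g. tau v ((p ** g) ** \<theta>))" if "ar \<theta>" "dm \<theta> = v" "cd \<theta> = m" for m \<theta>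
  by (rule linfun_cmp_left[OF linfun_cmp_right[OF \<tau>]]) (use that p in auto)
 have R_ex: "\<exists>\<theta>. R f \<theta>" if f: "ar f" "dm f = t" "cd f \<in> M" for f
 proof -
  note \<kappa>l = \<kappa>1[OF f]
  \<comment> \<open>The functional \<open>\<kappa> f\<close> is pushed along the surjection from
    Hom(m, cd r) to Hom(m, sso v) given by \<open>p\<close>; it descends because it vanishes on
    arrows through \<open>r\<close>.\<close>
  define \<Psi> where "\<Psi> k = \<kappa> f (SOME g. ar g & dm g = cd f & cd g = cd r & p ** g = k)" for k
  have wd: "\<Psi> (p ** g) = \<kappa> f g" if g: "ar g" "dm g = cd f" "cd g = cd r" for g
  proof -
   define g' where "g' = (SOME g'. ar g' & dm g' = cd f & cd g' = cd r & p ** g' = p ** g)"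
   have "ar g' & dm g' = cd f & cd g' = cd r & p ** g' = p ** g" unfolding g'_def by (rule someI[of _ g]) (simp add: g)
   then have g': "ar g'" "dm g' = cd f" "cd g' = cd r" "p ** g' = p ** g" by auto
   have "p ** (g' \<boxplus> ng g) = (p ** g') \<boxplus> ng (p ** g)" by (simp add: cmp_pl g g'(1-3) p)
   also have "... = zr (cd f) (sso v)" unfolding g'(4) by (simp add: g p)
   finally obtain l where l: "ar l" "dm l = cd f" "cd l = dm r" "r ** l = g' \<boxplus> ng g"
    using px[of "g' \<boxplus> ng g"] g g'(1-3) f by auto
   have "\<kappa> f g' = \<kappa> f g" by (rule linfun_diff[OF \<kappa>l]) (use g g'(1-3) \<kappa>2[OF f l(1-3)] l(4) in simp_all)
   then show ?thesis unfolding \<Psi>_def g'_def .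
  qed
  have s: "\<exists>g. ar g & dm g = cd f & cd g = cd r & p ** g = k" if "ar k" "dm k = cd f" "cd k = sso v" for k
   using ps[of k] that f(3) by auto
  have "linfun (cd f) (sso v) \<Psi>"
  proof (rule linfunI)
   fix k assume "ar k" "dm k = cd f" "cd k = sso v"
   then obtain g where g: "ar g" "dm g = cd f" "cd g = cd r" "k = p ** g" using s by blast
   show "\<Psi> k \<in> carrier K" unfolding g(4) wd[OF g(1-3)] by (rule linfunD(1)[OF \<kappa>l g(1-3)])
   { fix k' assume "ar k'" "dm k' = cd f" "cd k' = sso v"
    then obtain g' where g': "ar g'" "dm g' = cd f" "cd g' = cd r" "k' = p ** g'" using s by blast
    have "(p ** g) \<boxplus> (p ** g') = p ** (g \<boxplus> g')" by (simp add: cmp_pl g(1-3) g'(1-3) p)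
    then show "\<Psi> (k \<boxplus> k') = \<Psi> k \<oplus> \<Psi> k'" unfolding g(4) g'(4)
     using wd[of "g \<boxplus> g'"] wd[OF g(1-3)] wd[OF g'(1-3)] linfunD(3)[OF \<kappa>l g(1-3) g'(1-3)] g(1-3) g'(1-3) by simp }
   fix a assume a: "a \<in> carrier K"
   have "sm a (p ** g) = p ** sm a g" by (simp add: cmp_sm g(1-3) p a)
   then show "\<Psi> (sm a k) = a \<otimes> \<Psi> k" unfolding g(4)
    using wd[of "sm a g"] wd[OF g(1-3)] linfunD(2)[OF \<kappa>l g(1-3) a] g(1-3) a by simp
  qed
  then obtain \<theta> where "ar \<theta>" "dm \<theta> = v" "cd \<theta> = cd f" "!!k. [|ar k; dm k = cd f; cd k = sso v|] ==> \<Psi> k = tau v (k ** \<theta>)"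
   by (rule serre_rep2[OF v M_Ob[OF f(3)]]) (rule that, assumption+)
  then have "R f \<theta>" unfolding R_def using wd p by simp
  then show ?thesis ..
 qed
 have R_uniq: "\<theta> = \<theta>'" if R: "R f \<theta>" "R f \<theta>'" and fM: "cd f \<in> M" for f \<theta> \<theta>'
 proof -
  have 1: "ar \<theta>" "dm \<theta> = v" "cd \<theta> = cd f" "ar \<theta>'" "dm \<theta>' = v" "cd \<theta>' = cd f" using R unfolding R_def by auto
  have "\<theta> \<boxplus> ng \<theta>' = zr v (cd (\<theta> \<boxplus> ng \<theta>'))"
  proof (rule serre_nondeg_right[OF v])
   fix k assume "ar k" "dm k = cd (\<theta> \<boxplus> ng \<theta>')" "cd k = sso v"
   then have k: "ar k" "dm k = cd f" "cd k = sso v" using 1 by simp_all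
   then obtain g where g: "ar g" "dm g = cd f" "cd g = cd r" "p ** g = k" using ps[of k] fM by auto
   have "tau v (k ** \<theta>) = tau v (k ** \<theta>')" using R g unfolding R_def by auto
   then have "tau v (k ** \<theta>) \<oplus> \<ominus> tau v (k ** \<theta>') = \<zero>" using linfunD(1)[OF \<tau>, of "k ** \<theta>'"] k 1 by (simp add: r_neg)
   then show "tau v (k ** (\<theta> \<boxplus> ng \<theta>')) = \<zero>"
    using linfunD(3)[OF \<tau>, of "k ** \<theta>" "ng (k ** \<theta>')"] linfun_ng[OF \<tau>, of "k ** \<theta>'"] k 1 by (simp add: cmp_pl)
  qed (simp_all add: 1)
  then show ?thesis using diff_zr[of \<theta> \<theta>'] by (simp add: 1)
 qed
 have R_surj: "\<exists>f. ar f & dm f = t & cd f = m & R f \<theta>" if "m \<in> M" "ar \<theta>" "dm \<theta> = v" "cd \<theta> = m" for m \<theta>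
 proof -
  have "\<exists>f. ar f & dm f = t & cd f = m & (\<forall>g. ar g & dm g = m & cd g = cd r --> \<kappa> f g = tau v ((p ** g) ** \<theta>))"
  proof (rule \<kappa>3[OF that(1) R_lin[OF that(2-4)]], intro allI impI, elim conjE)
   fix g assume g: "ar g" "dm g = m" "cd g = dm r"
   have "(p ** r) ** g ** \<theta> = zr v (sso v)" unfolding pr using g that v r by simp
   then have "(p ** r ** g) ** \<theta> = zr v (sso v)" using g that p r by simp
   then show "tau v ((p ** r ** g) ** \<theta>) = \<zero>" using linfun_zr[OF \<tau>] v vO by simp
  qed
  then show ?thesis unfolding R_def using that by auto
 qed
 have R_inj: "f = f'" if "R f \<theta>" "R f' \<theta>" "ar f" "dm f = t" "cd f \<in> M" "ar f'" "dm f' = t" for f f' \<theta>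
  by (rule \<kappa>4) (use that in "auto simp: R_def")
 have R_nat: "R (a ** f) (a ** \<theta>)" if "R f \<theta>" "ar f" "dm f = t" "cd f \<in> M" "ar a" "dm a = cd f" "cd a \<in> M" for f \<theta> a
  using that \<kappa>5[OF that(2-7)] p unfolding R_def by simp
 \<comment> \<open>Yoneda does not apply, as \<open>t\<close> lies outside \<open>M\<close>. Instead
   the partner \<theta>0 of an approximation \<open>f0\<close> is lifted along \<open>f0\<close>;
   the obstruction \<open>g0 ** \<theta>0\<close> is tested by an approximation \<open>f1\<close> of
   the cone.\<close>
 obtain f0 where f0: "left_approx f0" "dm f0 = t" using left_approx_ex[OF assms] by blast
 have a0: "ar f0" "cd f0 \<in> M" using f0 unfolding left_approx_def by auto
 obtain g0 h0 where d0: "dist f0 g0 h0" using dist_ex[OF a0(1)] by blast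
 note d0' = dist_ar[OF d0]
 note c0 = left_approx_cone[OF assms f0 d0]
 obtain f1 where f1: "left_approx f1" "dm f1 = cd g0" using left_approx_ex[OF c0] by blast
 have a1: "ar f1" "cd f1 \<in> M" using f1 unfolding left_approx_def by auto
 obtain g1 h1 where d1: "dist f1 g1 h1" using dist_ex[OF a1(1)] by blast
 note d1' = dist_ar[OF d1]
 note c1 = left_approx_cone[OF c0 f1 d1]
 obtain \<theta>0 where \<theta>0: "R f0 \<theta>0" using R_ex[OF a0(1) f0(2) a0(2)] by blast
 have \<theta>t: "ar \<theta>0" "dm \<theta>0 = v" "cd \<theta>0 = cd f0" using \<theta>0 unfolding R_def by auto
 note ty = f0(2) a0 d0' f1(2) a1 d1' \<theta>t vO t(1) M_Ob
 have svVo: "sho v \<in> Vo" unfolding Vo_def using v S_sho kl_sho[OF vO] vk by simp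
 have "(f1 ** g0) ** f0 = zr t (cd f1)" using dist_zero1[OF d0] ty by simp
 then have 1: "R (zr t (cd f1)) ((f1 ** g0) ** \<theta>0)" using R_nat[OF \<theta>0, of "f1 ** g0"] ty by (simp del: cmp_assoc)
 obtain f2 where f2: "ar f2" "dm f2 = t" "cd f2 = cd f1" "R f2 (zr v (cd f1))" using R_surj[of "cd f1" "zr v (cd f1)"] ty by auto
 \<comment> \<open>That \<open>R\<close> relates zero to zero is read off from functionals: the
   partner \<open>f2\<close> of zero has the functional of zero, hence is zero.\<close>
 have "\<kappa> f2 g = \<kappa> (zr t (cd f1)) g" if g: "ar g" "dm g = cd f1" "cd g = cd r" for g
 proof -
  have "\<kappa> f2 g = tau v ((p ** g) ** zr v (cd f1))" using f2 g unfolding R_def by auto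
  also have "... = \<zero>" using linfun_zr[OF \<tau>] g p vO v by simp
  also have "\<zero> = \<kappa> (zr t (cd f1)) g"
  proof -
   obtain \<theta>z where "R (zr t (cd f0)) \<theta>z" using R_ex[of "zr t (cd f0)"] ty by auto
   have "\<kappa> (zr (cd f0) (cd f1) ** f0) g = \<kappa> f0 (g ** zr (cd f0) (cd f1))"
    by (rule \<kappa>5) (use ty g r in auto)
   then show ?thesis using linfun_zr[OF \<kappa>1[OF a0(1) f0(2) a0(2)]] ty g r by simp
  qed
  finally show ?thesis .
 qed
 then have "f2 = zr t (cd f1)" by (intro \<kappa>4) (use f2 ty in auto)
 then have "(f1 ** g0) ** \<theta>0 = zr v (cd f1)" using R_uniq[OF 1, of "zr v (cd f1)"] f2 ty by simp
 then have "f1 ** g0 ** \<theta>0 = zr v (cd f1)" using ty by simp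
 \<comment> \<open>Composition with \<open>f1\<close> detects vanishing here, because its cone lies
   in \<open>Uo\<close> and v[1] lies in \<open>Vo\<close>.\<close>
 moreover have "hz (sho v) (cd g1)" by (rule hz_Vo_Uo[OF svVo c1])
 ultimately have "g0 ** \<theta>0 = zr v (cd g0)"
  using fiber_cancel[OF d1, of "g0 ** \<theta>0"] ty by simp
 then obtain g where g: "ar g" "dm g = v" "cd g = t" "f0 ** g = \<theta>0"
  by - (rule dist_factor_right[OF d0, of \<theta>0], simp_all add: ty)
 \<comment> \<open>Every \<open>f\<close> factors through \<open>f0\<close>, so naturality extends
   the relation from \<open>f0\<close> to all \<open>f\<close>: the bijection is composition with
   \<open>g\<close>.\<close>
 have Rg: "R f (f ** g)" if f: "ar f" "dm f = t" "cd f \<in> M" for f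
 proof -
  obtain a where a: "ar a" "dm a = cd f0" "cd a = cd f" "a ** f0 = f" using f0 f unfolding left_approx_def by metis
  have "R (a ** f0) (a ** f0 ** g)" unfolding g(4) by (rule R_nat[OF \<theta>0]) (use a ty f in auto)
  moreover have "a ** f0 ** g = f ** g" by (rule pull[OF a(4)]) (use a(1-3) ty g(1-3) in auto)
  ultimately show ?thesis unfolding a(4) by simp
 qed
 obtain k w where dk: "dist g k w" using dist_ex[OF g(1)] by blast
 note dk' = dist_ar[OF dk]
 have T: "tr v t (cd k)" by (rule trI[OF dk]) (use g in auto)
 have inj: "f = zr t m" if f: "ar f" "dm f = t" "cd f = m" "f ** g = zr v m" "m \<in> M" for f m
 proof -
  have "f ** g = zr t m ** g" using f g t(1) M_Ob by simp
  then have "R (zr t m) (f ** g)" using Rg[of "zr t m"] t(1) f(5) M_Ob by simp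
  then show ?thesis using R_inj[OF Rg] f t(1) M_Ob by simp
 qed
 have surj: "\<exists>f. ar f & dm f = t & cd f = m & f ** g = q" if q: "ar q" "dm q = v" "cd q = m" "m \<in> M" for q m
  using R_surj[OF q(4,1-3)] R_uniq Rg q(4) by metis
 \<comment> \<open>In degree 0 the cone uses injectivity of composition with \<open>g\<close>, in
   degree 1 its surjectivity; in higher degrees \<open>t\<close> and \<open>v\<close> themselves
   have no arrows.\<close>
 have "kl (sho (cd k)) i" if i: "i > 0" for i
 proof -
  consider "i = 1" | "i = 2" | "i > 2" using i by linarith
  then have "kl (cd k) (i - 1)"
  proof cases
   case 1
   have "hz (cd k) m" if m: "m \<in> M" for m
   proof (rule hzI)
    fix q assume q: "ar q" "dm q = cd k" "cd q = m"
    have "(q ** k) ** g = zr v m" using dist_zero1[OF dk] q g dk' vO by simp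
    then have "q ** k = zr t m" by (intro inj) (use q g dk' m in auto)
    then obtain b where b: "ar b" "dm b = cd w" "cd b = m" "b ** w = q"
     by - (rule dist_factor_left[OF dist_rot[OF dk], of q], use q g dk' in auto)
    have "hz (sho v) m" using kl_sho[OF vO, of 0] vk[of "-1"] m unfolding kl_def by simp
    then have "b = zr (sho v) m" using hzD b dk' g by simp
    then show "q = zr (cd k) m" using b(4) dk' g m M_Ob by simp
   qed (use dk' M_Ob m in auto)
   then show ?thesis unfolding kl_def using 1 by simp
  next
   case 2
   have "hz (cd k) (sho m)" if m: "m \<in> M" for m
   proof (rule hzI)
    fix q assume q: "ar q" "dm q = cd k" "cd q = sho m"
    have "hz t (sho m)" using t(2)[of 1] m unfolding kl_def by simp
    then have "q ** k = zr t (sho m)" by (rule hzD) (use q dk' g in auto)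
    then obtain b where b: "ar b" "dm b = cd w" "cd b = sho m" "b ** w = q"
     by - (rule dist_factor_left[OF dist_rot[OF dk], of q], use q g dk' in auto)
    obtain b' where b': "ar b'" "dm b' = v" "cd b' = m" "sha b' = b"
     using sh_full[of v m b] b(1-3) dk' g m vO M_Ob by auto
    obtain l where l: "ar l" "dm l = t" "cd l = m" "l ** g = b'" using surj[OF b'(1-3) m] by blast
    have "q = (sha l ** sha g) ** w" unfolding b(4)[symmetric] b'(4)[symmetric] l(4)[symmetric] using l(1-3) g(1-3) by simp
    also have "... = sha l ** sha g ** w" by (rule cmp_assoc) (simp_all add: l(1-3) g(1-3) dk')
    also have "... = zr (cd k) (sho m)" unfolding dist_zero3[OF dk] using l(1-3) g dk' by simp
    finally show "q = zr (cd k) (sho m)" .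
   qed (use dk' M_Ob m in auto)
   then show ?thesis unfolding kl_def using 2 by simp
  next
   case 3
   then show ?thesis using kl_cone[OF T t(2) vk] by simp
  qed
  then show ?thesis using kl_sho dk' by simp
 qed
 then have "sho (cd k) \<in> Uo" unfolding Uo_def using dk' by simp
 then show ?thesis using T svVo by blast
qed

lemma Vo_ext: "ext_closed Vo"
 unfolding ext_closed_def
proof (intro ballI allI impI)
 fix x z y assume "x \<in> Vo" "z \<in> Vo" "tr x y z"
 then show "y \<in> Vo" using S_ext[of x y z] kl_mid[of x y z] unfolding Vo_def by blast
qed

text \<open>Induction on a bound \<open>n\<close> for the degrees with arrows from \<open>t\<close>
  to M[i]. Shifting by \<open>int n + 1\<close> brings the object into \<open>Uo\<close>, one
  application of \<open>Uo_step\<close> lowers the bound, and associativity collects the pieces from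
  \<open>Vo\<close>.\<close>

lemma co_t_structure: "star T Vo Uo = Ob T"
proof
 show "star T Vo Uo \<subseteq> Ob T" using star_iff tr_Ob by blast
 have *: "t \<in> star T Vo Uo" if "t \<in> Ob T" "\<forall>i>int n. kl t i" for n t
  using that
 proof (induction n arbitrary: t)
  case 0
  then have "t \<in> Uo" unfolding Uo_def by simp
  moreover obtain z where z: "zero_object T z" using zero_ex by blast
  moreover have "z \<in> Vo" unfolding Vo_def using S_zero[OF z] kl_zero[OF z] by blast
  ultimately show ?case using isom_tr2[OF isom_refl z, of t] 0 star_iff by blast
 next
  case (Suc n)
  let ?u = "sft (- (int n + 1)) t"
  have "?u \<in> Uo" unfolding Uo_def using Suc.prems kl_sft by simp
  then obtain v c where vc: "tr v ?u c" "sho v \<in> Vo" "sho c \<in> Uo" using Uo_step by blast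
  have ob: "v \<in> Ob T" "c \<in> Ob T" using tr_Ob[OF vc(1)] by auto
  have "v \<in> S" using vc(2) S_sho_iff ob unfolding Vo_def by simp
  moreover have "kl (sft (int n + 1) v) i" if "i \<le> 0" for i
  proof -
   have "kl (sho v) (i - int n)" using vc(2) that unfolding Vo_def by auto
   then show ?thesis using kl_sho[OF ob(1)] kl_sft[OF ob(1), of "int n + 1" i] by (simp add: algebra_simps)
  qed
  ultimately have 1: "sft (int n + 1) v \<in> Vo" using sft_S unfolding Vo_def by blast
  have "kl (sft (int n + 1) c) i" if "i > int n" for i
  proof -
   have "kl (sho c) (i - int n)" using vc(3) that unfolding Uo_def by auto
   then show ?thesis using kl_sho[OF ob(2)] kl_sft[OF ob(2), of "int n + 1" i] by (simp add: algebra_simps)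
  qed
  then have 2: "sft (int n + 1) c \<in> star T Vo Uo" using Suc.IH ob by simp
  have "tr (sft (int n + 1) v) (sft (int n + 1) ?u) (sft (int n + 1) c)" by (rule tr_sft[OF vc(1)])
  then have "tr (sft (int n + 1) v) t (sft (int n + 1) c)"
   by (rule tr_isom[OF _ isom_refl sft_neg_cancel(2)[OF Suc.prems(1)] isom_refl]) (use ob in auto)
  then have "t \<in> star T Vo (star T Vo Uo)" using 1 2 star_iff by blast
  then have "t \<in> star T (star T Vo Vo) Uo" unfolding star_assoc .
  moreover have "star T Vo Vo \<subseteq> Vo" using Vo_ext ext_closed_iff by blast
  ultimately show ?case using star_mono[of "star T Vo Vo" Vo Uo Uo] by blast
 qed
 show "Ob T \<subseteq> star T Vo Uo"
 proof
  fix t assume t: "t \<in> Ob T"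
  then obtain n where "\<forall>i>n. kl t i" using kl_bounded by blast
  then show "t \<in> star T Vo Uo" using *[OF t, of "nat n"] by auto
 qed
qed

end

section \<open>Finite length of the heart\<close>

lemma dim_exact:
 assumes "vectorspace K U" "vectorspace K V" "vectorspace K W" "vectorspace.fin_dim K U" "vectorspace.fin_dim K V"
  "f \<in> module_hom K U V" "g \<in> module_hom K V W" "inj_on f (carrier U)" "g ` carrier V = carrier W"
  "f ` carrier U = {v \<in> carrier V. g v = \<zero>\<^bsub>W\<^esub>}"
 shows "vectorspace.dim K V = vectorspace.dim K U + vectorspace.dim K W"
proof -
 interpret f: linear_map K U V f using assms unfolding linear_map_def mod_hom_def mod_hom_axioms_def vectorspace_def by blast
 interpret g: linear_map K V W g using assms unfolding linear_map_def mod_hom_def mod_hom_axioms_def vectorspace_def by blast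
 have "f.imT = g.kerT" using assms(10) unfolding f.im_def g.ker_def by simp
 moreover have "g.imT = carrier W" using g.surj_imp_imT_carrier[OF assms(9)] .
 ultimately show ?thesis
  using f.rank_nullity[OF assms(4)] f.inj_imp_dim_ker0[OF assms(8)] g.rank_nullity[OF assms(5)] by simp
qed

lemma dim_zero:
 assumes "vectorspace K V" "vectorspace.fin_dim K V" "vectorspace.dim K V = 0" shows "carrier V = {\<zero>\<^bsub>V\<^esub>}"
proof -
 interpret vectorspace K V by fact
 obtain A where A: "finite A" "basis A" using finite_basis_exists[OF assms(2)] by blast
 then have "A = {}" using dim_basis[OF A] assms(3) by simp
 then show ?thesis using A(2) span_empty unfolding basis_def by simp
qed

context relative_serre_quadruple
begin

definition Ho :: "'o set" where "Ho = {h \<in> Ob T. \<forall>i. i \<noteq> 0 --> kr h i}"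

lemma kr_S: assumes "t \<in> Ob T" "!!i. i \<ge> k ==> kr t i" shows "t \<in> S"
proof -
 have "sft (- k) t \<in> rperp T (shifts T M {0..})" using assms kr_sft unfolding rperp_shifts by simp
 then have "sft k (sft (- k) t) \<in> S" using RS2_subset sft_S by blast
 then show ?thesis using S_isom sft_neg_cancel(2)[OF assms(1)] by blast
qed

lemma kr_all_zero: assumes "t \<in> Ob T" "!!i. kr t i" shows "zero_object T t"
 using t_hz[OF assms(1,1), of 0] assms hz_self by blast

lemma Ho_S: "h \<in> Ho ==> h \<in> S"
 unfolding Ho_def by (rule kr_S[of _ 1]) auto

text \<open>Simple objects of the heart. Short exact sequences of a heart are the triangles with all
  three terms in it, so simplicity is stated by triangles and the abelian structure is never
  constructed.\<close>

definition simple :: "'o => bool" where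
 "simple s \<longleftrightarrow> s \<in> Ho & \<not> zero_object T s &
  (\<forall>a b. a \<in> Ho & b \<in> Ho & tr a s b --> zero_object T a \<or> zero_object T b)"

text \<open>Truncating the cone of \<open>f\<close> separates the cokernel \<open>q\<close> from the
  shifted kernel \<open>a\<close>, and the octahedron for s -> cone -> q produces the image
  \<open>shi (cd w1)\<close>. It is a subobject of \<open>s\<close> and a quotient of
  \<open>b\<close>, so if it is nonzero it is isomorphic to both.\<close>

lemma schur:
 assumes "simple b" "simple s" shows "hz b s \<or> b \<simeq> s"
proof (rule disjCI)
 assume "\<not> b \<simeq> s"
 have bs: "b \<in> Ob T" "s \<in> Ob T" "!!i. i \<noteq> 0 ==> kr b i" "!!i. i \<noteq> 0 ==> kr s i"
  using assms unfolding simple_def Ho_def by auto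
 show "hz b s"
 proof (rule hzI)
  fix f assume f: "ar f" "dm f = b" "cd f = s"
  obtain g h where d: "dist f g h" using dist_ex[OF f(1)] by blast
  note d' = dist_ar[OF d]
  have T: "tr b s (cd g)" using trI[OF d] f by simp
  have c: "kr (cd g) i" if "i \<noteq> 0" "i \<noteq> 1" for i using kr_cone[OF T bs(4)[of i] bs(3)[of "i - 1"]] that by simp
  obtain a q where aq: "tr a (cd g) q" "!!i. i < 1 ==> kr a i" "!!i. i \<ge> 1 ==> kr q i"
   by (rule t_truncation[of "cd g" 1]) (use d' in auto)
  have ob: "a \<in> Ob T" "q \<in> Ob T" using tr_Ob[OF aq(1)] by auto
  have q: "kr q i" if "i \<noteq> 0" for i
   using aq(3)[of i] kr_cone[OF aq(1) c[of i] aq(2)[of "i - 1"]] that by (cases "i < 0") auto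
  have a: "kr a i" if "i \<noteq> 1" for i
   using aq(2)[of i] kr_fiber[OF aq(1) c[of i] q[of "i + 1"]] that by (cases "i < 1") auto
  obtain u w v where k: "dist u w v" "dm u = a" "cd u = cd g" "cd w = q" using aq(1) by (rule trE)
  note k' = dist_ar[OF k(1)]
  note ty = d' k' k(2-4) f bs(1,2) ob
  obtain w1 w2 where l: "dist (w ** g) w1 w2" using dist_ex[of "w ** g"] ty by auto
  note l' = dist_ar[OF l]
  have "tr (cd h) (cd w1) (cd v)" by (rule octahedron_tr[OF dist_rot[OF d] dist_rot[OF k(1)] l]) (simp add: ty)
  then have "tr (shi (cd h)) (shi (cd w1)) (shi (cd v))" by (rule tr_shi)
  then have t1: "tr b (shi (cd w1)) a" by (rule tr_isom) (simp_all add: ty shi_sh l')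
  have "tr s q (cd w1)" by (rule trI[OF l]) (use ty in simp_all)
  then have t2: "tr (shi (cd w1)) s q" by (rule tr_unrot)
  have "kr (shi (cd w1)) i" if "i \<noteq> 0" for i
   using kr_fiber[OF t2 bs(4)[of i] q[of "i + 1"]] kr_mid[OF t1 bs(3)[of i] a[of i]] that by (cases "i = 1") auto
  then have e: "shi (cd w1) \<in> Ho" and qH: "q \<in> Ho" unfolding Ho_def using tr_Ob[OF t2] q by auto
  then consider "zero_object T (shi (cd w1))" | "zero_object T q" using assms(2) t2 unfolding simple_def by blast
  then show "f = zr b s"
  proof cases
   case 1
   have "cd w1 \<simeq> sho (shi (cd w1))" by (rule isom_sym, rule sh_shi) (use l' in simp)
   then have "zero_object T (cd w1)" using zero_object_isom[OF Sh.F_zero[OF 1]] isom_sym by blast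
   then have "hz (sho (dm f)) (cd w1)" using zero_objectD ty by simp
   moreover have "(w ** g) ** f = zr (dm f) (cd (w ** g))" using dist_zero1[OF d] ty by simp
   ultimately show ?thesis using fiber_cancel[OF l f(1)] ty by simp
  next
   case 2
   have es: "shi (cd w1) \<simeq> s" using tr_zero3[OF t2 2] .
   then have t3: "tr (shi a) b s" using tr_isom[OF tr_unrot[OF t1] _ _ es] bs(1) ob by simp
   have "shi a \<in> Ho" unfolding Ho_def using a kr_shi ob by simp
   then have "zero_object T (shi a)" using assms t3 unfolding simple_def by blast
   then have "b \<simeq> s" using tr_zero1[OF t3] by blast
   then show ?thesis using \<open>\<not> b \<simeq> s\<close> by blast
  qed
 qed (use bs in auto)
qed

lemma filt_mono: assumes "A \<subseteq> B" shows "filt A \<subseteq> filt B"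
proof
 fix x assume "x \<in> filt A" then show "x \<in> filt B"
  by (induction rule: filt.induct) (use assms filt.intros in blast)+
qed

lemma filt_finite: assumes "x \<in> filt A" shows "\<exists>B\<subseteq>A. finite B & x \<in> filt B"
 using assms
proof (induction rule: filt.induct)
 case (zero z)
 then show ?case using filt.zero[of z "{}"] by blast
next
 case (step a b t)
 then obtain B where B: "B \<subseteq> A" "finite B" "a \<in> filt B" by blast
 have "a \<in> filt (insert b B)" using B(3) filt_mono[of B "insert b B"] by blast
 then have "t \<in> filt (insert b B)" using filt.step[of a "insert b B" b t] step.hyps by blast
 then show ?case using B step.hyps by (intro exI[of _ "insert b B"]) auto
qed

text \<open>Hom(m, -) is exact on triangles of the heart, because there are no arrows from
  \<open>m\<close> to a[1] and b[-1], and by hypothesis it detects zero. So its dimension drops in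
  both outer terms of a nontrivial triangle.\<close>

lemma heart_filt:
 assumes m: "m \<in> M" "!!h. [|h \<in> Ho; hz m h|] ==> zero_object T h" and h: "h \<in> Ho"
 shows "h \<in> filt {s. simple s}"
 using h
proof (induction "vectorspace.dim K (Hom T m h)" arbitrary: h rule: less_induct)
 case less
 have mO: "m \<in> Ob T" using M_Ob[OF m(1)] .
 show ?case
 proof (cases "simple h \<or> zero_object T h")
  case True
  then show ?thesis using filt_base[of h] filt.zero less.prems unfolding Ho_def by blast
 next
  case False
  then obtain a b where ab: "a \<in> Ho" "b \<in> Ho" "tr a h b" "\<not> zero_object T a" "\<not> zero_object T b"
   using less.prems unfolding simple_def by blast
  have ob: "a \<in> Ob T" "h \<in> Ob T" "b \<in> Ob T" using tr_Ob[OF ab(3)] by auto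
  have "kr (sho a) 0" "kr (shi b) 0" using ab(1,2) kr_sho kr_shi ob unfolding Ho_def by auto
  then have hz: "hz m (sho a)" "hz m (shi b)" using m(1) unfolding kr_def by auto
  obtain f g k where d: "dist f g k" "dm f = a" "cd f = h" "cd g = b" using ab(3) by (rule trE)
  note d' = dist_ar[OF d(1)]
  note ty = d' d(2-4) mO ob
  have e1: "x = zr m a" if x: "ar x" "dm x = m" "cd x = a" "f ** x = zr m h" for x
  proof -
   have "hz (sho m) b" using hz(2) hz_sft[of m "shi b" 1] hz_cong[OF isom_refl sh_shi[OF ob(3)], of "sho m"] mO ob by simp
   then show ?thesis using fiber_cancel[OF d(1) x(1)] x ty by simp
  qed
  have e2: "\<exists>y. ar y & dm y = m & cd y = h & g ** y = x" if x: "ar x" "dm x = m" "cd x = b" for x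
  proof -
   have "k ** x = zr m (sho a)" by (rule hzD[OF hz(1)]) (use x ty in auto)
   then show ?thesis by - (rule exrE[OF dist_exr(2)[OF d(1)], of x], use x ty in auto)
  qed
  have dim: "vectorspace.dim K (Hom T m h) = vectorspace.dim K (Hom T m a) + vectorspace.dim K (Hom T m b)"
  proof (rule dim_exact[where f="\<lambda>x. f ** x" and g="\<lambda>x. g ** x"])
   show "(\<lambda>x. f ** x) \<in> module_hom K (Hom T m a) (Hom T m h)" "(\<lambda>x. g ** x) \<in> module_hom K (Hom T m h) (Hom T m b)"
    by (rule comp_linear_right; use ty in simp)+
   show "inj_on (\<lambda>x. f ** x) (arr T m a)"
   proof (rule inj_onI)
    fix x y assume "x \<in> arr T m a" "y \<in> arr T m a" and e: "f ** x = f ** y"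
    then have xy: "ar x" "dm x = m" "cd x = a" "ar y" "dm y = m" "cd y = a" using ty by auto
    have "f ** (x \<boxplus> ng y) = zr m h" using e by (simp add: cmp_pl xy ty)
    then have "x \<boxplus> ng y = zr m a" by (intro e1) (simp_all add: xy)
    then show "x = y" using diff_zr[of x y] by (simp add: xy)
   qed
   show "(\<lambda>x. g ** x) ` arr T m h = arr T m b"
   proof (intro equalityI subsetI)
    fix x assume "x \<in> arr T m b"
    then obtain y where "ar y" "dm y = m" "cd y = h" "g ** y = x" using e2[of x] ty by auto
    then show "x \<in> (\<lambda>x. g ** x) ` arr T m h" using ty by auto
   qed (use ty in auto)
   show "(\<lambda>x. f ** x) ` arr T m a = {v \<in> arr T m h. g ** v = \<zero>\<^bsub>Hom T m b\<^esub>}"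
   proof (intro equalityI subsetI)
    fix x assume "x \<in> (\<lambda>x. f ** x) ` arr T m a"
    then obtain y where y: "ar y" "dm y = m" "cd y = a" "x = f ** y" using ty by auto
    have "g ** f ** y = zr m b" using pull[OF dist_zero1[OF d(1)], of y] y(1-3) ty by simp
    then show "x \<in> {v \<in> arr T m h. g ** v = \<zero>\<^bsub>Hom T m b\<^esub>}" using y ty by (simp add: zr_eq)
   next
    fix x assume "x \<in> {v \<in> arr T m h. g ** v = \<zero>\<^bsub>Hom T m b\<^esub>}"
    then have x: "ar x" "dm x = m" "cd x = h" "g ** x = zr m b" using ty by (auto simp: zr_eq)
    then obtain y where y: "ar y" "dm y = dm x" "cd y = dm f" "f ** y = x"
     by - (rule exrE[OF dist_exr(1)[OF d(1)], of x], simp_all add: ty)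
    show "x \<in> (\<lambda>x. f ** x) ` arr T m a" by (rule image_eqI, rule y(4)[symmetric]) (use x y(1-3) ty in simp)
   qed
  qed (use hom_vectorspace hom_fin_dim mO ob in auto)
  have nz: "vectorspace.dim K (Hom T m c) > 0" if "c \<in> Ho" "\<not> zero_object T c" for c
  proof (rule ccontr)
   assume "\<not> ?thesis"
   moreover have "c \<in> Ob T" using that unfolding Ho_def by blast
   ultimately have "arr T m c = {\<zero>\<^bsub>Hom T m c\<^esub>}" using dim_zero[OF hom_vectorspace hom_fin_dim] mO by simp
   then have "hz m c" unfolding hom_zero_def by simp
   then show False using m(2) that by blast
  qed
  have "a \<in> filt {s. simple s}" "b \<in> filt {s. simple s}"
   using less.hyps dim nz[OF ab(1,4)] nz[OF ab(2,5)] ab(1,2) by simp_all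
  then show ?thesis using ext_closedD[OF filt_ext] ab(3) by blast
 qed
qed

text \<open>The lower bound that every object has for \<open>kr\<close> is moved to
  \<open>kl\<close> by Serre duality; this is where membership in \<open>S\<close> enters.\<close>

lemma S_kl_below: assumes "x \<in> S" shows "\<exists>n. \<forall>i<n. kl x i"
 using kr_bounded[OF sso_Ob[OF assms]] kl_iff_kr_sso[OF assms] by simp

lemma S_kr_above: assumes "x \<in> S" shows "\<exists>n. \<forall>i>n. kr x i"
proof -
 obtain v u where v: "v \<in> S" and u: "is_iso u" "dm u = x" "cd u = sso v" by (rule SS_dense[OF assms])
 obtain n where "\<forall>i>n. kl v i" using kl_bounded v S_Ob by blast
 then have "\<forall>i>n. kr (sso v) i" using kl_iff_kr_sso[OF v] by simp
 then show ?thesis using kr_isom[OF isom_sym[OF isomI[OF u]]] by blast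
qed

text \<open>The truncation \<open>p\<close> of \<open>m\<close> to the heart has a nonzero arrow to
  every simple object, so by \<open>schur\<close> each simple object is isomorphic to one of
  finitely many factors of \<open>p\<close>. Each factor has a bound of its own, and the minimum
  serves the whole heart.\<close>

lemma heart_bound:
 assumes m: "m \<in> M" "!!h. [|h \<in> Ho; hz m h|] ==> zero_object T h"
 shows "\<exists>n. \<forall>h\<in>Ho. \<forall>i<n. kl h i"
proof -
 have mO: "m \<in> Ob T" using M_Ob[OF m(1)] .
 obtain a p where ap: "tr a m p" "!!i. i < 1 ==> kr a i" "!!i. i \<ge> 1 ==> kr p i" by (rule t_truncation[OF mO, of 1]) (rule that, assumption+)
 have ob: "a \<in> Ob T" "p \<in> Ob T" using tr_Ob[OF ap(1)] by auto
 have "kr p i" if "i \<noteq> 0" for i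
  using ap(3)[of i] kr_cone[OF ap(1) M_kr[OF m(1)] ap(2)[of "i - 1"]] that by (cases "i < 0") auto
 then have "p \<in> Ho" unfolding Ho_def using ob by blast
 then obtain B where B: "B \<subseteq> {s. simple s}" "finite B" "p \<in> filt B" using filt_finite heart_filt[OF m] by blast
 have "\<exists>n. \<forall>s\<in>B. \<forall>i<n. kl s i" using B(2,1)
 proof (induction B)
  case (insert s B)
  then obtain n where "\<forall>s\<in>B. \<forall>i<n. kl s i" by blast
  moreover have "s \<in> S" using insert.prems Ho_S unfolding simple_def by blast
  then obtain k where "\<forall>i<k. kl s i" using S_kl_below by blast
  ultimately show ?case by (intro exI[of _ "min n k"]) auto
 qed simp
 then obtain n where n: "\<forall>s\<in>B. \<forall>i<n. kl s i" by blast
 have "kl s i" if s: "simple s" and i: "i < n" for s i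
 proof -
  have sH: "s \<in> Ho" "\<not> zero_object T s" using s unfolding simple_def by auto
  have "\<not> hz p s"
  proof
   assume "hz p s"
   moreover have "hz a s" by (rule t_hz[of _ _ 1]) (use ap ob sH in "auto simp: Ho_def")
   ultimately have "hz m s" using tr_hz_mid2[OF ap(1)] sH unfolding Ho_def by blast
   then show False using m(2) sH by blast
  qed
  then obtain b where b: "b \<in> B" "\<not> hz b s" using filt_hz_left[OF B(3)] sH unfolding Ho_def by blast
  then have "b \<simeq> s" using schur[of b s] B(1) s by blast
  then show ?thesis using kl_isom n b(1) i by blast
 qed
 moreover have "\<forall>i<n. kl h i" if h: "h \<in> filt {s. simple s}" and s: "!!s i. [|simple s; i < n|] ==> kl s i" for h
  using h by (induction rule: filt.induct) (use s kl_zero kl_mid in blast)+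
 ultimately show ?thesis using heart_filt[OF m] by blast
qed

definition Xo :: "'o set" where "Xo = {x \<in> S. \<forall>i<0. kr x i}"

text \<open>An object of X receives arrows from M[i] in finitely many degrees. Splitting off the top
  degree leaves a heart object shifted by k at least 0, and such a shift respects the lower
  bound.\<close>

lemma Xo_bound:
 assumes m: "m \<in> M" "!!h. [|h \<in> Ho; hz m h|] ==> zero_object T h"
 shows "\<exists>n. \<forall>x\<in>Xo. \<forall>i<n. kl x i"
proof -
 obtain n where n: "!!h i. h \<in> Ho ==> i < n ==> kl h i" using heart_bound[OF m] by blast
 have *: "\<forall>i<n. kl x i" if "x \<in> Xo" "\<forall>i\<ge>int k. kr x i" for x k
  using that
 proof (induction k arbitrary: x)
  case 0
  have "x \<in> Ob T" "!!i. kr x i" using 0 S_Ob unfolding Xo_def by (auto simp: not_less[symmetric])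
  then show ?case using kl_zero[OF kr_all_zero] by blast
 next
  case (Suc k)
  have x: "x \<in> S" "x \<in> Ob T" "!!i. i < 0 ==> kr x i" "!!i. i \<ge> int k + 1 ==> kr x i"
   using Suc.prems S_Ob unfolding Xo_def by (auto simp: add.commute)
  obtain a b where ab: "tr a x b" "!!i. i < int k ==> kr a i" "!!i. i \<ge> int k ==> kr b i" "b \<in> S"
   by (rule t_truncation[OF x(2), of "int k"]) (rule that, assumption+)
  have ob: "a \<in> Ob T" "b \<in> Ob T" using tr_Ob[OF ab(1)] by auto
  have "b \<in> Xo" unfolding Xo_def using ab(2,4) kr_cone[OF ab(1) x(3)] by simp
  then have b: "\<forall>i<n. kl b i" using Suc.IH ab(3) by blast
  have "kr a i" if "i \<noteq> int k" for i
   using ab(2)[of i] kr_fiber[OF ab(1) x(4)[of i] ab(3)[of "i + 1"]] that by (cases "i < int k") auto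
  then have "sft (- int k) a \<in> Ho" unfolding Ho_def using kr_sft ob by simp
  then have "kl a i" if "i < n" for i using n[of "sft (- int k) a" "i - int k"] kl_sft ob that by simp
  then show ?case using b kl_mid[OF ab(1)] by blast
 qed
 show ?thesis
 proof (intro exI ballI)
  fix x assume x: "x \<in> Xo"
  then obtain k where "\<forall>i>k. kr x i" using S_kr_above unfolding Xo_def by blast
  then show "\<forall>i<n. kl x i" by (intro *[OF x, of "nat (k + 1)"]) auto
 qed
qed

end

context lin_category
begin

lemma direct_sum_hz:
 assumes "direct_sum C xs b" "h \<in> Ob C" "!!x. x \<in> set xs ==> hz x h" shows "hz b h"
proof (rule hzI)
 show b: "b \<in> Ob C" using assms(1) unfolding direct_sum_def by blast
 fix f assume f: "ar f" "dm f = b" "cd f = h"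
 let ?n = "length xs"
 obtain \<iota> \<pi> where 1: "\<forall>i<?n. ar (\<iota> i) & dm (\<iota> i) = xs ! i & cd (\<iota> i) = b & ar (\<pi> i) & dm (\<pi> i) = b & cd (\<pi> i) = xs ! i"
  and 2: "fsum b b (\<lambda>i. \<iota> i ** \<pi> i) ?n = idt b" using assms(1) unfolding direct_sum_iff by blast
 have 0: "f ** (\<iota> i ** \<pi> i) ** idt b = zr b h" if "i < ?n" for i
 proof -
  have i: "ar (\<iota> i)" "dm (\<iota> i) = xs ! i" "cd (\<iota> i) = b" "ar (\<pi> i)" "dm (\<pi> i) = b" "cd (\<pi> i) = xs ! i" using 1 that by auto
  have "f ** \<iota> i = zr (xs ! i) h" by (rule hzD[OF assms(3)]) (use f i that in auto)
  then have "f ** \<iota> i ** \<pi> i = zr (xs ! i) h ** \<pi> i" by (rule pull) (use f i in auto)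
  then show ?thesis using f i assms(2) b by simp
 qed
 have z: "fsum b h (\<lambda>i. zr b h) n = zr b h" for n
  by (induction n) (use b assms(2) in "simp_all add: fsum_Suc")
 have "f = f ** fsum b b (\<lambda>i. \<iota> i ** \<pi> i) ?n ** idt b" unfolding 2 using f b by simp
 also have "... = fsum (dm (idt b)) (cd f) (\<lambda>i. f ** (\<iota> i ** \<pi> i) ** idt b) ?n"
  by (rule fsum_cmp) (use f b 1 in auto)
 also have "... = fsum b h (\<lambda>i. f ** (\<iota> i ** \<pi> i) ** idt b) ?n" using f b by simp
 also have "... = fsum b h (\<lambda>i. zr b h) ?n" by (rule fsum_cong) (simp_all add: 0 b assms(2))
 finally show "f = zr b h" unfolding z .
qed (rule assms)

lemma direct_sum_single: "x \<in> Ob C ==> direct_sum C [x] x"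
 by (rule direct_sumI[of _ _ "\<lambda>_. idt x" "\<lambda>_. idt x"]) (auto simp: fsum_Suc)

lemma direct_sum_zero: assumes "x \<in> Ob C" "zero_object C z" shows "direct_sum C [x, z] x"
 unfolding direct_sum_two using assms zero_objectD(1)[OF assms(2)] zero_cd[OF assms(2), of "idt z"]
 by (intro conjI exI[of _ "idt x"] exI[of _ "zr z x"] exI[of _ "idt x"] exI[of _ "zr x z"]; simp)

end

lemma (in lin_category) rperp_iff: "t \<in> rperp C X \<longleftrightarrow> t \<in> Ob C & (\<forall>x\<in>X. hz x t)"
proof -
 have "hom_zero C X {t} \<longleftrightarrow> (\<forall>x\<in>X. hz x t)" by (rule trans[OF hom_zero_iff]) simp
 then show ?thesis unfolding rperp_def by blast
qed

section \<open>The decomposition by X and its right orthogonal in case (ii)\<close>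

context relative_serre_quadruple
begin

lemma add_closure_self: assumes "m \<in> Ob T" shows "m \<in> add_closure T m"
proof -
 obtain z where z: "zero_object T z" using zero_ex by blast
 show ?thesis unfolding add_closure_def
  by (rule CollectI, rule exI[of _ 1], rule exI[of _ z], rule exI[of _ m])
   (use direct_sum_single[OF assms] direct_sum_zero[OF assms z] in simp)
qed

lemma add_closure_hz: assumes "a \<in> add_closure T m" "h \<in> Ob T" "hz m h" shows "hz a h"
proof -
 obtain n y b where b: "direct_sum T (replicate n m) b" "direct_sum T [a, y] b" using assms(1) unfolding add_closure_def by blast
 have "hz b h" by (rule direct_sum_hz[OF b(1) assms(2)]) (use assms(3) in auto)
 then show ?thesis using retr_hz_left[of a b h] direct_sum_retr[OF b(2)] assms(2) by blast
qed

lemma torsion_additive_generator: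
 assumes "m \<in> Ob T" "M = add_closure T m" shows "star T Xo (rperp T Xo) = Ob T"
proof
 show "star T Xo (rperp T Xo) \<subseteq> Ob T" using star_iff tr_Ob by blast
 have m: "m \<in> M" using add_closure_self[OF assms(1)] assms(2) by simp
 have g: "zero_object T h" if "h \<in> Ho" "hz m h" for h
 proof (rule kr_all_zero)
  show h: "h \<in> Ob T" using that unfolding Ho_def by blast
  show "kr h i" for i
  proof (cases "i = 0")
   case True
   then show ?thesis unfolding kr_def using add_closure_hz[OF _ h that(2)] assms(2) by simp
  qed (use that in "simp add: Ho_def")
 qed
 obtain n where n: "!!x i. x \<in> Xo ==> i < n ==> kl x i" using Xo_bound[OF m g] by blast
 show "Ob T \<subseteq> star T Xo (rperp T Xo)"
 proof
  fix t assume t: "t \<in> Ob T"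
  \<comment> \<open>Arrows from X to M[i] vanish for i < n. Hence x[1 - n] has none to M[i] for i
    \<le> 0 and lies in \<open>Vo\<close>; this fixes the shift.\<close>
  have "sft (1 - n) t \<in> star T Vo Uo" using co_t_structure t by simp
  then obtain v u where vu: "v \<in> Vo" "u \<in> Uo" "tr v (sft (1 - n) t) u" unfolding star_iff by blast
  have ob: "v \<in> Ob T" "u \<in> Ob T" using tr_Ob[OF vu(3)] by auto
  let ?v = "sft (- (1 - n)) v" and ?u = "sft (- (1 - n)) u"
  have "tr ?v (sft (- (1 - n)) (sft (1 - n) t)) ?u" by (rule tr_sft[OF vu(3)])
  then have T: "tr ?v t ?u" by (rule tr_isom[OF _ isom_refl sft_neg_cancel(1)[OF t] isom_refl]) (use ob in auto)
  have vS: "?v \<in> S" using vu(1) sft_S unfolding Vo_def by blast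
  \<comment> \<open>\<open>?v\<close> lies in a class that contains X but may be larger. Its
    truncation \<open>x\<close> is in X, and the remainder \<open>y\<close> is orthogonal to X, so
    it can be joined to \<open>?u\<close>.\<close>
  obtain x y where xy: "tr x ?v y" "!!i. i < 0 ==> kr x i" "!!i. i \<ge> 0 ==> kr y i" "y \<in> S"
   by (rule t_truncation[of ?v 0]) (use ob in auto)
  have x: "x \<in> Xo" unfolding Xo_def using S_fiber[OF xy(1) vS xy(4)] xy(2) by blast
  obtain d where d: "tr y d ?u" "tr x t d" using tr_assoc1[OF xy(1) T] by blast
  have "hz x' d" if x': "x' \<in> Xo" for x'
  proof -
   have x'O: "x' \<in> S" "x' \<in> Ob T" using x' S_Ob unfolding Xo_def by auto
   have "sft (1 - n) x' \<in> Vo" unfolding Vo_def using sft_S[OF x'O(1)] kl_sft[OF x'O(2)] n[OF x'] by simp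
   then have "hz (sft (1 - n) x') u" using hz_Vo_Uo vu(2) by blast
   then have "hz x' ?u" using hz_sft_left[OF x'O(2) ob(2)] by simp
   moreover have "hz x' y" by (rule t_hz[of _ _ 0]) (use x' x'O tr_Ob[OF xy(1)] xy(3) in "auto simp: Xo_def")
   ultimately show ?thesis using tr_hz_mid[OF d(1) x'O(2)] by blast
  qed
  then have "d \<in> rperp T Xo" unfolding rperp_iff using tr_Ob[OF d(2)] by blast
  then show "t \<in> star T Xo (rperp T Xo)" using x d(2) unfolding star_iff by blast
 qed
qed

end

subsection \<open>An extension of the Serre functor\<close>

locale serre_extension = relative_serre_quadruple K T S \<SS> M
 for K :: "('k, 'r) ring_scheme" (structure) and T :: "('o, 'm, 'k, 'z) tricat_scheme"
  and S :: "'o set" and \<SS> :: "('o, 'm, 'o, 'm) cfun" and M :: "'o set" +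
 fixes F :: "('o, 'm, 'o, 'm) cfun"
 assumes extends: "extends_serre K T S \<SS> F"

sublocale serre_extension \<subseteq> Fx: linear_functor K T T F
 using extends unfolding extends_serre_def triangle_equivalence_def triangle_functor_def
 by unfold_locales blast

context serre_extension
begin

abbreviation fo :: "'o => 'o" where "fo \<equiv> omap F"
abbreviation fa :: "'m => 'm" where "fa \<equiv> amap F"

lemma F_full: "Fx.full" and F_faithful: "Fx.faithful" and F_dense: "Fx.dense"
 using extends Fx.equivalenceD unfolding extends_serre_def triangle_equivalence_def cat_equivalence_def by blast+

definition fs :: "'o => 'm" where
 "fs = (SOME \<phi>. nat_iso T T (F \<circ>\<^sub>F Sh T) (Sh T \<circ>\<^sub>F F) \<phi> &
   (\<forall>x y z f g h. triangle T x y z f g h -->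
    triangle T (fo x) (fo y) (fo z) (fa f) (fa g) (\<phi> x ** fa h)))"

lemma fs: "nat_iso T T (F \<circ>\<^sub>F Sh T) (Sh T \<circ>\<^sub>F F) fs"
 "triangle T x y z f g h ==> triangle T (fo x) (fo y) (fo z) (fa f) (fa g) (fs x ** fa h)"
 using someI_ex[of "\<lambda>\<phi>. nat_iso T T (F \<circ>\<^sub>F Sh T) (Sh T \<circ>\<^sub>F F) \<phi> &
   (\<forall>x y z f g h. triangle T x y z f g h -->
    triangle T (fo x) (fo y) (fo z) (fa f) (fa g) (\<phi> x ** fa h))"] extends
 unfolding fs_def[symmetric] extends_serre_def triangle_equivalence_def triangle_functor_def by blast+

lemma fs_iso [simp]: "x \<in> Ob T ==> is_iso (fs x)" "x \<in> Ob T ==> dm (fs x) = fo (sho x)"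
  "x \<in> Ob T ==> cd (fs x) = sho (fo x)"
 using fs(1) isos_iff unfolding nat_iso_def by auto

lemma fs_nat: "ar f ==> fs (cd f) ** fa (sha f) = sha (fa f) ** fs (dm f)"
 using fs(1) arI unfolding nat_iso_def by auto

lemma F_dist: "dist f g h ==> dist (fa f) (fa g) (fs (dm f) ** fa h)"
 using fs(2)[of "dm f" "cd f" "cd g" f g h] unfolding triangle_iff by blast

lemma F_tr: assumes "tr x y z" shows "tr (fo x) (fo y) (fo z)"
proof -
 obtain f g h where d: "dist f g h" "dm f = x" "cd f = y" "cd g = z" using assms by (rule trE)
 show ?thesis by (rule trI[OF F_dist[OF d(1)]]) (use d dist_ar[OF d(1)] in auto)
qed

definition fe :: "'o => 'm" where "fe = (SOME \<eta>. nat_iso (full_subcat T S) T F \<SS> \<eta>)"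

lemma fe: "nat_iso (full_subcat T S) T F \<SS> fe"
 using extends someI_ex[of "nat_iso (full_subcat T S) T F \<SS>"] unfolding extends_serre_def fe_def by blast

lemma fe_iso [simp]: "x \<in> S ==> is_iso (fe x)" "x \<in> S ==> dm (fe x) = fo x" "x \<in> S ==> cd (fe x) = sso x"
 using fe isos_iff S_Ob unfolding nat_iso_def by auto

lemma fe_nat: "[|ar f; dm f \<in> S; cd f \<in> S|] ==> fe (cd f) ** fa f = amap \<SS> f ** fe (dm f)"
 using fe arI unfolding nat_iso_def by auto

lemma F_hz: assumes "hz x y" "x \<in> Ob T" "y \<in> Ob T" shows "hz (fo x) (fo y)"
proof (rule hzI)
 fix g assume "ar g" "dm g = fo x" "cd g = fo y"
 then obtain f where f: "ar f" "dm f = x" "cd f = y" "fa f = g" using Fx.fullD[OF F_full, of x y g] assms by blast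
 have "f = zr x y" by (rule hzD[OF assms(1) f(1-3)])
 then show "g = zr (fo x) (fo y)" using f(4) assms(2,3) by simp
qed (use assms in auto)

lemma fo_sso: "x \<in> S ==> fo x \<simeq> sso x"
 by (rule isomI[of "fe x"]) simp_all

text \<open>Serre duality turns \<open>kl v i\<close> into \<open>kr (sso v) i\<close>, and the
  shift by -1 moves the range i \<le> 0 to i < 0.\<close>

lemma fo_Vo_Xo: assumes "v \<in> Vo" shows "shi (fo v) \<in> Xo"
proof -
 have v: "v \<in> S" "v \<in> Ob T" "!!i. i \<le> 0 ==> kl v i" using assms S_Ob unfolding Vo_def by auto
 have "kr (fo v) i" if "i \<le> 0" for i
  using kr_isom[OF isom_sym[OF fo_sso[OF v(1)]]] kl_iff_kr_sso[OF v(1)] v(3)[OF that] by blast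
 then show ?thesis unfolding Xo_def
  using S_isom[OF sso_S[OF v(1)] isom_sym[OF fo_sso[OF v(1)]]] S_shi kr_shi v(2) by simp
qed

text \<open>Since \<open>\<SS>\<close> is dense on \<open>S\<close>, \<open>sho x\<close> is
  isomorphic to \<open>fo v\<close> for some \<open>v\<close> in \<open>Vo\<close>; the claim is
  then the image under \<open>F\<close> of Hom(v, u) = 0, desuspended.\<close>

lemma hz_Xo_fo_Uo: assumes "x \<in> Xo" "u \<in> Uo" shows "hz x (shi (fo u))"
proof -
 have u: "u \<in> Ob T" using assms(2) unfolding Uo_def by blast
 have x: "x \<in> S" "x \<in> Ob T" "!!i. i < 0 ==> kr x i" using assms(1) S_Ob unfolding Xo_def by auto
 obtain v a where v: "v \<in> S" and a: "is_iso a" "dm a = sho x" "cd a = sso v" using SS_dense[OF S_sho[OF x(1)]] .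
 have "kr (sso v) i" if "i \<le> 0" for i using kr_isom[OF isomI[OF a]] kr_sho[OF x(2)] x(3) that by simp
 then have "v \<in> Vo" unfolding Vo_def using v kl_iff_kr_sso[OF v] by blast
 then have "hz (fo v) (fo u)" using F_hz hz_Vo_Uo assms(2) S_Ob[OF v] u by blast
 moreover have "fo v \<simeq> sho x" using isom_trans[OF fo_sso[OF v] isom_sym[OF isomI[OF a]]] .
 ultimately have "hz (sho x) (fo u)" using hz_cong[OF _ isom_refl] u by simp
 moreover have "hz (sho x) (fo u) \<longleftrightarrow> hz (sho x) (sho (shi (fo u)))"
  using hz_cong[OF isom_refl isom_sym[OF sh_shi]] x u by simp
 ultimately show ?thesis using hz_sft[of x "shi (fo u)" 1] x u by simp
qed

lemma torsion_extension: "star T Xo (rperp T Xo) = Ob T"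
proof
 show "star T Xo (rperp T Xo) \<subseteq> Ob T" using star_iff tr_Ob by blast
 show "Ob T \<subseteq> star T Xo (rperp T Xo)"
 proof
  fix t assume t: "t \<in> Ob T"
  obtain w where w: "w \<in> Ob T" "fo w \<simeq> sho t" using F_dense Sh.F_ob[OF t] unfolding Fx.dense_def by blast
  then obtain v u where vu: "v \<in> Vo" "u \<in> Uo" "tr v w u" using co_t_structure star_iff by blast
  have ob: "v \<in> Ob T" "u \<in> Ob T" using tr_Ob[OF vu(3)] by auto
  have "tr (fo v) (sho t) (fo u)" using tr_isom[OF F_tr[OF vu(3)] isom_refl w(2) isom_refl] ob by simp
  then have "tr (shi (fo v)) (shi (sho t)) (shi (fo u))" by (rule tr_shi)
  then have T: "tr (shi (fo v)) t (shi (fo u))" using tr_isom[OF _ isom_refl shi_sh[OF t] isom_refl] ob by simp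
  then have "shi (fo u) \<in> rperp T Xo" using hz_Xo_fo_Uo[OF _ vu(2)] tr_Ob[OF T] unfolding rperp_iff by blast
  then show "t \<in> star T Xo (rperp T Xo)" using T fo_Vo_Xo[OF vu(1)] star_iff by blast
 qed
qed

end

context lin_category
begin

subsection \<open>The fundamental domain\<close>

lemma lperp_iff: "t \<in> lperp C X \<longleftrightarrow> t \<in> Ob C & (\<forall>x\<in>X. hz t x)"
proof -
 have "hom_zero C {t} X \<longleftrightarrow> (\<forall>x\<in>X. hz t x)" by (rule trans[OF hom_zero_iff]) simp
 then show ?thesis unfolding lperp_def by blast
qed

lemma full_subcat_lin_category: assumes "P \<subseteq> Ob C" shows "lin_category K (full_subcat C P)"
proof (rule lin_category.intro[OF field_axioms lin_category_axioms.intro], unfold full_subcat_simps)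
 have s: "x \<in> P ==> x \<in> Ob C" for x using assms by blast
 show "x \<in> P ==> y \<in> P ==> vectorspace K (Hom C x y)" for x y by (rule hom_vectorspace[OF s s])
 show "x \<in> P ==> y \<in> P ==> x' \<in> P ==> y' \<in> P ==> f \<in> arr C x y ==> f \<in> arr C x' y' ==> x = x' & y = y'"
  for x y x' y' f by (rule hom_disjoint[OF s s s s])
 show "x \<in> P ==> idt x \<in> arr C x x" for x by (rule id_arr[OF s])
 show "x \<in> P ==> y \<in> P ==> f \<in> arr C x y ==> idt y ** f = f" for x y f by (rule id_left[OF s s])
 show "x \<in> P ==> y \<in> P ==> f \<in> arr C x y ==> f ** idt x = f" for x y f by (rule id_right[OF s s])
 show "w \<in> P ==> x \<in> P ==> y \<in> P ==> z \<in> P ==> f \<in> arr C w x ==> g \<in> arr C x y ==> h \<in> arr C y z ==>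
  (h ** g) ** f = h ** g ** f" for w x y z f g h using lin_category.comp_assoc[OF lin_category_axioms s s s s] .
 show "x \<in> P ==> y \<in> P ==> z \<in> P ==> g \<in> arr C y z ==> (\<lambda>f. g ** f) \<in> module_hom K (Hom C x y) (Hom C x z)"
  for x y z g by (rule comp_linear_right[OF s s s])
 show "x \<in> P ==> y \<in> P ==> z \<in> P ==> f \<in> arr C x y ==> (\<lambda>g. g ** f) \<in> module_hom K (Hom C y z) (Hom C x z)"
  for x y z f by (rule comp_linear_left[OF s s s])
qed

lemma End_ring_ring: assumes x: "x \<in> Ob C" shows "ring (End_ring C x)"
proof (rule ringI)
 show "abelian_group (End_ring C x)"
 proof (rule abelian_groupI)
  fix f assume "f \<in> carrier (End_ring C x)"
  then show "\<exists>g\<in>carrier (End_ring C x). g \<oplus>\<^bsub>End_ring C x\<^esub> f = \<zero>\<^bsub>End_ring C x\<^esub>"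
   using x by (intro bexI[of _ "ng f"]) (auto simp: End_ring_def pl_eq zr_eq)
 qed (use x in "auto simp: End_ring_def pl_eq zr_eq pl_assoc pl_comm pl_lcomm")
 show "monoid (End_ring C x)" by (rule monoidI) (use x in "auto simp: End_ring_def")
qed (use x in "auto simp: End_ring_def pl_eq pl_cmp cmp_pl")

lemma End_ring_Units: assumes x: "x \<in> Ob C" shows "f \<in> Units (End_ring C x) \<longleftrightarrow> is_iso f & dm f = x & cd f = x"
 unfolding Units_def is_iso_def using x by (auto simp: End_ring_def)

lemma local_End_ring_iff:
 assumes x: "x \<in> Ob C"
 shows "local_ring (End_ring C x) \<longleftrightarrow> idt x \<noteq> zr x x &
  (\<forall>f g. ar f & dm f = x & cd f = x & \<not> is_iso f & ar g & dm g = x & cd g = x & \<not> is_iso g --> \<not> is_iso (f \<boxplus> g))"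
proof -
 have 1: "carrier (End_ring C x) = hom x x" "\<one>\<^bsub>End_ring C x\<^esub> = idt x" "\<zero>\<^bsub>End_ring C x\<^esub> = zr x x"
  using x by (auto simp: End_ring_def zr_eq)
 have 2: "f \<oplus>\<^bsub>End_ring C x\<^esub> g = f \<boxplus> g" if "f \<in> hom x x" for f g using that by (simp add: End_ring_def pl_eq)
 show ?thesis unfolding local_ring_def 1 using End_ring_ring[OF x] End_ring_Units[OF x] 2 x by auto
qed

lemma direct_sum_component: assumes "direct_sum C xs b" "x \<in> set xs"
 shows "\<exists>i p. ar i & ar p & dm i = x & cd i = b & dm p = b & cd p = x & p ** i = idt x"
proof -
 obtain k where k: "k < length xs" "xs ! k = x" using assms(2) unfolding in_set_conv_nth by blast
 obtain \<iota> \<pi> where "\<forall>i<length xs. ar (\<iota> i) & dm (\<iota> i) = xs ! i & cd (\<iota> i) = b &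
    ar (\<pi> i) & dm (\<pi> i) = b & cd (\<pi> i) = xs ! i"
  "\<forall>i<length xs. \<forall>j<length xs. \<pi> j ** \<iota> i = (if i = j then idt (xs ! i) else zr (xs ! i) (xs ! j))"
  using assms(1) unfolding direct_sum_iff by blast
 then show ?thesis using k by (intro exI[of _ "\<iota> k"] exI[of _ "\<pi> k"]) auto
qed

end

context relative_serre_quadruple
begin

text \<open>The left orthogonal of Y[1] (\<open>Al_lperp\<close>): the aisle of the t-structure
  moved by one, hence i \<le> 0 in place of i < 0.\<close>

definition Al :: "'o set" where "Al = {a \<in> Ob T. \<forall>i\<le>0. kr a i}"

lemma Al_lperp: "Al = lperp T (omap (Sh T) ` rperp T (shifts T M {0..}))"
proof (rule equalityI; rule subsetI)
 let ?Y = "rperp T (shifts T M {0..})"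
 have tp: "rperp T (shifts T M {..<0}) = lperp T ?Y" using RS2_t_structure unfolding t_structure_def torsion_pair_def by (elim conjE)
 have Y: "y \<in> Ob T" if "y \<in> ?Y" for y using that unfolding rperp_iff by blast
 have *: "hz a (sho y) \<longleftrightarrow> hz (shi a) y" if "a \<in> Ob T" "y \<in> ?Y" for a y
  using hz_sft_left[OF that(1) Y[OF that(2)], of "-1"] by simp
 fix a
 { assume a: "a \<in> Al"
  then have "shi a \<in> rperp T (shifts T M {..<0})" unfolding rperp_shifts Al_def using kr_shi by simp
  then show "a \<in> lperp T (omap (Sh T) ` ?Y)" using * a unfolding tp lperp_iff Al_def by blast }
 assume "a \<in> lperp T (omap (Sh T) ` ?Y)"
 then have a: "a \<in> Ob T" "shi a \<in> lperp T ?Y" using * unfolding lperp_iff by auto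
 then have "shi a \<in> rperp T (shifts T M {..<0})" unfolding tp by blast
 then have s: "\<forall>i\<in>{..<0}. kr (shi a) i" unfolding rperp_shifts by blast
 have "kr a i" if "i \<le> 0" for i using s kr_shi[OF a(1), of "i - 1"] that by simp
 then show "a \<in> Al" unfolding Al_def using a(1) by blast
qed

definition Zo :: "'o set" where "Zo = {z \<in> Al. \<forall>x\<in>Xo. hz x z}"

lemma Xo_eq: "Xo = rperp T (shifts T M {..<0}) \<inter> S"
 unfolding Xo_def rperp_shifts using S_Ob by auto

lemma fundamental_domain_eq: "fundamental_domain T S M = Zo"
 unfolding fundamental_domain_def Let_def Xo_eq[symmetric] Al_lperp[symmetric] Zo_def
 using rperp_iff Al_def by blast

lemma Zo_Ob: "Zo \<subseteq> Ob T"
 unfolding Zo_def Al_def by blast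

text \<open>Cutting at 1 rather than at 0 leaves \<open>kr\<close> for the first term up to degree 0
  included. Thus not only this term but also its desuspension is in X, while the other term is
  orthogonal to \<open>Al\<close>.\<close>

lemma S_truncation:
 assumes "c \<in> S"
 obtains i q w where "dist i q w" "cd i = c" "dm i \<in> Xo"
  "!!a. a \<in> Al ==> hz a (cd q)" "!!x. x \<in> Ob T ==> sho x \<simeq> dm i ==> x \<in> Xo"
proof -
 have c: "c \<in> Ob T" using assms S_Ob by simp
 obtain a b where ab: "tr a c b" "!!i. i < 1 ==> kr a i" "!!i. i \<ge> 1 ==> kr b i" "b \<in> S" by (rule t_truncation[OF c, of 1]) (rule that, assumption+)
 have ob: "a \<in> Ob T" "b \<in> Ob T" using tr_Ob[OF ab(1)] by auto
 obtain i q w where d: "dist i q w" "dm i = a" "cd i = c" "cd q = b" using ab(1) by (rule trE)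
 have aS: "a \<in> S" using S_fiber[OF ab(1) assms ab(4)] .
 show thesis
 proof (rule that[OF d(1,3)])
  show "dm i \<in> Xo" unfolding Xo_def d(2) using aS ab(2) by simp
  show "hz x (cd q)" if "x \<in> Al" for x unfolding d(4)
   by (rule t_hz[of _ _ 1]) (use that ab(3) ob in "auto simp: Al_def")
  show "x \<in> Xo" if "x \<in> Ob T" "sho x \<simeq> dm i" for x
  proof -
   have "kr x j" if "j < 0" for j
    using kr_isom[OF isom_sym[OF \<open>sho x \<simeq> dm i\<close>], of "j + 1"] ab(2)[of "j + 1"] kr_sho[OF \<open>x \<in> Ob T\<close>, of "j + 1"] that d(2) by simp
   moreover have "x \<in> S" using S_isom[OF aS] isom_sym that S_sho_iff d(2) by blast
   ultimately show ?thesis unfolding Xo_def by blast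
  qed
 qed
qed

text \<open>The arrow from \<open>a\<close> to the cone of \<open>s\<close> factors through the
  truncation of the cone in X, so the denominator may be refined to \<open>s'\<close> with cone in
  X. The fibre of \<open>s'\<close> is then in X too, so its arrow to \<open>b\<close> vanishes and
  the numerator factors through \<open>s'\<close>.\<close>

lemma Q_full:
 assumes "a \<in> Al" "b \<in> Ob T" "!!x. x \<in> Xo ==> hz x b" "Q.ar A" "Q.dm A = a" "Q.cd A = b"
 shows "\<exists>f. ar f & dm f = a & cd f = b & Qm f = A"
proof -
 obtain s f where sf: "s \<in> Sg" "ar f" "dm f = dm s" "cd s = a" "cd f = b" "A = cls s f"
  by (rule Q_arrE[OF assms(4)]) (use assms(5,6) in simp)
 obtain g h where d: "dist s g h" "cd g \<in> S" using sf(1) unfolding Sg_def' by blast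
 note d' = dist_ar[OF d(1)]
 obtain i q w where t: "dist i q w" "cd i = cd g" "dm i \<in> Xo" and Al: "!!a. a \<in> Al ==> hz a (cd q)"
  and X: "!!x. x \<in> Ob T ==> sho x \<simeq> dm i ==> x \<in> Xo" by (rule S_truncation[OF d(2)]) (rule that, assumption+)
 note t' = dist_ar[OF t(1)]
 note ty = d' t' t(2) sf(2-5)
 have "dm g \<in> Al" using ty assms(1) by simp
 then have "q ** g = zr (dm g) (cd q)" by (rule hzD[OF Al]) (use ty in auto)
 then obtain u where u: "ar u" "dm u = dm g" "cd u = dm i" "i ** u = g"
  by - (rule dist_factor_right[OF t(1), of g], simp_all add: ty)
 obtain s' h' where d1: "dist s' u h'" using dist_ex2[OF u(1)] by blast
 note d1' = dist_ar[OF d1]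
 have s': "s' \<in> Sg" unfolding Sg_iff[OF d1] u(3) using t(3) unfolding Xo_def by blast
 have cs: "cd s' = a" using d1'(4) u(2) d'(4) sf(4) by metis
 have "i ** u ** s' = g ** s'" by (rule pull[OF u(4)]) (simp_all add: u(1-3) d1'(1) cs ty)
 then have "g ** s' = zr (dm s') (cd g)" using dist_zero1[OF d1] u(1-3) d1' ty by simp
 then obtain p where p: "ar p" "dm p = dm s'" "cd p = dm s" "s ** p = s'"
  by - (rule dist_factor_right[OF d(1), of s'], use u(2) d1' ty in simp_all)
 have "s ** p \<in> Sg" unfolding p(4) by (rule s')
 then have pS: "p \<in> Sg" by (rule Sg_left) (use sf(1) p(1-3) in auto)
 have A1: "A = cls s' (f ** p)" using cls_ext(1)[of s f p] sf pS p(3,4) by simp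
 obtain k l e where k: "dist k s' l" "is_iso e" "dm e = cd l" "cd e = cd u" by (rule dist_unrot_ex[OF d1])
 note k' = dist_ar[OF k(1)]
 have "dm k \<in> Xo" by (rule X) (use k k' u isomI[OF k(2)] in auto)
 then have "(f ** p) ** k = zr (dm k) b" by (intro hzD[OF assms(3)]) (use p(1-3) sf k' in auto)
 then obtain f' where f': "ar f'" "dm f' = cd s'" "cd f' = b" "f' ** s' = f ** p"
  by - (rule dist_factor_left[OF k(1), of "f ** p"], use p(1-3) sf k' in auto)
 have ia: "roof (idt a) f'" "s' \<in> Sg" "cd s' = dm (idt a)" using f' cs s' assms(1) unfolding Al_def by auto
 have "A = cls (idt a ** s') (f' ** s')" unfolding A1 f'(4)[symmetric] using cs s' by simp
 also have "... = Qm f'" unfolding Qm_eq using cls_ext(1)[OF ia] f'(2) cs by simp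
 finally show ?thesis using f' cs by blast
qed

text \<open>An arrow that dies in the quotient factors through an object of \<open>S\<close>. Its
  first half passes through the truncation of that object in X, where the second half
  vanishes.\<close>

lemma Q_faithful:
 assumes "ar f" "dm f \<in> Al" "!!x. x \<in> Xo ==> hz x (cd f)" "Qm f = Q.zr (dm f) (cd f)"
 shows "f = zr (dm f) (cd f)"
proof -
 obtain a b where ab: "ar a" "ar b" "cd a = dm b" "dm b \<in> S" "f = b ** a"
  using assms(4) unfolding Qm_zero_iff[OF assms(1)] Sg_kills_iff[OF assms(1)] by blast
 obtain i q w where t: "dist i q w" "cd i = dm b" "dm i \<in> Xo" and Al: "!!a. a \<in> Al ==> hz a (cd q)"
  by (rule S_truncation[OF ab(4)]) (rule that, assumption+)
 note t' = dist_ar[OF t(1)]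
 have df: "dm f = dm a" "cd f = cd b" unfolding ab(5) using ab(1-3) by simp_all
 have "q ** a = zr (dm a) (cd q)" by (rule hzD[OF Al[OF assms(2)[unfolded df]]]) (use ab(1-3) t' t in auto)
 then obtain u where u: "ar u" "dm u = dm a" "cd u = dm i" "i ** u = a"
  by - (rule dist_factor_right[OF t(1), of a], use ab(1-3) t' t in simp_all)
 have bi: "b ** i = zr (dm i) (cd b)" by (rule hzD[OF assms(3)[OF t(3), unfolded df]]) (use ab(1-3) t' t in auto)
 have "b ** i ** u = zr (dm i) (cd b) ** u" by (rule pull[OF bi]) (use ab(1-3) t' t u in auto)
 then show ?thesis unfolding df unfolding ab(5) u(4) using u(1-3) ab(1-3) t' by simp
qed

end

section \<open>Equivalence of the fundamental domain with the quotient\<close>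

locale fundamental_equivalence = relative_serre_quadruple K T S \<SS> M
 for K :: "('k, 'r) ring_scheme" (structure) and T :: "('o, 'm, 'k, 'z) tricat_scheme"
  and S :: "'o set" and \<SS> :: "('o, 'm, 'o, 'm) cfun" and M :: "'o set" +
 assumes X_torsion: "star T Xo (rperp T Xo) = Ob T"
begin

lemma Q_dense: assumes "t \<in> Ob T" shows "\<exists>z\<in>Zo. z \<simeq>\<^sub>q t"
proof -
 obtain a b where ab: "tr a t b" "!!i. i < 1 ==> kr a i" "b \<in> S" by (rule t_truncation[OF assms, of 1]) (rule that, assumption+)
 have ob: "a \<in> Ob T" "b \<in> Ob T" using tr_Ob[OF ab(1)] by auto
 obtain i q w where d: "dist i q w" "dm i = a" "cd i = t" "cd q = b" using ab(1) by (rule trE)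
 have "i \<in> Sg" using Sg_iff[OF d(1)] d(4) ab(3) by simp
 then have at: "a \<simeq>\<^sub>q t" using Q.isomI[of "Qm i"] d by simp
 obtain x z where xz: "x \<in> Xo" "z \<in> rperp T Xo" "tr x a z" using X_torsion ob(1) star_iff by blast
 obtain f g h where e: "dist f g h" "dm f = x" "cd f = a" "cd g = z" using xz(3) by (rule trE)
 note e' = dist_ar[OF e(1)]
 have "g \<in> Sg" using Sg_iff[OF dist_rot[OF e(1)]] e' e(2) xz(1) S_sho unfolding Xo_def by simp
 then have "a \<simeq>\<^sub>q z" using Q.isomI[of "Qm g"] e e' by simp
 then have zt: "z \<simeq>\<^sub>q t" using at Q.isom_sym Q.isom_trans by blast
 \<comment> \<open>Passing to the right orthogonal of X does not leave \<open>Al\<close>: the cone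
   of x -> a needs \<open>kr x\<close> only in degree i - 1, which is negative.\<close>
 have "kr z i" if "i \<le> 0" for i
  by (rule kr_cone[OF xz(3)]) (use ab(2) xz(1) that in "auto simp: Xo_def")
 then have "z \<in> Zo" unfolding Zo_def Al_def using xz(2) unfolding rperp_iff by blast
 then show ?thesis using zt by blast
qed

lemma Z_functor: "linear_functor K (full_subcat T Zo) QC (quotient_functor T S)"
proof -
 have "lin_functor K (full_subcat T Zo) QC (quotient_functor T S)"
  using Qf.F Zo_Ob unfolding lin_functor_def by (simp add: subset_iff)
 then show ?thesis
  using full_subcat_lin_category[OF Zo_Ob] Q.lin_category_axioms
  unfolding linear_functor_def linear_functor_axioms_def two_lin_categories_def by blast
qed

lemma Z_equivalence: "cat_equivalence K (full_subcat T Zo) QC (quotient_functor T S)"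
proof -
 interpret Z: linear_functor K "full_subcat T Zo" QC "quotient_functor T S" by (rule Z_functor)
 \<comment> \<open>In the full subcategory \<open>ar\<close>, \<open>dm\<close> and
   \<open>cd\<close> are formed from the smaller set of objects; this translates them to those of
   \<open>T\<close>.\<close>
 have Zar: "Z.ar f \<longleftrightarrow> ar f & dm f \<in> Zo & cd f \<in> Zo" "Z.ar f ==> Z.dm f = dm f & Z.cd f = cd f" for f
 proof -
  have *: "ar f & dm f \<in> Zo & cd f \<in> Zo & Z.dm f = dm f & Z.cd f = cd f" if "Z.ar f" for f
  proof -
   have o: "Z.dm f \<in> Zo" "Z.cd f \<in> Zo" using Z.ar_Ob[OF that] by auto
   have "f \<in> arr T (Z.dm f) (Z.cd f)" using Z.arI[OF that] by simp
   then have "ar f" "dm f = Z.dm f" "cd f = Z.cd f" using arr_iff[OF subsetD[OF Zo_Ob o(1)] subsetD[OF Zo_Ob o(2)]] by blast+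
   then show ?thesis using o by simp
  qed
  show "Z.ar f ==> Z.dm f = dm f & Z.cd f = cd f" using * by blast
  have "Z.ar f" if "ar f" "dm f \<in> Zo" "cd f \<in> Zo"
   unfolding Z.ar_def full_subcat_simps by (rule bexI, rule bexI, rule arI[OF that(1)], rule that(3), rule that(2))
  then show "Z.ar f \<longleftrightarrow> ar f & dm f \<in> Zo & cd f \<in> Zo" using * by blast
 qed
 show ?thesis
 proof (rule Z.equivalenceI)
  show "Z.full" unfolding Z.full_def
  proof (intro ballI allI impI)
   fix x y A assume "x \<in> Ob (full_subcat T Zo)" "y \<in> Ob (full_subcat T Zo)"
    and A: "Q.ar A & Q.dm A = omap (quotient_functor T S) x & Q.cd A = omap (quotient_functor T S) y"
   then have xy: "x \<in> Zo" "y \<in> Zo" by auto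
   then have "\<exists>f. ar f & dm f = x & cd f = y & Qm f = A"
    by (intro Q_full) (use A Zo_Ob in "auto simp: Zo_def")
   then show "\<exists>f. Z.ar f & Z.dm f = x & Z.cd f = y & Qm f = A" using xy Zar by metis
  qed
  show "Z.faithful" unfolding Z.faithful_def
  proof (intro allI impI)
   fix f assume f: "Z.ar f & Qm f = Q.zr (omap (quotient_functor T S) (Z.dm f)) (omap (quotient_functor T S) (Z.cd f))"
   then have "f = zr (dm f) (cd f)" using Zar[of f] by (intro Q_faithful) (auto simp: Zo_def)
   then show "f = Z.zr (Z.dm f) (Z.cd f)" using Zar(2)[of f] f unfolding Z.zr_def zr_def by simp
  qed
  show "Z.dense" unfolding Z.dense_def using Q_dense by simp
 qed
qed

text \<open>Up to isomorphism both objects lie in Z, where a Hom-space of the quotient is a linear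
  image of the one in \<open>T\<close>.\<close>

lemma Q_hom_finite: "hom_finite K QC"
 unfolding hom_finite_def
proof (intro ballI)
 fix x y assume xy: "x \<in> Ob QC" "y \<in> Ob QC"
 obtain z where z: "z \<in> Zo" "z \<simeq>\<^sub>q x" using Q_dense[of x] xy by auto
 obtain w where w: "w \<in> Zo" "w \<simeq>\<^sub>q y" using Q_dense[of y] xy by auto
 obtain a where a: "Q.is_iso a" "Q.dm a = x" "Q.cd a = z" using Q.isom_sym[OF z(2)] unfolding Q.isom_def by blast
 obtain b where b: "Q.is_iso b" "Q.dm b = w" "Q.cd b = y" using w(2) unfolding Q.isom_def by blast
 have ob: "z \<in> Ob T" "w \<in> Ob T" "x \<in> Ob T" "y \<in> Ob T" using z w Zo_Ob xy by auto
 have 1: "Qm \<in> module_hom K (Hom T z w) (Hom QC z w)" using Qf.F_mod[of z w] ob by simp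
 have 2: "(\<lambda>f. f *q a) \<in> module_hom K (Hom QC z w) (Hom QC x w)"
  by (rule Q.comp_linear_left) (use a ob in simp_all)
 have 3: "(\<lambda>f. b *q f) \<in> module_hom K (Hom QC x w) (Hom QC x y)"
  by (rule Q.comp_linear_right) (use b ob in simp_all)
 let ?f = "\<lambda>f. b *q Qm f *q a"
 have "?f \<in> module_hom K (Hom T z w) (Hom QC x y)"
  using module_hom_comp[OF module_hom_comp[OF 1 2] 3] .
 moreover have "?f ` arr T z w = arr QC x y"
 proof (intro equalityI subsetI)
  fix A assume "A \<in> arr QC x y"
  then have A: "Q.ar A" "Q.dm A = x" "Q.cd A = y" using ob by auto
  have "\<exists>f. ar f & dm f = z & cd f = w & Qm f = Q.iv b *q A *q Q.iv a"
   by (rule Q_full) (use z w A a b ob in "auto simp: Zo_def")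
  then obtain f where f: "ar f" "dm f = z" "cd f = w" "Qm f = Q.iv b *q A *q Q.iv a" by blast
  have "b *q Qm f *q a = (b *q Q.iv b) *q A *q (Q.iv a *q a)" unfolding f(4) using a b A by simp
  also have "... = A" using a b A by (simp del: Q.cmp_assoc)
  finally have "A = b *q Qm f *q a" by (rule sym)
  then show "A \<in> ?f ` arr T z w" by (rule image_eqI) (use f(1-3) ob in simp)
 qed (use a b ob in auto)
 moreover have "linear_map K (Hom T z w) (Hom QC x y) ?f"
  using hom_vectorspace[OF ob(1,2)] Q.hom_vectorspace[of x y] ob calculation(1)
  unfolding linear_map_def mod_hom_def mod_hom_axioms_def vectorspace_def by simp
 ultimately show "vectorspace.fin_dim K (Hom QC x y)"
  using linear_map.surj_fin_dim hom_fin_dim[OF ob(1,2)] by blast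
qed

lemma Z_local: assumes "z \<in> Zo" "local_ring (End_ring T z)" shows "local_ring (End_ring QC z)"
proof -
 have z: "z \<in> Ob T" "z \<in> Al" "!!x. x \<in> Xo ==> hz x z" using assms(1) Zo_Ob unfolding Zo_def by auto
 have loc: "idt z \<noteq> zr z z" "!!f g. [|ar f; dm f = z; cd f = z; \<not> is_iso f; ar g; dm g = z; cd g = z; \<not> is_iso g|] ==> \<not> is_iso (f \<boxplus> g)"
  using assms(2) unfolding local_End_ring_iff[OF z(1)] by auto
 have fa: "f = g" if "ar f" "dm f = z" "cd f = z" "ar g" "dm g = z" "cd g = z" "Qm f = Qm g" for f g
 proof -
  have "Qm (f \<boxplus> ng g) = Q.zr z z" using that by simp
  then have "f \<boxplus> ng g = zr z z" using Q_faithful[of "f \<boxplus> ng g"] that z by simp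
  then show ?thesis using diff_zr[of f g] that by simp
 qed
 have fu: "\<exists>f. ar f & dm f = z & cd f = z & Qm f = A" if "Q.ar A" "Q.dm A = z" "Q.cd A = z" for A
  by (rule Q_full) (use z that in auto)
 have iso: "is_iso f" if f: "ar f" "dm f = z" "cd f = z" "Q.is_iso (Qm f)" for f
 proof -
  obtain g where g: "ar g" "dm g = z" "cd g = z" "Qm g = Q.iv (Qm f)" using fu[of "Q.iv (Qm f)"] f by auto
  have "g ** f = idt z" by (rule fa) (use f g z in simp_all)
  moreover have "f ** g = idt z" by (rule fa) (use f g z in simp_all)
  ultimately show ?thesis using isoI[of f g] f g by simp
 qed
 have "Q.idt z \<noteq> Q.zr z z"
 proof
  assume "Q.idt z = Q.zr z z"
  then have "Qm (idt z) = Qm (zr z z)" using z by simp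
  then show False using fa[of "idt z" "zr z z"] loc(1) z by simp
 qed
 moreover have "\<not> Q.is_iso (A \<boxplus>\<^sub>q B)"
  if A: "Q.ar A" "Q.dm A = z" "Q.cd A = z" "\<not> Q.is_iso A" and B: "Q.ar B" "Q.dm B = z" "Q.cd B = z" "\<not> Q.is_iso B" for A B
 proof -
  obtain f where f: "ar f" "dm f = z" "cd f = z" "Qm f = A" using fu A by blast
  obtain g where g: "ar g" "dm g = z" "cd g = z" "Qm g = B" using fu B by blast
  have "\<not> is_iso f" "\<not> is_iso g" using A(4) B(4) f(4) g(4) by auto
  then have "\<not> is_iso (f \<boxplus> g)" using loc(2) f g by blast
  then show ?thesis using iso[of "f \<boxplus> g"] f g by auto
 qed
 ultimately show ?thesis using Q.local_End_ring_iff[of z] z(1) by simp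
qed

lemma Q_krull_schmidt: "krull_schmidt QC"
 unfolding krull_schmidt_def
proof (intro conjI ballI)
 show "additive_cat QC" by (rule Q_additive)
 fix x assume "x \<in> Ob QC"
 then obtain z where z: "z \<in> Zo" "z \<simeq>\<^sub>q x" using Q_dense by auto
 then obtain xs where xs: "!!y. y \<in> set xs ==> local_ring (End_ring T y)" "direct_sum T xs z"
  using RS0_krull_schmidt Zo_Ob unfolding krull_schmidt_def by blast
 \<comment> \<open>Z is closed under retracts, so the summands of \<open>z\<close> stay where the
   quotient functor is fully faithful and keep local endomorphism rings.\<close>
 have "y \<in> Zo" if "y \<in> set xs" for y
 proof -
  have "retr y z" using direct_sum_component[OF xs(2) that] unfolding retr_def by blast
  then show ?thesis using z(1) kr_retr retr_hz_right[of y z] retr_Ob S_Ob unfolding Zo_def Al_def Xo_def by blast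
 qed
 then have "\<forall>y\<in>set xs. local_ring (End_ring QC y)" using Z_local xs(1) by blast
 moreover have "map (omap (quotient_functor T S)) xs = xs" by (induction xs) auto
 then have "direct_sum QC xs z" using Qf.F_direct_sum[OF xs(2)] by simp
 then have "direct_sum QC xs x"
 proof (rule Q.direct_sum_isom[OF _ refl _ z(2)])
  fix i assume "i < length xs"
  then have "xs ! i \<in> Ob T" using xs(2) unfolding direct_sum_def by auto
  then show "xs ! i \<simeq>\<^sub>q xs ! i" by simp
 qed
 ultimately show "\<exists>xs. (\<forall>y\<in>set xs. local_ring (End_ring QC y)) & direct_sum QC xs x" by blast
qed

end

text \<open>The point is to lift denominators: by \<open>lift\<close>, one that ends at
  \<open>omap P x\<close> is, up to an isomorphism, the image of a denominator ending at
  \<open>x\<close>. Vanishing and existence of fractions are then pulled back along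
  \<open>P\<close>.\<close>

lemma (in verdier) induced_equivalence:
 assumes P: "preserves_Sg P" "!!s. [|ar s; amap P s \<in> Sg|] ==> s \<in> Sg"
  and full: "!!x y g. [|x \<in> Ob T; y \<in> Ob T; ar g; dm g = omap P x; cd g = omap P y|] ==> \<exists>f. ar f & dm f = x & cd f = y & amap P f = g"
  and faithful: "!!f. [|ar f; amap P f = zr (omap P (dm f)) (omap P (cd f))|] ==> f = zr (dm f) (cd f)"
  and dense: "!!y. y \<in> Ob T ==> \<exists>x\<in>Ob T. omap P x \<simeq> y"
 shows "cat_equivalence K QC QC (induced_functor T S P)"
proof -
 interpret P: linear_functor K T T P by unfold_locales (use P(1) in "simp add: preserves_Sg_def")
 interpret I: linear_functor K QC QC "induced_functor T S P" by unfold_locales (rule induced_functor[OF P(1)])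
 have lift: "\<exists>e u. is_iso e & cd e = dm t & u \<in> Sg & cd u = x & dm e = omap P (dm u) & t ** e = amap P u"
  if t: "t \<in> Sg" "cd t = omap P x" "x \<in> Ob T" for t x
 proof -
  obtain w where w: "w \<in> Ob T" "omap P w \<simeq> dm t" using dense[of "dm t"] t(1) by auto
  obtain e where e: "is_iso e" "dm e = omap P w" "cd e = dm t" using w(2) unfolding isom_def by blast
  obtain u where u: "ar u" "dm u = w" "cd u = x" "amap P u = t ** e" using full[OF w(1) t(3), of "t ** e"] t e by auto
  have "u \<in> Sg" by (rule P(2)) (use u t e Sg_iso in auto)
  then show ?thesis by - (rule exI[of _ e], rule exI[of _ u], use e u in simp)
 qed
 show ?thesis
 proof (rule I.equivalenceI)
  show "I.faithful" unfolding I.faithful_def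
  proof (intro allI impI, elim conjE)
   fix A assume A: "Q.ar A" "amap (induced_functor T S P) A = Q.zr (omap (induced_functor T S P) (Q.dm A)) (omap (induced_functor T S P) (Q.cd A))"
   obtain s f where sf: "s \<in> Sg" "ar f" "dm f = dm s" "cd s = Q.dm A" "cd f = Q.cd A" "A = cls s f" "A = Qm f *q Q.iv (Qm s)"
    by (rule Q_arrE[OF A(1)])
   have Ps: "amap P s \<in> Sg" using P(1) sf(1) unfolding preserves_Sg_def by blast
   have "Qm (amap P f) *q Q.iv (Qm (amap P s)) = amap (induced_functor T S P) A"
    unfolding sf(6) using induced_cls[OF P(1), of s f] cls_Qm[of "amap P s" "amap P f"] sf(1-3) Ps by simp
   also have "... = Q.zr (omap P (dm s)) (omap P (cd f)) *q Q.iv (Qm (amap P s))" using A sf(1-5) Ps by simp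
   finally have "Qm (amap P f) = Q.zr (dm (amap P f)) (cd (amap P f))"
    using Q.iso_rcancel[of "Q.iv (Qm (amap P s))" "Qm (amap P f)" "Q.zr (omap P (dm s)) (omap P (cd f))"] sf(1-3) Ps by simp
   then obtain t where t: "t \<in> Sg" "cd t = omap P (dm f)" "amap P f ** t = zr (dm t) (cd (amap P f))"
    using Qm_zero_iff[of "amap P f"] sf(2) by auto
   obtain e u where u: "is_iso e" "cd e = dm t" "u \<in> Sg" "cd u = dm f" "dm e = omap P (dm u)" "t ** e = amap P u"
    using lift[OF t(1,2)] sf(2) by auto
   have "amap P f ** t ** e = zr (dm t) (cd (amap P f)) ** e" by (rule pull[OF t(3)]) (use t(1,2) u(1,2) sf(2) in simp_all)
   then have "amap P (f ** u) = zr (omap P (dm u)) (omap P (cd f))" using u sf(2) by simp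
   then have "f ** u = zr (dm u) (cd f)" using faithful[of "f ** u"] u(3,4) sf(2) by simp
   then have "Qm f = Q.zr (dm f) (cd f)" using Qm_zero_iff[OF sf(2)] u(3,4) by blast
   then have "Qm f *q Q.iv (Qm s) = Q.zr (Q.dm A) (Q.cd A)" using sf(1-5) A(1) by simp
   then show "A = Q.zr (Q.dm A) (Q.cd A)" by (rule trans[OF sf(7)])
  qed
  show "I.full" unfolding I.full_def
  proof (intro ballI allI impI, elim conjE)
   fix x y B assume "x \<in> Ob QC" "y \<in> Ob QC" and B: "Q.ar B" "Q.dm B = omap (induced_functor T S P) x" "Q.cd B = omap (induced_functor T S P) y"
   then have xy: "x \<in> Ob T" "y \<in> Ob T" by simp_all
   obtain t g where tg: "t \<in> Sg" "ar g" "dm g = dm t" "cd t = Q.dm B" "cd g = Q.cd B" "B = cls t g" by (rule Q_arrE[OF B(1)])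
   obtain e u where u: "is_iso e" "cd e = dm t" "u \<in> Sg" "cd u = x" "dm e = omap P (dm u)" "t ** e = amap P u"
    using lift[OF tg(1) _ xy(1)] tg(4) B(2) by auto
   have ge: "ar (g ** e)" "dm (g ** e) = omap P (dm u)" "cd (g ** e) = omap P y" using tg(1-5) u(1,2,5) B(3) by simp_all
   obtain f where f: "ar f" "dm f = dm u" "cd f = y" "amap P f = g ** e"
    using full[OF ar_Ob(1)[OF Sg_ar[OF u(3)]] xy(2) ge] by blast
   have "cls (t ** e) (g ** e) = cls t g" by (rule cls_ext) (use tg(1-3) u(1,2) Sg_iso in simp_all)
   then have "amap (induced_functor T S P) (cls u f) = B"
    using induced_cls[OF P(1), of u f] u(3) f(1,2) unfolding f(4) u(6)[symmetric] tg(6) by simp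
   then show "\<exists>A. Q.ar A & Q.dm A = x & Q.cd A = y & amap (induced_functor T S P) A = B"
    using u(3,4) f(1-3) by (intro exI[of _ "cls u f"]) simp
  qed
  show "I.dense" unfolding I.dense_def
  proof
   fix y assume "y \<in> Ob QC"
   then obtain x where x: "x \<in> Ob T" "omap P x \<simeq> y" using dense by auto
   then show "\<exists>x\<in>Ob QC. omap (induced_functor T S P) x \<simeq>\<^sub>q y" using Qf.F_isom[OF x(2)] by auto
  qed
 qed
qed

sublocale serre_extension \<subseteq> fundamental_equivalence K T S \<SS> M
 by unfold_locales (rule torsion_extension)

context serre_extension
begin

subsection \<open>The Serre functor of the quotient\<close>

definition ep :: "'o => 'm" where "ep = (SOME e. nat_iso T T (Sh T \<circ>\<^sub>F Shi T) id_cfun e)"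

lemma ep: "nat_iso T T (Sh T \<circ>\<^sub>F Shi T) id_cfun ep"
 using p_shift someI_ex[of "nat_iso T T (Sh T \<circ>\<^sub>F Shi T) id_cfun"] unfolding quasi_inverse_def ep_def by blast

lemma ep_iso [simp]: "x \<in> Ob T ==> is_iso (ep x)" "x \<in> Ob T ==> dm (ep x) = sho (shi x)" "x \<in> Ob T ==> cd (ep x) = x"
 using ep isos_iff[of "sho (shi x)" x "ep x"] unfolding nat_iso_def by simp_all

lemma ep_nat: assumes "ar f" shows "ep (cd f) ** sha (amap (Shi T) f) = f ** ep (dm f)"
 using ep arI[OF assms] assms unfolding nat_iso_def by simp

abbreviation po :: "'o => 'o" where "po x \<equiv> fo (shi x)"
abbreviation pa :: "'m => 'm" where "pa f \<equiv> fa (amap (Shi T) f)"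

text \<open>The comparison of F(x[-1])[1] with F x, composed from the compatibility of
  \<open>F\<close> with the shift and the isomorphism x[-1][1] -> x.\<close>

definition th :: "'o => 'm" where "th x = fa (ep x) ** iv (fs (shi x))"

lemma th [simp]: "x \<in> Ob T ==> is_iso (th x)" "x \<in> Ob T ==> dm (th x) = sho (po x)" "x \<in> Ob T ==> cd (th x) = fo x"
 unfolding th_def by simp_all

lemma th_nat: assumes "ar a" shows "fa a ** th (dm a) = th (cd a) ** sha (pa a)"
proof -
 let ?x = "dm a" and ?y = "cd a"
 have ob: "?x \<in> Ob T" "?y \<in> Ob T" using assms by auto
 have 1: "fs (shi ?y) ** fa (sha (amap (Shi T) a)) = sha (pa a) ** fs (shi ?x)"
  using fs_nat[of "amap (Shi T) a"] assms by simp
 have "iv (fs (shi ?y)) ** sha (pa a) = iv (fs (shi ?y)) ** (sha (pa a) ** fs (shi ?x)) ** iv (fs (shi ?x))"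
  using assms ob by simp
 also have "... = fa (sha (amap (Shi T) a)) ** iv (fs (shi ?x))" unfolding 1[symmetric] using assms ob by simp
 finally have 2: "iv (fs (shi ?y)) ** sha (pa a) = fa (sha (amap (Shi T) a)) ** iv (fs (shi ?x))" .
 have 3: "fa (ep ?y) ** fa (sha (amap (Shi T) a)) = fa a ** fa (ep ?x)"
  using arg_cong[OF ep_nat[OF assms], of fa] assms ob by simp
 have "th ?y ** sha (pa a) = fa (ep ?y) ** iv (fs (shi ?y)) ** sha (pa a)" unfolding th_def using assms ob by simp
 also have "... = fa (ep ?y) ** fa (sha (amap (Shi T) a)) ** iv (fs (shi ?x))" unfolding 2 ..
 also have "... = (fa a ** fa (ep ?x)) ** iv (fs (shi ?x))" by (rule pull[OF 3]) (use assms ob in simp_all)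
 also have "... = fa a ** th ?x" unfolding th_def using assms ob by simp
 finally show ?thesis by (rule sym)
qed

text \<open>For a triangle \<open>w \<rightarrow> x \<rightarrow> c \<rightarrow> w[1]\<close> with \<open>c \<in> S\<close>, a roof \<open>x \<leftarrow> w \<rightarrow> F (x[-1])\<close> gives
 \<open>c \<rightarrow> w[1] \<rightarrow> F x \<rightarrow> F c\<close>, whose trace under the Serre duality of \<open>S\<close> is \<open>trv\<close>.\<close>

definition trv :: "'m => 'm => 'm => 'k" where
 "trv g h f = tau (cd g) (fe (cd g) ** fa g ** th (dm g) ** sha f ** h)"

text \<open>TR3 gives an arrow \<open>c\<close> of cones over \<open>a\<close> and \<open>k\<close>,
  and cyclicity of \<open>tau\<close> on \<open>S\<close> moves it from one end of the composite to
  the other. The case of an identity \<open>a\<close> gives independence of the roof, the general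
  case cyclicity of the trace on the quotient.\<close>

lemma trv_key:
 assumes d: "dist s g h" "dist s' g' h'" "cd g \<in> S" "cd g' \<in> S"
  and a: "ar a" "dm a = cd s'" "cd a = cd s" and k: "ar k" "dm k = dm s'" "cd k = dm s" "a ** s' = s ** k"
  and f: "ar f" "dm f = dm s" "cd f = po (cd s')"
 shows "trv g' h' (f ** k) = trv g h (pa a ** f)"
proof -
 note d1 = dist_ar[OF d(1)] and d2 = dist_ar[OF d(2)]
 obtain c where c: "ar c" "dm c = cd g'" "cd c = cd g" "c ** g' = g ** a" "sha k ** h' = h ** c"
  using dist_morphism[OF d(2,1) k(1) a(1)] k a by auto
 note ty = d1 d2 a k(1-3) f c(1-3) d(3,4)
 let ?w = "fe (cd g') ** fa g' ** th (cd s') ** sha f ** h"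
 have w: "ar ?w" "dm ?w = cd g" "cd ?w = sso (cd g')" by (simp_all add: ty)
 have "sha (f ** k) ** h' = sha f ** sha k ** h'" by (simp add: ty)
 also have "... = sha f ** h ** c" unfolding c(5) ..
 finally have "trv g' h' (f ** k) = tau (dm c) (?w ** c)" unfolding trv_def by (simp add: ty)
 also have "... = tau (cd c) (amap \<SS> c ** ?w)" by (rule tau_cyclic[symmetric]) (use w in "simp_all add: ty")
 also have "amap \<SS> c ** ?w = (fe (cd g) ** fa c) ** fa g' ** th (cd s') ** sha f ** h"
  by (rule pull) (use fe_nat[OF c(1)] ssa[OF c(1)] ty in simp_all)
 also have "... = fe (cd g) ** fa c ** fa g' ** th (cd s') ** sha f ** h" by (simp add: ty)
 also have "fa c ** fa g' ** th (cd s') ** sha f ** h = fa (g ** a) ** th (cd s') ** sha f ** h"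
  by (rule pull) (use arg_cong[OF c(4), of fa] in "simp_all add: ty")
 also have "... = fa g ** fa a ** th (cd s') ** sha f ** h" by (simp add: ty)
 also have "fa a ** th (cd s') ** sha f ** h = (th (cd s) ** sha (pa a)) ** sha f ** h"
  by (rule pull) (use th_nat[OF a(1)] in "simp_all add: ty")
 also have "... = th (cd s) ** sha (pa a ** f) ** h" by (simp add: ty)
 finally show ?thesis unfolding trv_def by (simp add: ty)
qed

lemma trv_linfun: assumes "dist s g h" "cd g \<in> S" shows "linfun (dm s) (po (cd s)) (trv g h)"
proof -
 note d = dist_ar[OF assms(1)]
 note ty = d assms(2)
 show ?thesis unfolding trv_def
  by (rule linfunI) (simp_all add: ty pl_cmp cmp_pl sm_cmp cmp_sm linfunD[OF tau_linfun[OF assms(2)]])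
qed

lemma Fo_S_iff: assumes "x \<in> Ob T" shows "fo x \<in> S \<longleftrightarrow> x \<in> S"
proof
 assume "x \<in> S" then show "fo x \<in> S" using S_isom[OF sso_S isom_sym[OF fo_sso]] by blast
next
 assume "fo x \<in> S"
 then obtain v u where v: "v \<in> S" and u: "is_iso u" "dm u = fo x" "cd u = sso v" by (rule SS_dense)
 have "fo v \<simeq> fo x" using isom_trans[OF fo_sso[OF v] isom_sym[OF isomI[OF u]]] .
 then have "v \<simeq> x" using Fx.ff_reflects_isom[OF F_full F_faithful S_Ob[OF v] assms] by blast
 then show "x \<in> S" using S_isom v by blast
qed

lemma Fa_Sg_iff: assumes "ar s" shows "fa s \<in> Sg \<longleftrightarrow> s \<in> Sg"
proof -
 obtain g h where d: "dist s g h" using dist_ex assms by blast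
 show ?thesis using Sg_iff[OF d] Sg_iff[OF F_dist[OF d]] Fo_S_iff dist_ar[OF d] by simp
qed

lemma pa_Sg_iff: assumes "ar s" shows "pa s \<in> Sg \<longleftrightarrow> s \<in> Sg"
proof -
 have "sha (amap (Shi T) s) \<in> Sg \<longleftrightarrow> s \<in> Sg"
  using Sg_conj[of "ep (dm s)" "ep (cd s)" "sha (amap (Shi T) s)" s] ep_nat[OF assms] assms by simp
 then show ?thesis using Fa_Sg_iff[of "amap (Shi T) s"] Sg_sha_iff[of "amap (Shi T) s"] assms by simp
qed

definition Ph :: "('o, ('m \<times> 'm) set, 'o, ('m \<times> 'm) set) cfun" where
 "Ph = induced_functor T S (F \<circ>\<^sub>F Shi T)"

lemma preserves_P: "preserves_Sg (F \<circ>\<^sub>F Shi T)"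
 unfolding preserves_Sg_def using lin_functor_comp[OF Shi.F Fx.F] pa_Sg_iff by simp

lemma Ph_Qm: "ar f ==> amap Ph (Qm f) = Qm (pa f)"
 unfolding Ph_def using induced_Qm[OF preserves_P] by simp

lemma Ph_ob [simp]: "omap Ph x = po x"
 unfolding Ph_def by simp

lemma Ph_equivalence: "cat_equivalence K QC QC Ph"
 unfolding Ph_def
proof (rule induced_equivalence[OF preserves_P])
 note shi = Shi.equivalenceD[OF quasi_inverse_sym[OF p_shift]]
 show "s \<in> Sg" if "ar s" "amap (F \<circ>\<^sub>F Shi T) s \<in> Sg" for s using that pa_Sg_iff by simp
 show "\<exists>f. ar f & dm f = x & cd f = y & amap (F \<circ>\<^sub>F Shi T) f = g"
  if xy: "x \<in> Ob T" "y \<in> Ob T" "ar g" "dm g = omap (F \<circ>\<^sub>F Shi T) x" "cd g = omap (F \<circ>\<^sub>F Shi T) y" for x y g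
 proof -
  obtain k where k: "ar k" "dm k = shi x" "cd k = shi y" "fa k = g" using Fx.fullD[OF F_full, of "shi x" "shi y" g] xy by auto
  then show ?thesis using Shi.fullD[OF shi(2) xy(1,2) k(1-3)] by auto
 qed
 show "f = zr (dm f) (cd f)" if "ar f" "amap (F \<circ>\<^sub>F Shi T) f = zr (omap (F \<circ>\<^sub>F Shi T) (dm f)) (omap (F \<circ>\<^sub>F Shi T) (cd f))" for f
 proof -
  have "amap (Shi T) f = zr (shi (dm f)) (shi (cd f))"
   using F_faithful[unfolded Fx.faithful_def, rule_format, of "amap (Shi T) f"] that by simp
  then show ?thesis using shi(1)[unfolded Shi.faithful_def, rule_format, of f] that(1) by simp
 qed
 show "\<exists>x\<in>Ob T. omap (F \<circ>\<^sub>F Shi T) x \<simeq> y" if y: "y \<in> Ob T" for y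
 proof -
  obtain w where w: "w \<in> Ob T" "fo w \<simeq> y" using F_dense y unfolding Fx.dense_def by blast
  obtain x where x: "x \<in> Ob T" "shi x \<simeq> w" using shi(3) w(1) unfolding Shi.dense_def by blast
  show ?thesis using isom_trans[OF Fx.F_isom[OF x(2)] w(2)] x(1) by auto
 qed
qed

end

sublocale serre_extension \<subseteq> Ph: linear_functor K "verdier_quotient T S" "verdier_quotient T S" Ph
 by unfold_locales (use induced_functor[OF preserves_P] in "simp add: Ph_def")

section \<open>The trace form on the quotient\<close>

context serre_extension
begin

definition tq :: "'o => ('m \<times> 'm) set => 'k" where
 "tq x A = (SOME v. \<exists>s f g h. dist s g h & cd g \<in> S & ar f & dm f = dm s & cd s = x & cd f = po x &
  A = cls s f & v = trv g h f)"

lemma trv_ext: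
 assumes "dist s g h" "dist (s ** u) g' h'" "cd g \<in> S" "cd g' \<in> S" "ar u" "cd u = dm s" "ar f" "dm f = dm s" "cd f = po (cd s)"
 shows "trv g' h' (f ** u) = trv g h f"
proof -
 note d = dist_ar[OF assms(1)]
 have "trv g' h' (f ** u) = trv g h (pa (idt (cd s)) ** f)"
  by (rule trv_key[OF assms(1-4), of "idt (cd s)" u]) (use assms d in simp_all)
 then show ?thesis using assms d by simp
qed

text \<open>Independence of the chosen roof and cone: two representing roofs have a common
  refinement, and by \<open>trv_ext\<close> refining the denominator does not change the
  trace.\<close>

lemma tq_cls:
 assumes "dist s g h" "cd g \<in> S" "ar f" "dm f = dm s" "cd s = x" "cd f = po x"
 shows "tq x (cls s f) = trv g h f"
 unfolding tq_def
proof (rule some_equality)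
 show "\<exists>s' f' g' h'. dist s' g' h' & cd g' \<in> S & ar f' & dm f' = dm s' & cd s' = x & cd f' = po x &
  cls s f = cls s' f' & trv g h f = trv g' h' f'" using assms by blast
 fix v assume "\<exists>s' f' g' h'. dist s' g' h' & cd g' \<in> S & ar f' & dm f' = dm s' & cd s' = x & cd f' = po x &
  cls s f = cls s' f' & v = trv g' h' f'"
 then obtain s' f' g' h' where *: "dist s' g' h'" "cd g' \<in> S" "ar f'" "dm f' = dm s'" "cd s' = x" "cd f' = po x"
  "cls s f = cls s' f'" "v = trv g' h' f'" by blast
 have s: "s \<in> Sg" "s' \<in> Sg" using Sg_iff[OF assms(1)] Sg_iff[OF *(1)] assms(2) *(2) by auto
 then have "rel s f s' f'" using cls_eq_iff[of s f s' f'] *(7) assms(3,4) by simp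
 then obtain u u' where u: "u \<in> Sg" "u' \<in> Sg" "dm u = dm u'" "cd u = dm s" "cd u' = dm s'"
   "s ** u = s' ** u'" "f ** u = f' ** u'" by (rule relE)
 have su: "s ** u \<in> Sg" using s u by simp
 then obtain g0 h0 where d0: "dist (s ** u) g0 h0" "cd g0 \<in> S" unfolding Sg_def' by blast
 have "trv g0 h0 (f ** u) = trv g h f" by (rule trv_ext[OF assms(1) d0(1)]) (use assms d0 u in auto)
 moreover have "trv g0 h0 (f' ** u') = trv g' h' f'" by (rule trv_ext[OF *(1)]) (use * d0 u in auto)
 ultimately show "v = trv g h f" unfolding *(8) u(7) by simp
qed

lemma tq_linfun: assumes "x \<in> Ob T" shows "Q.linfun x (po x) (tq x)"
proof (rule Q.linfunI)
 have lf: "linfun (dm s) (po x) (trv g h)" if "dist s g h" "cd g \<in> S" "cd s = x" for s g h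
  using trv_linfun[OF that(1,2)] that(3) by simp
 fix A assume A: "Q.ar A" "Q.dm A = x" "Q.cd A = po x"
 obtain s0 f0 where s0: "s0 \<in> Sg" "ar f0" "dm f0 = dm s0" "cd s0 = x" "cd f0 = po x" "A = cls s0 f0"
  by (rule Q_arrE[OF A(1)]) (use A in simp)
 obtain g0 h0 where d0: "dist s0 g0 h0" "cd g0 \<in> S" using s0(1) unfolding Sg_def' by blast
 have t0: "tq x A = trv g0 h0 f0" unfolding s0(6) by (rule tq_cls[OF d0 s0(2-5)])
 show "tq x A \<in> carrier K" unfolding t0 by (rule linfunD(1)[OF lf[OF d0 s0(4)] s0(2,3,5)])
 show "tq x (Q.sm a A) = a \<otimes> tq x A" if a: "a \<in> carrier K" for a
 proof -
  have "Q.sm a A = cls s0 (sm a f0)"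
   using Q_smult[of s0 f0 x "po x" a] Q.sm_eq[OF A, of a] s0 a by simp
  then show ?thesis using tq_cls[OF d0, of "sm a f0" x] s0 a t0 linfunD(2)[OF lf[OF d0 s0(4)] s0(2,3,5) a] by simp
 qed
 fix B assume B: "Q.ar B" "Q.dm B = x" "Q.cd B = po x"
 obtain s1 f1 where s1: "s1 \<in> Sg" "ar f1" "dm f1 = dm s1" "cd s1 = x" "cd f1 = po x" "B = cls s1 f1"
  by (rule Q_arrE[OF B(1)]) (use B in simp)
 obtain s f f' where s: "roof s f" "roof s f'" "cd s = cd s0" "cd f = cd f0" "cd f' = cd f1"
   "cls s0 f0 = cls s f" "cls s1 f1 = cls s f'"
  by (rule common_denominator[of s0 f0 s1 f1]) (use s0 s1 in auto)
 have ss: "s \<in> Sg" "ar f" "dm f = dm s" "cd s = x" "cd f = po x" "ar f'" "dm f' = dm s" "cd f' = po x" using s s0 s1 by auto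
 obtain g h where d: "dist s g h" "cd g \<in> S" using ss(1) unfolding Sg_def' by blast
 have "A \<boxplus>\<^sub>q B = cls s (f \<boxplus> f')"
  using Q_add[of s f f' x "po x"] Q.pl_eq[OF A, of B] ss s0(6) s1(6) s(6,7) by simp
 then have "tq x (A \<boxplus>\<^sub>q B) = trv g h (f \<boxplus> f')" using tq_cls[OF d, of "f \<boxplus> f'" x] ss by simp
 also have "... = trv g h f \<oplus> trv g h f'" by (rule linfunD(3)[OF lf[OF d ss(4)] ss(2,3,5,6,7,8)])
 finally show "tq x (A \<boxplus>\<^sub>q B) = tq x A \<oplus> tq x B"
  unfolding s0(6) s1(6) s(6,7) tq_cls[OF d ss(2,3,4,5)] tq_cls[OF d ss(6,7,4,8)] .
qed

lemma tq_cyclic_Qm: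
 assumes "ar a" "Q.ar H" "Q.dm H = cd a" "Q.cd H = po (dm a)"
 shows "tq (cd a) (Qm (pa a) *q H) = tq (dm a) (H *q Qm a)"
proof -
 obtain s f where sf: "s \<in> Sg" "ar f" "dm f = dm s" "cd s = cd a" "cd f = po (dm a)" "H = cls s f" "H = Qm f *q Q.iv (Qm s)"
  by (rule Q_arrE[OF assms(2)]) (use assms in simp)
 obtain u k where u: "u \<in> Sg" "cd u = dm a" "ar k" "dm k = dm u" "cd k = dm s" "a ** u = s ** k"
  by (rule ore[OF assms(1) sf(1,4)])
 obtain g h where d: "dist s g h" "cd g \<in> S" using sf(1) unfolding Sg_def' by blast
 obtain g' h' where d': "dist u g' h'" "cd g' \<in> S" using u(1) unfolding Sg_def' by blast
 have 1: "Qm (pa a) *q H = cls s (pa a ** f)" unfolding sf(7) using cls_Qm[of s "pa a ** f"] sf(1-5) assms(1) by simp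
 have q: "Qm a *q Qm u = Qm s *q Qm k" using arg_cong[OF u(6), of Qm] u(1-5) sf(1) assms(1) by simp
 have "Q.iv (Qm s) *q Qm a = Q.iv (Qm s) *q (Qm a *q Qm u) *q Q.iv (Qm u)"
  using u(1,2) sf(1,4) assms(1) by simp
 also have "... = Qm k *q Q.iv (Qm u)" unfolding q using u(1-5) sf(1,4) assms(1) by simp
 finally have "H *q Qm a = Qm f *q Qm k *q Q.iv (Qm u)" unfolding sf(7) using sf(1-5) assms(1) by simp
 then have 2: "H *q Qm a = cls u (f ** k)" using cls_Qm[of u "f ** k"] u(1-5) sf(1-5) assms(1) by simp
 have "tq (dm a) (cls u (f ** k)) = trv g' h' (f ** k)" by (rule tq_cls[OF d']) (use u(1-5) sf(1-5) in simp_all)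
 also have "... = trv g h (pa a ** f)" by (rule trv_key[OF d(1) d'(1) d(2) d'(2), of a k]) (use u sf(1-5) assms(1) in simp_all)
 also have "... = tq (cd a) (cls s (pa a ** f))" by (rule tq_cls[OF d, symmetric]) (use sf(1-5) assms(1) in simp_all)
 finally show ?thesis unfolding 1 2 by (rule sym)
qed

text \<open>A fraction is treated one factor at a time: cyclicity for the numerator
  \<open>f\<close>, then cyclicity for the denominator \<open>s\<close> read backwards, with the
  inverse of \<open>Qm (pa s)\<close> in between.\<close>

lemma tq_cyclic:
 assumes "Q.ar A" "Q.ar H" "Q.dm H = Q.cd A" "Q.cd H = po (Q.dm A)"
 shows "tq (Q.cd A) (amap Ph A *q H) = tq (Q.dm A) (H *q A)"
proof -
 obtain s f where sf: "s \<in> Sg" "ar f" "dm f = dm s" "cd s = Q.dm A" "cd f = Q.cd A" "A = Qm f *q Q.iv (Qm s)"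
  by (rule Q_arrE[OF assms(1)])
 let ?i = "Q.iv (Qm s)" and ?j = "Q.iv (Qm (pa s))"
 have ps: "pa s \<in> Sg" using pa_Sg_iff sf(1) by simp
 have PA: "amap Ph A = Qm (pa f) *q ?j" unfolding sf(6) using sf(1-5) by (simp add: Ph_Qm)
 have ji: "Q.iv (Qm (pa s)) *q Qm (pa s) = Q.idt (po (dm s))" using Q.iv(4)[OF Qm_iso[OF ps]] sf(1) by simp
 note ty = sf(1-5) assms(2-4) ps
 have 1: "tq (Q.cd A) (amap Ph A *q H) = tq (cd f) (Qm (pa f) *q ?j *q H)" unfolding PA by (simp add: ty)
 also have "... = tq (dm s) ((?j *q H) *q Qm f)" using tq_cyclic_Qm[of f "?j *q H"] by (simp add: ty)
 also have "(?j *q H) *q Qm f = (?j *q H *q A) *q Qm s" unfolding sf(6) by (simp add: ty)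
 also have "tq (dm s) ... = tq (cd s) (Qm (pa s) *q ?j *q H *q A)"
  by (rule tq_cyclic_Qm[symmetric]) (use assms(1) in "simp_all add: ty")
 also have "Qm (pa s) *q ?j *q H *q A = Q.idt (po (cd s)) *q H *q A"
  by (rule Q.pull) (use Q.iv(5)[OF Qm_iso[OF ps]] assms(1) in "simp_all add: ty")
 also have "... = H *q A" using assms(1) by (simp add: ty)
 finally show ?thesis by (simp add: ty)
qed

end

text \<open>A trace form determines the duality: the arrow assigned to a functional is the one that
  represents it through \<open>t\<close>. Uniqueness of this arrow gives linearity, and cyclicity
  gives naturality in the first argument.\<close>

lemma (in lin_category) serre_duality_trace:
 assumes P: "lin_functor K C C P"
  and lin: "!!x. x \<in> Ob C ==> linfun x (omap P x) (t x)"
  and cyc: "!!a h. [|ar a; ar h; dm h = cd a; cd h = omap P (dm a)|] ==> t (cd a) (amap P a ** h) = t (dm a) (h ** a)"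
  and rep: "!!x y \<phi>. [|x \<in> Ob C; y \<in> Ob C; linfun x y \<phi>|] ==>
   \<exists>h. ar h & dm h = y & cd h = omap P x & (\<forall>g. ar g & dm g = x & cd g = y --> \<phi> g = t x (h ** g))"
  and nd: "!!x h. [|x \<in> Ob C; ar h; cd h = omap P x; \<forall>g. ar g & dm g = x & cd g = dm h --> t x (h ** g) = \<zero>|] ==>
   h = zr (dm h) (cd h)"
 shows "serre_duality K C (Ob C) P"
proof -
 interpret P: linear_functor K C C P by unfold_locales (rule P)
 define R where "R x y \<phi> h \<longleftrightarrow> ar h & dm h = y & cd h = omap P x &
  (\<forall>g. ar g & dm g = x & cd g = y --> \<phi> g = t x (h ** g))" for x y \<phi> h
 define \<eta> where "\<eta> x y \<phi> = (SOME h. R x y \<phi> h)" for x y \<phi>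
 have \<eta>: "R x y \<phi> (\<eta> x y \<phi>)" if "x \<in> Ob C" "y \<in> Ob C" "\<phi> \<in> carrier (dual K (Hom C x y))" for x y \<phi>
 proof -
  have "\<exists>h. R x y \<phi> h" unfolding R_def using rep[OF that(1,2)] that linfun_dual[OF that(1,2)] by blast
  then show ?thesis unfolding \<eta>_def by (rule someI_ex)
 qed
 have uniq: "h = h'" if R: "R x y \<phi> h" "R x y \<phi> h'" and x: "x \<in> Ob C" for x y \<phi> h h'
 proof -
  have h: "ar h" "dm h = y" "cd h = omap P x" "ar h'" "dm h' = y" "cd h' = omap P x" using R unfolding R_def by auto
  have "t x ((h \<boxplus> ng h') ** g) = \<zero>" if g: "ar g" "dm g = x" "cd g = y" for g
  proof -
   have e: "t x (h ** g) = t x (h' ** g)" using R g unfolding R_def by auto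
   have k: "t x (h' ** g) \<in> carrier K" by (rule linfunD(1)[OF lin[OF x]]) (simp_all add: h g)
   have "t x ((h \<boxplus> ng h') ** g) = t x (h ** g) \<oplus> t x (ng (h' ** g))"
    using linfunD(3)[OF lin[OF x], of "h ** g" "ng (h' ** g)"] by (simp add: h g pl_cmp)
   also have "t x (ng (h' ** g)) = \<ominus> t x (h' ** g)" by (rule linfun_ng[OF lin[OF x]]) (simp_all add: h g)
   finally show ?thesis unfolding e using k by (simp add: r_neg)
  qed
  then have "h \<boxplus> ng h' = zr (dm (h \<boxplus> ng h')) (cd (h \<boxplus> ng h'))" by (intro nd[OF x]) (simp_all add: h)
  then show ?thesis using diff_zr[of h h'] by (simp add: h)
 qed
 have eqI: "\<eta> x y \<phi> = h" if "x \<in> Ob C" "y \<in> Ob C" "\<phi> \<in> carrier (dual K (Hom C x y))" "R x y \<phi> h" for x y \<phi> h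
  using uniq[OF \<eta>[OF that(1-3)] that(4,1)] .
 show ?thesis unfolding serre_duality_def
 proof (intro exI[of _ \<eta>] conjI ballI)
  fix x y assume x: "x \<in> Ob C" and y: "y \<in> Ob C"
  note et = \<eta>[OF x y, unfolded R_def]
  note di = linfun_dual[OF x y]
  interpret H: vspace K "Hom C x y" by (rule hom_vspace[OF x y])
  have arr: "\<eta> x y \<phi> \<in> arr C y (omap P x)" if "\<phi> \<in> carrier (dual K (Hom C x y))" for \<phi> using et[OF that] x y by simp
  have ad: "\<eta> x y (\<phi> \<oplus>\<^bsub>dual K (Hom C x y)\<^esub> \<psi>) = \<eta> x y \<phi> \<oplus>\<^bsub>Hom C y (omap P x)\<^esub> \<eta> x y \<psi>"
   if p: "\<phi> \<in> carrier (dual K (Hom C x y))" and q: "\<psi> \<in> carrier (dual K (Hom C x y))" for \<phi> \<psi>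
  proof -
   have s: "\<phi> \<oplus>\<^bsub>dual K (Hom C x y)\<^esub> \<psi> = (\<lambda>v\<in>arr C x y. \<phi> v \<oplus> \<psi> v)" by (simp add: dual_def)
   have pq: "\<phi> \<oplus>\<^bsub>dual K (Hom C x y)\<^esub> \<psi> \<in> carrier (dual K (Hom C x y))" unfolding s using H.dual_add[OF p q] .
   have "R x y (\<phi> \<oplus>\<^bsub>dual K (Hom C x y)\<^esub> \<psi>) (\<eta> x y \<phi> \<boxplus> \<eta> x y \<psi>)"
    unfolding R_def s using et[OF p] et[OF q] x y by (simp add: pl_cmp linfunD[OF lin[OF x]])
   then show ?thesis using eqI[OF x y pq] pl_eq[of "\<eta> x y \<phi>" y "omap P x"] et[OF p] by simp
  qed
  have sm: "\<eta> x y (a \<odot>\<^bsub>dual K (Hom C x y)\<^esub> \<phi>) = a \<odot>\<^bsub>Hom C y (omap P x)\<^esub> \<eta> x y \<phi>"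
   if a: "a \<in> carrier K" and p: "\<phi> \<in> carrier (dual K (Hom C x y))" for a \<phi>
  proof -
   have s: "a \<odot>\<^bsub>dual K (Hom C x y)\<^esub> \<phi> = (\<lambda>v\<in>arr C x y. a \<otimes> \<phi> v)" by (simp add: dual_def)
   have l: "linfun x y \<phi>" using p di by blast
   have pq: "a \<odot>\<^bsub>dual K (Hom C x y)\<^esub> \<phi> \<in> carrier (dual K (Hom C x y))" unfolding s
    by (rule linfun_restrict[OF x y], rule linfunI) (simp_all add: linfunD[OF l] r_distr m_lcomm a)
   have "R x y (a \<odot>\<^bsub>dual K (Hom C x y)\<^esub> \<phi>) (sm a (\<eta> x y \<phi>))"
    unfolding R_def s using et[OF p] x y a by (simp add: sm_cmp linfunD[OF lin[OF x]])
   then show ?thesis using eqI[OF x y pq] sm_eq[of "\<eta> x y \<phi>" y "omap P x"] et[OF p] by simp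
  qed
  show "\<eta> x y \<in> module_hom K (dual K (Hom C x y)) (Hom C y (omap P x))"
   unfolding module_hom_def using arr ad sm by blast
  show "bij_betw (\<eta> x y) (carrier (dual K (Hom C x y))) (arr C y (omap P x))"
  proof (rule bij_betw_imageI)
   show "inj_on (\<eta> x y) (carrier (dual K (Hom C x y)))"
   proof (rule inj_onI)
    fix \<phi> \<psi> assume p: "\<phi> \<in> carrier (dual K (Hom C x y))" and q: "\<psi> \<in> carrier (dual K (Hom C x y))" and e: "\<eta> x y \<phi> = \<eta> x y \<psi>"
    show "\<phi> = \<psi>"
    proof (rule extensionalityI)
     show "\<phi> \<in> extensional (arr C x y)" "\<psi> \<in> extensional (arr C x y)" using p q di by blast+
     fix g assume "g \<in> arr C x y"
     then have g: "ar g & dm g = x & cd g = y" using x y by simp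
     have "\<phi> g = t x (\<eta> x y \<phi> ** g)" "\<psi> g = t x (\<eta> x y \<psi> ** g)" using et[OF p] et[OF q] g by blast+
     then show "\<phi> g = \<psi> g" unfolding e by simp
    qed
   qed
   show "\<eta> x y ` carrier (dual K (Hom C x y)) = arr C y (omap P x)"
   proof (intro equalityI subsetI)
    fix h assume "h \<in> arr C y (omap P x)"
    then have h: "ar h" "dm h = y" "cd h = omap P x" using x y by auto
    let ?\<phi> = "\<lambda>g\<in>arr C x y. t x (h ** g)"
    have p: "?\<phi> \<in> carrier (dual K (Hom C x y))"
     by (rule linfun_restrict[OF x y linfun_cmp_left[OF lin[OF x] h]])
    have "R x y ?\<phi> h" unfolding R_def using h x y by simp
    then show "h \<in> \<eta> x y ` carrier (dual K (Hom C x y))" using eqI[OF x y p] p by (intro image_eqI[of _ _ ?\<phi>]) auto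
   qed (use arr in blast)
  qed
 next
  fix x x' y y' a b \<phi> assume ob: "x \<in> Ob C" "x' \<in> Ob C" "y \<in> Ob C" "y' \<in> Ob C" and "a \<in> arr C x x'" "b \<in> arr C y' y"
   and \<phi>: "\<phi> \<in> carrier (dual K (Hom C x y))"
  then have ab: "ar a" "dm a = x" "cd a = x'" "ar b" "dm b = y'" "cd b = y" by auto
  have l: "linfun x y \<phi>" using \<phi> linfun_dual[OF ob(1,3)] by blast
  have e: "ar (\<eta> x y \<phi>)" "dm (\<eta> x y \<phi>) = y" "cd (\<eta> x y \<phi>) = omap P x"
   and e': "!!g. [|ar g; dm g = x; cd g = y|] ==> \<phi> g = t x (\<eta> x y \<phi> ** g)" using \<eta>[OF ob(1,3) \<phi>] unfolding R_def by auto
  let ?h = "\<eta> x y \<phi>"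
  have p: "(\<lambda>g\<in>arr C x' y'. \<phi> ((b ** g) ** a)) \<in> carrier (dual K (Hom C x' y'))"
   by (rule linfun_restrict[OF ob(2,4)], rule linfunI) (simp_all add: ab cmp_pl pl_cmp cmp_sm sm_cmp linfunD[OF l])
  have "\<phi> ((b ** g) ** a) = t x' ((amap P a ** ?h ** b) ** g)" if g: "ar g" "dm g = x'" "cd g = y'" for g
  proof -
   have "\<phi> ((b ** g) ** a) = t (dm a) ((?h ** b ** g) ** a)" using e'[of "(b ** g) ** a"] by (simp add: ab g e)
   also have "... = t (cd a) (amap P a ** ?h ** b ** g)" by (rule cyc[symmetric]) (simp_all add: ab g e)
   finally show ?thesis by (simp add: ab g e ob)
  qed
  then have "R x' y' (\<lambda>g\<in>arr C x' y'. \<phi> ((b ** g) ** a)) (amap P a ** ?h ** b)" unfolding R_def using ab e ob by simp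
  then have "\<eta> x' y' (\<lambda>g\<in>arr C x' y'. \<phi> ((b ** g) ** a)) = amap P a ** ?h ** b" by (rule eqI[OF ob(2,4) p])
  then show "\<eta> x' y' (\<lambda>g\<in>arr C x' y'. \<phi> ((b ** g) ** a)) = (amap P a ** ?h) ** b" by (simp add: ab e ob)
 qed
qed

section \<open>Nondegeneracy of the trace form\<close>

context serre_extension
begin

text \<open>An object of \<open>X\<^sup>\<bottom>\<close> is, up to a shift, in the image of \<^term>\<open>Uo\<close> under \<open>F\<close>.\<close>

lemma hz_sho_fo:
 assumes "w \<in> Ob T" "!!x. x \<in> Xo ==> hz x w" "z \<in> Ob T" "!!j. j \<le> 0 ==> kr z j" shows "hz (sho w) (fo z)"
proof -
 obtain t where t: "t \<in> Ob T" "fo t \<simeq> sho w" using F_dense Sh.F_ob[OF assms(1)] unfolding Fx.dense_def by blast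
 obtain v u where vu: "v \<in> Vo" "u \<in> Uo" "tr v t u" using co_t_structure t(1) star_iff by blast
 have v: "v \<in> Ob T" using tr_Ob[OF vu(3)] by blast
 have "hz (sho (shi (fo v))) (sho w)" using hz_sft[of "shi (fo v)" w 1] assms(2)[OF fo_Vo_Xo[OF vu(1)]] v assms(1) by simp
 then have vt: "hz (fo v) (fo t)" using hz_cong[OF sh_shi[of "fo v"] isom_sym[OF t(2)]] v by simp
 obtain f g h where d: "dist f g h" "dm f = v" "cd f = t" "cd g = u" using vu(3) by (rule trE)
 note d' = dist_ar[OF d(1)]
 have "fa f = zr (fo (dm f)) (fo (cd f))" by (rule hzD) (use vt d d' in auto)
 \<comment> \<open>Faithfulness of \<open>F\<close> kills the arrow from the component in
   \<open>Vo\<close> to \<open>t\<close>, so \<open>t\<close> is a retract of its component in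
   \<open>Uo\<close>.\<close>
 then have "f = zr (dm f) (cd f)" using F_faithful d' unfolding Fx.faithful_def by blast
 then have "idt t ** f = zr (dm f) (cd (idt t))" using d d' t(1) by simp
 then obtain b where "ar b" "dm b = cd g" "cd b = cd (idt t)" "b ** g = idt t"
  by - (rule dist_factor_left[OF d(1), of "idt t"], use d t(1) in simp_all)
 then have "retr t u" unfolding retr_def using d d' t(1) by (intro exI[of _ g] exI[of _ b]) simp
 moreover have "hz u z" by (rule hz_Uo[OF vu(2) assms(3,4)])
 ultimately have "hz t z" using retr_hz_left assms(3) by blast
 then have "hz (fo t) (fo z)" by (rule F_hz) (use t assms(3) in auto)
 then show ?thesis using hz_cong[OF t(2) isom_refl] assms(3) by simp
qed

text \<open>In the triangle v -> z -> u the arrow \<open>j : z -> u\<close> is inverted by the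
  quotient, as \<open>v\<close> is in \<open>S\<close>. So an arrow to \<open>po z\<close> may be
  replaced by an arrow w -> \<open>po u\<close> of \<open>T\<close>, and the pairing becomes the
  Serre pairing of \<open>S\<close> at v[1]. There \<open>g\<close> enters through
  \<open>?m\<close>, the other arrow through \<Omega>, and both assignments are bijective.\<close>

lemma Z_pairing:
 assumes z: "z \<in> Zo" and w: "w \<in> Zo"
 shows "Q.linfun z w \<phi> ==> \<exists>h. Q.ar h & Q.dm h = w & Q.cd h = po z &
   (\<forall>g. Q.ar g & Q.dm g = z & Q.cd g = w --> \<phi> g = tq z (h *q g))"
  and "[|Q.ar h; Q.dm h = w; Q.cd h = po z; \<forall>g. Q.ar g & Q.dm g = z & Q.cd g = w --> tq z (h *q g) = \<zero>|] ==>
   h = Q.zr w (po z)"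
proof -
 have zo: "z \<in> Ob T" "!!j. j \<le> 0 ==> kr z j" "z \<in> Al" using z unfolding Zo_def Al_def by auto
 have wo: "w \<in> Ob T" "!!j. j \<le> 0 ==> kr w j" "w \<in> Al" "!!x. x \<in> Xo ==> hz x w" using w unfolding Zo_def Al_def by auto
 obtain v u where vu: "v \<in> Vo" "u \<in> Uo" "tr v z u" using co_t_structure zo(1) star_iff by blast
 have ob: "v \<in> Ob T" "u \<in> Ob T" using tr_Ob[OF vu(3)] by auto
 have vS: "sho v \<in> S" using vu(1) S_sho unfolding Vo_def by blast
 obtain i j k where d: "dist i j k" "dm i = v" "cd i = z" "cd j = u" using vu(3) by (rule trE)
 note d' = dist_ar[OF d(1)]
 note dj = dist_rot[OF d(1)]
 let ?m = "ng (sha i)"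
 have j: "j \<in> Sg" using Sg_iff[OF dj] d d' vS by simp
 define \<Omega> where "\<Omega> = fe (sho v) ** fa k ** th u"
 note ty = d' d(2-4) zo(1) wo(1) ob vS
 have \<Omega>: "ar \<Omega>" "dm \<Omega> = sho (po u)" "cd \<Omega> = sso (sho v)" unfolding \<Omega>_def by (simp_all add: ty)
 \<comment> \<open>Here and in the next lines are the four vanishings behind the two bijections:
   arrows from \<open>u\<close> to \<open>w\<close> and w[1] for \<open>g\<close>, arrows from w[1]
   to \<open>fo z\<close> and its shift for \<Omega>.\<close>
 have hzu: "hz u w" "hz u (sho w)" using hz_Uo[OF vu(2)] wo(1,2) kr_sho by simp_all
 have hzw: "hz (sho w) (fo z)" by (rule hz_sho_fo[OF wo(1,4) zo(1,2)])
 have "hz (sho w) (fo (sho z))" by (rule hz_sho_fo[OF wo(1,4)]) (use zo kr_sho in auto)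
 then have hzw': "hz (sho w) (sho (fo z))" using hz_cong[OF isom_refl isomI[of "fs z"]] zo(1) wo(1) by simp
 \<comment> \<open>For \<open>Q_full\<close> the target \<open>po u\<close> only has to be right
   orthogonal to X; it need not lie in Z.\<close>
 have Xu: "hz x (po u)" if x: "x \<in> Xo" for x
 proof -
  have xO: "x \<in> Ob T" using x S_Ob unfolding Xo_def by blast
  have "sho (po u) \<simeq> fo u" by (rule isomI[of "th u"]) (use ob in auto)
  then have "po u \<simeq> shi (fo u)" using isom_trans[OF isom_sym[OF shi_sh] shi_isom] ob by simp
  then show ?thesis using hz_isom_right[OF isom_sym] hz_Xo_fo_Uo[OF x vu(2)] xO by blast
 qed
 have L_surj: "\<exists>g. ar g & dm g = z & cd g = w & sha g ** ?m = y" if y: "ar y" "dm y = sho v" "cd y = sho w" for y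
 proof -
  have "y ** k = zr u (sho w)" by (rule hzD[OF hzu(2)]) (use y ty in auto)
  then obtain b where b: "ar b" "dm b = cd ?m" "cd b = cd y" "b ** ?m = y"
   by - (rule dist_factor_left[OF dist_rot[OF dj], of y], use y ty in simp_all)
  obtain g where "ar g" "dm g = z" "cd g = w" "sha g = b" using sh_full[of z w b] b(1-3) y ty by auto
  then show ?thesis using b(4) by blast
 qed
 have L_inj: "g = zr z w" if g: "ar g" "dm g = z" "cd g = w" "sha g ** ?m = zr (sho v) (sho w)" for g
 proof -
  have "ng (sha (g ** i)) = zr (sho v) (sho w)" using g ty by simp
  then have "ng (ng (sha (g ** i))) = ng (zr (sho v) (sho w))" by (rule arg_cong)
  then have "sha (g ** i) = sha (zr v w)" using g(1-3) ty by simp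
  then have "g ** i = zr v w" by (rule sh_faithful[rotated -1]) (use g(1-3) ty in simp_all)
  then obtain b where b: "ar b" "dm b = cd j" "cd b = cd g" "b ** j = g"
   by - (rule dist_factor_left[OF d(1), of g], use g(1-3) ty in simp_all)
  have "b = zr u w" by (rule hzD[OF hzu(1)]) (use b(1-3) g(1-3) ty in auto)
  then show ?thesis using b(4) ty by simp
 qed
 have O_surj: "\<exists>h0. ar h0 & dm h0 = w & cd h0 = po u & \<Omega> ** sha h0 = l" if l: "ar l" "dm l = sho w" "cd l = sso (sho v)" for l
 proof -
  let ?l = "iv (fe (sho v)) ** l"
  have tl: "ar ?l" "dm ?l = sho w" "cd ?l = fo (sho v)" using l ty by simp_all
  have "(fs z ** fa ?m) ** ?l = zr (sho w) (sho (fo z))" by (rule hzD[OF hzw']) (use tl ty in simp_all)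
  then obtain m where m: "ar m" "dm m = dm ?l" "cd m = dm (fa k)" "fa k ** m = ?l"
   by - (rule exrE[OF dist_exr(2)[OF F_dist[OF dj]], of ?l], use tl ty in simp_all)
  obtain h0 where h0: "ar h0" "dm h0 = w" "cd h0 = po u" "sha h0 = iv (th u) ** m"
   using sh_full[of w "po u" "iv (th u) ** m"] m(1-3) tl ty by auto
  have "\<Omega> ** sha h0 = fe (sho v) ** fa k ** (th u ** iv (th u)) ** m" unfolding \<Omega>_def h0(4) using m(1-3) tl ty by simp
  also have "... = fe (sho v) ** fa k ** m" using m(1-3) ty by (simp del: cmp_assoc)
  also have "... = (fe (sho v) ** iv (fe (sho v))) ** l" unfolding m(4) using l ty by simp
  also have "... = l" using l ty by (simp del: cmp_assoc)
  finally show ?thesis using h0(1-3) by blast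
 qed
 have O_inj: "h0 = zr w (po u)" if h0: "ar h0" "dm h0 = w" "cd h0 = po u" "\<Omega> ** sha h0 = zr (sho w) (sso (sho v))" for h0
 proof -
  have "fe (sho v) ** fa k ** th u ** sha h0 = fe (sho v) ** zr (sho w) (fo (sho v))"
   using h0 ty unfolding \<Omega>_def by simp
  then have "fa k ** th u ** sha h0 = zr (sho w) (fo (sho v))"
   by (rule iso_lcancel[rotated -1]) (use h0(1-3) ty in simp_all)
  then obtain m where m: "ar m" "dm m = sho w" "cd m = dm (fa j)" "fa j ** m = th u ** sha h0"
   by - (rule exrE[OF dist_exr(1)[OF F_dist[OF dj]], of "th u ** sha h0"], use h0(1-3) ty in simp_all)
  have "m = zr (sho w) (fo z)" by (rule hzD[OF hzw]) (use m(1-3) ty in auto)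
  then have "th u ** sha h0 = th u ** zr (sho w) (sho (po u))" using m(4)[symmetric] ty by simp
  then have "sha h0 = sha (zr w (po u))" using iso_lcancel[of "th u" "sha h0" "zr (sho w) (sho (po u))"] h0(1-3) ty by simp
  then show ?thesis by (rule sh_faithful[rotated -1]) (use h0(1-3) ty in simp_all)
 qed
 let ?j = "Q.iv (Qm (pa j))"
 have pj: "pa j \<in> Sg" using pa_Sg_iff j by simp
 \<comment> \<open>Cyclicity moves \<open>j\<close> around the trace, which leaves the trace of a
   roof with denominator \<open>j\<close>; its cone v[1] is known, so the value is computed in
   \<open>T\<close>.\<close>
 have val: "tq z ((?j *q Qm h0) *q Qm g) = tau (sho v) ((\<Omega> ** sha h0) ** sha g ** ?m)"
  if h0: "ar h0" "dm h0 = w" "cd h0 = po u" and g: "ar g" "dm g = z" "cd g = w" for h0 g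
 proof -
  let ?H = "(?j *q Qm h0 *q Qm g) *q Q.iv (Qm j)"
  note ty' = ty h0 g j pj
  have "tq z ((?j *q Qm h0) *q Qm g) = tq (dm j) (?H *q Qm j)" by (simp add: ty')
  also have "... = tq (cd j) (Qm (pa j) *q ?H)" by (rule tq_cyclic_Qm[symmetric]) (simp_all add: ty')
  also have "Qm (pa j) *q ?H = (Qm (pa j) *q ?j) *q Qm (h0 ** g) *q Q.iv (Qm j)" by (simp add: ty')
  also have "... = cls j (h0 ** g)" using cls_Qm[of j "h0 ** g"] by (simp add: ty' del: Q.cmp_assoc)
  also have "tq (cd j) ... = trv k ?m (h0 ** g)" by (rule tq_cls[OF dj]) (simp_all add: ty')
  also have "... = tau (sho v) ((\<Omega> ** sha h0) ** sha g ** ?m)" unfolding trv_def \<Omega>_def by (simp add: ty')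
  finally show ?thesis .
 qed
 { assume \<phi>: "Q.linfun z w \<phi>"
  \<comment> \<open>\<open>G\<close> inverts the bijection \<open>g \<mapsto> sha g ** ?m\<close>,
    so a functional on arrows of the quotient becomes one on Hom(v[1], w[1]), to which Serre duality
    applies.\<close>
  define G where "G y = (SOME g. ar g & dm g = z & cd g = w & sha g ** ?m = y)" for y
  have G: "ar (G y)" "dm (G y) = z" "cd (G y) = w" "sha (G y) ** ?m = y" if "ar y" "dm y = sho v" "cd y = sho w" for y
   using someI_ex[OF L_surj[OF that]] unfolding G_def by auto
  have G_eq: "G (sha g ** ?m) = g" if g: "ar g" "dm g = z" "cd g = w" for g
  proof -
   note G' = G[of "sha g ** ?m"]
   have t: "ar (G (sha g ** ?m))" "dm (G (sha g ** ?m)) = z" "cd (G (sha g ** ?m)) = w"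
    and e: "sha (G (sha g ** ?m)) ** ?m = sha g ** ?m"
    using G'(1-4) g ty by simp_all
   have "sha (G (sha g ** ?m) \<boxplus> ng g) ** ?m = (sha (G (sha g ** ?m)) ** ?m) \<boxplus> ng (sha g ** ?m)"
    using t g ty by (simp add: pl_cmp del: cmp_ng)
   also have "... = zr (sho v) (sho w)" unfolding e using g ty by (simp del: cmp_ng)
   finally have "G (sha g ** ?m) \<boxplus> ng g = zr z w" by (intro L_inj) (use t g in simp_all)
   then show ?thesis using diff_zr[of "G (sha g ** ?m)" g] t g by simp
  qed
  have "linfun (sho v) (sho w) (\<lambda>y. \<phi> (Qm (G y)))"
  proof (rule linfunI)
   fix y assume y: "ar y" "dm y = sho v" "cd y = sho w"
   note Gy = G[OF y]
   show "\<phi> (Qm (G y)) \<in> carrier K" by (rule Q.linfunD(1)[OF \<phi>]) (use Gy in simp_all)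
   { fix y' assume y': "ar y'" "dm y' = sho v" "cd y' = sho w"
    note Gy' = G[OF y']
    have "sha (G y \<boxplus> G y') ** ?m = y \<boxplus> y'" using Gy Gy' ty by (simp add: pl_cmp del: cmp_ng)
    then have "G (y \<boxplus> y') = G y \<boxplus> G y'" using G_eq[of "G y \<boxplus> G y'"] Gy(1-3) Gy'(1-3) by simp
    then show "\<phi> (Qm (G (y \<boxplus> y'))) = \<phi> (Qm (G y)) \<oplus> \<phi> (Qm (G y'))"
     using Q.linfunD(3)[OF \<phi>, of "Qm (G y)" "Qm (G y')"] Gy(1-3) Gy'(1-3) by simp }
   fix a assume a: "a \<in> carrier K"
   have "sha (sm a (G y)) ** ?m = sm a y" using Gy a ty by (simp add: sm_cmp del: cmp_ng)
   then have "G (sm a y) = sm a (G y)" using G_eq[of "sm a (G y)"] Gy(1-3) a by simp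
   then show "\<phi> (Qm (G (sm a y))) = a \<otimes> \<phi> (Qm (G y))"
    using Q.linfunD(2)[OF \<phi>, of "Qm (G y)" a] Gy(1-3) a by simp
  qed
  then obtain l where l: "ar l" "dm l = sho w" "cd l = sso (sho v)"
   "!!y. [|ar y; dm y = sho v; cd y = sho w|] ==> \<phi> (Qm (G y)) = tau (sho v) (l ** y)"
   by (rule serre_rep[OF vS Sh.F_ob[OF wo(1)]]) (rule that, assumption+)
  obtain h0 where h0: "ar h0" "dm h0 = w" "cd h0 = po u" "\<Omega> ** sha h0 = l" using O_surj[OF l(1-3)] by blast
  show "\<exists>h. Q.ar h & Q.dm h = w & Q.cd h = po z &
   (\<forall>g. Q.ar g & Q.dm g = z & Q.cd g = w --> \<phi> g = tq z (h *q g))"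
  proof (intro exI[of _ "?j *q Qm h0"] conjI allI impI)
   fix g' assume "Q.ar g' & Q.dm g' = z & Q.cd g' = w"
   then obtain g where g: "ar g" "dm g = z" "cd g = w" "Qm g = g'" using Q_full[OF zo(3) wo(1,4)] by blast
   have "\<phi> g' = tau (sho v) (l ** sha g ** ?m)" using l(4)[of "sha g ** ?m"] G_eq[OF g(1-3)] g ty by simp
   then show "\<phi> g' = tq z ((?j *q Qm h0) *q g')" using val[OF h0(1-3) g(1-3)] h0(4) g(4) by simp
  qed (use h0(1-3) pj ty in simp_all) }
 assume h: "Q.ar h" "Q.dm h = w" "Q.cd h = po z" and 0: "\<forall>g. Q.ar g & Q.dm g = z & Q.cd g = w --> tq z (h *q g) = \<zero>"
 have "\<exists>h0. ar h0 & dm h0 = w & cd h0 = po u & Qm h0 = Qm (pa j) *q h"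
  by (rule Q_full[OF wo(3) _ Xu]) (use h ty in simp_all)
 then obtain h0 where h0: "ar h0" "dm h0 = w" "cd h0 = po u" "Qm h0 = Qm (pa j) *q h" by blast
 have hh: "?j *q Qm h0 = h" unfolding h0(4) using h pj ty by simp
 have "\<Omega> ** sha h0 = zr (dm (\<Omega> ** sha h0)) (sso (sho v))"
 proof (rule serre_nondeg_left[OF vS])
  fix y assume "ar y" "dm y = sho v" "cd y = dm (\<Omega> ** sha h0)"
  then obtain g where g: "ar g" "dm g = z" "cd g = w" "sha g ** ?m = y" using L_surj[of y] h0(1-3) \<Omega> by auto
  have "tq z ((?j *q Qm h0) *q Qm g) = \<zero>" unfolding hh using 0 g(1-3) by simp
  then show "tau (sho v) ((\<Omega> ** sha h0) ** y) = \<zero>" using val[OF h0(1-3) g(1-3)] g(4) by simp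
 qed (use h0(1-3) \<Omega> in simp_all)
 then have "h0 = zr w (po u)" by (intro O_inj) (use h0(1-3) \<Omega> in simp_all)
 then show "h = Q.zr w (po z)" using hh pj ty by simp
qed

text \<open>Every object is isomorphic in the quotient to one of Z. Representability and
  nondegeneracy are carried over along such isomorphisms \<open>a\<close> and \<open>b\<close>,
  where cyclicity of the trace exchanges \<open>a\<close> with its image under
  \<open>Ph\<close>.\<close>

lemma Q_serre_duality: "serre_duality K QC (Ob QC) Ph"
proof (rule Q.serre_duality_trace[where t=tq])
 show "lin_functor K QC QC Ph" by (rule Ph.F)
 show "Q.linfun x (omap Ph x) (tq x)" if "x \<in> Ob QC" for x using tq_linfun that by simp
 show "tq (Q.cd a) (amap Ph a *q h) = tq (Q.dm a) (h *q a)"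
  if "Q.ar a" "Q.ar h" "Q.dm h = Q.cd a" "Q.cd h = omap Ph (Q.dm a)" for a h using tq_cyclic that by simp
next
 fix x y \<phi> assume "x \<in> Ob QC" "y \<in> Ob QC" and \<phi>: "Q.linfun x y \<phi>"
 then have xy: "x \<in> Ob T" "y \<in> Ob T" by simp_all
 obtain z where z: "z \<in> Zo" "z \<simeq>\<^sub>q x" using Q_dense[OF xy(1)] by blast
 obtain w where w: "w \<in> Zo" "w \<simeq>\<^sub>q y" using Q_dense[OF xy(2)] by blast
 obtain a where a: "Q.is_iso a" "Q.dm a = x" "Q.cd a = z" using Q.isom_sym[OF z(2)] unfolding Q.isom_def by blast
 obtain b where b: "Q.is_iso b" "Q.dm b = w" "Q.cd b = y" using w(2) unfolding Q.isom_def by blast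
 have "Q.linfun z w (\<lambda>g. \<phi> ((b *q g) *q a))"
  by (rule Q.linfun_cmp_left[OF Q.linfun_cmp_right[OF \<phi>]]) (use a b in simp_all)
 then obtain h where h: "Q.ar h" "Q.dm h = w" "Q.cd h = po z"
  "!!g. [|Q.ar g; Q.dm g = z; Q.cd g = w|] ==> \<phi> ((b *q g) *q a) = tq z (h *q g)"
  using Z_pairing(1)[OF z(1) w(1)] by blast
 let ?h = "Q.iv (amap Ph a) *q h *q Q.iv b"
 have "\<phi> g = tq x (?h *q g)" if g: "Q.ar g" "Q.dm g = x" "Q.cd g = y" for g
 proof -
  let ?g = "Q.iv b *q g *q Q.iv a"
  have "(b *q ?g) *q a = (b *q Q.iv b) *q g *q (Q.iv a *q a)" using a b g by simp
  also have "... = g" using a b g by (simp del: Q.cmp_assoc)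
  finally have "\<phi> g = tq z (h *q ?g)" using h(4)[of ?g] a b g by simp
  also have "h *q ?g = (amap Ph a *q Q.iv (amap Ph a)) *q h *q ?g" using a b g h(1-3) by (simp del: Q.cmp_assoc)
  also have "... = amap Ph a *q ?h *q g *q Q.iv a" using a b g h(1-3) by simp
  also have "tq z ... = tq (Q.cd a) (amap Ph a *q ?h *q g *q Q.iv a)" using a by simp
  also have "... = tq (Q.dm a) ((?h *q g *q Q.iv a) *q a)" by (rule tq_cyclic) (use a b g h(1-3) in simp_all)
  also have "... = tq x (?h *q g)" using a b g h(1-3) by simp
  finally show ?thesis .
 qed
 then show "\<exists>h. Q.ar h & Q.dm h = y & Q.cd h = omap Ph x & (\<forall>g. Q.ar g & Q.dm g = x & Q.cd g = y --> \<phi> g = tq x (h *q g))"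
  by (intro exI[of _ ?h]) (use a b h(1-3) in simp)
next
 fix x h assume "x \<in> Ob QC" and h: "Q.ar h" "Q.cd h = omap Ph x" and 0: "\<forall>g. Q.ar g & Q.dm g = x & Q.cd g = Q.dm h --> tq x (h *q g) = \<zero>"
 then have xy: "x \<in> Ob T" "Q.dm h \<in> Ob T" by simp_all
 obtain z where z: "z \<in> Zo" "z \<simeq>\<^sub>q x" using Q_dense[OF xy(1)] by blast
 obtain w where w: "w \<in> Zo" "w \<simeq>\<^sub>q Q.dm h" using Q_dense[OF xy(2)] by blast
 obtain a where a: "Q.is_iso a" "Q.dm a = x" "Q.cd a = z" using Q.isom_sym[OF z(2)] unfolding Q.isom_def by blast
 obtain b where b: "Q.is_iso b" "Q.dm b = w" "Q.cd b = Q.dm h" using w(2) unfolding Q.isom_def by blast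
 note ty = h a b
 have "amap Ph a *q h *q b = Q.zr w (po z)"
 proof (rule Z_pairing(2)[OF z(1) w(1)])
  show "\<forall>g. Q.ar g & Q.dm g = z & Q.cd g = w --> tq z ((amap Ph a *q h *q b) *q g) = \<zero>"
  proof (intro allI impI)
   fix g assume g: "Q.ar g & Q.dm g = z & Q.cd g = w"
   have "tq (Q.cd a) (amap Ph a *q h *q b *q g) = tq (Q.dm a) ((h *q b *q g) *q a)"
    by (rule tq_cyclic) (use g in "simp_all add: ty")
   also have "... = tq x (h *q b *q g *q a)" using g by (simp add: ty)
   also have "... = \<zero>" using 0 g by (simp add: ty)
   finally show "tq z ((amap Ph a *q h *q b) *q g) = \<zero>" using g by (simp add: ty)
  qed
 qed (simp_all add: ty)
 then have "amap Ph a *q h *q b = amap Ph a *q Q.zr w (po x)" using xy(1) a b w(1) Zo_Ob by (simp add: subset_iff)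
 then have "h *q b = Q.zr w (po x)" by (rule Q.iso_lcancel[rotated -1]) (use xy(1) w(1) Zo_Ob in "simp_all add: ty subset_iff")
 then have "h *q b = Q.zr (Q.dm h) (po x) *q b" using xy(1) by (simp add: ty)
 then have "h = Q.zr (Q.dm h) (po x)" by (rule Q.iso_rcancel[rotated -1]) (use xy in "simp_all add: ty")
 then show "h = Q.zr (Q.dm h) (Q.cd h)" unfolding h(2) Ph_ob .
qed

lemma Q_serre_functor: "serre_functor K QC (induced_functor T S (F \<circ>\<^sub>F Shi T))"
 unfolding serre_functor_def using Ph_equivalence Q_serre_duality unfolding Ph_def by blast

end

theorem theorem2p12:
 fixes K :: "('k, 'r) ring_scheme"
  and T :: "('o, 'm, 'k, 'z) tricat_scheme"
  and S M :: "'o set"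
  and \<SS> :: "('o, 'm, 'o, 'm) cfun"
 assumes "field K"
  and "relative_serre_quadruple K T S \<SS> M"
  and "(\<exists>F. extends_serre K T S \<SS> F) \<or> (\<exists>m\<in>Ob T. M = add_closure T m)"
 shows "cat_equivalence K (full_subcat T (fundamental_domain T S M)) (verdier_quotient T S)
      (quotient_functor T S \<circ>\<^sub>F id_cfun)
    \<and> triangulated_category K (verdier_quotient T S)
    \<and> hom_finite K (verdier_quotient T S)
    \<and> krull_schmidt (verdier_quotient T S)
    \<and> (\<forall>F. extends_serre K T S \<SS> F \<longrightarrow>
      serre_functor K (verdier_quotient T S) (induced_functor T S (F \<circ>\<^sub>F Shi T)))"
proof -
 interpret relative_serre_quadruple K T S \<SS> M by fact
 have ext: "serre_extension K T S \<SS> M F" if "extends_serre K T S \<SS> F" for F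
  by unfold_locales (rule that)
 \<comment> \<open>The two cases differ in how \<open>T\<close> is decomposed by X and its right
   orthogonal. The equivalence, Hom-finiteness and the Krull-Schmidt property are deduced from this
   decomposition; the Serre functor again uses the extension \<open>F\<close>.\<close>
 have "star T Xo (rperp T Xo) = Ob T"
  using assms(3)
 proof
  assume "\<exists>F. extends_serre K T S \<SS> F"
  then show ?thesis using serre_extension.torsion_extension[OF ext] by blast
 next
  assume "\<exists>m\<in>Ob T. M = add_closure T m"
  then show ?thesis using torsion_additive_generator by blast
 qed
 then interpret fundamental_equivalence K T S \<SS> M by unfold_locales
 show ?thesis unfolding fundamental_domain_eq comp_id_cfun
  using Z_equivalence Q_triangulated Q_hom_finite Q_krull_schmidt serre_extension.Q_serre_functor[OF ext] by blast
qed

end
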